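(* Let $\Omega$ be a bounded open subset of $\mathbb{R}^2$ with a Lipschitz boundary, let $\varepsilon_n>0$ with $\varepsilon_n\to0$, and let $f\in H^{-1}(\Omega)\cap W^{-1,q}(\Omega)$ with $q>2$. Let $h\in\mathbb{R}$, $\ell\ge1$, $\alpha_1,\beta_1>0$, and let $t_n\in(0,\tfrac12]$, $\alpha_{2,n}>0$, $\beta_{2,n}>0$ be sequences with $t_n\to0$. Let $Y=(-\tfrac{\ell}{2},\tfrac{\ell}{2})\times(-\tfrac12,\tfrac12)$ and $$\omega_n=\{(x_1,x_2)\in Y:\ |x_1|\le t_n\ \text{or}\ |x_2|\le t_n\},\qquad \Sigma_n(h)=\begin{cases}\alpha_{2,n}I_2+\beta_{2,n}hJ&\text{in }\omega_n\\ \alpha_1I_2+\beta_1hJ&\text{in }Y\setminus\omega_n,\end{cases}$$ extended by $Y$-periodicity to $\mathbb{R}^2$, and set $\sigma_n(h)(x)=\Sigma_n(h)(x/\varepsilon_n)$ for $x\in\Omega$. Assume that $$2t_n(\ell+1)\,\alpha_{2,n}\to\alpha_2>0\qquad\text{and}\qquad 2t_n(\ell+1)\,\beta_{2,n}\to\beta_2>0 .$$ Then the homogenized conductivity of the problem $$-\operatorname{div}(\sigma_n(h)\nabla u_n)=f\ \text{ in }\Omega,\qquad u_n=0\ \text{ on }\partial\Omega$$ is given by $$\sigma_*(h)=\begin{pmatrix}\alpha_1+\dfrac{\alpha_2^2+\beta_2^2h^2}{(\ell+1)\alpha_2}&-h\beta_1\\[2mm] h\beta_1&\alpha_1+\dfr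ac{\alpha_2^2+\beta_2^2h^2}{\ell(\ell+1)\alpha_2}\end{pmatrix}.$$
   Context: $I_2$ is the $2\times2$ unit matrix and $J=\begin{pmatrix}0&-1\\1&0\end{pmatrix}$. "$Y$-periodic" means periodic with period $\ell$ in $x_1$ and $1$ in $x_2$. That the homogenized conductivity is $\sigma_*(h)$ means that the solution $u_n$ of the problem in the claim converges uniformly in $\Omega$ to the solution $u\in H^1_0(\Omega)$ of $-\operatorname{div}(\sigma_*(h)\nabla u)=f$ in $\Omega$, $u=0$ on $\partial\Omega$. *)

theory Defs
  imports "HOL-Analysis.Analysis"
begin

section \<open>Domains with Lipschitz boundary\<close>

definition J :: "real^2^2" where
  "J = vector [vector [0, -1], vector [1, 0]]"

text \<open>Near each boundary point, in the orthonormal frame \<open>(J e, e)\<close>, the set is the strict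
  epigraph of a Lipschitz function. Taking \<open>\<gamma>\<close> Lipschitz on the whole line is no
  restriction, since Lipschitz functions on intervals extend.\<close>

definition lipschitz_boundary :: "(real^2) set \<Rightarrow> bool" where
  "lipschitz_boundary \<Omega> \<longleftrightarrow>
    (\<forall>x0 \<in> frontier \<Omega>. \<exists>r > 0. \<exists>e. \<exists>\<gamma> :: real \<Rightarrow> real. \<exists>L.
       norm e = 1 \<and> L-lipschitz_on UNIV \<gamma> \<and>
       \<Omega> \<inter> ball x0 r = {x \<in> ball x0 r. (x - x0) \<bullet> e > \<gamma> ((x - x0) \<bullet> (J *v e))})"


section \<open>Test functions\<close>

definition grad :: "(real^2 \<Rightarrow> real) \<Rightarrow> real^2 \<Rightarrow> real^2" where
  "grad \<phi> x = (\<chi> i. frechet_derivative \<phi> (at x) (axis i 1))"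

primrec Ck :: "nat \<Rightarrow> (real^2 \<Rightarrow> real) \<Rightarrow> bool" where
  "Ck 0 \<phi> \<longleftrightarrow> continuous_on UNIV \<phi>"
| "Ck (Suc k) \<phi> \<longleftrightarrow> (\<forall>x. \<phi> differentiable (at x)) \<and> (\<forall>i. Ck k (\<lambda>x. grad \<phi> x $ i))"

definition test_functions :: "(real^2) set \<Rightarrow> (real^2 \<Rightarrow> real) set" where
  "test_functions \<Omega> =
    {\<phi>. (\<forall>k. Ck k \<phi>) \<and> compact (closure {x. \<phi> x \<noteq> 0}) \<and> closure {x. \<phi> x \<noteq> 0} \<subseteq> \<Omega>}"


section \<open>Sobolev spaces\<close>

text \<open>Functions in \<open>L\<^sup>p\<close> and Sobolev spaces are represented by everywhere defined functions, of
  which only the values almost everywhere in \<open>\<Omega>\<close> matter; the measure is the completed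
  Lebesgue measure.\<close>

definition Lp :: "(real^2) set \<Rightarrow> real \<Rightarrow> (real^2 \<Rightarrow> 'b::euclidean_space) set" where
  "Lp \<Omega> p = {u. u \<in> borel_measurable (lebesgue_on \<Omega>) \<and>
                 integrable (lebesgue_on \<Omega>) (\<lambda>x. norm (u x) powr p)}"

definition weak_gradient ::
    "(real^2) set \<Rightarrow> (real^2 \<Rightarrow> real) \<Rightarrow> (real^2 \<Rightarrow> real^2) \<Rightarrow> bool" where
  "weak_gradient \<Omega> u g \<longleftrightarrow>
    (\<forall>\<phi> \<in> test_functions \<Omega>. \<forall>i.
       (LINT x|lebesgue_on \<Omega>. u x * grad \<phi> x $ i) =
       - (LINT x|lebesgue_on \<Omega>. g x $ i * \<phi> x))"

text \<open>The \<open>W\<^sup>1\<^sup>,\<^sup>p\<close> norm of a function \<open>u\<close> with gradient \<open>g\<close>.\<close>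

definition W1_norm ::
    "(real^2) set \<Rightarrow> real \<Rightarrow> (real^2 \<Rightarrow> real) \<Rightarrow> (real^2 \<Rightarrow> real^2) \<Rightarrow> real" where
  "W1_norm \<Omega> p u g =
    ((LINT x|lebesgue_on \<Omega>. \<bar>u x\<bar> powr p) +
     (LINT x|lebesgue_on \<Omega>. norm (g x) powr p)) powr (1 / p)"

text \<open>\<open>u\<close> lies in \<open>W\<^sup>1\<^sup>,\<^sup>p\<^sub>0(\<Omega>)\<close>, the closure of the test functions in \<open>W\<^sup>1\<^sup>,\<^sup>p(\<Omega>)\<close>, and has weak
  gradient \<open>g\<close>, which is unique almost everywhere in \<open>\<Omega>\<close>.\<close>

definition W1_0 ::
    "(real^2) set \<Rightarrow> real \<Rightarrow> (real^2 \<Rightarrow> real) \<Rightarrow> (real^2 \<Rightarrow> real^2) \<Rightarrow> bool" where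
  "W1_0 \<Omega> p u g \<longleftrightarrow>
    u \<in> Lp \<Omega> p \<and> g \<in> Lp \<Omega> p \<and> weak_gradient \<Omega> u g \<and>
    (\<exists>\<Phi>. (\<forall>k. \<Phi> k \<in> test_functions \<Omega>) \<and>
         (\<lambda>k::nat. W1_norm \<Omega> p (\<lambda>x. \<Phi> k x - u x) (\<lambda>x. grad (\<Phi> k) x - g x)) \<longlonglongrightarrow> 0)"

text \<open>\<open>W\<^sup>-\<^sup>1\<^sup>,\<^sup>q(\<Omega>)\<close> is the dual of \<open>W\<^sup>1\<^sup>,\<^sup>p\<^sub>0(\<Omega>)\<close> for the conjugate exponent \<open>p = q / (q - 1)\<close>.
  As usual its elements are identified with distributions, that is, with their restrictions
  to the dense subspace of test functions; this is what gives a meaning to intersections of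
  such spaces for different exponents. The values of \<open>f\<close> on other functions are irrelevant.\<close>

definition W_neg1 :: "(real^2) set \<Rightarrow> real \<Rightarrow> ((real^2 \<Rightarrow> real) \<Rightarrow> real) set" where
  "W_neg1 \<Omega> q =
    {f. (\<forall>\<phi> \<in> test_functions \<Omega>. \<forall>\<psi> \<in> test_functions \<Omega>.
           f (\<lambda>x. \<phi> x + \<psi> x) = f \<phi> + f \<psi>) \<and>
        (\<forall>\<phi> \<in> test_functions \<Omega>. \<forall>c. f (\<lambda>x. c * \<phi> x) = c * f \<phi>) \<and>
        (\<exists>C. \<forall>\<phi> \<in> test_functions \<Omega>. \<bar>f \<phi>\<bar> \<le> C * W1_norm \<Omega> (q / (q - 1)) \<phi> (grad \<phi>))}"

abbreviation H_neg1 :: "(real^2) set \<Rightarrow> ((real^2 \<Rightarrow> real) \<Rightarrow> real) set" where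
  "H_neg1 \<Omega> \<equiv> W_neg1 \<Omega> 2"


section \<open>The conductivity problem and its homogenized conductivity\<close>

text \<open>\<open>u \<in> H\<^sup>1\<^sub>0(\<Omega>)\<close> and \<open>-div (\<sigma> \<nabla>u) = f\<close> in the sense of distributions in \<open>\<Omega>\<close>.\<close>

definition dirichlet_solution ::
    "(real^2) set \<Rightarrow> (real^2 \<Rightarrow> real^2^2) \<Rightarrow> ((real^2 \<Rightarrow> real) \<Rightarrow> real) \<Rightarrow> (real^2 \<Rightarrow> real) \<Rightarrow> bool" where
  "dirichlet_solution \<Omega> \<sigma> f u \<longleftrightarrow>
    (\<exists>g. W1_0 \<Omega> 2 u g \<and>
         (\<forall>\<phi> \<in> test_functions \<Omega>. (LINT x|lebesgue_on \<Omega>. (\<sigma> x *v g x) \<bullet> grad \<phi> x) = f \<phi>))"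

definition the_dirichlet_solution ::
    "(real^2) set \<Rightarrow> (real^2 \<Rightarrow> real^2^2) \<Rightarrow> ((real^2 \<Rightarrow> real) \<Rightarrow> real) \<Rightarrow> (real^2 \<Rightarrow> real) \<Rightarrow> bool" where
  "the_dirichlet_solution \<Omega> \<sigma> f u \<longleftrightarrow>
    dirichlet_solution \<Omega> \<sigma> f u \<and>
    (\<forall>v. dirichlet_solution \<Omega> \<sigma> f v \<longrightarrow> (AE x in lebesgue_on \<Omega>. v x = u x))"

text \<open>Elements of \<open>H\<^sup>1\<^sub>0(\<Omega>)\<close> being classes of functions, uniform convergence is that of suitable
  representatives; as there are countably many functions, this is convergence in
  \<open>L\<^sup>\<infinity>(\<Omega>)\<close>, and ordinary uniform convergence of the continuous representatives
  if these exist.\<close>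

definition homogenized_conductivity ::
    "(real^2) set \<Rightarrow> ((real^2 \<Rightarrow> real) \<Rightarrow> real) \<Rightarrow> (nat \<Rightarrow> real^2 \<Rightarrow> real^2^2) \<Rightarrow> real^2^2 \<Rightarrow> bool" where
  "homogenized_conductivity \<Omega> f \<sigma> A \<longleftrightarrow>
    (\<exists>v u. (\<forall>n. the_dirichlet_solution \<Omega> (\<sigma> n) f (v n)) \<and>
           the_dirichlet_solution \<Omega> (\<lambda>_. A) f u \<and>
           uniform_limit \<Omega> v u sequentially)"


section \<open>The periodic cross-shaped structure\<close>

definition cell :: "real \<Rightarrow> (real^2) set" where
  "cell l = {x. - (l / 2) < x $ 1 \<and> x $ 1 < l / 2 \<and> - (1 / 2) < x $ 2 \<and> x $ 2 < 1 / 2}"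

definition cross :: "real \<Rightarrow> real \<Rightarrow> (real^2) set" where
  "cross l t = {x \<in> cell l. \<bar>x $ 1\<bar> \<le> t \<or> \<bar>x $ 2\<bar> \<le> t}"

text \<open>Translate by a period into the half-open cell. Points outside the translates of the open
  cell form a null set, on which the periodic extension below is arbitrary.\<close>

definition cell_translate :: "real \<Rightarrow> real^2 \<Rightarrow> real^2" where
  "cell_translate l x = vector [x $ 1 - l * of_int (round (x $ 1 / l)), x $ 2 - of_int (round (x $ 2))]"

definition hall_matrix :: "real \<Rightarrow> real \<Rightarrow> real \<Rightarrow> real^2^2" where
  "hall_matrix \<alpha> \<beta> h = \<alpha> *\<^sub>R mat 1 + (\<beta> * h) *\<^sub>R J"

definition cross_conductivity ::
    "real \<Rightarrow> real \<Rightarrow> real \<Rightarrow> real \<Rightarrow> real \<Rightarrow> real \<Rightarrow> real \<Rightarrow> real^2 \<Rightarrow> real^2^2" where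
  "cross_conductivity l t \<alpha>1 \<beta>1 \<alpha>2 \<beta>2 h x =
    (if cell_translate l x \<in> cross l t then hall_matrix \<alpha>2 \<beta>2 h else hall_matrix \<alpha>1 \<beta>1 h)"

lemma cell_translate_cell:
  assumes "l > 0" "x \<in> cell l"
  shows "cell_translate l x = x"
proof -
  have "round (x $ 1 / l) = 0" "round (x $ 2) = 0"
    using assms by (auto simp: cell_def round_def floor_eq_iff field_simps)
  then show ?thesis
    by (simp add: cell_translate_def vec_eq_iff forall_2)
qed

lemma cross_conductivity_on_cell:
  assumes "l > 0" "x \<in> cell l"
  shows "cross_conductivity l t \<alpha>1 \<beta>1 \<alpha>2 \<beta>2 h x =
    (if x \<in> cross l t then hall_matrix \<alpha>2 \<beta>2 h else hall_matrix \<alpha>1 \<beta>1 h)"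
  using assms by (simp add: cross_conductivity_def cell_translate_cell)

lemma cross_conductivity_periodic:
  assumes "l > 0"
  shows "cross_conductivity l t \<alpha>1 \<beta>1 \<alpha>2 \<beta>2 h (x + vector [l, 0]) =
         cross_conductivity l t \<alpha>1 \<beta>1 \<alpha>2 \<beta>2 h x"
    and "cross_conductivity l t \<alpha>1 \<beta>1 \<alpha>2 \<beta>2 h (x + vector [0, 1]) =
         cross_conductivity l t \<alpha>1 \<beta>1 \<alpha>2 \<beta>2 h x"
proof -
  have r: "round (y + 1) = round y + 1" for y :: real
    unfolding round_def using floor_add_int[of "y + 1/2" 1] by (simp add: algebra_simps)
  then have r': "round (1 + y) = round y + 1" for y :: real
    by (metis add.commute)
  have "cell_translate l (x + vector [l, 0]) = cell_translate l x"
    using assms by (simp add: cell_translate_def add_divide_distrib r r' algebra_simps)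
  moreover have "cell_translate l (x + vector [0, 1]) = cell_translate l x"
    by (simp add: cell_translate_def r)
  ultimately show "cross_conductivity l t \<alpha>1 \<beta>1 \<alpha>2 \<beta>2 h (x + vector [l, 0]) =
      cross_conductivity l t \<alpha>1 \<beta>1 \<alpha>2 \<beta>2 h x"
    and "cross_conductivity l t \<alpha>1 \<beta>1 \<alpha>2 \<beta>2 h (x + vector [0, 1]) =
      cross_conductivity l t \<alpha>1 \<beta>1 \<alpha>2 \<beta>2 h x"
    by (simp_all add: cross_conductivity_def)
qed

end

theory Submission imports Defs begin

text \<open>Write \<open>A\<close>, \<open>B\<close> for the coefficients in the strips (the factor \<open>h\<close> included) and \<open>\<phi>\<close> for a test
  function close to the limit solution. In a horizontal strip the field \<open>(1, e)\<close> with \<open>e = - B / A\<close>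
  has no transversal flux and the longitudinal flux \<open>(A\<^sup>2 + B\<^sup>2) / A\<close>, and similarly in a vertical
  strip. A corrector of size \<open>\<epsilon> t\<close> supported near the strips turns \<open>\<nabla>\<phi>\<close> into a combination of these
  fields. Its flux is close, in the energy norm, to one that oscillates in each component only in the
  transversal direction; there the derivative can be moved by parts, and
  \<open>2 t (A\<^sup>2 + B\<^sup>2) / A\<close> converges to \<open>(\<alpha>\<^sub>2\<^sup>2 + \<beta>\<^sub>2\<^sup>2 h\<^sup>2) / ((l + 1) \<alpha>\<^sub>2)\<close>. The crossings, where
  both corrections interfere, have the relative area \<open>t\<^sup>2\<close> and contribute an energy of order \<open>t\<close>. Testing
  with the difference gives convergence in \<open>L\<^sup>2\<close>.

  Convergence is uniform because the solutions are equicontinuous up to the boundary, with a modulus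
  that depends on the lower ellipticity bound only and not on the unbounded coefficients: by the
  Courant--Lebesgue lemma, the energy bound yields a small square on whose boundary the solution
  oscillates little, and as \<open>f\<close> lies in \<open>W\<^sup>-\<^sup>1\<^sup>,\<^sup>q\<close> with \<open>q > 2\<close>, Stampacchia's method extends this to the
  interior. At the boundary of \<open>\<Omega>\<close> such squares meet the complement, where the solution is zero.\<close>

section \<open>Gradients and smooth functions\<close>

text \<open>In the strips the coefficients are of order 1 / t, so no estimate that is uniform in n
  may use their upper bound. The residual R of the corrector is therefore paired with the energy of
  the test function: it costs the integral of R^2 divided by the coefficient. At a crossing R is of
  order 1 / t, which costs 1 / t there, and the relative area t^2 leaves order t.

  The entries of the limit are densities: horizontal strips fill the fraction 2 t, vertical ones 2 t
  / l, and both carry the flux (A^2 + B^2) / A along themselves. They carry none across, so the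
  off-diagonal entries are those of the material between the strips.

  Truncation and Courant--Lebesgue need smooth functions, while solutions are limits. Each solution
  thus comes with a sequence of test functions that solve the equation up to an error tending to 0.
  With such an error level sets become small instead of null, and Borel--Cantelli along the sequence
  recovers a statement almost everywhere. Existence is proved in the same spirit, from approximate
  minimizers in the incomplete space of test functions.\<close>

lemma has_derivative_grad:
  fixes \<phi> :: "real^2 \<Rightarrow> real"
  assumes "\<phi> differentiable (at x)"
  shows "(\<phi> has_derivative (\<lambda>v. grad \<phi> x \<bullet> v)) (at x)"
proof -
  have d: "(\<phi> has_derivative frechet_derivative \<phi> (at x)) (at x)"
    using assms frechet_derivative_works by blast
  then interpret bounded_linear "frechet_derivative \<phi> (at x)"
    by (rule has_derivative_bounded_linear)
  have "frechet_derivative \<phi> (at x) = (\<lambda>v. grad \<phi> x \<bullet> v)"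
  proof
    fix v :: "real^2"
    have "v = v $ 1 *\<^sub>R axis 1 1 + v $ 2 *\<^sub>R axis 2 1"
      by (simp add: vec_eq_iff forall_2 axis_def)
    then have "frechet_derivative \<phi> (at x) v = frechet_derivative \<phi> (at x) (v $ 1 *\<^sub>R axis 1 1 + v $ 2 *\<^sub>R axis 2 1)"
      by simp
    also have "\<dots> = v $ 1 * frechet_derivative \<phi> (at x) (axis 1 1) + v $ 2 * frechet_derivative \<phi> (at x) (axis 2 1)"
      by (simp add: add scaleR)
    also have "\<dots> = grad \<phi> x \<bullet> v"
      by (simp add: grad_def inner_vec_def sum_2)
    finally show "frechet_derivative \<phi> (at x) v = grad \<phi> x \<bullet> v" .
  qed
  with d show ?thesis by simp
qed

lemma grad_eqI:
  assumes "(\<phi> has_derivative (\<lambda>v. g \<bullet> v)) (at x)"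
  shows "grad \<phi> x = g"
  using frechet_derivative_at[OF assms]
  by (simp add: grad_def vec_eq_iff inner_axis fun_eq_iff)
     (metis inner_axis inner_real_def mult.right_neutral)

lemma grad_local:
  assumes "open U" "x \<in> U" "\<And>y. y \<in> U \<Longrightarrow> \<phi> y = \<psi> y"
  shows "\<phi> differentiable (at x) \<longleftrightarrow> \<psi> differentiable (at x)" "grad \<phi> x = grad \<psi> x"
proof -
  have e: "(\<phi> has_derivative D) (at x) \<longleftrightarrow> (\<psi> has_derivative D) (at x)" for D
    using has_derivative_transform_within_open[of \<phi> D x UNIV U \<psi>]
      has_derivative_transform_within_open[of \<psi> D x UNIV U \<phi>] assms by auto
  then show "\<phi> differentiable (at x) \<longleftrightarrow> \<psi> differentiable (at x)"
    by (simp add: differentiable_def)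
  show "grad \<phi> x = grad \<psi> x"
    using e by (simp add: grad_def frechet_derivative_def)
qed

lemma grad_const [simp]: "grad (\<lambda>x. c) x = 0"
  by (rule grad_eqI) simp

lemma grad_add:
  assumes "\<phi> differentiable (at x)" "\<psi> differentiable (at x)"
  shows "grad (\<lambda>x. \<phi> x + \<psi> x) x = grad \<phi> x + grad \<psi> x"
  by (rule grad_eqI)
     (auto intro!: derivative_eq_intros has_derivative_grad assms simp: inner_add_left)

lemma grad_mult:
  assumes "\<phi> differentiable (at x)" "\<psi> differentiable (at x)"
  shows "grad (\<lambda>x. \<phi> x * \<psi> x) x = \<phi> x *\<^sub>R grad \<psi> x + \<psi> x *\<^sub>R grad \<phi> x"
  by (rule grad_eqI)
     (auto intro!: derivative_eq_intros has_derivative_grad assms simp: inner_add_left)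

lemma grad_cmult:
  assumes "\<phi> differentiable (at x)"
  shows "grad (\<lambda>x. c * \<phi> x) x = c *\<^sub>R grad \<phi> x"
  using grad_mult[of "\<lambda>x. c" x \<phi>] assms by simp

lemma grad_diff:
  assumes "\<phi> differentiable (at x)" "\<psi> differentiable (at x)"
  shows "grad (\<lambda>x. \<phi> x - \<psi> x) x = grad \<phi> x - grad \<psi> x"
  by (rule grad_eqI)
     (auto intro!: derivative_eq_intros has_derivative_grad assms simp: inner_diff_left)

lemma grad_comp:
  assumes "\<phi> differentiable (at x)" "(G has_real_derivative G') (at (\<phi> x))"
  shows "(\<lambda>x. G (\<phi> x)) differentiable (at x)" "grad (\<lambda>x. G (\<phi> x)) x = G' *\<^sub>R grad \<phi> x"
proof -
  have "((\<lambda>x. G (\<phi> x)) has_derivative (\<lambda>v. (G' *\<^sub>R grad \<phi> x) \<bullet> v)) (at x)"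
    using has_derivative_compose[OF has_derivative_grad[OF assms(1)]
        assms(2)[unfolded has_field_derivative_def]] by simp
  then show "(\<lambda>x. G (\<phi> x)) differentiable (at x)" "grad (\<lambda>x. G (\<phi> x)) x = G' *\<^sub>R grad \<phi> x"
    by (auto simp: differentiable_def intro: grad_eqI)
qed

lemma Ck_continuous: "Ck k \<phi> \<Longrightarrow> continuous_on UNIV \<phi>"
  by (cases k) (auto intro!: differentiable_imp_continuous_on
      simp: differentiable_on_def intro: differentiable_at_withinI)

lemma Ck_SucD: "Ck (Suc k) \<phi> \<Longrightarrow> Ck k \<phi>"
proof (induction k arbitrary: \<phi>)
  case 0
  then show ?case using Ck_continuous[OF 0] by simp
next
  case (Suc k)
  then show ?case by (subst Ck.simps(2)) auto
qed

text \<open>Regularity is checked near each point. This glues functions that are defined by cases,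
  such as the truncation on a square that is extended by 0.\<close>

lemma Ck_local:
  assumes "\<And>x. \<exists>U \<psi>. open U \<and> x \<in> U \<and> Ck k \<psi> \<and> (\<forall>y\<in>U. \<phi> y = \<psi> y)"
  shows "Ck k \<phi>"
  using assms
proof (induction k arbitrary: \<phi>)
  case 0
  have "isCont \<phi> x" for x
  proof -
    obtain U \<psi> where "open U" "x \<in> U" "continuous_on UNIV \<psi>" "\<forall>y\<in>U. \<phi> y = \<psi> y"
      using 0[of x] by auto
    then have "continuous_on U \<phi>"
      by (metis continuous_on_cong continuous_on_subset subset_UNIV)
    then show ?thesis using \<open>open U\<close> \<open>x \<in> U\<close> by (simp add: continuous_on_eq_continuous_at)
  qed
  then show ?case by (simp add: continuous_at_imp_continuous_on)
next
  case (Suc k)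
  have "\<phi> differentiable (at x)" for x
  proof -
    obtain U \<psi> where U: "open U" "x \<in> U" "Ck (Suc k) \<psi>" "\<forall>y\<in>U. \<phi> y = \<psi> y"
      using Suc.prems[of x] by auto
    then show ?thesis using grad_local(1)[of U x \<phi> \<psi>] by simp
  qed
  moreover have "Ck k (\<lambda>x. grad \<phi> x $ i)" for i
  proof (rule Suc.IH)
    fix x
    obtain U \<psi> where U: "open U" "x \<in> U" "Ck (Suc k) \<psi>" "\<forall>y\<in>U. \<phi> y = \<psi> y"
      using Suc.prems[of x] by auto
    then have "\<forall>y\<in>U. grad \<phi> y $ i = grad \<psi> y $ i"
      using grad_local(2)[OF U(1), of _ \<phi> \<psi>] by simp
    moreover have "Ck k (\<lambda>x. grad \<psi> x $ i)" using U(3) by simp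
    ultimately show "\<exists>U \<psi>. open U \<and> x \<in> U \<and> Ck k \<psi> \<and> (\<forall>y\<in>U. grad \<phi> y $ i = \<psi> y)"
      using U(1,2) by blast
  qed
  ultimately show ?case by simp
qed

lemma Ck_const: "Ck k (\<lambda>x. c)"
  by (induction k arbitrary: c) auto

lemma Ck_add: "Ck k \<phi> \<Longrightarrow> Ck k \<psi> \<Longrightarrow> Ck k (\<lambda>x. \<phi> x + \<psi> x)"
proof (induction k arbitrary: \<phi> \<psi>)
  case 0
  then show ?case by (auto intro!: continuous_intros)
next
  case (Suc k)
  then show ?case by (auto simp: grad_add)
qed

lemma Ck_mult: "Ck k \<phi> \<Longrightarrow> Ck k \<psi> \<Longrightarrow> Ck k (\<lambda>x. \<phi> x * \<psi> x)"
proof (induction k arbitrary: \<phi> \<psi>)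
  case 0
  then show ?case by (auto intro!: continuous_intros)
next
  case (Suc k)
  have "Ck k \<phi>" "Ck k \<psi>" using Suc.prems by (auto dest: Ck_SucD simp del: Ck.simps)
  then show ?case using Suc.prems Suc.IH by (auto simp: grad_mult intro!: Ck_add)
qed

lemma Ck_coord: "Ck k (\<lambda>x. x $ j)"
proof (cases k)
  case (Suc n)
  have d: "((\<lambda>x. x $ j) has_derivative (\<lambda>v. axis j 1 \<bullet> v)) (at x)" for x :: "real^2"
    using bounded_linear_imp_has_derivative[OF bounded_linear_vec_nth]
    by (simp add: inner_axis' )
  then have "grad (\<lambda>x. x $ j) x = axis j 1" for x :: "real^2"
    by (rule grad_eqI)
  then show ?thesis using d Suc by (auto simp: differentiable_def Ck_const)
qed (auto intro!: continuous_intros)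

text \<open>The derivative is existentially quantified, so closure rules are proved by exhibiting
  it. Functions of this class serve as profiles: \<open>Ck_comp\<close> composes them with functions
  of the plane, and \<open>Dk_per\<close> makes them periodic.\<close>

primrec Dk :: "nat \<Rightarrow> (real \<Rightarrow> real) \<Rightarrow> bool" where
  "Dk 0 f \<longleftrightarrow> continuous_on UNIV f"
| "Dk (Suc k) f \<longleftrightarrow> (\<exists>f'. (\<forall>x. (f has_real_derivative f' x) (at x)) \<and> Dk k f')"

lemma Dk_SucI: "(\<And>x. (f has_real_derivative f' x) (at x)) \<Longrightarrow> Dk k f' \<Longrightarrow> Dk (Suc k) f"
  by auto

lemma Dk_continuous: "Dk k f \<Longrightarrow> continuous_on UNIV f"
proof (cases k)
  case (Suc n)
  moreover assume "Dk k f"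
  ultimately obtain f' where "\<forall>x. (f has_real_derivative f' x) (at x)" by auto
  then show ?thesis by (intro continuous_at_imp_continuous_on) (blast intro: DERIV_isCont)
qed simp

lemma Dk_SucD: "Dk (Suc k) f \<Longrightarrow> Dk k f"
proof (induction k arbitrary: f)
  case 0
  then show ?case using Dk_continuous[OF 0] by simp
next
  case (Suc k)
  obtain f' where f': "\<forall>x. (f has_real_derivative f' x) (at x)" "Dk (Suc k) f'"
    using Suc.prems by (subst (asm) Dk.simps(2)) (erule exE, erule conjE)
  show ?case
  proof (rule Dk_SucI)
    show "(f has_real_derivative f' x) (at x)" for x using f'(1) by (rule spec)
    show "Dk k f'" using f'(2) by (rule Suc.IH)
  qed
qed

lemma Dk_const: "Dk k (\<lambda>x. c)"
proof (induction k arbitrary: c)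
  case (Suc k)
  show ?case unfolding Dk.simps
    by (rule exI[of _ "\<lambda>x. 0"]) (simp add: Suc)
qed auto

lemma Dk_add: "Dk k f \<Longrightarrow> Dk k g \<Longrightarrow> Dk k (\<lambda>x. f x + g x)"
proof (induction k arbitrary: f g)
  case 0
  then show ?case by (auto intro!: continuous_intros)
next
  case (Suc k)
  obtain f' g' where *: "\<And>x. (f has_real_derivative f' x) (at x)" "Dk k f'"
    "\<And>x. (g has_real_derivative g' x) (at x)" "Dk k g'"
    using Suc.prems by auto
  then show ?case unfolding Dk.simps
    by (intro exI[of _ "\<lambda>x. f' x + g' x"]) (auto intro: DERIV_add Suc.IH)
qed

lemma Dk_mult: "Dk k f \<Longrightarrow> Dk k g \<Longrightarrow> Dk k (\<lambda>x. f x * g x)"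
proof (induction k arbitrary: f g)
  case 0
  then show ?case by (auto intro!: continuous_intros)
next
  case (Suc k)
  obtain f' g' where *: "\<And>x. (f has_real_derivative f' x) (at x)" "Dk k f'"
    "\<And>x. (g has_real_derivative g' x) (at x)" "Dk k g'"
    using Suc.prems by auto
  have "Dk k f" "Dk k g" using Suc.prems by (blast dest: Dk_SucD)+
  then have "Dk k (\<lambda>x. f x * g' x + f' x * g x)"
    using * by (intro Dk_add Suc.IH)
  moreover have "((\<lambda>x. f x * g x) has_real_derivative f x * g' x + f' x * g x) (at x)" for x
    using * by (auto intro!: derivative_eq_intros)
  ultimately show ?case by (rule Dk_SucI[rotated])
qed

lemma Dk_inverse:
  assumes "Dk k f" "\<And>x. f x \<noteq> 0"
  shows "Dk k (\<lambda>x. inverse (f x))"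
  using assms
proof (induction k arbitrary: f)
  case 0
  then show ?case by (auto intro!: continuous_intros)
next
  case (Suc k)
  obtain f' where *: "\<And>x. (f has_real_derivative f' x) (at x)" "Dk k f'"
    using Suc.prems by auto
  have "Dk k f" using Suc.prems by (blast dest: Dk_SucD)
  then have "Dk k (\<lambda>x. (-1) * (inverse (f x) * (f' x * inverse (f x))))"
    using * Suc by (intro Dk_mult Dk_const Suc.IH) auto
  moreover have "((\<lambda>x. inverse (f x)) has_real_derivative (-1) * (inverse (f x) * (f' x * inverse (f x)))) (at x)" for x
    using * Suc.prems by (auto intro!: derivative_eq_intros)
  ultimately show ?case by (rule Dk_SucI[rotated])
qed

lemma Dk_affine:
  assumes "Dk k f"
  shows "Dk k (\<lambda>x. f (a * x + b))"
  using assms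
proof (induction k arbitrary: f)
  case 0
  then show ?case by (auto intro!: continuous_intros continuous_on_compose2[of UNIV f])
next
  case (Suc k)
  obtain f' where *: "\<And>x. (f has_real_derivative f' x) (at x)" "Dk k f'"
    using Suc.prems by auto
  have "((\<lambda>x. f (a * x + b)) has_real_derivative a * f' (a * x + b)) (at x)" for x
  proof -
    have "((\<lambda>x. a * x + b) has_real_derivative a) (at x)"
      by (auto intro!: derivative_eq_intros)
    from DERIV_chain2[OF *(1) this] show ?thesis by (simp add: mult.commute)
  qed
  moreover have "Dk k (\<lambda>x. a * f' (a * x + b))"
    using * by (intro Dk_mult Dk_const Suc.IH)
  ultimately show ?case by (rule Dk_SucI)
qed

lemma Dk_id: "Dk k (\<lambda>x. x)"
proof (cases k)
  case (Suc n)
  then show ?thesis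
    by (auto simp: Dk_const intro: exI[of _ "\<lambda>x. 1"])
qed auto

lemma Dk_local:
  assumes "\<And>x. \<exists>U g. open U \<and> x \<in> U \<and> Dk k g \<and> (\<forall>y\<in>U. f y = g y)"
  shows "Dk k f"
  using assms
proof (induction k arbitrary: f)
  case 0
  have "isCont f x" for x
  proof -
    obtain U g where "open U" "x \<in> U" "continuous_on UNIV g" "\<forall>y\<in>U. f y = g y"
      using 0[of x] by auto
    then have "continuous_on U f"
      by (metis continuous_on_cong continuous_on_subset subset_UNIV)
    then show ?thesis using \<open>open U\<close> \<open>x \<in> U\<close> by (simp add: continuous_on_eq_continuous_at)
  qed
  then show ?case by (simp add: continuous_at_imp_continuous_on)
next
  case (Suc k)
  have ex: "\<exists>U g g'. open U \<and> x \<in> U \<and> (\<forall>x. (g has_real_derivative g' x) (at x)) \<and> Dk k g' \<and> (\<forall>y\<in>U. f y = g y)" for x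
    using Suc.prems[of x] by (metis Dk.simps(2))
  have der: "(f has_real_derivative g' y) (at y)"
    if "open U" "y \<in> U" "\<forall>x. (g has_real_derivative g' x) (at x)" "\<forall>y\<in>U. f y = g y" for U g g' y
    using that has_field_derivative_transform_within_open[of g "g' y" y U f] by auto
  then have D: "(f has_real_derivative deriv f x) (at x)" for x
    using ex[of x] der by (meson DERIV_deriv_iff_real_differentiable DERIV_imp_deriv real_differentiable_def)
  moreover have "Dk k (deriv f)"
  proof (rule Suc.IH)
    fix x
    obtain U g g' where U: "open U" "x \<in> U" "\<forall>x. (g has_real_derivative g' x) (at x)" "Dk k g'" "\<forall>y\<in>U. f y = g y"
      using ex[of x] by auto
    then have "\<forall>y\<in>U. deriv f y = g' y" using der by (metis DERIV_imp_deriv)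
    with U show "\<exists>U g. open U \<and> x \<in> U \<and> Dk k g \<and> (\<forall>y\<in>U. deriv f y = g y)" by blast
  qed
  ultimately show ?case by (rule Dk_SucI)
qed

lemma Ck_comp:
  assumes "Dk k f" "Ck k \<phi>"
  shows "Ck k (\<lambda>x. f (\<phi> x))"
  using assms
proof (induction k arbitrary: f)
  case 0
  then show ?case by (auto intro!: continuous_on_compose2[of UNIV f])
next
  case (Suc k)
  obtain f' where *: "\<And>x. (f has_real_derivative f' x) (at x)" "Dk k f'"
    using Suc.prems by auto
  have "Ck k \<phi>" using Suc.prems(2) by (rule Ck_SucD)
  then have "Ck k (\<lambda>x. f' (\<phi> x))" using * Suc.IH by auto
  then show ?case using Suc.prems *(1)
    by (auto simp: grad_comp[OF _ *(1)] intro!: Ck_mult)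
qed

section \<open>Smooth functions of the plane and test functions\<close>

definition smooth :: "(real^2 \<Rightarrow> real) \<Rightarrow> bool" where
  "smooth \<phi> \<longleftrightarrow> (\<forall>k. Ck k \<phi>)"

lemma smooth_const: "smooth (\<lambda>x. c)"
  and smooth_coord: "smooth (\<lambda>x. x $ j)"
  and smooth_add: "smooth \<phi> \<Longrightarrow> smooth \<psi> \<Longrightarrow> smooth (\<lambda>x. \<phi> x + \<psi> x)"
  and smooth_mult: "smooth \<phi> \<Longrightarrow> smooth \<psi> \<Longrightarrow> smooth (\<lambda>x. \<phi> x * \<psi> x)"
  and smooth_comp: "(\<And>k. Dk k f) \<Longrightarrow> smooth \<phi> \<Longrightarrow> smooth (\<lambda>x. f (\<phi> x))"
  by (auto simp: smooth_def Ck_const Ck_coord Ck_add Ck_mult Ck_comp)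

lemma smooth_diff: "smooth \<phi> \<Longrightarrow> smooth \<psi> \<Longrightarrow> smooth (\<lambda>x. \<phi> x - \<psi> x)"
  using smooth_add[OF _ smooth_mult[OF smooth_const[of "-1"]], of \<phi> \<psi>] by simp

lemma smooth_continuous: "smooth \<phi> \<Longrightarrow> continuous_on UNIV \<phi>"
  by (auto simp: smooth_def dest: Ck_continuous)

lemma smooth_differentiable: "smooth \<phi> \<Longrightarrow> \<phi> differentiable (at x)"
  by (metis smooth_def Ck.simps(2))

lemma smooth_grad: "smooth \<phi> \<Longrightarrow> smooth (\<lambda>x. grad \<phi> x $ i)"
  unfolding smooth_def by (metis Ck.simps(2))

lemma smooth_local:
  assumes "\<And>x. \<exists>U \<psi>. open U \<and> x \<in> U \<and> smooth \<psi> \<and> (\<forall>y\<in>U. \<phi> y = \<psi> y)"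
  shows "smooth \<phi>"
  unfolding smooth_def
proof
  fix k show "Ck k \<phi>"
    by (rule Ck_local) (metis assms smooth_def)
qed

text \<open>Any compact set off which the function vanishes may replace the closed support. The
  closure rules then only have to name such a set, for instance a union in the case of sums.\<close>

lemma test_functions_iff:
  "\<phi> \<in> test_functions \<Omega> \<longleftrightarrow> smooth \<phi> \<and> (\<exists>K. compact K \<and> K \<subseteq> \<Omega> \<and> (\<forall>x. x \<notin> K \<longrightarrow> \<phi> x = 0))"
    (is "?L \<longleftrightarrow> ?R")
proof
  assume ?L
  then show ?R unfolding test_functions_def smooth_def
    by (intro conjI exI[of _ "closure {x. \<phi> x \<noteq> 0}"]) (use closure_subset[of "{x. \<phi> x \<noteq> 0}"] in auto)
next
  assume R: ?R
  then obtain K where K: "compact K" "K \<subseteq> \<Omega>" "\<forall>x. x \<notin> K \<longrightarrow> \<phi> x = 0" by auto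
  then have "closure {x. \<phi> x \<noteq> 0} \<subseteq> K"
    by (intro closure_minimal) (auto simp: compact_imp_closed)
  moreover from this have "compact (closure {x. \<phi> x \<noteq> 0})"
    using K(1) by (metis closed_closure compact_Int_closed inf.absorb_iff2)
  ultimately show ?L using K R unfolding test_functions_def smooth_def by auto
qed

lemma test_functionsE:
  assumes "\<phi> \<in> test_functions \<Omega>"
  obtains K where "smooth \<phi>" "compact K" "K \<subseteq> \<Omega>" "\<And>x. x \<notin> K \<Longrightarrow> \<phi> x = 0" "\<And>x. x \<notin> K \<Longrightarrow> grad \<phi> x = 0"
proof -
  obtain K where K: "smooth \<phi>" "compact K" "K \<subseteq> \<Omega>" "\<And>x. x \<notin> K \<Longrightarrow> \<phi> x = 0"
    using assms by (auto simp: test_functions_iff)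
  have "grad \<phi> x = 0" if "x \<notin> K" for x
    using grad_local(2)[of "-K" x \<phi> "\<lambda>x. 0"] K that by (auto simp: compact_imp_closed open_Compl)
  with K that show ?thesis by auto
qed

lemma test_functions_smooth: "\<phi> \<in> test_functions \<Omega> \<Longrightarrow> smooth \<phi>"
  by (simp add: test_functions_iff)

lemma test_functions_zero: "(\<lambda>x. 0) \<in> test_functions \<Omega>"
  by (auto simp: test_functions_iff smooth_const)

lemma test_functions_add:
  assumes "\<phi> \<in> test_functions \<Omega>" "\<psi> \<in> test_functions \<Omega>"
  shows "(\<lambda>x. \<phi> x + \<psi> x) \<in> test_functions \<Omega>"
proof -
  obtain K L where "compact K" "K \<subseteq> \<Omega>" "\<forall>x. x \<notin> K \<longrightarrow> \<phi> x = 0"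
    "compact L" "L \<subseteq> \<Omega>" "\<forall>x. x \<notin> L \<longrightarrow> \<psi> x = 0"
    using assms by (auto simp: test_functions_iff)
  then have "compact (K \<union> L) \<and> K \<union> L \<subseteq> \<Omega> \<and> (\<forall>x. x \<notin> K \<union> L \<longrightarrow> \<phi> x + \<psi> x = 0)"
    by auto
  then show ?thesis using assms unfolding test_functions_iff by (blast intro: smooth_add)
qed

lemma test_functions_mult:
  assumes "\<phi> \<in> test_functions \<Omega>" "smooth \<psi>"
  shows "(\<lambda>x. \<psi> x * \<phi> x) \<in> test_functions \<Omega>"
  using assms by (auto simp: test_functions_iff intro: smooth_mult)

lemma test_functions_cmult:
  "\<phi> \<in> test_functions \<Omega> \<Longrightarrow> (\<lambda>x. c * \<phi> x) \<in> test_functions \<Omega>"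
  by (rule test_functions_mult[OF _ smooth_const])

lemma test_functions_diff:
  assumes "\<phi> \<in> test_functions \<Omega>" "\<psi> \<in> test_functions \<Omega>"
  shows "(\<lambda>x. \<phi> x - \<psi> x) \<in> test_functions \<Omega>"
  using test_functions_add[OF assms(1) test_functions_cmult[OF assms(2), of "-1"]] by simp

lemma test_functions_grad:
  assumes "\<phi> \<in> test_functions \<Omega>"
  shows "(\<lambda>x. grad \<phi> x $ i) \<in> test_functions \<Omega>"
  using assms by (elim test_functionsE) (auto simp: test_functions_iff smooth_grad)

section \<open>Cut-off functions\<close>

text \<open>For \<open>n = 0\<close> this is the flat function exp (- 1 / t). The powers of 1 / t
  make the family closed under differentiation up to linear combinations, so that one induction on
  the order gives smoothness of all members at once.\<close>

definition exp_inv :: "nat \<Rightarrow> real \<Rightarrow> real" where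
  "exp_inv n t = (if t > 0 then (1 / t) ^ n * exp (- (1 / t)) else 0)"

lemma exp_inv_tendsto: "(exp_inv n \<longlongrightarrow> 0) (at 0)"
proof -
  have "((\<lambda>x. x ^ n / exp x) \<longlongrightarrow> 0) (at_top :: real filter)"
    by (rule tendsto_power_div_exp_0)
  then have "((\<lambda>x. (inverse x) ^ n / exp (inverse x)) \<longlongrightarrow> 0) (at_right (0::real))"
    by (rule filterlim_compose[OF _ filterlim_inverse_at_top_right])
  then have "(exp_inv n \<longlongrightarrow> 0) (at_right 0)"
    by (rule Lim_transform_eventually)
       (auto simp: exp_inv_def eventually_at_right_field inverse_eq_divide exp_minus divide_simps intro!: exI[of _ 1])
  moreover have "(exp_inv n \<longlongrightarrow> 0) (at_left 0)"
    by (rule Lim_transform_eventually[OF tendsto_const])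
       (auto simp: exp_inv_def eventually_at_left_field intro!: exI[of _ "-1"])
  ultimately show ?thesis by (intro filterlim_split_at)
qed

lemma exp_inv_has_derivative:
  "(exp_inv n has_real_derivative exp_inv (n + 2) t + (- real n) * exp_inv (n + 1) t) (at t)"
proof -
  consider "t < 0" | "t = 0" | "t > 0" by linarith
  then show ?thesis
  proof cases
    case 1
    have "((\<lambda>t. 0) has_real_derivative 0) (at t)" by simp
    then have "(exp_inv n has_real_derivative 0) (at t)"
      by (rule has_field_derivative_transform_within_open[of _ _ _ "{..<0}"])
         (use 1 in \<open>auto simp: exp_inv_def\<close>)
    with 1 show ?thesis by (simp add: exp_inv_def)
  next
    case 2
    \<comment> \<open>At 0 the difference quotient of \<open>exp_inv n\<close> is
      \<open>exp_inv (n + 1)\<close> itself, whose limit is known.\<close>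
    have "((\<lambda>h. (exp_inv n (0 + h) - exp_inv n 0) / h) \<longlongrightarrow> 0) (at 0)"
      by (rule Lim_transform_eventually[OF exp_inv_tendsto[of "n + 1"]])
         (auto simp: exp_inv_def)
    with 2 show ?thesis by (auto simp: DERIV_def exp_inv_def)
  next
    case 3
    have "((\<lambda>t. (1 / t) ^ n * exp (- (1 / t))) has_real_derivative
       (1 / t) ^ (n + 2) * exp (- (1 / t)) + (- real n) * ((1 / t) ^ (n + 1) * exp (- (1 / t)))) (at t)"
    proof -
      have y: "((\<lambda>t. 1 / t) has_real_derivative - ((1 / t)\<^sup>2)) (at t)"
        using 3 by (auto intro!: derivative_eq_intros simp: power2_eq_square)
      show ?thesis
        using DERIV_mult[OF DERIV_power[OF y, of n] DERIV_fun_exp[OF DERIV_minus[OF y]]]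
        by (rule DERIV_cong) (cases n; simp add: power2_eq_square algebra_simps flip: add_divide_distrib)
    qed
    then have "(exp_inv n has_real_derivative
       (1 / t) ^ (n + 2) * exp (- (1 / t)) + (- real n) * ((1 / t) ^ (n + 1) * exp (- (1 / t)))) (at t)"
      by (rule has_field_derivative_transform_within_open[of _ _ _ "{0<..}"])
         (use 3 in \<open>auto simp: exp_inv_def\<close>)
    with 3 show ?thesis by (simp add: exp_inv_def)
  qed
qed

lemma Dk_exp_inv: "Dk k (exp_inv n)"
proof (induction k arbitrary: n)
  case 0
  show ?case using exp_inv_has_derivative[of n]
    by (auto intro!: continuous_at_imp_continuous_on intro: DERIV_isCont)
next
  case (Suc k)
  show ?case
    by (rule Dk_SucI[OF exp_inv_has_derivative]) (intro Dk_add Dk_mult Dk_const Suc)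
qed

lemma exp_inv_0_ge: "t \<ge> 1 \<Longrightarrow> exp_inv 0 t \<ge> exp (-1)"
  by (auto simp: exp_inv_def)

text \<open>\<open>exp_inv 2\<close> is the derivative of \<open>exp_inv 0\<close>, the profile of
  the smooth truncation. Since its values lie in [0, 1], the gradient of the truncation is
  \<open>D x *\<^sub>R grad \<phi> x\<close> with a factor satisfying
  \<open>D^2 \<le> D\<close>.\<close>

lemma exp_inv_2_bounds: "0 \<le> exp_inv 2 t" "exp_inv 2 t \<le> 1"
proof -
  show "0 \<le> exp_inv 2 t" by (auto simp: exp_inv_def)
  have *: "x\<^sup>2 * exp (- x) \<le> 1" if "x > 0" for x :: real
  proof -
    \<comment> \<open>At x / 2 the quadratic Taylor polynomial of exp exceeds x because (x / 2 -
      1)^2 is nonnegative; squaring x <= exp (x / 2) gives the claim.\<close>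
    have "1 + x/2 + (x/2)\<^sup>2 / 2 \<le> exp (x/2)"
      using that by (intro exp_lower_Taylor_quadratic) auto
    moreover have "0 \<le> (x/2 - 1)\<^sup>2" by simp
    ultimately have "x \<le> exp (x/2)" by (simp add: power2_eq_square algebra_simps)
    then have "x\<^sup>2 \<le> (exp (x/2))\<^sup>2" using that by (intro power_mono) auto
    also have "\<dots> = exp x" by (simp add: power2_eq_square flip: exp_add)
    finally show ?thesis by (simp add: exp_minus divide_simps)
  qed
  show "exp_inv 2 t \<le> 1"
    using *[of "1/t"] by (auto simp: exp_inv_def)
qed

lemma exp_inv_0_has_derivative: "(exp_inv 0 has_real_derivative exp_inv 2 t) (at t)"
  using exp_inv_has_derivative[of 0 t] by (simp add: numeral_2_eq_2)

definition smooth_step :: "real \<Rightarrow> real" where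
  "smooth_step x = exp_inv 0 x * inverse (exp_inv 0 x + exp_inv 0 ((-1) * x + 1))"

lemma Dk_smooth_step: "Dk k smooth_step"
proof -
  have "exp_inv 0 x + exp_inv 0 ((-1) * x + 1) \<noteq> 0" for x
    by (cases "x > 0"; cases "x < 1") (auto simp: exp_inv_def add_pos_pos less_imp_neq[symmetric])
  then have "Dk k (\<lambda>x. exp_inv 0 x * inverse (exp_inv 0 x + exp_inv 0 ((-1) * x + 1)))"
    by (intro Dk_mult Dk_inverse Dk_add Dk_exp_inv Dk_affine)
  then show ?thesis by (simp add: smooth_step_def[abs_def])
qed

lemma smooth_step_0: "x \<le> 0 \<Longrightarrow> smooth_step x = 0"
  and smooth_step_1: "x \<ge> 1 \<Longrightarrow> smooth_step x = 1"
  by (auto simp: smooth_step_def exp_inv_def)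

text \<open>Rescaled to \<open>t * S (y / t)\<close>, this is the profile of the corrector: slope
  exactly 1 across a strip of half-width t, support in the strip four times as wide, and a
  derivative bounded independently of t.\<close>

lemma cutoff_identity_exists:
  obtains S S' :: "real \<Rightarrow> real" and C :: real where
    "\<And>k. Dk k S" "\<And>y. (S has_real_derivative S' y) (at y)"
    "\<And>y. \<bar>y\<bar> \<le> 1 \<Longrightarrow> S y = y" "\<And>y. \<bar>y\<bar> \<le> 1 \<Longrightarrow> S' y = 1"
    "\<And>y. \<bar>y\<bar> \<ge> 4 \<Longrightarrow> S y = 0" "\<And>y. \<bar>y\<bar> \<ge> 4 \<Longrightarrow> S' y = 0"
    "\<And>y. \<bar>S y\<bar> \<le> C" "\<And>y. \<bar>S' y\<bar> \<le> C" "C \<ge> 1" "continuous_on UNIV S'"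
proof -
  \<comment> \<open>Both steps equal 1 for \<open>\<bar>y\<bar> \<le> 2\<close>, and one of them
    vanishes for \<open>\<bar>y\<bar> \<ge> 3\<close>. The claimed ranges 1 and 4 lie strictly
    inside, so the values of the derivative can be read off on open sets.\<close>
  define S where "S y = y * (smooth_step ((-1) * y + 3) * smooth_step (1 * y + 3))" for y
  have D: "Dk k S" for k
    unfolding S_def[abs_def] by (intro Dk_mult Dk_id Dk_affine Dk_smooth_step)
  from D[of 1] obtain S' where S': "\<And>y. (S has_real_derivative S' y) (at y)" "continuous_on UNIV S'"
    by auto
  have S1: "S y = y" if "\<bar>y\<bar> < 2" for y
    using that by (simp add: S_def smooth_step_1)
  have S0: "S y = 0" if "\<bar>y\<bar> > 3" for y
    using that smooth_step_0[of "3 - y"] smooth_step_0[of "y + 3"] by (cases "y > 0") (auto simp: S_def)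
  have "S' y = 1" if "\<bar>y\<bar> \<le> 1" for y
  proof -
    have "((\<lambda>y. y) has_real_derivative 1) (at y)" by simp
    then have "(S has_real_derivative 1) (at y)"
      by (rule has_field_derivative_transform_within_open[of _ _ _ "{-2<..<2}"])
         (use that S1 in auto)
    then show ?thesis using S' DERIV_unique by blast
  qed
  moreover have S'0: "S' y = 0" if "\<bar>y\<bar> > 3" for y
  proof -
    have "((\<lambda>y. 0) has_real_derivative 0) (at y)" by simp
    then have "(S has_real_derivative 0) (at y)"
      by (rule has_field_derivative_transform_within_open[of _ _ _ "{..<-3} \<union> {3<..}"])
         (use that S0 in auto)
    then show ?thesis using S' DERIV_unique by blast
  qed
  moreover have "\<exists>B. \<forall>y. \<bar>f y\<bar> \<le> B" if "continuous_on UNIV f" "\<And>y. \<bar>y\<bar> > 3 \<Longrightarrow> f y = 0" for f :: "real \<Rightarrow> real"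
  proof -
    have "compact (f ` {-3..3})"
      using that by (intro compact_continuous_image) (auto intro: continuous_on_subset)
    then obtain B where B: "\<forall>z\<in>f ` {-3..3}. norm z \<le> B"
      by (meson bounded_iff compact_imp_bounded)
    then have "\<bar>f y\<bar> \<le> max B 0" for y
    proof (cases "\<bar>y\<bar> > 3")
      case False
      then have "f y \<in> f ` {-3..3}" by (intro imageI) auto
      with B have "norm (f y) \<le> B" by blast
      then show ?thesis by simp
    qed (use that(2)[of y] in auto)
    then show ?thesis by blast
  qed
  from this[of S] this[of S'] obtain B1 B2 where "\<forall>y. \<bar>S y\<bar> \<le> B1" "\<forall>y. \<bar>S' y\<bar> \<le> B2"
    using S0 S'0 S' Dk_continuous[OF D[of 0]] by auto
  moreover from this have "\<bar>S y\<bar> \<le> max 1 (max B1 B2)" "\<bar>S' y\<bar> \<le> max 1 (max B1 B2)" for y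
    by (meson le_max_iff_disj)+
  ultimately show ?thesis
    by (intro that[of S S' "max 1 (max B1 B2)"]) (use D S' S1 S0 S'0 in auto)
qed

section \<open>Integration by parts in the plane\<close>

text \<open>A point is given by its coordinate \<open>i\<close> and the other one. Statements about
  lines parallel to an axis then cover both directions at once, the roles being exchanged by
  \<open>pt_oth\<close>.\<close>

definition pt :: "2 \<Rightarrow> real \<Rightarrow> real \<Rightarrow> real^2" where
  "pt i s u = (\<chi> k. if k = i then s else u)"

definition oth :: "2 \<Rightarrow> 2" where
  "oth i = (if i = 1 then 2 else 1)"

lemma oth_neq [simp]: "oth i \<noteq> i" "i \<noteq> oth i"
  using exhaust_2[of i] by (auto simp: oth_def)

lemma neq_oth_iff: "k \<noteq> i \<longleftrightarrow> k = oth i"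
  using exhaust_2[of i] exhaust_2[of k] by (auto simp: oth_def)

lemma pt_nth [simp]: "pt i s u $ i = s" "pt i s u $ (oth i) = u"
  by (auto simp: pt_def)

lemma pt_eta [simp]: "pt i (x $ i) (x $ oth i) = x"
  by (auto simp: pt_def vec_eq_iff neq_oth_iff)

lemma pt_oth: "pt (oth i) u s = pt i s u"
  by (auto simp: pt_def vec_eq_iff neq_oth_iff)

lemma UNIV_oth: "(UNIV :: 2 set) = {i, oth i}"
  using neq_oth_iff by blast

lemma all_oth: "(\<forall>k. P k) \<longleftrightarrow> P i \<and> P (oth i)"
  by (metis neq_oth_iff)

lemma pt_axis: "pt i s u = s *\<^sub>R axis i 1 + u *\<^sub>R axis (oth i) 1"
  by (auto simp: pt_def vec_eq_iff axis_def neq_oth_iff)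

lemma continuous_pt: "continuous_on UNIV (\<lambda>(s, u). pt i s u)"
  unfolding pt_axis case_prod_beta by (intro continuous_intros)

lemma measurable_pt [measurable]: "(\<lambda>(s, u). pt i s u) \<in> borel_measurable (lborel \<Otimes>\<^sub>M lborel)"
  using borel_measurable_continuous_onI[OF continuous_pt]
  by (simp add: lborel_prod)

lemma measurable_pt_snd [measurable]: "(\<lambda>u. pt i s u) \<in> borel_measurable borel"
  unfolding pt_axis by measurable

lemma Basis_real2: "(Basis :: (real^2) set) = {axis i 1, axis (oth i) 1}"
  by (auto simp: Basis_vec_def) (metis UNIV_I UNIV_oth empty_iff insert_iff)

text \<open>Lebesgue measure is determined by its values on boxes, whose preimages are products of
  intervals. This carries the theorems of Fubini and Tonelli from the product space over to
  \<open>real^2\<close>, with either coordinate as the inner one.\<close>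

lemma distr_pt: "distr (lborel \<Otimes>\<^sub>M lborel) borel (\<lambda>(s, u). pt i s u) = lborel"
proof (rule lborel_eqI[symmetric])
  fix l u :: "real^2"
  assume lu: "\<And>b. b \<in> Basis \<Longrightarrow> l \<bullet> b \<le> u \<bullet> b"
  have le: "l $ k \<le> u $ k" for k
    using lu[of "axis k 1"] by (simp add: inner_axis)
  have "(\<lambda>(s, w). pt i s w) -` box l u \<inter> space (lborel \<Otimes>\<^sub>M lborel) = {l $ i<..<u $ i} \<times> {l $ oth i<..<u $ oth i}"
    by (auto simp: mem_box_cart space_pair_measure all_oth[of _ i])
  then have "emeasure (distr (lborel \<Otimes>\<^sub>M lborel) borel (\<lambda>(s, w). pt i s w)) (box l u)
     = emeasure lborel {l $ i<..<u $ i} * emeasure lborel {l $ oth i<..<u $ oth i}"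
    by (simp add: emeasure_distr lborel.emeasure_pair_measure_Times)
  also have "\<dots> = ennreal ((u $ i - l $ i) * (u $ oth i - l $ oth i))"
    using le by (simp add: ennreal_mult)
  also have "(u $ i - l $ i) * (u $ oth i - l $ oth i) = (\<Prod>b\<in>Basis. (u - l) \<bullet> b)"
    by (simp add: Basis_real2[of i] axis_eq_axis inner_axis)
  finally show "emeasure (distr (lborel \<Otimes>\<^sub>M lborel) borel (\<lambda>(s, w). pt i s w)) (box l u)
     = (\<Prod>b\<in>Basis. (u - l) \<bullet> b)" .
qed simp

lemma nn_integral_pt:
  assumes [measurable]: "f \<in> borel_measurable borel"
  shows "(\<integral>\<^sup>+x. f x \<partial>lborel) = (\<integral>\<^sup>+u. \<integral>\<^sup>+s. f (pt i s u) \<partial>lborel \<partial>lborel)"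
proof -
  have "(\<integral>\<^sup>+x. f x \<partial>lborel) = (\<integral>\<^sup>+x. f x \<partial>distr (lborel \<Otimes>\<^sub>M lborel) borel (\<lambda>(s, u). pt i s u))"
    by (simp add: distr_pt)
  also have "\<dots> = (\<integral>\<^sup>+z. f (case z of (s, u) \<Rightarrow> pt i s u) \<partial>(lborel \<Otimes>\<^sub>M lborel))"
    by (intro nn_integral_distr) auto
  also have "\<dots> = (\<integral>\<^sup>+u. \<integral>\<^sup>+s. f (pt i s u) \<partial>lborel \<partial>lborel)"
    by (subst lborel_pair.nn_integral_snd[symmetric]) auto
  finally show ?thesis .
qed

lemma integral_pt:
  fixes f :: "real^2 \<Rightarrow> real"
  assumes "integrable lborel f"
  shows "(LINT x|lborel. f x) = (LINT u|lborel. LINT s|lborel. f (pt i s u))"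
proof -
  have [measurable]: "f \<in> borel_measurable borel" using assms by simp
  have "integrable (distr (lborel \<Otimes>\<^sub>M lborel) borel (\<lambda>(s, u). pt i s u)) f"
    using assms by (simp add: distr_pt)
  then have i: "integrable (lborel \<Otimes>\<^sub>M lborel) (\<lambda>(s, u). f (pt i s u))"
    by (subst (asm) integrable_distr_eq) (auto simp: case_prod_unfold)
  have "(LINT x|lborel. f x) = (LINT x|distr (lborel \<Otimes>\<^sub>M lborel) borel (\<lambda>(s, u). pt i s u). f x)"
    by (simp add: distr_pt)
  also have "\<dots> = (LINT z|(lborel \<Otimes>\<^sub>M lborel). f (case z of (s, u) \<Rightarrow> pt i s u))"
    by (intro integral_distr) auto
  also have "\<dots> = (LINT u|lborel. LINT s|lborel. f (pt i s u))"
    using lborel_pair.integral_snd[OF i] by (simp add: case_prod_unfold)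
  finally show ?thesis .
qed

lemma integrable_compact_support:
  fixes f :: "'a::euclidean_space \<Rightarrow> 'b::euclidean_space"
  assumes "continuous_on UNIV f" "compact K" "\<And>x. x \<notin> K \<Longrightarrow> f x = 0"
  shows "integrable lborel f"
proof -
  have "integrable lborel (\<lambda>x. indicator K x *\<^sub>R f x)"
    using assms by (intro borel_integrable_compact) (auto intro: continuous_on_subset)
  moreover have "(\<lambda>x. indicator K x *\<^sub>R f x) = f"
    using assms(3) by (auto simp: indicator_def)
  ultimately show ?thesis by simp
qed

lemma integrable_bounded_mult:
  fixes f :: "'a \<Rightarrow> 'b::euclidean_space" and z :: "'a \<Rightarrow> real"
  assumes "integrable M f" "z \<in> borel_measurable M" "\<And>x. \<bar>z x\<bar> \<le> C"
  shows "integrable M (\<lambda>x. z x *\<^sub>R f x)"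
proof (rule Bochner_Integration.integrable_bound[where f = "\<lambda>x. C *\<^sub>R f x"])
  show "AE x in M. norm (z x *\<^sub>R f x) \<le> norm (C *\<^sub>R f x)"
    using assms(3) by (auto intro!: AE_I2 mult_right_mono) (meson abs_ge_self order_trans)
qed (use assms in auto)

lemma line_derivative:
  assumes "smooth \<phi>"
  shows "((\<lambda>s. \<phi> (pt i s u)) has_real_derivative grad \<phi> (pt i s u) $ i) (at s)"
proof -
  have "((\<lambda>s. pt i s u) has_derivative (\<lambda>h. h *\<^sub>R axis i 1)) (at s)"
    unfolding pt_axis by (auto intro!: derivative_eq_intros)
  from has_derivative_compose[OF this has_derivative_grad[OF smooth_differentiable[OF assms]]]
  have "((\<lambda>s. \<phi> (pt i s u)) has_derivative (\<lambda>h. h * grad \<phi> (pt i s u) $ i)) (at s)"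
    by (simp add: inner_axis)
  then show ?thesis by (simp add: has_field_derivative_def mult_commute_abs)
qed

lemma continuous_line:
  assumes "continuous_on UNIV f"
  shows "continuous_on UNIV (\<lambda>s. f (pt i s u))"
  by (rule continuous_on_compose2[OF assms]) (auto simp: pt_axis intro!: continuous_intros)

lemma compact_line_bound:
  assumes "compact K"
  obtains L where "L > 0" "\<And>s u. pt i s u \<in> K \<Longrightarrow> \<bar>s\<bar> \<le> L"
proof -
  obtain B where B: "\<And>x. x \<in> K \<Longrightarrow> norm x \<le> B"
    using compact_imp_bounded[OF assms] by (auto simp: bounded_iff)
  have "\<bar>s\<bar> \<le> max B 1" if "pt i s u \<in> K" for s u
    using B[OF that] component_le_norm_cart[of "pt i s u" i] by simp
  then show ?thesis by (intro that[of "max B 1"]) auto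
qed

text \<open>The strong form of the fundamental theorem of calculus tolerates finitely many
  exceptional points in each bounded interval. They are needed for the corners of the saw-tooth
  primitive.\<close>

lemma by_parts_line:
  fixes Z z \<rho> \<rho>' :: "real \<Rightarrow> real"
  assumes \<rho>: "\<And>s. (\<rho> has_real_derivative \<rho>' s) (at s)" "continuous_on UNIV \<rho>'"
    and sup: "\<And>s. \<bar>s\<bar> > L \<Longrightarrow> \<rho> s = 0" "\<And>s. \<bar>s\<bar> > L \<Longrightarrow> \<rho>' s = 0" "L > 0"
    and Z: "continuous_on UNIV Z" "\<And>a. finite (T \<inter> {-a..a})" "\<And>s. s \<notin> T \<Longrightarrow> (Z has_real_derivative z s) (at s)"
    and z: "z \<in> borel_measurable borel" "\<And>s. \<bar>z s\<bar> \<le> C"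
  shows "(LINT s|lborel. z s * \<rho> s) = - (LINT s|lborel. Z s * \<rho>' s)"
proof -
  have c\<rho>: "continuous_on UNIV \<rho>"
    using \<rho>(1) by (intro continuous_at_imp_continuous_on) (blast intro: DERIV_isCont)
  have out: "\<rho> s = 0" "\<rho>' s = 0" if "s \<notin> {-L..L}" for s
    using that sup(1,2)[of s] by (auto simp: abs_if not_le)
  have "integrable lborel (\<lambda>s. z s *\<^sub>R \<rho> s)"
    by (rule integrable_bounded_mult[OF integrable_compact_support[OF c\<rho> compact_Icc]])
       (use z out in auto)
  then have i1: "integrable lborel (\<lambda>s. z s * \<rho> s)" by simp
  have i2: "integrable lborel (\<lambda>s. Z s * \<rho>' s)"
    by (rule integrable_compact_support[OF _ compact_Icc])
       (use Z(1) \<rho>(2) out in \<open>auto intro!: continuous_intros\<close>)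
  \<comment> \<open>Strictly beyond \<open>L\<close>, so that the boundary terms vanish:
    \<open>\<rho>\<close> is known to be 0 only for \<open>\<bar>s\<bar> > L\<close>.\<close>
  define a where "a = L + 1"
  have "((\<lambda>s. z s * \<rho> s + Z s * \<rho>' s) has_integral (Z a * \<rho> a - Z (-a) * \<rho> (-a))) {-a..a}"
  proof (rule fundamental_theorem_of_calculus_strong[where S = "T \<inter> {-a..a}"])
    show "((\<lambda>s. Z s * \<rho> s) has_vector_derivative z x * \<rho> x + Z x * \<rho>' x) (at x)"
      if "x \<in> {-a..a} - T \<inter> {-a..a}" for x
    proof -
      have "(Z has_real_derivative z x) (at x)" using Z(3) that by auto
      from DERIV_mult[OF this \<rho>(1)[of x]] show ?thesis
        by (simp add: has_real_derivative_iff_has_vector_derivative algebra_simps)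
    qed
    show "continuous_on {- a..a} (\<lambda>s. Z s * \<rho> s)"
      using Z(1) c\<rho> by (intro continuous_intros) (auto intro: continuous_on_subset)
    show "finite (T \<inter> {-a..a})" by (rule Z(2))
  qed (use sup(3) a_def in auto)
  moreover have "\<rho> a = 0" "\<rho> (-a) = 0" using sup by (auto simp: a_def)
  ultimately have "((\<lambda>s. z s * \<rho> s + Z s * \<rho>' s) has_integral 0) {-a..a}" by simp
  then have "((\<lambda>s. z s * \<rho> s + Z s * \<rho>' s) has_integral 0) UNIV"
    by (rule has_integral_on_superset) (use sup in \<open>auto simp: a_def abs_if not_le\<close>)
  moreover have "((\<lambda>s. z s * \<rho> s + Z s * \<rho>' s) has_integral (LINT s|lborel. z s * \<rho> s + Z s * \<rho>' s)) UNIV"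
    by (intro has_integral_integral_lborel Bochner_Integration.integrable_add i1 i2)
  ultimately have "(LINT s|lborel. z s * \<rho> s + Z s * \<rho>' s) = 0"
    by (metis has_integral_unique)
  then show ?thesis using i1 i2 by simp
qed

section \<open>Compactly supported functions and integration by parts against oscillating
  factors\<close>

definition cs :: "(real^2 \<Rightarrow> real) \<Rightarrow> bool" where
  "cs \<phi> \<longleftrightarrow> \<phi> \<in> test_functions UNIV"

lemma test_functions_cs: "\<phi> \<in> test_functions \<Omega> \<Longrightarrow> cs \<phi>"
  by (auto simp: cs_def test_functions_iff)

lemma csE:
  assumes "cs \<phi>"
  obtains K where "smooth \<phi>" "compact K" "\<And>x. x \<notin> K \<Longrightarrow> \<phi> x = 0" "\<And>x. x \<notin> K \<Longrightarrow> grad \<phi> x = 0"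
  using assms unfolding cs_def by (elim test_functionsE) blast

lemma cs_grad: "cs \<phi> \<Longrightarrow> cs (\<lambda>x. grad \<phi> x $ i)"
  unfolding cs_def by (rule test_functions_grad)

lemma cs_mult: "cs \<phi> \<Longrightarrow> smooth \<psi> \<Longrightarrow> cs (\<lambda>x. \<psi> x * \<phi> x)"
  unfolding cs_def by (rule test_functions_mult)

lemma cs_continuous: "cs \<phi> \<Longrightarrow> continuous_on UNIV \<phi>"
  unfolding cs_def by (intro smooth_continuous test_functions_smooth)

lemma cs_smooth: "cs \<phi> \<Longrightarrow> smooth \<phi>"
  unfolding cs_def by (rule test_functions_smooth)

lemma cs_measurable: "cs \<phi> \<Longrightarrow> \<phi> \<in> borel_measurable borel"
  by (intro borel_measurable_continuous_onI cs_continuous)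

lemma cs_integrable: "cs \<phi> \<Longrightarrow> integrable lborel \<phi>"
  by (elim csE) (rule integrable_compact_support[OF smooth_continuous])

lemma continuous_grad: "smooth \<phi> \<Longrightarrow> continuous_on UNIV (grad \<phi>)"
proof -
  assume "smooth \<phi>"
  then have "continuous_on UNIV (\<lambda>x. \<chi> i. grad \<phi> x $ i)"
    by (intro continuous_on_vec_lambda smooth_continuous smooth_grad)
  then show ?thesis by simp
qed

text \<open>The factor \<open>w\<close> is constant along each line in direction \<open>i\<close>
  and passes through the inner integral, so it may be merely bounded and measurable. This is what
  makes factors oscillating in one coordinate harmless for derivatives in the other.\<close>

lemma by_parts:
  fixes Z z w :: "real \<Rightarrow> real"
  assumes \<phi>: "cs \<phi>"
    and Z: "continuous_on UNIV Z" "\<And>a. finite (T \<inter> {-a..a})" "\<And>s. s \<notin> T \<Longrightarrow> (Z has_real_derivative z s) (at s)"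
      "\<And>s. \<bar>Z s\<bar> \<le> C"
    and z: "z \<in> borel_measurable borel" "\<And>s. \<bar>z s\<bar> \<le> C"
    and w: "w \<in> borel_measurable borel" "\<And>s. \<bar>w s\<bar> \<le> C"
  shows "(LINT x|lborel. w (x $ oth i) * z (x $ i) * \<phi> x) =
    - (LINT x|lborel. w (x $ oth i) * Z (x $ i) * grad \<phi> x $ i)"
proof -
  obtain K where K: "smooth \<phi>" "compact K" "\<And>x. x \<notin> K \<Longrightarrow> \<phi> x = 0" "\<And>x. x \<notin> K \<Longrightarrow> grad \<phi> x = 0"
    using csE[OF \<phi>] by blast
  obtain L where L: "L > 0" "\<And>s u. pt i s u \<in> K \<Longrightarrow> \<bar>s\<bar> \<le> L"
    using compact_line_bound[OF K(2)] by blast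
  have [measurable]: "w \<in> borel_measurable borel" "z \<in> borel_measurable borel" "Z \<in> borel_measurable borel"
    using w z borel_measurable_continuous_onI[OF Z(1)] by auto
  have C: "C \<ge> 0" using w(2)[of 0] by linarith
  have b: "\<bar>w a * z c\<bar> \<le> C * C" "\<bar>w a * Z c\<bar> \<le> C * C" for a c
    using w(2)[of a] z(2)[of c] Z(4)[of c] C by (auto simp: abs_mult intro!: mult_mono)
  have [measurable]: "(\<lambda>x::real^2. x $ k) \<in> borel_measurable borel" for k
    by (intro borel_measurable_continuous_onI continuous_intros)
  have "integrable lborel (\<lambda>x. (w (x $ oth i) * z (x $ i)) *\<^sub>R \<phi> x)"
    by (rule integrable_bounded_mult[OF cs_integrable[OF \<phi>] _ b(1)]) simp
  then have i1: "integrable lborel (\<lambda>x. w (x $ oth i) * z (x $ i) * \<phi> x)" by simp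
  have "integrable lborel (\<lambda>x. (w (x $ oth i) * Z (x $ i)) *\<^sub>R (grad \<phi> x $ i))"
    by (rule integrable_bounded_mult[OF cs_integrable[OF cs_grad[OF \<phi>]] _ b(2)]) simp
  then have i2: "integrable lborel (\<lambda>x. w (x $ oth i) * Z (x $ i) * grad \<phi> x $ i)" by simp
  have line: "(LINT s|lborel. z s * \<phi> (pt i s u)) = - (LINT s|lborel. Z s * grad \<phi> (pt i s u) $ i)" for u
  proof (rule by_parts_line[where T = T and L = L and C = C])
    show "((\<lambda>s. \<phi> (pt i s u)) has_real_derivative grad \<phi> (pt i s u) $ i) (at s)" for s
      by (rule line_derivative[OF K(1)])
    show "continuous_on UNIV (\<lambda>s. grad \<phi> (pt i s u) $ i)"
      by (rule continuous_line[OF smooth_continuous[OF smooth_grad[OF K(1)]]])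
    show "\<phi> (pt i s u) = 0" "grad \<phi> (pt i s u) $ i = 0" if "\<bar>s\<bar> > L" for s
    proof -
      have "pt i s u \<notin> K" using L(2)[of s u] that by auto
      then show "\<phi> (pt i s u) = 0" "grad \<phi> (pt i s u) $ i = 0" by (simp_all add: K(3,4))
    qed
  qed (use Z z L in auto)
  have "(LINT x|lborel. w (x $ oth i) * z (x $ i) * \<phi> x) = (LINT u|lborel. LINT s|lborel. w u * z s * \<phi> (pt i s u))"
    by (subst integral_pt[OF i1, of i]) simp
  also have "\<dots> = (LINT u|lborel. w u * (LINT s|lborel. z s * \<phi> (pt i s u)))"
    by (simp add: mult.assoc)
  also have "\<dots> = (LINT u|lborel. - (LINT s|lborel. w u * Z s * grad \<phi> (pt i s u) $ i))"
    by (simp add: line mult.assoc)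
  also have "\<dots> = - (LINT x|lborel. w (x $ oth i) * Z (x $ i) * grad \<phi> x $ i)"
    by (subst integral_pt[OF i2, of i]) simp
  finally show ?thesis .
qed

lemma integral_grad_eq_0: "cs \<phi> \<Longrightarrow> (LINT x|lborel. grad \<phi> x $ i) = 0"
  using by_parts[of \<phi> "\<lambda>x. 1" "{}" "\<lambda>x. 0" 1 "\<lambda>x. 1" i] by auto

lemma by_parts_cs:
  assumes "cs \<phi>" "cs \<psi>"
  shows "(LINT x|lborel. \<phi> x * grad \<psi> x $ i) = - (LINT x|lborel. grad \<phi> x $ i * \<psi> x)"
proof -
  have s: "smooth \<phi>" "smooth \<psi>" using assms cs_smooth by auto
  have "cs (\<lambda>x. \<phi> x * grad \<psi> x $ i)" "cs (\<lambda>x. grad \<phi> x $ i * \<psi> x)"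
    using assms s by (auto intro: cs_mult cs_grad smooth_grad)
  then have i: "integrable lborel (\<lambda>x. \<phi> x * grad \<psi> x $ i)" "integrable lborel (\<lambda>x. grad \<phi> x $ i * \<psi> x)"
    using cs_integrable by auto
  have "0 = (LINT x|lborel. grad (\<lambda>x. \<phi> x * \<psi> x) x $ i)"
    using integral_grad_eq_0[OF cs_mult[OF assms(2) s(1)]] by simp
  also have "\<dots> = (LINT x|lborel. \<phi> x * grad \<psi> x $ i + grad \<phi> x $ i * \<psi> x)"
    by (simp add: grad_mult smooth_differentiable s algebra_simps)
  also have "\<dots> = (LINT x|lborel. \<phi> x * grad \<psi> x $ i) + (LINT x|lborel. grad \<phi> x $ i * \<psi> x)"
    using i by simp
  finally show ?thesis by simp
qed

section \<open>The Sobolev and Courant--Lebesgue inequalities\<close>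

lemma line_variation:
  assumes "smooth \<phi>" "a \<le> b"
  shows "ennreal \<bar>\<phi> (pt i b u) - \<phi> (pt i a u)\<bar> \<le> (\<integral>\<^sup>+s. ennreal \<bar>grad \<phi> (pt i s u) $ i\<bar> * indicator {a..b} s \<partial>lborel)"
proof -
  have "has_bochner_integral lborel (\<lambda>s. indicator {a..b} s *\<^sub>R grad \<phi> (pt i s u) $ i) (\<phi> (pt i b u) - \<phi> (pt i a u))"
  proof (rule has_bochner_integral_FTC_Icc[OF assms(2)])
    show "((\<lambda>s. \<phi> (pt i s u)) has_vector_derivative grad \<phi> (pt i s u) $ i) (at s within {a..b})" for s
      using line_derivative[OF assms(1), of i u s]
      by (simp add: has_real_derivative_iff_has_vector_derivative has_vector_derivative_at_within)
    show "continuous_on {a..b} (\<lambda>s. grad \<phi> (pt i s u) $ i)"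
      using continuous_line[OF smooth_continuous[OF smooth_grad[OF assms(1)]]]
      by (rule continuous_on_subset) auto
  qed
  then have i: "integrable lborel (\<lambda>s. indicator {a..b} s *\<^sub>R grad \<phi> (pt i s u) $ i)"
    and e: "(LINT s|lborel. indicator {a..b} s *\<^sub>R grad \<phi> (pt i s u) $ i) = \<phi> (pt i b u) - \<phi> (pt i a u)"
    by (auto simp: has_bochner_integral_iff)
  have "ennreal (norm (\<phi> (pt i b u) - \<phi> (pt i a u))) \<le> (\<integral>\<^sup>+s. ennreal (norm (indicator {a..b} s *\<^sub>R grad \<phi> (pt i s u) $ i)) \<partial>lborel)"
    using integral_norm_bound_ennreal[OF i] e by simp
  also have "\<dots> = (\<integral>\<^sup>+s. ennreal \<bar>grad \<phi> (pt i s u) $ i\<bar> * indicator {a..b} s \<partial>lborel)"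
    by (intro nn_integral_cong) (auto simp: indicator_def)
  finally show ?thesis by simp
qed

lemma grad_measurable: "smooth \<phi> \<Longrightarrow> (\<lambda>x. grad \<phi> x $ i) \<in> borel_measurable borel"
  by (intro borel_measurable_continuous_onI smooth_continuous smooth_grad)

lemma cs_line_bound:
  assumes "cs \<phi>"
  shows "ennreal \<bar>\<phi> (pt i s u)\<bar> \<le> (\<integral>\<^sup>+s. ennreal \<bar>grad \<phi> (pt i s u) $ i\<bar> \<partial>lborel)"
proof -
  obtain K where K: "smooth \<phi>" "compact K" "\<And>x. x \<notin> K \<Longrightarrow> \<phi> x = 0" "\<And>x. x \<notin> K \<Longrightarrow> grad \<phi> x = 0"
    using csE[OF assms] by blast
  obtain L where L: "L > 0" "\<And>s u. pt i s u \<in> K \<Longrightarrow> \<bar>s\<bar> \<le> L"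
    using compact_line_bound[OF K(2)] by blast
  define a where "a = min (- L - 1) s"
  have "pt i a u \<notin> K" using L(2)[of a u] by (auto simp: a_def)
  then have "ennreal \<bar>\<phi> (pt i s u)\<bar> = ennreal \<bar>\<phi> (pt i s u) - \<phi> (pt i a u)\<bar>"
    using K(3) by simp
  also have "\<dots> \<le> (\<integral>\<^sup>+s'. ennreal \<bar>grad \<phi> (pt i s' u) $ i\<bar> * indicator {a..s} s' \<partial>lborel)"
    by (rule line_variation[OF K(1)]) (simp add: a_def)
  also have "\<dots> \<le> (\<integral>\<^sup>+s. ennreal \<bar>grad \<phi> (pt i s u) $ i\<bar> \<partial>lborel)"
    by (intro nn_integral_mono) (auto simp: indicator_def)
  finally show ?thesis .
qed

text \<open>The Gagliardo--Nirenberg inequality in the plane. At each point the function is bounded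
  by the integral of its gradient over the horizontal line and also over the vertical line through
  that point; the product of the two bounds separates the variables.\<close>

lemma sobolev_nn:
  assumes "cs \<phi>"
  shows "(\<integral>\<^sup>+x. ennreal ((\<phi> x)\<^sup>2) \<partial>lborel) \<le> (\<integral>\<^sup>+x. ennreal (norm (grad \<phi> x)) \<partial>lborel)\<^sup>2"
proof -
  define A where "A i u = (\<integral>\<^sup>+s. ennreal \<bar>grad \<phi> (pt i s u) $ i\<bar> \<partial>lborel)" for i u
  have sm: "smooth \<phi>" using assms by (rule cs_smooth)
  have [measurable]: "\<phi> \<in> borel_measurable borel" "(\<lambda>x. grad \<phi> x $ i) \<in> borel_measurable borel" for i
    using cs_measurable[OF assms] grad_measurable[OF sm] by auto
  have [measurable]: "(\<lambda>(u, s). grad \<phi> (pt i s u) $ i) \<in> borel_measurable (lborel \<Otimes>\<^sub>M lborel)" for i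
  proof -
    have "(\<lambda>(u, s). pt i s u) \<in> borel_measurable (lborel \<Otimes>\<^sub>M lborel)"
      using measurable_pt[of "oth i"] by (simp add: pt_oth)
    from measurable_compose[OF this grad_measurable[OF sm, of i]] show ?thesis
      by (simp add: case_prod_unfold)
  qed
  have mA [measurable]: "A i \<in> borel_measurable borel" for i
  proof -
    have "(\<lambda>u. \<integral>\<^sup>+s. ennreal \<bar>grad \<phi> (pt i s u) $ i\<bar> \<partial>lborel) \<in> borel_measurable lborel"
      by measurable
    then show ?thesis by (simp add: A_def[abs_def])
  qed
  have iA: "(\<integral>\<^sup>+u. A i u \<partial>lborel) \<le> (\<integral>\<^sup>+x. ennreal (norm (grad \<phi> x)) \<partial>lborel)" for i
  proof -
    have "(\<integral>\<^sup>+u. A i u \<partial>lborel) = (\<integral>\<^sup>+x. ennreal \<bar>grad \<phi> x $ i\<bar> \<partial>lborel)"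
      unfolding A_def by (subst nn_integral_pt[of _ i]) auto
    also have "\<dots> \<le> (\<integral>\<^sup>+x. ennreal (norm (grad \<phi> x)) \<partial>lborel)"
      by (intro nn_integral_mono ennreal_leI component_le_norm_cart)
    finally show ?thesis .
  qed
  have "(\<integral>\<^sup>+x. ennreal ((\<phi> x)\<^sup>2) \<partial>lborel) = (\<integral>\<^sup>+u. \<integral>\<^sup>+s. ennreal ((\<phi> (pt 1 s u))\<^sup>2) \<partial>lborel \<partial>lborel)"
    by (subst nn_integral_pt[of _ 1]) auto
  also have "\<dots> \<le> (\<integral>\<^sup>+u. \<integral>\<^sup>+s. A 1 u * A (oth 1) s \<partial>lborel \<partial>lborel)"
  proof (intro nn_integral_mono)
    fix u s
    have "ennreal ((\<phi> (pt 1 s u))\<^sup>2) = ennreal \<bar>\<phi> (pt 1 s u)\<bar> * ennreal \<bar>\<phi> (pt (oth 1) u s)\<bar>"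
      by (simp add: pt_oth power2_eq_square flip: ennreal_mult)
    also have "\<dots> \<le> A 1 u * A (oth 1) s"
      unfolding A_def by (intro mult_mono cs_line_bound assms) auto
    finally show "ennreal ((\<phi> (pt 1 s u))\<^sup>2) \<le> A 1 u * A (oth 1) s" .
  qed
  also have "\<dots> = (\<integral>\<^sup>+u. A 1 u \<partial>lborel) * (\<integral>\<^sup>+s. A (oth 1) s \<partial>lborel)"
    by (simp add: nn_integral_cmult nn_integral_multc)
  also have "\<dots> \<le> (\<integral>\<^sup>+x. ennreal (norm (grad \<phi> x)) \<partial>lborel)\<^sup>2"
    unfolding power2_eq_square by (intro mult_mono iA) auto
  finally show ?thesis .
qed

section \<open>Squares with sides parallel to the axes; they replace discs because Fubini applies to
  their sides\<close>

definition square :: "real^2 \<Rightarrow> real \<Rightarrow> (real^2) set" where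
  "square c r = {x. \<forall>i. \<bar>x $ i - c $ i\<bar> \<le> r}"

definition square_bd :: "real^2 \<Rightarrow> real \<Rightarrow> (real^2) set" where
  "square_bd c r = {x \<in> square c r. \<exists>i. \<bar>x $ i - c $ i\<bar> = r}"

lemma ex_2: "(\<exists>i::2. P i) \<longleftrightarrow> P 1 \<or> P 2"
  using forall_2[of "\<lambda>i. \<not> P i"] by blast

text \<open>Every boundary point reaches the corner \<open>?P r r\<close> along at most two sides,
  which costs 2 D. Two such paths give the factor 4.\<close>

lemma square_bd_oscillation:
  fixes \<phi> :: "real^2 \<Rightarrow> real"
  assumes side: "\<And>i a b u. \<bar>u - c $ oth i\<bar> = r \<Longrightarrow> \<bar>a - c $ i\<bar> \<le> r \<Longrightarrow> \<bar>b - c $ i\<bar> \<le> r \<Longrightarrow>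
      \<bar>\<phi> (pt i a u) - \<phi> (pt i b u)\<bar> \<le> D"
    and xy: "x \<in> square_bd c r" "y \<in> square_bd c r" and r: "r > 0"
  shows "\<bar>\<phi> x - \<phi> y\<bar> \<le> 4 * D"
proof -
  let ?P = "\<lambda>a b. pt 1 (c $ 1 + a) (c $ 2 + b)"
  have o: "oth 1 = 2" "oth 2 = 1" by (auto simp: oth_def)
  have sw: "pt 2 a b = pt 1 b a" for a b using pt_oth[of 1] by (simp add: o)
  have corner: "\<bar>\<phi> z - \<phi> (?P r r)\<bar> \<le> 2 * D" if "z \<in> square_bd c r" for z
  proof -
    have z: "\<bar>z $ 1 - c $ 1\<bar> \<le> r" "\<bar>z $ 2 - c $ 2\<bar> \<le> r"
      "\<bar>z $ 1 - c $ 1\<bar> = r \<or> \<bar>z $ 2 - c $ 2\<bar> = r"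
      using that by (auto simp: square_bd_def square_def forall_2 ex_2)
    have ze: "z = pt 1 (z $ 1) (z $ 2)" using pt_eta[of 1 z] by (simp add: o)
    from z(3) show ?thesis
    proof
      assume *: "\<bar>z $ 1 - c $ 1\<bar> = r"
      have "\<bar>\<phi> (pt 2 (z $ 2) (z $ 1)) - \<phi> (pt 2 (c $ 2 + r) (z $ 1))\<bar> \<le> D"
        by (rule side) (use * z r in \<open>auto simp: o\<close>)
      moreover have "\<bar>\<phi> (pt 1 (z $ 1) (c $ 2 + r)) - \<phi> (pt 1 (c $ 1 + r) (c $ 2 + r))\<bar> \<le> D"
        by (rule side) (use * z r in \<open>auto simp: o\<close>)
      ultimately show ?thesis using ze by (simp add: sw)
    next
      assume *: "\<bar>z $ 2 - c $ 2\<bar> = r"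
      have "\<bar>\<phi> (pt 1 (z $ 1) (z $ 2)) - \<phi> (pt 1 (c $ 1 + r) (z $ 2))\<bar> \<le> D"
        by (rule side) (use * z r in \<open>auto simp: o\<close>)
      moreover have "\<bar>\<phi> (pt 2 (z $ 2) (c $ 1 + r)) - \<phi> (pt 2 (c $ 2 + r) (c $ 1 + r))\<bar> \<le> D"
        by (rule side) (use * z r in \<open>auto simp: o\<close>)
      ultimately show ?thesis using ze by (simp add: sw)
    qed
  qed
  from corner[OF xy(1)] corner[OF xy(2)] show ?thesis by linarith
qed

text \<open>Cauchy--Schwarz on a segment of length at most 2 r. The energy is taken over the whole
  line, since it is the quantity that is integrated over parallel lines afterwards.\<close>

lemma line_energy_variation:
  assumes "smooth \<phi>" and H: "(\<integral>\<^sup>+s. ennreal ((grad \<phi> (pt i s u) $ i)\<^sup>2) \<partial>lborel) \<le> ennreal h"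
    and ab: "\<bar>a - c\<bar> \<le> r" "\<bar>b - c\<bar> \<le> r" and "h \<ge> 0" "r > 0"
  shows "(\<phi> (pt i a u) - \<phi> (pt i b u))\<^sup>2 \<le> 2 * r * h"
  using ab
proof (induction a b rule: linorder_wlog)
  case (le a b)
  have [measurable]: "(\<lambda>x. grad \<phi> x $ i) \<in> borel_measurable borel"
    by (rule grad_measurable[OF assms(1)])
  have "(ennreal \<bar>\<phi> (pt i b u) - \<phi> (pt i a u)\<bar>)\<^sup>2
      \<le> (\<integral>\<^sup>+s. ennreal \<bar>grad \<phi> (pt i s u) $ i\<bar> * indicator {a..b} s \<partial>lborel)\<^sup>2"
    by (intro power_mono line_variation assms le) auto
  also have "\<dots> \<le> (\<integral>\<^sup>+s. (ennreal \<bar>grad \<phi> (pt i s u) $ i\<bar>)\<^sup>2 \<partial>lborel) * (\<integral>\<^sup>+s. (indicator {a..b} s)\<^sup>2 \<partial>lborel)"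
    by (intro Cauchy_Schwarz_nn_integral) auto
  also have "(\<integral>\<^sup>+s. (ennreal \<bar>grad \<phi> (pt i s u) $ i\<bar>)\<^sup>2 \<partial>lborel) = (\<integral>\<^sup>+s. ennreal ((grad \<phi> (pt i s u) $ i)\<^sup>2) \<partial>lborel)"
    by (intro nn_integral_cong) (simp add: ennreal_power)
  also have "(\<integral>\<^sup>+s. (indicator {a..b} s)\<^sup>2 \<partial>lborel) = (\<integral>\<^sup>+s. indicator {a..b} s \<partial>(lborel :: real measure))"
    by (intro nn_integral_cong) (auto simp: indicator_def)
  also have "\<dots> = ennreal (b - a)" using le by simp
  also have "(\<integral>\<^sup>+s. ennreal ((grad \<phi> (pt i s u) $ i)\<^sup>2) \<partial>lborel) * ennreal (b - a) \<le> ennreal h * ennreal (2 * r)"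
    using le by (intro mult_mono H ennreal_leI) auto
  finally have "ennreal ((\<phi> (pt i b u) - \<phi> (pt i a u))\<^sup>2) \<le> ennreal (2 * r * h)"
    using assms by (simp add: ennreal_power ennreal_mult'[symmetric] mult.commute)
  then show ?case using assms by (simp add: power2_commute)
next
  case (sym a b)
  then show ?case by (simp add: power2_commute)
qed

text \<open>Suppose that for every s between r and R the energies on the four lines through the
  sides eventually exceeded q / s. By Fatou's lemma the integral of q / s, which is 8 K, would be at
  most 4 K. Hence a single s serves infinitely many members of the sequence, and this is why the
  conclusion holds frequently instead of eventually.\<close>

lemma courant_lebesgue:
  fixes \<phi> :: "nat \<Rightarrow> real^2 \<Rightarrow> real"
  assumes cs: "\<And>j. cs (\<phi> j)" and K: "\<And>j. (\<integral>\<^sup>+x. ennreal ((norm (grad (\<phi> j) x))\<^sup>2) \<partial>lborel) \<le> ennreal K"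
    and "K > 0" "0 < r" "r < R"
  obtains s where "r < s" "s < R"
    "\<exists>\<^sub>F j in sequentially. \<forall>x\<in>square_bd c s. \<forall>y\<in>square_bd c s.
       \<bar>\<phi> j x - \<phi> j y\<bar> \<le> 4 * sqrt (16 * K / ln (R / r))"
proof -
  define H where "H j i u = (\<integral>\<^sup>+s. ennreal ((grad (\<phi> j) (pt i s u) $ i)\<^sup>2) \<partial>lborel)" for j i u
  have sm: "smooth (\<phi> j)" for j using cs by (rule cs_smooth)
  have [measurable]: "(\<lambda>x. grad (\<phi> j) x $ i) \<in> borel_measurable borel" for i j
    using grad_measurable[OF sm] by auto
  have mH [measurable]: "H j i \<in> borel_measurable borel" for i j
  proof -
    have "(\<lambda>(u, s). pt i s u) \<in> borel_measurable (lborel \<Otimes>\<^sub>M lborel)"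
      using measurable_pt[of "oth i"] by (simp add: pt_oth)
    from measurable_compose[OF this grad_measurable[OF sm, of j i]]
    have [measurable]: "(\<lambda>(u, s). grad (\<phi> j) (pt i s u) $ i) \<in> borel_measurable (lborel \<Otimes>\<^sub>M lborel)"
      by (simp add: case_prod_unfold)
    have "(\<lambda>u. \<integral>\<^sup>+s. ennreal ((grad (\<phi> j) (pt i s u) $ i)\<^sup>2) \<partial>lborel) \<in> borel_measurable lborel"
      by measurable
    then show ?thesis by (simp add: H_def[abs_def])
  qed
  have iH: "(\<integral>\<^sup>+u. H j i u \<partial>lborel) \<le> ennreal K" for i j
  proof -
    have "(\<integral>\<^sup>+u. H j i u \<partial>lborel) = (\<integral>\<^sup>+x. ennreal ((grad (\<phi> j) x $ i)\<^sup>2) \<partial>lborel)"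
      unfolding H_def by (subst nn_integral_pt[of _ i]) auto
    also have "\<dots> \<le> (\<integral>\<^sup>+x. ennreal ((norm (grad (\<phi> j) x))\<^sup>2) \<partial>lborel)"
      by (intro nn_integral_mono ennreal_leI) (simp add: abs_le_square_iff[symmetric] component_le_norm_cart)
    also have "\<dots> \<le> ennreal K" by (rule K)
    finally show ?thesis .
  qed
  \<comment> \<open>The energies on the four lines that carry the sides of the square of half-side
    s. Integrated over s, each of them contributes at most K.\<close>
  define L where "L j s = (H j 1 (c $ 2 + s) + H j 1 (c $ 2 + (-1) * s)) + (H j 2 (c $ 1 + s) + H j 2 (c $ 1 + (-1) * s))" for j s
  have [measurable]: "L j \<in> borel_measurable borel" for j
    unfolding L_def[abs_def] by measurable
  have aff: "(\<integral>\<^sup>+s. H j i (a + s) \<partial>lborel) \<le> ennreal K" "(\<integral>\<^sup>+s. H j i (a + (-1) * s) \<partial>lborel) \<le> ennreal K" for j i a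
    using nn_integral_real_affine[of "H j i" 1 a] nn_integral_real_affine[of "H j i" "-1" a] iH[of j i] by auto
  have iL: "(\<integral>\<^sup>+s. L j s \<partial>lborel) \<le> ennreal (4 * K)" for j
  proof -
    have "(\<integral>\<^sup>+s. L j s \<partial>lborel) =
       ((\<integral>\<^sup>+s. H j 1 (c $ 2 + s) \<partial>lborel) + (\<integral>\<^sup>+s. H j 1 (c $ 2 + (-1) * s) \<partial>lborel)) +
       ((\<integral>\<^sup>+s. H j 2 (c $ 1 + s) \<partial>lborel) + (\<integral>\<^sup>+s. H j 2 (c $ 1 + (-1) * s) \<partial>lborel))"
    proof -
      have M: "(\<lambda>s. H j i (a + s)) \<in> borel_measurable lborel"
        "(\<lambda>s. H j i (a + (-1) * s)) \<in> borel_measurable lborel" for i a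
        by measurable
      note S = borel_measurable_add[OF M]
      show ?thesis
        unfolding L_def nn_integral_add[OF S S] nn_integral_add[OF M] by (rule refl)
    qed
    also have "\<dots> \<le> (ennreal K + ennreal K) + (ennreal K + ennreal K)"
      by (intro add_mono aff)
    also have "\<dots> = ennreal (4 * K)" using \<open>K > 0\<close> by (simp flip: ennreal_plus)
    finally show ?thesis .
  qed
  define \<Lambda> where "\<Lambda> = ln (R / r)"
  have \<Lambda>: "\<Lambda> > 0" using assms by (simp add: \<Lambda>_def)
  \<comment> \<open>Chosen so that q / s has the integral 8 K over (r, R), twice the available
    energy 4 K. A side of half-length s then has squared variation at most 2 s (q / s) = 2 q, whence
    the constant 16 K / ln (R / r).\<close>
  define q where "q = 8 * K / \<Lambda>"
  have q: "q > 0" using \<Lambda> \<open>K > 0\<close> by (simp add: q_def)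
  have "\<exists>s\<in>{r<..<R}. \<exists>\<^sub>F j in sequentially. L j s \<le> ennreal (q / s)"
  proof (rule ccontr)
    assume "\<not> ?thesis"
    then have ev: "\<forall>\<^sub>F j in sequentially. ennreal (q / s) < L j s" if "s \<in> {r<..<R}" for s
      using that by (auto simp: frequently_def not_le)
    have lim: "ennreal (q / s) \<le> liminf (\<lambda>j. L j s)" if "s \<in> {r<..<R}" for s
      using ev[OF that] by (intro Liminf_bounded) (auto elim: eventually_mono)
    have "(\<integral>\<^sup>+s. ennreal (q / s) * indicator {r..R} s \<partial>lborel) = ennreal (q * ln R - q * ln r)"
    proof (rule nn_integral_FTC_Icc)
      show "DERIV (\<lambda>x. q * ln x) x :> q / x" if "x \<in> {r..R}" for x
        using that assms by (auto intro!: derivative_eq_intros)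
    qed (use q assms in auto)
    moreover have "q * ln R - q * ln r = 8 * K"
    proof -
      have "q * ln R - q * ln r = q * \<Lambda>"
        using assms by (simp add: \<Lambda>_def ln_div algebra_simps)
      then show ?thesis using \<Lambda> by (simp add: q_def)
    qed
    ultimately have "ennreal (8 * K) = (\<integral>\<^sup>+s. ennreal (q / s) * indicator {r..R} s \<partial>lborel)" by simp
    also have "\<dots> = (\<integral>\<^sup>+s. ennreal (q / s) * indicator {r<..<R} s \<partial>lborel)"
      by (rule nn_integral_cong_AE)
         (use AE_lborel_singleton[of r] AE_lborel_singleton[of R] in \<open>eventually_elim, auto simp: indicator_def\<close>)
    also have "\<dots> \<le> (\<integral>\<^sup>+s. liminf (\<lambda>j. L j s) \<partial>lborel)"
      by (intro nn_integral_mono) (use lim in \<open>auto simp: indicator_def\<close>)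
    also have "\<dots> \<le> liminf (\<lambda>j. \<integral>\<^sup>+s. L j s \<partial>lborel)"
      by (rule nn_integral_liminf) simp
    also have "\<dots> \<le> ennreal (4 * K)"
      using Liminf_mono[of "\<lambda>j. \<integral>\<^sup>+s. L j s \<partial>lborel" "\<lambda>j. ennreal (4 * K)" sequentially] iL
      by (simp add: Liminf_const)
    finally show False using \<open>K > 0\<close> by simp
  qed
  then obtain s where s: "r < s" "s < R" and fr: "\<exists>\<^sub>F j in sequentially. L j s \<le> ennreal (q / s)" by auto
  have "\<bar>\<phi> j x - \<phi> j y\<bar> \<le> 4 * sqrt (16 * K / \<Lambda>)"
    if j: "L j s \<le> ennreal (q / s)" and "x \<in> square_bd c s" "y \<in> square_bd c s" for j x y
  proof (rule square_bd_oscillation)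
    fix i a b u assume u: "\<bar>u - c $ oth i\<bar> = s" and ab: "\<bar>a - c $ i\<bar> \<le> s" "\<bar>b - c $ i\<bar> \<le> s"
    have "H j i u \<le> L j s"
    proof -
      have "i = 1 \<or> i = 2" by (rule exhaust_2)
      moreover have "u = c $ oth i + s \<or> u = c $ oth i + (-1) * s" using u by auto
      ultimately show ?thesis
        unfolding L_def oth_def by (auto intro: add_increasing add_increasing2)
    qed
    with j have "(\<integral>\<^sup>+s. ennreal ((grad (\<phi> j) (pt i s u) $ i)\<^sup>2) \<partial>lborel) \<le> ennreal (q / s)"
      by (simp add: H_def)
    from line_energy_variation[OF sm this ab] q s assms
    have "(\<phi> j (pt i a u) - \<phi> j (pt i b u))\<^sup>2 \<le> 2 * q" by simp
    also have "2 * q = 16 * K / \<Lambda>" by (simp add: q_def)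
    finally show "\<bar>\<phi> j (pt i a u) - \<phi> j (pt i b u)\<bar> \<le> sqrt (16 * K / \<Lambda>)"
      by (metis real_le_rsqrt power2_abs)
  qed (use that s assms in auto)
  then have "\<exists>\<^sub>F j in sequentially. \<forall>x\<in>square_bd c s. \<forall>y\<in>square_bd c s.
       \<bar>\<phi> j x - \<phi> j y\<bar> \<le> 4 * sqrt (16 * K / \<Lambda>)"
    using fr by (auto elim: frequently_elim1)
  with s show ?thesis using that unfolding \<Lambda>_def by blast
qed

section \<open>Square integrable functions\<close>

definition sqint :: "'a measure \<Rightarrow> ('a \<Rightarrow> 'b::euclidean_space) \<Rightarrow> bool" where
  "sqint M f \<longleftrightarrow> f \<in> borel_measurable M \<and> integrable M (\<lambda>x. (norm (f x))\<^sup>2)"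

definition nrm2 :: "'a measure \<Rightarrow> ('a \<Rightarrow> 'b::euclidean_space) \<Rightarrow> real" where
  "nrm2 M f = sqrt (LINT x|M. (norm (f x))\<^sup>2)"

lemma sqint_measurable [measurable_dest]: "sqint M f \<Longrightarrow> f \<in> borel_measurable M"
  by (simp add: sqint_def)

lemma nrm2_nonneg [simp]: "0 \<le> nrm2 M f"
  by (simp add: nrm2_def)

lemma nrm2_power2: "(nrm2 M f)\<^sup>2 = (LINT x|M. (norm (f x))\<^sup>2)"
  by (simp add: nrm2_def)

lemma nrm2_le_iff: "c \<ge> 0 \<Longrightarrow> nrm2 M f \<le> c \<longleftrightarrow> (LINT x|M. (norm (f x))\<^sup>2) \<le> c\<^sup>2"
  using nrm2_power2[of M f] nrm2_nonneg[of M f] by (metis abs_le_square_iff abs_of_nonneg)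

lemma nn_nrm2:
  assumes "sqint M f"
  shows "(\<integral>\<^sup>+x. ennreal ((norm (f x))\<^sup>2) \<partial>M) = ennreal ((nrm2 M f)\<^sup>2)"
  using assms unfolding nrm2_power2 sqint_def by (intro nn_integral_eq_integral) auto

lemma sqint_nnI:
  assumes "f \<in> borel_measurable M" "(\<integral>\<^sup>+x. ennreal ((norm (f x))\<^sup>2) \<partial>M) \<le> ennreal (c\<^sup>2)" "c \<ge> 0"
  shows "sqint M f" "nrm2 M f \<le> c"
proof -
  have "(\<integral>\<^sup>+x. ennreal ((norm (f x))\<^sup>2) \<partial>M) < \<infinity>"
    using assms(2) by (rule le_less_trans) simp
  then show s: "sqint M f"
    using assms(1) by (auto simp: sqint_def intro!: integrableI_nonneg)
  show "nrm2 M f \<le> c"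
    using assms(2,3) nn_nrm2[OF s] by (simp add: power2_le_iff_abs_le)
qed

lemma sqint_norm_mult:
  assumes "sqint M f" "sqint M g"
  shows "integrable M (\<lambda>x. norm (f x) * norm (g x))"
proof (rule Bochner_Integration.integrable_bound[where f = "\<lambda>x. (norm (f x))\<^sup>2 + (norm (g x))\<^sup>2"])
  show "AE x in M. norm (norm (f x) * norm (g x)) \<le> norm ((norm (f x))\<^sup>2 + (norm (g x))\<^sup>2)"
  proof (rule AE_I2)
    fix x
    have "norm (f x) * norm (g x) \<le> 2 * (norm (f x) * norm (g x))" by simp
    also have "\<dots> \<le> (norm (f x))\<^sup>2 + (norm (g x))\<^sup>2"
      using sum_squares_bound[of "norm (f x)" "norm (g x)"] by (simp add: mult.assoc)
    finally show "norm (norm (f x) * norm (g x)) \<le> norm ((norm (f x))\<^sup>2 + (norm (g x))\<^sup>2)"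
      by simp
  qed
qed (use assms in \<open>auto simp: sqint_def\<close>)

lemma sqint_inner:
  assumes "sqint M f" "sqint M g"
  shows "integrable M (\<lambda>x. f x \<bullet> g x)"
proof (rule Bochner_Integration.integrable_bound[OF sqint_norm_mult[OF assms]])
  show "AE x in M. norm (f x \<bullet> g x) \<le> norm (norm (f x) * norm (g x))"
    by (intro AE_I2) (simp add: Cauchy_Schwarz_ineq2)
qed (use assms in \<open>auto simp: sqint_def\<close>)

lemma nrm2_norm_mult:
  assumes "sqint M f" "sqint M g"
  shows "(LINT x|M. norm (f x) * norm (g x)) \<le> nrm2 M f * nrm2 M g"
proof -
  let ?I = "LINT x|M. norm (f x) * norm (g x)"
  have [measurable]: "f \<in> borel_measurable M" "g \<in> borel_measurable M"
    using assms by (auto simp: sqint_def)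
  have "ennreal (?I\<^sup>2) = (\<integral>\<^sup>+x. ennreal (norm (f x)) * ennreal (norm (g x)) \<partial>M)\<^sup>2"
    using nn_integral_eq_integral[OF sqint_norm_mult[OF assms]]
    by (simp add: ennreal_mult' ennreal_power)
  also have "\<dots> \<le> (\<integral>\<^sup>+x. (ennreal (norm (f x)))\<^sup>2 \<partial>M) * (\<integral>\<^sup>+x. (ennreal (norm (g x)))\<^sup>2 \<partial>M)"
    by (intro Cauchy_Schwarz_nn_integral) auto
  also have "\<dots> = ennreal ((nrm2 M f * nrm2 M g)\<^sup>2)"
    using nn_nrm2[OF assms(1)] nn_nrm2[OF assms(2)]
    by (simp add: ennreal_power power_mult_distrib ennreal_mult)
  finally have "?I\<^sup>2 \<le> (nrm2 M f * nrm2 M g)\<^sup>2" by (simp)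
  then show ?thesis by (rule power2_le_imp_le) simp
qed

lemma nrm2_inner:
  assumes "sqint M f" "sqint M g"
  shows "\<bar>LINT x|M. f x \<bullet> g x\<bar> \<le> nrm2 M f * nrm2 M g"
proof -
  have "\<bar>LINT x|M. f x \<bullet> g x\<bar> \<le> (LINT x|M. norm (f x) * norm (g x))"
  proof -
    have "norm (LINT x|M. f x \<bullet> g x) \<le> (LINT x|M. norm (f x) * norm (g x))"
      by (rule order_trans[OF Bochner_Integration.integral_norm_bound Bochner_Integration.integral_mono])
         (use sqint_inner[OF assms] sqint_norm_mult[OF assms] in \<open>auto simp: Cauchy_Schwarz_ineq2\<close>)
    then show ?thesis by simp
  qed
  also note nrm2_norm_mult[OF assms]
  finally show ?thesis .
qed

lemma sqint_bound:
  assumes "sqint M g" "f \<in> borel_measurable M" "AE x in M. norm (f x) \<le> norm (g x)"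
  shows "sqint M f" "nrm2 M f \<le> nrm2 M g"
proof -
  have le: "(\<integral>\<^sup>+x. ennreal ((norm (f x))\<^sup>2) \<partial>M) \<le> ennreal ((nrm2 M g)\<^sup>2)"
    unfolding nn_nrm2[OF assms(1), symmetric]
    by (intro nn_integral_mono_AE) (use assms(3) in \<open>eventually_elim, auto intro!: ennreal_leI power_mono\<close>)
  from sqint_nnI[OF assms(2) le] show "sqint M f" "nrm2 M f \<le> nrm2 M g" by auto
qed

lemma sqint_add:
  assumes "sqint M f" "sqint M g"
  shows "sqint M (\<lambda>x. f x + g x)" and nrm2_add: "nrm2 M (\<lambda>x. f x + g x) \<le> nrm2 M f + nrm2 M g"
proof -
  have [measurable]: "f \<in> borel_measurable M" "g \<in> borel_measurable M"
    using assms by (auto simp: sqint_def)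
  have i: "integrable M (\<lambda>x. (norm (f x))\<^sup>2 + 2 * (f x \<bullet> g x) + (norm (g x))\<^sup>2)"
    using assms sqint_inner[OF assms] by (auto simp: sqint_def)
  have e: "(norm (f x + g x))\<^sup>2 = (norm (f x))\<^sup>2 + 2 * (f x \<bullet> g x) + (norm (g x))\<^sup>2" for x
    by (simp add: power2_norm_eq_inner inner_add_left inner_add_right inner_commute)
  show "sqint M (\<lambda>x. f x + g x)" unfolding sqint_def e using i by auto
  have "(LINT x|M. (norm (f x + g x))\<^sup>2) = (nrm2 M f)\<^sup>2 + 2 * (LINT x|M. f x \<bullet> g x) + (nrm2 M g)\<^sup>2"
    unfolding e nrm2_power2 using assms sqint_inner[OF assms] by (auto simp: sqint_def)
  also have "\<dots> \<le> (nrm2 M f)\<^sup>2 + 2 * (nrm2 M f * nrm2 M g) + (nrm2 M g)\<^sup>2"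
    using nrm2_inner[OF assms] by auto
  also have "\<dots> = (nrm2 M f + nrm2 M g)\<^sup>2" by (simp add: power2_sum)
  finally show "nrm2 M (\<lambda>x. f x + g x) \<le> nrm2 M f + nrm2 M g"
    by (subst nrm2_le_iff) auto
qed

lemma sqint_scaleR: "sqint M f \<Longrightarrow> sqint M (\<lambda>x. c *\<^sub>R f x)"
  by (auto simp: sqint_def power_mult_distrib)

lemma nrm2_scaleR: "nrm2 M (\<lambda>x. c *\<^sub>R f x) = \<bar>c\<bar> * nrm2 M f"
  by (simp add: nrm2_def power_mult_distrib real_sqrt_mult)

lemma nrm2_minus: "nrm2 M (\<lambda>x. - f x) = nrm2 M f"
  by (simp add: nrm2_def)

lemma nrm2_commute: "nrm2 M (\<lambda>x. f x - g x) = nrm2 M (\<lambda>x. g x - f x)"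
  by (simp add: nrm2_def norm_minus_commute)

lemma sqint_diff:
  assumes "sqint M f" "sqint M g"
  shows "sqint M (\<lambda>x. f x - g x)" and nrm2_diff: "nrm2 M (\<lambda>x. f x - g x) \<le> nrm2 M f + nrm2 M g"
proof -
  have "sqint M (\<lambda>x. - g x)" using assms(2) by (simp add: sqint_def)
  from sqint_add[OF assms(1) this] show "sqint M (\<lambda>x. f x - g x)" "nrm2 M (\<lambda>x. f x - g x) \<le> nrm2 M f + nrm2 M g"
    by (auto simp: nrm2_minus)
qed

lemma nrm2_triangle:
  assumes "sqint M f" "sqint M g" "sqint M h"
  shows "nrm2 M (\<lambda>x. f x - h x) \<le> nrm2 M (\<lambda>x. f x - g x) + nrm2 M (\<lambda>x. g x - h x)"
  using nrm2_add[OF sqint_diff(1)[OF assms(1,2)] sqint_diff(1)[OF assms(2,3)]] by simp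

lemma nrm2_le_add:
  assumes "sqint M f" "sqint M g"
  shows "nrm2 M f \<le> nrm2 M (\<lambda>x. f x - g x) + nrm2 M g"
  using nrm2_add[OF sqint_diff(1)[OF assms] assms(2)] by simp

lemma sqint_const: "finite_measure M \<Longrightarrow> sqint M (\<lambda>x. c)"
  by (simp add: sqint_def finite_measure.integrable_const)

lemma sqint_integrable:
  assumes "finite_measure M" "sqint M f"
  shows "integrable M f"
  using sqint_norm_mult[OF assms(2) sqint_const[OF assms(1), of "1::real"]] assms(2)
  by (auto simp: sqint_def intro: Bochner_Integration.integrable_bound)

lemma nrm2_const: "finite_measure M \<Longrightarrow> nrm2 M (\<lambda>x. c) = norm c * sqrt (measure M (space M))"
  by (simp add: nrm2_def finite_measure.integrable_const real_sqrt_mult)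

lemma L1_le_nrm2:
  assumes "finite_measure M" "sqint M f"
  shows "(LINT x|M. norm (f x)) \<le> nrm2 M f * sqrt (measure M (space M))"
  using nrm2_norm_mult[OF assms(2) sqint_const[OF assms(1), of "1::real"]] nrm2_const[OF assms(1), of "1::real"] by simp

lemma L1_le_nrm2_supp:
  assumes "finite_measure M" "sqint M f" "A \<in> sets M" "\<And>x. x \<in> space M \<Longrightarrow> x \<notin> A \<Longrightarrow> f x = 0"
  shows "(LINT x|M. norm (f x)) \<le> nrm2 M f * sqrt (measure M A)"
proof -
  interpret finite_measure M by fact
  have eq: "(\<lambda>x. (norm (indicator A x :: real))\<^sup>2) = (indicator A :: _ \<Rightarrow> real)"
    by (auto simp: indicator_def)
  have s: "sqint M (indicator A :: _ \<Rightarrow> real)"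
    unfolding sqint_def eq using assms(3) by (auto simp: less_top[symmetric])
  have n: "nrm2 M (indicator A :: _ \<Rightarrow> real) = sqrt (measure M A)"
    unfolding nrm2_def eq using assms(3) sets.sets_into_space[OF assms(3)] by (simp add: Int_absorb2)
  have "(LINT x|M. norm (f x)) = (LINT x|M. norm (f x) * norm (indicator A x :: real))"
    by (intro Bochner_Integration.integral_cong) (use assms(4) in \<open>auto simp: indicator_def\<close>)
  also have "\<dots> \<le> nrm2 M f * sqrt (measure M A)"
    using nrm2_norm_mult[OF assms(2) s] n by simp
  finally show ?thesis .
qed

lemma nrm2_cong_AE:
  assumes "f \<in> borel_measurable M" "g \<in> borel_measurable M" "AE x in M. f x = g x"
  shows "nrm2 M f = nrm2 M g"
proof -
  have "(LINT x|M. (norm (f x))\<^sup>2) = (LINT x|M. (norm (g x))\<^sup>2)"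
    by (rule integral_cong_AE) (use assms in auto)
  then show ?thesis by (simp add: nrm2_def)
qed

lemma nrm2_eq_0:
  assumes "sqint M f" "nrm2 M f = 0"
  shows "AE x in M. f x = 0"
proof -
  have "AE x in M. (norm (f x))\<^sup>2 = 0"
    using assms integral_nonneg_eq_0_iff_AE[of M "\<lambda>x. (norm (f x))\<^sup>2"]
    by (simp add: sqint_def nrm2_def)
  then show ?thesis by simp
qed

text \<open>The Riesz--Fischer theorem for sequences with geometrically decreasing increments. On a
  finite measure space the increments are summable in L1, hence almost everywhere, so no subsequence
  has to be extracted.\<close>

lemma L2_complete_fast:
  fixes s :: "nat \<Rightarrow> 'a \<Rightarrow> 'b::euclidean_space"
  assumes fin: "finite_measure M" and s: "\<And>k. sqint M (s k)"
    and fast: "\<And>k. nrm2 M (\<lambda>x. s (Suc k) x - s k x) \<le> C * (1/2)^k"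
  obtains u where "sqint M u" "(\<lambda>k. nrm2 M (\<lambda>x. s k x - u x)) \<longlonglongrightarrow> 0"
proof -
  interpret finite_measure M by fact
  have [measurable]: "s k \<in> borel_measurable M" for k using s by (simp add: sqint_def)
  have C: "C \<ge> 0" using order_trans[OF nrm2_nonneg fast[of 0]] by simp
  define d where "d k x = norm (s (Suc k) x - s k x)" for k x
  have [measurable]: "d k \<in> borel_measurable M" for k unfolding d_def[abs_def] by measurable
  define \<mu> where "\<mu> = sqrt (measure M (space M))"
  have di: "(\<integral>\<^sup>+x. ennreal (d k x) \<partial>M) \<le> ennreal (C * \<mu> * (1/2)^k)" for k
  proof -
    have sd: "sqint M (\<lambda>x. s (Suc k) x - s k x)" by (intro sqint_diff s)
    have "(\<integral>\<^sup>+x. ennreal (d k x) \<partial>M) = ennreal (LINT x|M. d k x)"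
      unfolding d_def using sqint_integrable[OF fin sd] by (intro nn_integral_eq_integral) auto
    also have "(LINT x|M. d k x) \<le> C * (1/2)^k * \<mu>"
      using L1_le_nrm2[OF fin sd] fast[of k] mult_right_mono[OF fast[of k], of \<mu>]
      unfolding d_def \<mu>_def by (auto intro: order_trans)
    finally show ?thesis by (simp add: mult_ac ennreal_leI)
  qed
  have "(\<integral>\<^sup>+x. (\<Sum>k. ennreal (d k x)) \<partial>M) = (\<Sum>k. \<integral>\<^sup>+x. ennreal (d k x) \<partial>M)"
    by (rule nn_integral_suminf) simp
  also have "\<dots> \<le> (\<Sum>k. ennreal (C * \<mu> * (1/2)^k))"
    by (intro suminf_le di) auto
  also have "\<dots> = ennreal (\<Sum>k. C * \<mu> * (1/2)^k)"
    using C by (intro suminf_ennreal2) (auto simp: \<mu>_def intro!: summable_mult summable_geometric)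
  finally have "(\<integral>\<^sup>+x. (\<Sum>k. ennreal (d k x)) \<partial>M) \<noteq> \<infinity>"
    by (auto simp: top_unique)
  then have "AE x in M. (\<Sum>k. ennreal (d k x)) \<noteq> \<infinity>"
    by (intro nn_integral_PInf_AE) simp_all
  then have conv: "AE x in M. convergent (\<lambda>k. s k x)"
  proof eventually_elim
    case (elim x)
    then have "summable (\<lambda>k. d k x)"
      by (intro summable_suminf_not_top) (auto simp: d_def)
    then have "summable (\<lambda>k. s (Suc k) x - s k x)"
      unfolding d_def by (rule summable_norm_cancel)
    then have "convergent (\<lambda>n. \<Sum>k<n. s (Suc k) x - s k x)"
      by (simp add: summable_iff_convergent)
    then have "convergent (\<lambda>n. s n x - s 0 x)" by (simp add: sum_lessThan_telescope[of "\<lambda>k. s k x"])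
    then show ?case by (rule convergent_diff_const_right_iff[THEN iffD1])
  qed
  define u where "u x = lim (\<lambda>k. s k x)" for x
  have [measurable]: "u \<in> borel_measurable M" unfolding u_def[abs_def] by measurable
  have lim: "AE x in M. (\<lambda>k. s k x) \<longlonglongrightarrow> u x"
    using conv unfolding u_def by eventually_elim (simp add: convergent_LIMSEQ_iff)
  \<comment> \<open>The subtracted tail makes the induction close: the next increment, of size C
    (1/2)^(n + k), is exactly what the tail loses when k grows by one.\<close>
  have cau: "nrm2 M (\<lambda>x. s n x - s (n + k) x) \<le> 2 * C * (1/2)^n - 2 * C * (1/2)^(n + k)" for n k
  proof (induction k)
    case 0
    then show ?case by (simp add: nrm2_def)
  next
    case (Suc k)
    have "nrm2 M (\<lambda>x. s n x - s (n + Suc k) x)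
      \<le> nrm2 M (\<lambda>x. s n x - s (n + k) x) + nrm2 M (\<lambda>x. s (n + k) x - s (n + Suc k) x)"
      by (intro nrm2_triangle s)
    also have "nrm2 M (\<lambda>x. s (n + k) x - s (n + Suc k) x) \<le> C * (1/2)^(n + k)"
      using fast[of "n + k"] by (subst nrm2_commute) simp
    finally show ?case using Suc by simp
  qed
  have est: "sqint M (\<lambda>x. s n x - u x)" "nrm2 M (\<lambda>x. s n x - u x) \<le> 2 * C * (1/2)^n" for n
  proof -
    \<comment> \<open>The limit is known pointwise only; Fatou's lemma turns the Cauchy bound into a
      bound on the distance to it.\<close>
    have "(\<integral>\<^sup>+x. ennreal ((norm (s n x - u x))\<^sup>2) \<partial>M) = (\<integral>\<^sup>+x. liminf (\<lambda>k. ennreal ((norm (s n x - s (n + k) x))\<^sup>2)) \<partial>M)"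
    proof (rule nn_integral_cong_AE)
      show "AE x in M. ennreal ((norm (s n x - u x))\<^sup>2) = liminf (\<lambda>k. ennreal ((norm (s n x - s (n + k) x))\<^sup>2))"
        using lim
      proof eventually_elim
        case (elim x)
        then have "(\<lambda>k. s (n + k) x) \<longlonglongrightarrow> u x"
          using LIMSEQ_ignore_initial_segment[OF elim, of n] by (simp add: add.commute)
        then have "(\<lambda>k. ennreal ((norm (s n x - s (n + k) x))\<^sup>2)) \<longlonglongrightarrow> ennreal ((norm (s n x - u x))\<^sup>2)"
          by (intro tendsto_ennrealI tendsto_intros)
        then show ?case by (intro lim_imp_Liminf[symmetric]) simp_all
      qed
    qed
    also have "\<dots> \<le> liminf (\<lambda>k. \<integral>\<^sup>+x. ennreal ((norm (s n x - s (n + k) x))\<^sup>2) \<partial>M)"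
      by (rule nn_integral_liminf) simp
    also have "\<dots> \<le> liminf (\<lambda>k::nat. ennreal ((2 * C * (1/2)^n)\<^sup>2))"
    proof (rule Liminf_mono, rule always_eventually, rule allI)
      fix k
      have "nrm2 M (\<lambda>x. s n x - s (n + k) x) \<le> 2 * C * (1/2)^n"
        using cau[of n k] C by (smt (verit) zero_le_power mult_nonneg_nonneg zero_le_divide_1_iff)
      then show "(\<integral>\<^sup>+x. ennreal ((norm (s n x - s (n + k) x))\<^sup>2) \<partial>M) \<le> ennreal ((2 * C * (1/2)^n)\<^sup>2)"
        by (subst nn_nrm2) (auto intro!: sqint_diff s ennreal_leI power_mono)
    qed
    also have "\<dots> = ennreal ((2 * C * (1/2)^n)\<^sup>2)" by (simp add: Liminf_const)
    finally have "(\<integral>\<^sup>+x. ennreal ((norm (s n x - u x))\<^sup>2) \<partial>M) \<le> ennreal ((2 * C * (1/2)^n)\<^sup>2)" .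
    from sqint_nnI[OF _ this] C show "sqint M (\<lambda>x. s n x - u x)" "nrm2 M (\<lambda>x. s n x - u x) \<le> 2 * C * (1/2)^n"
      by auto
  qed
  have su: "sqint M u" using sqint_diff(1)[OF s[of 0] est(1)[of 0]] by simp
  have "(\<lambda>n. 2 * C * (1/2)^n) \<longlonglongrightarrow> 2 * C * 0"
    by (intro tendsto_intros LIMSEQ_power_zero) simp
  then have lim0: "(\<lambda>n. 2 * C * (1/2)^n) \<longlonglongrightarrow> 0" by simp
  have "(\<lambda>k. nrm2 M (\<lambda>x. s k x - u x)) \<longlonglongrightarrow> 0"
    by (rule tendsto_sandwich[OF _ _ tendsto_const lim0]) (use est(2) in auto)
  with su show ?thesis by (rule that)
qed

section \<open>Coercive forms on incomplete spaces\<close>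

text \<open>Neither completeness nor definiteness is assumed: the intended space consists of test
  functions with the Dirichlet form. Representation theorems hold up to an arbitrarily small error,
  measured in the dual norm, and the limit is taken later in L2. Linearity is stated with
  \<open>\<phi> + c * \<psi>\<close>, one rule for sums and multiples; in the second argument it
  follows by symmetry.\<close>

locale pre_hilbert =
  fixes V :: "('a \<Rightarrow> real) set" and I :: "('a \<Rightarrow> real) \<Rightarrow> ('a \<Rightarrow> real) \<Rightarrow> real"
  assumes zero_mem: "(\<lambda>x. 0) \<in> V"
    and comb_mem: "\<And>\<phi> \<psi> c. \<phi> \<in> V \<Longrightarrow> \<psi> \<in> V \<Longrightarrow> (\<lambda>x. \<phi> x + c * \<psi> x) \<in> V"
    and I_comb: "\<And>\<phi> \<psi> \<eta> c. \<phi> \<in> V \<Longrightarrow> \<psi> \<in> V \<Longrightarrow> \<eta> \<in> V \<Longrightarrow> I (\<lambda>x. \<phi> x + c * \<psi> x) \<eta> = I \<phi> \<eta> + c * I \<psi> \<eta>"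
    and I_commute: "\<And>\<phi> \<psi>. I \<phi> \<psi> = I \<psi> \<phi>"
    and I_nonneg: "\<And>\<phi>. \<phi> \<in> V \<Longrightarrow> 0 \<le> I \<phi> \<phi>"
    and I_cauchy_schwarz: "\<And>\<phi> \<psi>. \<phi> \<in> V \<Longrightarrow> \<psi> \<in> V \<Longrightarrow> \<bar>I \<phi> \<psi>\<bar> \<le> sqrt (I \<phi> \<phi>) * sqrt (I \<psi> \<psi>)"
begin

definition n :: "('a \<Rightarrow> real) \<Rightarrow> real" where "n \<phi> = sqrt (I \<phi> \<phi>)"

lemma n_nonneg: "\<phi> \<in> V \<Longrightarrow> 0 \<le> n \<phi>"
  by (simp add: n_def I_nonneg)

lemma n_power2: "\<phi> \<in> V \<Longrightarrow> (n \<phi>)\<^sup>2 = I \<phi> \<phi>"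
  by (simp add: n_def I_nonneg)

definition bounded_functional :: "(('a \<Rightarrow> real) \<Rightarrow> real) \<Rightarrow> real \<Rightarrow> bool" where
  "bounded_functional r C \<longleftrightarrow>
    (\<forall>\<phi>\<in>V. \<forall>\<psi>\<in>V. \<forall>c. r (\<lambda>x. \<phi> x + c * \<psi> x) = r \<phi> + c * r \<psi>) \<and> (\<forall>\<phi>\<in>V. \<bar>r \<phi>\<bar> \<le> C * n \<phi>)"

lemma I_expand:
  assumes "w \<in> V" "\<eta> \<in> V"
  shows "I (\<lambda>x. w x + s * \<eta> x) (\<lambda>x. w x + s * \<eta> x) = I w w + 2 * s * I w \<eta> + s\<^sup>2 * I \<eta> \<eta>"
proof -
  let ?z = "\<lambda>x. w x + s * \<eta> x"
  have z: "?z \<in> V" using assms by (rule comb_mem)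
  have "I ?z ?z = I w ?z + s * I \<eta> ?z" by (rule I_comb) (use assms z in auto)
  also have "I w ?z = I w w + s * I w \<eta>"
    using I_comb[OF assms assms(1), of s] by (simp add: I_commute[of w ?z] I_commute[of \<eta> w])
  also have "I \<eta> ?z = I w \<eta> + s * I \<eta> \<eta>"
    using I_comb[OF assms assms(2), of s] by (simp add: I_commute[of \<eta> ?z])
  finally show ?thesis by (simp add: algebra_simps power2_eq_square)
qed

text \<open>The representing vector would minimize the energy \<open>E\<close>, which is bounded
  below. A point whose energy is within e^2 / 2 of the infimum satisfies the Euler equation up to an
  error e in the dual norm.\<close>

lemma approx_riesz:
  assumes r: "bounded_functional r C" and e: "e > 0"
  obtains w where "w \<in> V" "\<And>\<eta>. \<eta> \<in> V \<Longrightarrow> \<bar>r \<eta> - I w \<eta>\<bar> \<le> e * n \<eta>"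
proof -
  define E where "E \<phi> = I \<phi> \<phi> / 2 - r \<phi>" for \<phi>
  have lower: "- (C\<^sup>2) / 2 \<le> E \<phi>" if "\<phi> \<in> V" for \<phi>
  proof -
    have "r \<phi> \<le> C * n \<phi>" using r that unfolding bounded_functional_def by (meson abs_le_D1)
    moreover have "0 \<le> (n \<phi> - C)\<^sup>2" by simp
    ultimately show ?thesis using n_power2[OF that] by (simp add: E_def power2_eq_square algebra_simps)
  qed
  define m where "m = Inf (E ` V)"
  have bdd: "bdd_below (E ` V)" using lower by (auto simp: bdd_below_def)
  have m: "m \<le> E \<phi>" if "\<phi> \<in> V" for \<phi>
    unfolding m_def using that bdd by (intro cInf_lower) auto
  have "\<exists>z\<in>E ` V. z < m + e\<^sup>2 / 2"
    using cInf_lessD[of "E ` V" "m + e\<^sup>2 / 2"] zero_mem e by (auto simp: m_def)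
  then obtain w where w: "w \<in> V" "E w < m + e\<^sup>2 / 2" by auto
  have "\<bar>r \<eta> - I w \<eta>\<bar> \<le> e * n \<eta>" if \<eta>: "\<eta> \<in> V" for \<eta>
  proof -
    define D where "D = r \<eta> - I w \<eta>"
    have key: "s * D \<le> e\<^sup>2 / 2 + s\<^sup>2 * (n \<eta>)\<^sup>2 / 2" for s
    proof -
      have "r (\<lambda>x. w x + s * \<eta> x) = r w + s * r \<eta>"
        using r w \<eta> unfolding bounded_functional_def by blast
      then have "E (\<lambda>x. w x + s * \<eta> x) = E w - s * D + s\<^sup>2 * (n \<eta>)\<^sup>2 / 2"
        unfolding E_def I_expand[OF w(1) \<eta>] D_def n_power2[OF \<eta>] by (simp add: algebra_simps)
      then show ?thesis using m[OF comb_mem[OF w(1) \<eta>, of s]] w(2) by linarith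
    qed
    show ?thesis
    proof (cases "n \<eta> = 0")
      case True
      have "D = 0"
      proof (rule ccontr)
        assume "D \<noteq> 0"
        \<comment> \<open>Along a direction of norm 0 the quadratic term is absent and the linear
          one is unbounded; this s makes the left-hand side of \<open>key\<close> equal to e^2 / 2 +
          1.\<close>
        then show False using key[of "(e\<^sup>2 / 2 + 1) / D"] True by simp
      qed
      then show ?thesis using True by (simp add: D_def)
    next
      case False
      then have N: "n \<eta> > 0" using n_nonneg[OF \<eta>] by simp
      \<comment> \<open>This s makes both terms on the right-hand side of \<open>key\<close> equal
        to e^2 / 2; its two signs give the absolute value.\<close>
      have "(e / n \<eta>) * D \<le> e\<^sup>2" "(- e / n \<eta>) * D \<le> e\<^sup>2"
        using key[of "e / n \<eta>"] key[of "- e / n \<eta>"] N by (simp_all add: power_divide)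
      then have "e * D \<le> e * (e * n \<eta>)" "e * (- D) \<le> e * (e * n \<eta>)"
        using N by (simp_all add: power2_eq_square field_simps)
      then have "D \<le> e * n \<eta>" "- D \<le> e * n \<eta>"
        using e by (simp_all only: mult_le_cancel_left_pos)
      then show ?thesis by (simp add: D_def)
    qed
  qed
  with w(1) show ?thesis by (rule that)
qed

text \<open>A gradient iteration for the nonsymmetric form: the approximation is corrected by \<tau>
  times an approximate Riesz representative of its residual. With exact representatives and \<tau> =
  \<alpha> / M^2 the residual would shrink by sqrt (1 - \<alpha>^2 / M^2). The representatives carry
  a relative error d, and d is taken so small that the factor stays below some \<theta> < 1.\<close>

lemma approx_lax_milgram:
  assumes r: "bounded_functional r C"
    and B1: "\<And>\<phi> \<psi> \<eta> c. \<phi> \<in> V \<Longrightarrow> \<psi> \<in> V \<Longrightarrow> \<eta> \<in> V \<Longrightarrow> B (\<lambda>x. \<phi> x + c * \<psi> x) \<eta> = B \<phi> \<eta> + c * B \<psi> \<eta>"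
    and B2: "\<And>\<phi> \<psi> \<eta> c. \<phi> \<in> V \<Longrightarrow> \<psi> \<in> V \<Longrightarrow> \<eta> \<in> V \<Longrightarrow> B \<eta> (\<lambda>x. \<phi> x + c * \<psi> x) = B \<eta> \<phi> + c * B \<eta> \<psi>"
    and M: "\<And>\<phi> \<psi>. \<phi> \<in> V \<Longrightarrow> \<psi> \<in> V \<Longrightarrow> \<bar>B \<phi> \<psi>\<bar> \<le> M * n \<phi> * n \<psi>" "M > 0"
    and \<alpha>: "\<And>\<phi>. \<phi> \<in> V \<Longrightarrow> \<alpha> * (n \<phi>)\<^sup>2 \<le> B \<phi> \<phi>" "\<alpha> > 0" "\<alpha> \<le> M"
    and e: "e > 0"
  obtains w where "w \<in> V" "\<And>\<eta>. \<eta> \<in> V \<Longrightarrow> \<bar>r \<eta> - B w \<eta>\<bar> \<le> e * n \<eta>"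
proof -
  define \<tau> where "\<tau> = \<alpha> / M\<^sup>2"
  have \<tau>: "\<tau> > 0" using \<alpha> M by (simp add: \<tau>_def)
  define k2 where "k2 = 1 - \<alpha>\<^sup>2 / M\<^sup>2"
  have k2: "0 \<le> k2" "k2 < 1" using \<alpha> M by (auto simp: k2_def power_mono)
  define \<theta> where "\<theta> = (1 + sqrt k2) / 2"
  have sk: "sqrt k2 < 1" "0 \<le> sqrt k2" using k2 by (auto simp: real_sqrt_lt_1_iff)
  have \<theta>: "sqrt k2 < \<theta> \<and> \<theta> < 1 \<and> \<theta> > 0"
  proof -
    have "s < (1 + s) / 2 \<and> (1 + s) / 2 < 1 \<and> 0 < (1 + s) / 2" if "0 \<le> s" "s < 1" for s :: real
      using that by auto
    from this[OF sk(2,1)] show ?thesis unfolding \<theta>_def .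
  qed
  \<comment> \<open>The factor by which one step multiplies the residual. The square root bounds the
    norm of \<open>z\<close> below, and \<open>d\<close> and \<open>\<tau> * d\<close> are the
    errors of the two representatives. By continuity at 0, where its value is sqrt k2, it is below
    \<theta> for small d.\<close>
  define F where "F d = sqrt (k2 * (1 + d)\<^sup>2 + 2 * \<tau> * d * (1 + d) + 2 * \<tau>\<^sup>2 * M * (1 + d) * d + \<tau>\<^sup>2 * d\<^sup>2) + d + \<tau> * d" for d
  have "(F \<longlongrightarrow> F 0) (at_right 0)"
    unfolding F_def by (intro tendsto_intros)
  moreover have "F 0 < \<theta>" using \<theta> by (simp add: F_def)
  ultimately have "eventually (\<lambda>d. F d < \<theta>) (at_right 0)" by (rule order_tendstoD(2))
  then obtain b where b: "b > 0" "\<And>d. 0 < d \<Longrightarrow> d < b \<Longrightarrow> F d < \<theta>"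
    by (auto simp: eventually_at_right_field)
  define d where "d = b / 2"
  have d: "d > 0" "F d < \<theta>" using b by (auto simp: d_def)
  have rlin: "r (\<lambda>x. \<phi> x + c * \<psi> x) = r \<phi> + c * r \<psi>" if "\<phi> \<in> V" "\<psi> \<in> V" for \<phi> \<psi> c
    using r that unfolding bounded_functional_def by blast
  have step: "\<exists>\<phi>'\<in>V. \<forall>\<eta>\<in>V. \<bar>r \<eta> - B \<phi>' \<eta>\<bar> \<le> (\<theta> * \<rho>) * n \<eta>"
    if \<phi>: "\<phi> \<in> V" and res: "\<And>\<eta>. \<eta> \<in> V \<Longrightarrow> \<bar>r \<eta> - B \<phi> \<eta>\<bar> \<le> \<rho> * n \<eta>" and \<rho>: "\<rho> > 0" for \<phi> \<rho>
  proof -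
    define R where "R \<eta> = r \<eta> - B \<phi> \<eta>" for \<eta>
    have bR: "bounded_functional R \<rho>"
      unfolding bounded_functional_def R_def using res rlin B2 \<phi> by (auto simp: algebra_simps)
    obtain w where w: "w \<in> V" "\<And>\<eta>. \<eta> \<in> V \<Longrightarrow> \<bar>R \<eta> - I w \<eta>\<bar> \<le> (d * \<rho>) * n \<eta>"
      using approx_riesz[OF bR, of "d * \<rho>"] d \<rho> by auto
    have bB: "bounded_functional (B w) (M * n w)"
      unfolding bounded_functional_def using B2 M(1) w(1) by auto
    obtain y where y: "y \<in> V" "\<And>\<eta>. \<eta> \<in> V \<Longrightarrow> \<bar>B w \<eta> - I y \<eta>\<bar> \<le> (d * \<rho>) * n \<eta>"
      using approx_riesz[OF bB, of "d * \<rho>"] d \<rho> by auto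
    have nw0: "n w \<ge> 0" "n y \<ge> 0" using w y n_nonneg by auto
    have "(n w)\<^sup>2 \<le> (\<rho> * (1 + d)) * n w"
    proof -
      have "I w w \<le> \<bar>R w - I w w\<bar> + \<bar>R w\<bar>" by linarith
      also have "\<dots> \<le> (d * \<rho>) * n w + \<rho> * n w"
        using w(2)[OF w(1)] res[OF w(1)] by (simp add: R_def)
      finally show ?thesis using n_power2[OF w(1)] by (simp add: algebra_simps)
    qed
    then have nw: "n w \<le> \<rho> * (1 + d)"
      using nw0 d \<rho> by (cases "n w = 0") (auto simp: power2_eq_square)
    have "(n y)\<^sup>2 \<le> (M * n w + d * \<rho>) * n y"
    proof -
      have "I y y \<le> \<bar>B w y - I y y\<bar> + \<bar>B w y\<bar>" by linarith
      also have "\<dots> \<le> (d * \<rho>) * n y + M * n w * n y"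
        using y(2)[OF y(1)] M(1)[OF w(1) y(1)] by simp
      finally show ?thesis using n_power2[OF y(1)] by (simp add: algebra_simps)
    qed
    then have ny: "n y \<le> M * n w + d * \<rho>"
      using nw0 d \<rho> M by (cases "n y = 0") (auto simp: power2_eq_square)
    \<comment> \<open>Up to the errors of \<open>w\<close> and \<open>y\<close> this represents the
      residual after the step, since \<open>w\<close> represents \<open>R\<close> and
      \<open>y\<close> represents \<open>B w\<close>.\<close>
    define z where "z = (\<lambda>x. w x + (- \<tau>) * y x)"
    have z: "z \<in> V" unfolding z_def by (rule comb_mem[OF w(1) y(1)])
    have nz: "n z \<le> (sqrt (k2 * (1 + d)\<^sup>2 + 2 * \<tau> * d * (1 + d) + 2 * \<tau>\<^sup>2 * M * (1 + d) * d + \<tau>\<^sup>2 * d\<^sup>2)) * \<rho>"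
    proof -
      have "I z z = (n w)\<^sup>2 - 2 * \<tau> * I w y + \<tau>\<^sup>2 * (n y)\<^sup>2"
        unfolding z_def I_expand[OF w(1) y(1)] by (simp add: n_power2 w y)
      also have "I w y = I y w" by (rule I_commute)
      also have "I y w \<ge> \<alpha> * (n w)\<^sup>2 - d * \<rho> * n w"
        using y(2)[OF w(1)] \<alpha>(1)[OF w(1)] by linarith
      then have "(n w)\<^sup>2 - 2 * \<tau> * I y w + \<tau>\<^sup>2 * (n y)\<^sup>2 \<le> (n w)\<^sup>2 - 2 * \<tau> * (\<alpha> * (n w)\<^sup>2 - d * \<rho> * n w) + \<tau>\<^sup>2 * (n y)\<^sup>2"
        using \<tau> by simp
      also have "\<dots> \<le> (n w)\<^sup>2 - 2 * \<tau> * (\<alpha> * (n w)\<^sup>2 - d * \<rho> * n w) + \<tau>\<^sup>2 * (M * n w + d * \<rho>)\<^sup>2"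
        using ny nw0 \<tau> by (auto intro!: power_mono)
      also have "\<dots> = k2 * (n w)\<^sup>2 + 2 * \<tau> * d * \<rho> * n w + 2 * \<tau>\<^sup>2 * M * d * \<rho> * n w + \<tau>\<^sup>2 * d\<^sup>2 * \<rho>\<^sup>2"
      proof -
        have "1 - 2 * \<tau> * \<alpha> + \<tau>\<^sup>2 * M\<^sup>2 = k2"
          using M by (simp add: \<tau>_def k2_def power2_eq_square)
        then have "k2 * (n w)\<^sup>2 = (1 - 2 * \<tau> * \<alpha> + \<tau>\<^sup>2 * M\<^sup>2) * (n w)\<^sup>2" by simp
        then show ?thesis by (simp add: power2_eq_square algebra_simps)
      qed
      also have "\<dots> \<le> k2 * (\<rho> * (1 + d))\<^sup>2 + 2 * \<tau> * d * \<rho> * (\<rho> * (1 + d)) + 2 * \<tau>\<^sup>2 * M * d * \<rho> * (\<rho> * (1 + d)) + \<tau>\<^sup>2 * d\<^sup>2 * \<rho>\<^sup>2"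
        using nw nw0 k2 \<tau> d \<rho> M by (intro add_mono mult_left_mono power_mono) auto
      also have "\<dots> = (k2 * (1 + d)\<^sup>2 + 2 * \<tau> * d * (1 + d) + 2 * \<tau>\<^sup>2 * M * (1 + d) * d + \<tau>\<^sup>2 * d\<^sup>2) * \<rho>\<^sup>2"
        by (simp add: power2_eq_square algebra_simps)
      finally have "sqrt (I z z) \<le> sqrt ((k2 * (1 + d)\<^sup>2 + 2 * \<tau> * d * (1 + d) + 2 * \<tau>\<^sup>2 * M * (1 + d) * d + \<tau>\<^sup>2 * d\<^sup>2) * \<rho>\<^sup>2)"
        by (rule real_sqrt_le_mono)
      then show ?thesis using \<rho> by (simp add: n_def real_sqrt_mult)
    qed
    define \<phi>' where "\<phi>' = (\<lambda>x. \<phi> x + \<tau> * w x)"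
    have \<phi>': "\<phi>' \<in> V" unfolding \<phi>'_def by (rule comb_mem[OF \<phi> w(1)])
    have "\<bar>r \<eta> - B \<phi>' \<eta>\<bar> \<le> (\<theta> * \<rho>) * n \<eta>" if \<eta>: "\<eta> \<in> V" for \<eta>
    proof -
      have n\<eta>: "n \<eta> \<ge> 0" using n_nonneg[OF \<eta>] .
      have "I z \<eta> = I w \<eta> + (- \<tau>) * I y \<eta>" unfolding z_def by (rule I_comb[OF w(1) y(1) \<eta>])
      then have "r \<eta> - B \<phi>' \<eta> = (R \<eta> - I w \<eta>) + I z \<eta> + (- \<tau>) * (B w \<eta> - I y \<eta>)"
        unfolding \<phi>'_def R_def using B1[OF \<phi> w(1) \<eta>] by (simp add: algebra_simps)
      then have "\<bar>r \<eta> - B \<phi>' \<eta>\<bar> \<le> \<bar>R \<eta> - I w \<eta>\<bar> + \<bar>I z \<eta>\<bar> + \<tau> * \<bar>B w \<eta> - I y \<eta>\<bar>"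
        using \<tau> abs_mult[of "- \<tau>" "B w \<eta> - I y \<eta>"] by simp
      also have "\<dots> \<le> (d * \<rho>) * n \<eta> + n z * n \<eta> + \<tau> * ((d * \<rho>) * n \<eta>)"
        using w(2)[OF \<eta>] y(2)[OF \<eta>] I_cauchy_schwarz[OF z \<eta>] \<tau>
        by (intro add_mono mult_left_mono) (auto simp: n_def)
      also have "\<dots> = (d * \<rho> + n z + \<tau> * d * \<rho>) * n \<eta>" by (simp add: algebra_simps)
      also have "\<dots> \<le> (F d * \<rho>) * n \<eta>"
        using nz n\<eta> by (intro mult_right_mono) (auto simp: F_def algebra_simps)
      also have "\<dots> \<le> (\<theta> * \<rho>) * n \<eta>"
        using d \<rho> n\<eta> by (intro mult_right_mono) auto
      finally show ?thesis .
    qed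
    with \<phi>' show ?thesis by blast
  qed
  define C' where "C' = max C 1"
  have C': "C' > 0" by (simp add: C'_def)
  have iter: "\<exists>\<phi>\<in>V. \<forall>\<eta>\<in>V. \<bar>r \<eta> - B \<phi> \<eta>\<bar> \<le> (\<theta> ^ k * C') * n \<eta>" for k
  proof (induction k)
    case 0
    have "B (\<lambda>x. 0) \<eta> = 0" if "\<eta> \<in> V" for \<eta>
      using B1[OF zero_mem zero_mem that, of 1] by simp
    moreover have "\<bar>r \<eta>\<bar> \<le> C' * n \<eta>" if "\<eta> \<in> V" for \<eta>
      using r that n_nonneg[OF that] mult_right_mono[of C C' "n \<eta>"]
      unfolding bounded_functional_def C'_def by fastforce
    ultimately show ?case by (intro bexI[OF _ zero_mem]) simp
  next
    case (Suc k)
    then obtain \<phi> where "\<phi> \<in> V" "\<forall>\<eta>\<in>V. \<bar>r \<eta> - B \<phi> \<eta>\<bar> \<le> (\<theta> ^ k * C') * n \<eta>" by blast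
    with step[of \<phi> "\<theta> ^ k * C'"] \<theta> C' show ?case by (simp add: mult.assoc)
  qed
  obtain k where "\<theta> ^ k < e / C'"
    using real_arch_pow_inv[of "e / C'" \<theta>] \<theta> e C' by auto
  then have k: "\<theta> ^ k * C' \<le> e" using C' by (simp add: field_simps)
  obtain \<phi> where \<phi>: "\<phi> \<in> V" "\<And>\<eta>. \<eta> \<in> V \<Longrightarrow> \<bar>r \<eta> - B \<phi> \<eta>\<bar> \<le> (\<theta> ^ k * C') * n \<eta>"
    using iter[of k] by blast
  have "\<bar>r \<eta> - B \<phi> \<eta>\<bar> \<le> e * n \<eta>" if "\<eta> \<in> V" for \<eta>
    using \<phi>(2)[OF that] mult_right_mono[OF k n_nonneg[OF that]] by linarith
  with \<phi>(1) show ?thesis by (rule that)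
qed

end

section \<open>The Dirichlet problem\<close>

lemma Lp_2_iff: "u \<in> Lp \<Omega> 2 \<longleftrightarrow> sqint (lebesgue_on \<Omega>) u"
  by (simp add: Lp_def sqint_def)

lemma W1_norm_2: "W1_norm \<Omega> 2 u g = sqrt ((nrm2 (lebesgue_on \<Omega>) u)\<^sup>2 + (nrm2 (lebesgue_on \<Omega>) g)\<^sup>2)"
  by (simp add: W1_norm_def nrm2_power2 powr_half_sqrt)

lemma W1_norm_2_tendsto_0_iff:
  "(\<lambda>k. W1_norm \<Omega> 2 (u k) (g k)) \<longlonglongrightarrow> 0 \<longleftrightarrow>
    (\<lambda>k. nrm2 (lebesgue_on \<Omega>) (u k)) \<longlonglongrightarrow> 0 \<and> (\<lambda>k. nrm2 (lebesgue_on \<Omega>) (g k)) \<longlonglongrightarrow> 0"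
proof
  assume lim: "(\<lambda>k. W1_norm \<Omega> 2 (u k) (g k)) \<longlonglongrightarrow> 0"
  have "nrm2 (lebesgue_on \<Omega>) (u k) \<le> W1_norm \<Omega> 2 (u k) (g k)" "nrm2 (lebesgue_on \<Omega>) (g k) \<le> W1_norm \<Omega> 2 (u k) (g k)" for k
    unfolding W1_norm_2 by (auto intro!: real_le_rsqrt)
  then show "(\<lambda>k. nrm2 (lebesgue_on \<Omega>) (u k)) \<longlonglongrightarrow> 0 \<and> (\<lambda>k. nrm2 (lebesgue_on \<Omega>) (g k)) \<longlonglongrightarrow> 0"
    by (intro conjI tendsto_sandwich[OF _ _ tendsto_const lim]) auto
next
  assume *: "(\<lambda>k. nrm2 (lebesgue_on \<Omega>) (u k)) \<longlonglongrightarrow> 0 \<and> (\<lambda>k. nrm2 (lebesgue_on \<Omega>) (g k)) \<longlonglongrightarrow> 0"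
  have "(\<lambda>k. sqrt ((nrm2 (lebesgue_on \<Omega>) (u k))\<^sup>2 + (nrm2 (lebesgue_on \<Omega>) (g k))\<^sup>2)) \<longlonglongrightarrow> sqrt (0\<^sup>2 + 0\<^sup>2)"
    using * by (intro tendsto_intros) auto
  then show "(\<lambda>k. W1_norm \<Omega> 2 (u k) (g k)) \<longlonglongrightarrow> 0" by (simp add: W1_norm_2)
qed

definition elliptic :: "(real^2 \<Rightarrow> real^2^2) \<Rightarrow> real \<Rightarrow> real \<Rightarrow> bool" where
  "elliptic \<sigma> \<alpha> \<Lambda> \<longleftrightarrow> \<sigma> \<in> borel_measurable borel \<and> 0 < \<alpha> \<and> \<alpha> \<le> \<Lambda> \<and>
    (\<forall>x \<xi>. \<alpha> * (norm \<xi>)\<^sup>2 \<le> (\<sigma> x *v \<xi>) \<bullet> \<xi> \<and> norm (\<sigma> x *v \<xi>) \<le> \<Lambda> * norm \<xi>)"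

lemma borel_measurable_mv:
  fixes A :: "'a \<Rightarrow> real^2^2" and g :: "'a \<Rightarrow> real^2"
  assumes "A \<in> borel_measurable M" "g \<in> borel_measurable M"
  shows "(\<lambda>x. A x *v g x) \<in> borel_measurable M"
proof -
  have "continuous_on UNIV (\<lambda>p :: (real^2^2) \<times> (real^2). fst p *v snd p)"
    unfolding matrix_vector_mult_def by (intro continuous_intros)
  from borel_measurable_continuous_Pair[OF assms this] show ?thesis .
qed

locale bdd_domain =
  fixes \<Omega> :: "(real^2) set"
  assumes open_\<Omega>: "open \<Omega>" and bounded_\<Omega>: "bounded \<Omega>"
begin

abbreviation "N \<equiv> lebesgue_on \<Omega>"
abbreviation "T \<equiv> test_functions \<Omega>"

lemma sets_\<Omega> [simp]: "\<Omega> \<in> sets lebesgue" "\<Omega> \<in> lmeasurable"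
  using open_\<Omega> bounded_\<Omega> by (auto simp: bounded_set_imp_lmeasurable)

lemma finite_N: "finite_measure N"
  by (rule finite_measure_lebesgue_on) simp

lemma borel_N: "f \<in> borel_measurable borel \<Longrightarrow> f \<in> borel_measurable N"
  by (intro measurable_restrict_space1 measurable_completion) simp

lemma integral_N:
  fixes f :: "real^2 \<Rightarrow> 'b::euclidean_space"
  assumes "f \<in> borel_measurable borel" "\<And>x. x \<notin> \<Omega> \<Longrightarrow> f x = 0"
  shows "(LINT x|N. f x) = (LINT x|lborel. f x)" "integrable N f \<longleftrightarrow> integrable lborel f"
proof -
  have "(\<lambda>x. indicator \<Omega> x *\<^sub>R f x) = f"
    using assms(2) by (auto simp: indicator_def)
  then show "(LINT x|N. f x) = (LINT x|lborel. f x)" "integrable N f \<longleftrightarrow> integrable lborel f"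
    using assms(1) by (auto simp: integral_restrict_space integrable_restrict_space integral_completion integrable_completion)
qed

lemma T_outside: "\<phi> \<in> T \<Longrightarrow> x \<notin> \<Omega> \<Longrightarrow> \<phi> x = 0" "\<phi> \<in> T \<Longrightarrow> x \<notin> \<Omega> \<Longrightarrow> grad \<phi> x = 0"
  by (elim test_functionsE, blast)+

lemma T_smooth: "\<phi> \<in> T \<Longrightarrow> smooth \<phi>"
  by (rule test_functions_smooth)

lemma T_diff: "\<phi> \<in> T \<Longrightarrow> \<phi> differentiable (at x)"
  by (intro smooth_differentiable T_smooth)

lemma T_measurable: "\<phi> \<in> T \<Longrightarrow> \<phi> \<in> borel_measurable borel" "\<phi> \<in> T \<Longrightarrow> grad \<phi> \<in> borel_measurable borel"
  by (auto intro!: borel_measurable_continuous_onI smooth_continuous continuous_grad T_smooth)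

lemma T_sqint:
  assumes "\<phi> \<in> T"
  shows "sqint N \<phi>" "sqint N (grad \<phi>)" "integrable lborel (\<lambda>x. (norm (grad \<phi> x))\<^sup>2)" "integrable lborel (\<lambda>x. (norm (\<phi> x))\<^sup>2)"
proof -
  obtain K where K: "smooth \<phi>" "compact K" "K \<subseteq> \<Omega>" "\<And>x. x \<notin> K \<Longrightarrow> \<phi> x = 0" "\<And>x. x \<notin> K \<Longrightarrow> grad \<phi> x = 0"
    using test_functionsE[OF assms] by metis
  have c: "continuous_on UNIV (\<lambda>x. (norm (\<phi> x))\<^sup>2)" "continuous_on UNIV (\<lambda>x. (norm (grad \<phi> x))\<^sup>2)"
    using smooth_continuous[OF K(1)] continuous_grad[OF K(1)] by (auto intro!: continuous_intros)
  show 1: "integrable lborel (\<lambda>x. (norm (grad \<phi> x))\<^sup>2)" "integrable lborel (\<lambda>x. (norm (\<phi> x))\<^sup>2)"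
    using integrable_compact_support[OF c(1) K(2)] integrable_compact_support[OF c(2) K(2)] K by auto
  have "integrable N (\<lambda>x. (norm (\<phi> x))\<^sup>2)" "integrable N (\<lambda>x. (norm (grad \<phi> x))\<^sup>2)"
    using 1 integral_N(2)[of "\<lambda>x. (norm (\<phi> x))\<^sup>2"] integral_N(2)[of "\<lambda>x. (norm (grad \<phi> x))\<^sup>2"]
      T_outside[OF assms] T_measurable[OF assms] by auto
  then show "sqint N \<phi>" "sqint N (grad \<phi>)"
    using T_measurable[OF assms] by (auto simp: sqint_def borel_N)
qed

lemma nn_grad_T:
  assumes "\<phi> \<in> T"
  shows "(\<integral>\<^sup>+x. ennreal ((norm (grad \<phi> x))\<^sup>2) \<partial>lborel) = ennreal ((nrm2 N (grad \<phi>))\<^sup>2)"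
proof -
  have "(\<integral>\<^sup>+x. ennreal ((norm (grad \<phi> x))\<^sup>2) \<partial>lborel) = ennreal (LINT x|lborel. (norm (grad \<phi> x))\<^sup>2)"
    using T_sqint(3)[OF assms] by (intro nn_integral_eq_integral) auto
  also have "(LINT x|lborel. (norm (grad \<phi> x))\<^sup>2) = (LINT x|N. (norm (grad \<phi> x))\<^sup>2)"
    using T_outside[OF assms] T_measurable[OF assms] by (intro integral_N(1)[symmetric]) auto
  finally show ?thesis by (simp add: nrm2_power2)
qed

text \<open>Cauchy--Schwarz on A turns the Sobolev inequality into a Poincare inequality whose
  constant is the square root of the measure of A. The gain for small A drives Stampacchia's
  iteration; A = \<Omega> gives the constant \<open>cP\<close>.\<close>

lemma poincare_supp:
  assumes "\<phi> \<in> T" "A \<in> sets N" "\<And>x. x \<notin> A \<Longrightarrow> grad \<phi> x = 0"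
  shows "nrm2 N \<phi> \<le> sqrt (measure N A) * nrm2 N (grad \<phi>)"
proof -
  have [measurable]: "\<phi> \<in> borel_measurable borel" "grad \<phi> \<in> borel_measurable borel"
    using T_measurable[OF assms(1)] by auto
  obtain K where K: "smooth \<phi>" "compact K" "K \<subseteq> \<Omega>" "\<And>x. x \<notin> K \<Longrightarrow> \<phi> x = 0" "\<And>x. x \<notin> K \<Longrightarrow> grad \<phi> x = 0"
    using test_functionsE[OF assms(1)] by metis
  have c: "continuous_on UNIV (\<lambda>x. norm (grad \<phi> x))"
    using continuous_grad[OF K(1)] by (auto intro!: continuous_intros)
  have i: "integrable lborel (\<lambda>x. norm (grad \<phi> x))"
    using integrable_compact_support[OF c K(2)] K by auto
  have "ennreal ((nrm2 N \<phi>)\<^sup>2) = (\<integral>\<^sup>+x. ennreal ((\<phi> x)\<^sup>2) \<partial>lborel)"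
  proof -
    have "(LINT x|N. (norm (\<phi> x))\<^sup>2) = (LINT x|lborel. (norm (\<phi> x))\<^sup>2)"
      using T_outside[OF assms(1)] by (intro integral_N(1)) auto
    moreover have "(\<integral>\<^sup>+x. ennreal ((norm (\<phi> x))\<^sup>2) \<partial>lborel) = ennreal (LINT x|lborel. (norm (\<phi> x))\<^sup>2)"
      using T_sqint(4)[OF assms(1)] by (intro nn_integral_eq_integral) auto
    ultimately show ?thesis by (simp add: nrm2_power2)
  qed
  also have "\<dots> \<le> (\<integral>\<^sup>+x. ennreal (norm (grad \<phi> x)) \<partial>lborel)\<^sup>2"
    by (rule sobolev_nn[OF test_functions_cs[OF assms(1)]])
  also have "(\<integral>\<^sup>+x. ennreal (norm (grad \<phi> x)) \<partial>lborel) = ennreal (LINT x|lborel. norm (grad \<phi> x))"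
    using i by (intro nn_integral_eq_integral) auto
  also have "(LINT x|lborel. norm (grad \<phi> x)) = (LINT x|N. norm (grad \<phi> x))"
    using T_outside[OF assms(1)] by (intro integral_N(1)[symmetric]) auto
  finally have "ennreal ((nrm2 N \<phi>)\<^sup>2) \<le> ennreal ((LINT x|N. norm (grad \<phi> x))\<^sup>2)"
    by (simp add: ennreal_power)
  then have "(nrm2 N \<phi>)\<^sup>2 \<le> (LINT x|N. norm (grad \<phi> x))\<^sup>2" by simp
  then have "nrm2 N \<phi> \<le> (LINT x|N. norm (grad \<phi> x))" by (rule power2_le_imp_le) simp
  also have "\<dots> \<le> nrm2 N (grad \<phi>) * sqrt (measure N A)"
    by (rule L1_le_nrm2_supp[OF finite_N T_sqint(2)[OF assms(1)] assms(2)]) (use assms(3) in auto)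
  finally show ?thesis by (simp add: mult.commute)
qed

definition cP :: real where "cP = sqrt (measure N \<Omega>)"

lemma cP_nonneg: "0 \<le> cP" by (simp add: cP_def)

lemma poincare: "\<phi> \<in> T \<Longrightarrow> nrm2 N \<phi> \<le> cP * nrm2 N (grad \<phi>)"
  unfolding cP_def by (rule poincare_supp) (auto simp: sets_restrict_space_iff T_outside)

lemma W1_norm_T_le: "\<phi> \<in> T \<Longrightarrow> W1_norm \<Omega> 2 \<phi> (grad \<phi>) \<le> (cP + 1) * nrm2 N (grad \<phi>)"
proof -
  assume \<phi>: "\<phi> \<in> T"
  have "sqrt ((nrm2 N \<phi>)\<^sup>2 + (nrm2 N (grad \<phi>))\<^sup>2) \<le> nrm2 N \<phi> + nrm2 N (grad \<phi>)"
    by (rule sqrt_sum_squares_le_sum) auto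
  also have "\<dots> \<le> (cP + 1) * nrm2 N (grad \<phi>)" using poincare[OF \<phi>] by (simp add: algebra_simps)
  finally show ?thesis by (simp add: W1_norm_2)
qed

lemma sqint_mv:
  assumes "elliptic \<sigma> \<alpha> \<Lambda>" "sqint N g"
  shows "sqint N (\<lambda>x. \<sigma> x *v g x)" "nrm2 N (\<lambda>x. \<sigma> x *v g x) \<le> \<Lambda> * nrm2 N g"
proof -
  have \<Lambda>: "\<Lambda> > 0" using assms(1) by (auto simp: elliptic_def)
  have m: "(\<lambda>x. \<sigma> x *v g x) \<in> borel_measurable N"
    using assms by (auto simp: elliptic_def sqint_def intro!: borel_measurable_mv borel_N[of \<sigma>])
  have "AE x in N. norm (\<sigma> x *v g x) \<le> norm (\<Lambda> *\<^sub>R g x)"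
    using assms(1) \<Lambda> by (auto simp: elliptic_def)
  from sqint_bound[OF sqint_scaleR[OF assms(2)] m this] \<Lambda>
  show "sqint N (\<lambda>x. \<sigma> x *v g x)" "nrm2 N (\<lambda>x. \<sigma> x *v g x) \<le> \<Lambda> * nrm2 N g"
    by (auto simp: nrm2_scaleR)
qed

text \<open>The arguments are vector fields, not functions: weak gradients of solutions are limits
  of gradients and enter the same estimates.\<close>

definition form :: "(real^2 \<Rightarrow> real^2^2) \<Rightarrow> (real^2 \<Rightarrow> real^2) \<Rightarrow> (real^2 \<Rightarrow> real^2) \<Rightarrow> real" where
  "form \<sigma> g h = (LINT x|N. (\<sigma> x *v g x) \<bullet> h x)"

lemma form_bound:
  assumes "elliptic \<sigma> \<alpha> \<Lambda>" "sqint N g" "sqint N h"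
  shows "\<bar>form \<sigma> g h\<bar> \<le> \<Lambda> * nrm2 N g * nrm2 N h"
  unfolding form_def
  using nrm2_inner[OF sqint_mv(1)[OF assms(1,2)] assms(3)] mult_right_mono[OF sqint_mv(2)[OF assms(1,2)], of "nrm2 N h"]
  by simp

lemma form_coercive:
  assumes "elliptic \<sigma> \<alpha> \<Lambda>" "sqint N g"
  shows "\<alpha> * (nrm2 N g)\<^sup>2 \<le> form \<sigma> g g"
proof -
  have "\<alpha> * (nrm2 N g)\<^sup>2 = (LINT x|N. \<alpha> * (norm (g x))\<^sup>2)" by (simp add: nrm2_power2)
  also have "\<dots> \<le> form \<sigma> g g"
    unfolding form_def
    by (intro Bochner_Integration.integral_mono sqint_inner sqint_mv(1)[OF assms] assms(2))
       (use assms in \<open>auto simp: elliptic_def sqint_def\<close>)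
  finally show ?thesis .
qed

lemma form_add_left:
  assumes "elliptic \<sigma> \<alpha> \<Lambda>" "sqint N g" "sqint N g'" "sqint N h"
  shows "form \<sigma> (\<lambda>x. g x + c *\<^sub>R g' x) h = form \<sigma> g h + c * form \<sigma> g' h"
proof -
  have "form \<sigma> (\<lambda>x. g x + c *\<^sub>R g' x) h = (LINT x|N. (\<sigma> x *v g x) \<bullet> h x + c * ((\<sigma> x *v g' x) \<bullet> h x))"
    unfolding form_def by (simp add: matrix_vector_right_distrib inner_add_left matrix_vector_mult_scaleR)
  also have "\<dots> = form \<sigma> g h + c * form \<sigma> g' h"
    unfolding form_def using assms sqint_inner[OF sqint_mv(1)] by (subst Bochner_Integration.integral_add) auto
  finally show ?thesis .
qed

lemma form_add_right:
  assumes "elliptic \<sigma> \<alpha> \<Lambda>" "sqint N g" "sqint N h" "sqint N h'"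
  shows "form \<sigma> g (\<lambda>x. h x + c *\<^sub>R h' x) = form \<sigma> g h + c * form \<sigma> g h'"
proof -
  have "form \<sigma> g (\<lambda>x. h x + c *\<^sub>R h' x) = (LINT x|N. (\<sigma> x *v g x) \<bullet> h x + c * ((\<sigma> x *v g x) \<bullet> h' x))"
    unfolding form_def by (simp add: inner_add_right)
  also have "\<dots> = form \<sigma> g h + c * form \<sigma> g h'"
    unfolding form_def using assms sqint_inner[OF sqint_mv(1)] by (subst Bochner_Integration.integral_add) auto
  finally show ?thesis .
qed

lemma form_diff_left:
  assumes "elliptic \<sigma> \<alpha> \<Lambda>" "sqint N g" "sqint N g'" "sqint N h"
  shows "form \<sigma> (\<lambda>x. g x - g' x) h = form \<sigma> g h - form \<sigma> g' h"
  using form_add_left[OF assms, of "-1"] by simp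

lemma T_comb: "\<phi> \<in> T \<Longrightarrow> \<psi> \<in> T \<Longrightarrow> (\<lambda>x. \<phi> x + c * \<psi> x) \<in> T"
  by (intro test_functions_add test_functions_cmult)

lemma grad_T_comb: "\<phi> \<in> T \<Longrightarrow> \<psi> \<in> T \<Longrightarrow> grad (\<lambda>x. \<phi> x + c * \<psi> x) = (\<lambda>x. grad \<phi> x + c *\<^sub>R grad \<psi> x)"
proof
  fix x assume *: "\<phi> \<in> T" "\<psi> \<in> T"
  have "(\<lambda>x. c * \<psi> x) differentiable (at x)" by (rule T_diff[OF test_functions_cmult[OF *(2)]])
  then show "grad (\<lambda>x. \<phi> x + c * \<psi> x) x = grad \<phi> x + c *\<^sub>R grad \<psi> x"
    using * by (simp add: grad_add grad_cmult T_diff)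
qed

lemma grad_T_diff: "\<phi> \<in> T \<Longrightarrow> \<psi> \<in> T \<Longrightarrow> grad (\<lambda>x. \<phi> x - \<psi> x) = (\<lambda>x. grad \<phi> x - grad \<psi> x)"
  by (rule ext) (simp add: grad_diff T_diff)

definition dirichlet_ip :: "(real^2 \<Rightarrow> real) \<Rightarrow> (real^2 \<Rightarrow> real) \<Rightarrow> real" where
  "dirichlet_ip \<phi> \<psi> = (LINT x|N. grad \<phi> x \<bullet> grad \<psi> x)"

lemma dirichlet_ip_self: "dirichlet_ip \<phi> \<phi> = (nrm2 N (grad \<phi>))\<^sup>2"
  by (simp add: dirichlet_ip_def nrm2_power2 power2_norm_eq_inner)

sublocale dir: pre_hilbert T dirichlet_ip
proof
  show "(\<lambda>x. 0) \<in> T" by (rule test_functions_zero)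
  show "(\<lambda>x. \<phi> x + c * \<psi> x) \<in> T" if "\<phi> \<in> T" "\<psi> \<in> T" for \<phi> \<psi> c
    using that by (rule T_comb)
  show "dirichlet_ip (\<lambda>x. \<phi> x + c * \<psi> x) \<eta> = dirichlet_ip \<phi> \<eta> + c * dirichlet_ip \<psi> \<eta>"
    if "\<phi> \<in> T" "\<psi> \<in> T" "\<eta> \<in> T" for \<phi> \<psi> \<eta> c
    unfolding dirichlet_ip_def grad_T_comb[OF that(1,2)]
    using that by (simp add: inner_add_left sqint_inner T_sqint)
  show "dirichlet_ip \<phi> \<psi> = dirichlet_ip \<psi> \<phi>" for \<phi> \<psi>
    by (simp add: dirichlet_ip_def inner_commute)
  show "0 \<le> dirichlet_ip \<phi> \<phi>" for \<phi> by (simp add: dirichlet_ip_self)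
  show "\<bar>dirichlet_ip \<phi> \<psi>\<bar> \<le> sqrt (dirichlet_ip \<phi> \<phi>) * sqrt (dirichlet_ip \<psi> \<psi>)" if "\<phi> \<in> T" "\<psi> \<in> T" for \<phi> \<psi>
    using nrm2_inner[OF T_sqint(2)[OF that(1)] T_sqint(2)[OF that(2)]]
    by (simp add: dirichlet_ip_self) (simp add: dirichlet_ip_def)
qed

lemma dir_n: "dir.n \<phi> = nrm2 N (grad \<phi>)"
  by (simp add: dir.n_def dirichlet_ip_self)

definition H_functional :: "((real^2 \<Rightarrow> real) \<Rightarrow> real) \<Rightarrow> real \<Rightarrow> bool" where
  "H_functional f C \<longleftrightarrow> dir.bounded_functional f C \<and> C \<ge> 0"

lemma H_neg1_functional:
  assumes "f \<in> H_neg1 \<Omega>"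
  obtains C where "H_functional f C"
proof -
  obtain C where C: "\<And>\<phi>. \<phi> \<in> T \<Longrightarrow> \<bar>f \<phi>\<bar> \<le> C * W1_norm \<Omega> 2 \<phi> (grad \<phi>)"
  proof -
    have "\<exists>C. \<forall>\<phi>\<in>T. \<bar>f \<phi>\<bar> \<le> C * W1_norm \<Omega> 2 \<phi> (grad \<phi>)"
      using assms by (simp add: W_neg1_def)
    then show ?thesis using that by blast
  qed
  have "f (\<lambda>x. \<phi> x + c * \<psi> x) = f \<phi> + c * f \<psi>" if "\<phi> \<in> T" "\<psi> \<in> T" for \<phi> \<psi> c
    using assms that test_functions_cmult[OF that(2), of c] by (auto simp: W_neg1_def)
  moreover have "\<bar>f \<phi>\<bar> \<le> (\<bar>C\<bar> * (cP + 1)) * nrm2 N (grad \<phi>)" if "\<phi> \<in> T" for \<phi>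
  proof -
    have "\<bar>f \<phi>\<bar> \<le> C * W1_norm \<Omega> 2 \<phi> (grad \<phi>)" by (rule C[OF that])
    also have "\<dots> \<le> \<bar>C\<bar> * W1_norm \<Omega> 2 \<phi> (grad \<phi>)" by (intro mult_right_mono) (auto simp: W1_norm_2)
    also have "\<dots> \<le> \<bar>C\<bar> * ((cP + 1) * nrm2 N (grad \<phi>))"
      by (intro mult_left_mono W1_norm_T_le that) auto
    finally show ?thesis by (simp add: mult.assoc)
  qed
  ultimately have "H_functional f (\<bar>C\<bar> * (cP + 1))"
    unfolding H_functional_def dir.bounded_functional_def dir_n using cP_nonneg by auto
  then show ?thesis by (rule that)
qed

lemma H_functionalD:
  assumes "H_functional f C"
  shows "\<phi> \<in> T \<Longrightarrow> \<bar>f \<phi>\<bar> \<le> C * nrm2 N (grad \<phi>)" "C \<ge> 0"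
    "\<phi> \<in> T \<Longrightarrow> \<psi> \<in> T \<Longrightarrow> f (\<lambda>x. \<phi> x + c * \<psi> x) = f \<phi> + c * f \<psi>"
    "\<phi> \<in> T \<Longrightarrow> \<psi> \<in> T \<Longrightarrow> f (\<lambda>x. \<phi> x - \<psi> x) = f \<phi> - f \<psi>"
proof -
  show 1: "\<phi> \<in> T \<Longrightarrow> \<bar>f \<phi>\<bar> \<le> C * nrm2 N (grad \<phi>)" "C \<ge> 0"
    using assms by (auto simp: H_functional_def dir.bounded_functional_def dir_n)
  show 2: "\<phi> \<in> T \<Longrightarrow> \<psi> \<in> T \<Longrightarrow> f (\<lambda>x. \<phi> x + c * \<psi> x) = f \<phi> + c * f \<psi>" for c
    using assms by (auto simp: H_functional_def dir.bounded_functional_def)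
  show "\<phi> \<in> T \<Longrightarrow> \<psi> \<in> T \<Longrightarrow> f (\<lambda>x. \<phi> x - \<psi> x) = f \<phi> - f \<psi>"
    using 2[of "-1"] by simp
qed

end

lemma nrm2_inner_tendsto:
  assumes "\<And>k. sqint M (f k)" "sqint M g" "sqint M h" "(\<lambda>k. nrm2 M (\<lambda>x. f k x - g x)) \<longlonglongrightarrow> 0"
  shows "(\<lambda>k. LINT x|M. f k x \<bullet> h x) \<longlonglongrightarrow> (LINT x|M. g x \<bullet> h x)"
proof (rule LIM_zero_cancel, rule tendsto_rabs_zero_cancel)
  have le: "\<bar>(LINT x|M. f k x \<bullet> h x) - (LINT x|M. g x \<bullet> h x)\<bar> \<le> nrm2 M (\<lambda>x. f k x - g x) * nrm2 M h" for k
    using nrm2_inner[OF sqint_diff(1)[OF assms(1,2)] assms(3), of k] sqint_inner[OF assms(1,3), of k] sqint_inner[OF assms(2,3)]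
    by (simp add: inner_diff_left)
  have lim: "(\<lambda>k. nrm2 M (\<lambda>x. f k x - g x) * nrm2 M h) \<longlonglongrightarrow> 0"
    using tendsto_mult_right[OF assms(4), of "nrm2 M h"] by simp
  show "(\<lambda>k. \<bar>(LINT x|M. f k x \<bullet> h x) - (LINT x|M. g x \<bullet> h x)\<bar>) \<longlonglongrightarrow> 0"
    by (rule tendsto_sandwich[OF _ _ tendsto_const lim]) (use le in auto)
qed

lemma nrm2_tendsto:
  assumes "\<And>k. sqint M (f k)" "sqint M g" "(\<lambda>k. nrm2 M (\<lambda>x. f k x - g x)) \<longlonglongrightarrow> 0"
  shows "(\<lambda>k. nrm2 M (f k)) \<longlonglongrightarrow> nrm2 M g"
proof (rule LIM_zero_cancel, rule tendsto_rabs_zero_cancel)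
  have le: "\<bar>nrm2 M (f k) - nrm2 M g\<bar> \<le> nrm2 M (\<lambda>x. f k x - g x)" for k
    using nrm2_le_add[OF assms(1)[of k] assms(2)] nrm2_le_add[OF assms(2) assms(1)[of k]] nrm2_commute[of M "f k" g] by simp
  show "(\<lambda>k. \<bar>nrm2 M (f k) - nrm2 M g\<bar>) \<longlonglongrightarrow> 0"
    by (rule tendsto_sandwich[OF _ _ tendsto_const assms(3)]) (use le in auto)
qed

lemma sqint_nth:
  fixes g :: "'a \<Rightarrow> real^2"
  assumes "sqint M g"
  shows "sqint M (\<lambda>x. g x $ i)" "nrm2 M (\<lambda>x. g x $ i) \<le> nrm2 M g"
proof -
  have "(\<lambda>x::real^2. x $ i) \<in> borel_measurable borel"
    by (intro borel_measurable_continuous_onI continuous_intros)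
  from measurable_compose[OF _ this] have m: "(\<lambda>x. g x $ i) \<in> borel_measurable M"
    using assms by (auto simp: sqint_def)
  have "AE x in M. norm (g x $ i) \<le> norm (g x)" by (simp add: component_le_norm_cart)
  from sqint_bound[OF assms m this] show "sqint M (\<lambda>x. g x $ i)" "nrm2 M (\<lambda>x. g x $ i) \<le> nrm2 M g" .
qed

section \<open>Weak solutions as limits of test functions\<close>

context bdd_domain
begin

text \<open>An element of H^1_0 together with its gradient and a chosen approximating sequence.
  Keeping the sequence as an argument lets smooth arguments be run on it before the limit is taken;
  by \<open>W1_0_iff\<close> nothing else is encoded.\<close>

definition approx :: "(real^2 \<Rightarrow> real) \<Rightarrow> (real^2 \<Rightarrow> real^2) \<Rightarrow> (nat \<Rightarrow> real^2 \<Rightarrow> real) \<Rightarrow> bool" where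
  "approx u g \<phi> \<longleftrightarrow> (\<forall>k. \<phi> k \<in> T) \<and> sqint N u \<and> sqint N g \<and>
    (\<lambda>k. nrm2 N (\<lambda>x. \<phi> k x - u x)) \<longlonglongrightarrow> 0 \<and> (\<lambda>k. nrm2 N (\<lambda>x. grad (\<phi> k) x - g x)) \<longlonglongrightarrow> 0"

lemma approxD:
  assumes "approx u g \<phi>"
  shows "\<phi> k \<in> T" "sqint N u" "sqint N g"
    "(\<lambda>k. nrm2 N (\<lambda>x. \<phi> k x - u x)) \<longlonglongrightarrow> 0" "(\<lambda>k. nrm2 N (\<lambda>x. grad (\<phi> k) x - g x)) \<longlonglongrightarrow> 0"
  using assms by (auto simp: approx_def)

lemma approx_weak_gradient:
  assumes "approx u g \<phi>"
  shows "weak_gradient \<Omega> u g"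
  unfolding weak_gradient_def
proof (intro ballI allI)
  fix \<psi> i assume \<psi>: "\<psi> \<in> T"
  note a = approxD[OF assms]
  have g\<psi>: "(\<lambda>x. grad \<psi> x $ i) \<in> T" using \<psi> by (rule test_functions_grad)
  have "(LINT x|N. \<phi> k x * grad \<psi> x $ i) = - (LINT x|N. grad (\<phi> k) x $ i * \<psi> x)" for k
  proof -
    have m: "\<phi> k \<in> borel_measurable borel" "(\<lambda>x. grad (\<phi> k) x $ i) \<in> borel_measurable borel"
       "\<psi> \<in> borel_measurable borel" "(\<lambda>x. grad \<psi> x $ i) \<in> borel_measurable borel"
      using T_measurable(1) a(1) \<psi> g\<psi> test_functions_grad[OF a(1)] by auto
    have "(LINT x|N. \<phi> k x * grad \<psi> x $ i) = (LINT x|lborel. \<phi> k x * grad \<psi> x $ i)"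
      using m T_outside[OF a(1)] by (intro integral_N(1)) auto
    also have "\<dots> = - (LINT x|lborel. grad (\<phi> k) x $ i * \<psi> x)"
      by (intro by_parts_cs test_functions_cs[OF a(1)] test_functions_cs[OF \<psi>])
    also have "(LINT x|lborel. grad (\<phi> k) x $ i * \<psi> x) = (LINT x|N. grad (\<phi> k) x $ i * \<psi> x)"
      using m T_outside[OF a(1)] by (intro integral_N(1)[symmetric]) auto
    finally show ?thesis .
  qed
  moreover have "(\<lambda>k. LINT x|N. \<phi> k x * grad \<psi> x $ i) \<longlonglongrightarrow> (LINT x|N. u x * grad \<psi> x $ i)"
    using nrm2_inner_tendsto[OF _ a(2) _ a(4), of "\<lambda>x. grad \<psi> x $ i"] T_sqint(1)[OF a(1)] T_sqint(1)[OF g\<psi>] by simp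
  moreover have "(\<lambda>k. - (LINT x|N. grad (\<phi> k) x $ i * \<psi> x)) \<longlonglongrightarrow> - (LINT x|N. g x $ i * \<psi> x)"
  proof -
    have le: "nrm2 N (\<lambda>x. grad (\<phi> k) x $ i - g x $ i) \<le> nrm2 N (\<lambda>x. grad (\<phi> k) x - g x)" for k
      using sqint_nth(2)[OF sqint_diff(1)[OF T_sqint(2)[OF a(1)] a(3)], of k i] by simp
    have "(\<lambda>k. nrm2 N (\<lambda>x. grad (\<phi> k) x $ i - g x $ i)) \<longlonglongrightarrow> 0"
      by (rule tendsto_sandwich[OF _ _ tendsto_const a(5)]) (use le in auto)
    from nrm2_inner_tendsto[OF _ sqint_nth(1)[OF a(3)] _ this, of \<psi>] T_sqint(1)[OF \<psi>] sqint_nth(1)[OF T_sqint(2)[OF a(1)]]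
    show ?thesis by (intro tendsto_minus) simp
  qed
  ultimately show "(LINT x|N. u x * grad \<psi> x $ i) = - (LINT x|N. g x $ i * \<psi> x)"
    using LIMSEQ_unique by simp
qed

lemma W1_0_iff: "W1_0 \<Omega> 2 u g \<longleftrightarrow> (\<exists>\<phi>. approx u g \<phi>)"
proof
  assume "W1_0 \<Omega> 2 u g"
  then show "\<exists>\<phi>. approx u g \<phi>"
    unfolding W1_0_def Lp_2_iff W1_norm_2_tendsto_0_iff approx_def by blast
next
  assume "\<exists>\<phi>. approx u g \<phi>"
  then obtain \<phi> where \<phi>: "approx u g \<phi>" ..
  show "W1_0 \<Omega> 2 u g"
    unfolding W1_0_def Lp_2_iff W1_norm_2_tendsto_0_iff
    using approx_weak_gradient[OF \<phi>] \<phi>[unfolded approx_def] by blast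
qed

definition sol :: "(real^2 \<Rightarrow> real^2^2) \<Rightarrow> ((real^2 \<Rightarrow> real) \<Rightarrow> real) \<Rightarrow> (real^2 \<Rightarrow> real) \<Rightarrow> (real^2 \<Rightarrow> real^2) \<Rightarrow> (nat \<Rightarrow> real^2 \<Rightarrow> real) \<Rightarrow> bool" where
  "sol \<sigma> f u g \<phi> \<longleftrightarrow> approx u g \<phi> \<and> (\<forall>\<psi>\<in>T. form \<sigma> g (grad \<psi>) = f \<psi>)"

lemma dirichlet_solution_iff: "dirichlet_solution \<Omega> \<sigma> f u \<longleftrightarrow> (\<exists>g \<phi>. sol \<sigma> f u g \<phi>)"
  unfolding dirichlet_solution_def W1_0_iff sol_def form_def by blast

lemma form_tendsto_right:
  assumes "elliptic \<sigma> \<alpha> \<Lambda>" "sqint N g" "approx u g' \<phi>"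
  shows "(\<lambda>k. form \<sigma> g (grad (\<phi> k))) \<longlonglongrightarrow> form \<sigma> g g'"
  using nrm2_inner_tendsto[OF T_sqint(2) approxD(3)[OF assms(3)] sqint_mv(1)[OF assms(1,2)] approxD(5)[OF assms(3)]] approxD(1)[OF assms(3)]
  unfolding form_def by (simp add: inner_commute)

lemma approx_grad_zero:
  assumes "approx u g \<phi>" "nrm2 N g = 0"
  shows "AE x in N. u x = 0"
proof -
  note a = approxD[OF assms(1)]
  have "(\<lambda>k. nrm2 N (grad (\<phi> k))) \<longlonglongrightarrow> 0"
    using nrm2_tendsto[OF T_sqint(2)[OF a(1)] a(3,5)] assms(2) by simp
  then have lim: "(\<lambda>k. cP * nrm2 N (grad (\<phi> k))) \<longlonglongrightarrow> 0"
    using tendsto_mult_left[of _ 0 _ cP] by simp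
  have "(\<lambda>k. nrm2 N (\<phi> k)) \<longlonglongrightarrow> 0"
    by (rule tendsto_sandwich[OF _ _ tendsto_const lim]) (use poincare a(1) in auto)
  moreover have "(\<lambda>k. nrm2 N (\<phi> k)) \<longlonglongrightarrow> nrm2 N u"
    by (rule nrm2_tendsto[OF T_sqint(1)[OF a(1)] a(2,4)])
  ultimately have "nrm2 N u = 0" using LIMSEQ_unique by blast
  then show ?thesis by (rule nrm2_eq_0[OF a(2)])
qed

lemma approx_diff:
  assumes "approx u g \<phi>" "approx u' g' \<phi>'"
  shows "approx (\<lambda>x. u x - u' x) (\<lambda>x. g x - g' x) (\<lambda>k x. \<phi> k x - \<phi>' k x)"
proof -
  note a = approxD[OF assms(1)] and b = approxD[OF assms(2)]
  have 1: "(\<lambda>k. nrm2 N (\<lambda>x. \<phi> k x - u x) + nrm2 N (\<lambda>x. \<phi>' k x - u' x)) \<longlonglongrightarrow> 0"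
    using tendsto_add[OF a(4) b(4)] by simp
  have 2: "(\<lambda>k. nrm2 N (\<lambda>x. grad (\<phi> k) x - g x) + nrm2 N (\<lambda>x. grad (\<phi>' k) x - g' x)) \<longlonglongrightarrow> 0"
    using tendsto_add[OF a(5) b(5)] by simp
  have b1: "nrm2 N (\<lambda>x. (\<phi> k x - \<phi>' k x) - (u x - u' x)) \<le> nrm2 N (\<lambda>x. \<phi> k x - u x) + nrm2 N (\<lambda>x. \<phi>' k x - u' x)" for k
    using nrm2_diff[OF sqint_diff(1)[OF T_sqint(1)[OF a(1)] a(2)] sqint_diff(1)[OF T_sqint(1)[OF b(1)] b(2)], of k k]
    by (simp add: algebra_simps)
  have b2: "nrm2 N (\<lambda>x. (grad (\<phi> k) x - grad (\<phi>' k) x) - (g x - g' x)) \<le> nrm2 N (\<lambda>x. grad (\<phi> k) x - g x) + nrm2 N (\<lambda>x. grad (\<phi>' k) x - g' x)" for k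
    using nrm2_diff[OF sqint_diff(1)[OF T_sqint(2)[OF a(1)] a(3)] sqint_diff(1)[OF T_sqint(2)[OF b(1)] b(3)], of k k]
    by (simp add: algebra_simps)
  have "(\<lambda>k. nrm2 N (\<lambda>x. (\<phi> k x - \<phi>' k x) - (u x - u' x))) \<longlonglongrightarrow> 0"
    by (rule tendsto_sandwich[OF _ _ tendsto_const 1]) (use b1 in auto)
  moreover have "(\<lambda>k. nrm2 N (\<lambda>x. (grad (\<phi> k) x - grad (\<phi>' k) x) - (g x - g' x))) \<longlonglongrightarrow> 0"
    by (rule tendsto_sandwich[OF _ _ tendsto_const 2]) (use b2 in auto)
  ultimately show ?thesis
    unfolding approx_def using a b by (simp add: grad_T_diff test_functions_diff sqint_diff)
qed

lemma sol_unique: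
  assumes e: "elliptic \<sigma> \<alpha> \<Lambda>" and s: "sol \<sigma> f u g \<phi>" "sol \<sigma> f u' g' \<phi>'"
  shows "AE x in N. u x = u' x"
proof -
  have a: "approx u g \<phi>" "approx u' g' \<phi>'" using s by (auto simp: sol_def)
  define w where "w = (\<lambda>x. g x - g' x)"
  define \<eta> where "\<eta> = (\<lambda>k x. \<phi> k x - \<phi>' k x)"
  have ap: "approx (\<lambda>x. u x - u' x) w \<eta>" unfolding w_def \<eta>_def by (rule approx_diff[OF a])
  have sw: "sqint N w" by (rule approxD(3)[OF ap])
  have "form \<sigma> w (grad (\<eta> k)) = 0" for k
  proof -
    have \<eta>T: "\<eta> k \<in> T" by (rule approxD(1)[OF ap])
    show ?thesis unfolding w_def
      using form_diff_left[OF e approxD(3)[OF a(1)] approxD(3)[OF a(2)] T_sqint(2)[OF \<eta>T]] s \<eta>T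
      by (simp add: sol_def)
  qed
  then have "form \<sigma> w w = 0"
    using form_tendsto_right[OF e sw ap] by (simp add: LIMSEQ_const_iff)
  then have "nrm2 N w = 0"
    using form_coercive[OF e sw] e by (auto simp: elliptic_def mult_le_0_iff)
  from approx_grad_zero[OF ap this] show ?thesis by eventually_elim simp
qed

lemma sol_grad_bound:
  assumes e: "elliptic \<sigma> \<alpha> \<Lambda>" and s: "sol \<sigma> f u g \<phi>" and f: "H_functional f C"
  shows "\<alpha> * nrm2 N g \<le> C"
proof -
  have ap: "approx u g \<phi>" using s by (simp add: sol_def)
  note a = approxD[OF ap]
  have "form \<sigma> g g \<le> C * nrm2 N g"
  proof (rule LIMSEQ_le[OF form_tendsto_right[OF e a(3) ap]])
    show "(\<lambda>k. C * nrm2 N (grad (\<phi> k))) \<longlonglongrightarrow> C * nrm2 N g"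
      by (intro tendsto_intros nrm2_tendsto[OF T_sqint(2)[OF a(1)] a(3,5)])
    show "\<exists>n. \<forall>k\<ge>n. form \<sigma> g (grad (\<phi> k)) \<le> C * nrm2 N (grad (\<phi> k))"
      using s a(1) H_functionalD(1)[OF f a(1)] by (auto simp: sol_def dest: abs_le_D1)
  qed
  with form_coercive[OF e a(3)] have "(\<alpha> * nrm2 N g) * nrm2 N g \<le> C * nrm2 N g"
    by (simp add: power2_eq_square)
  then show ?thesis
    using H_functionalD(2)[OF f] nrm2_nonneg[of N g] by (cases "nrm2 N g = 0") auto
qed

text \<open>Test functions with residuals at most \<alpha> 2^(-k) in the dual norm form, by
  coercivity, a sequence of gradients with geometrically decreasing increments; Poincare gives the
  same for the functions. Their limits in L2 solve the equation because the form is continuous in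
  the gradient.\<close>

lemma sol_exists:
  assumes e: "elliptic \<sigma> \<alpha> \<Lambda>" and f: "H_functional f C"
  obtains u g \<phi> where "sol \<sigma> f u g \<phi>"
proof -
  have \<alpha>: "\<alpha> > 0" "\<alpha> \<le> \<Lambda>" using e by (auto simp: elliptic_def)
  let ?B = "\<lambda>\<phi> \<psi>. form \<sigma> (grad \<phi>) (grad \<psi>)"
  have ex: "\<exists>w\<in>T. \<forall>\<eta>\<in>T. \<bar>f \<eta> - ?B w \<eta>\<bar> \<le> e' * nrm2 N (grad \<eta>)" if e': "e' > 0" for e'
  proof (rule dir.approx_lax_milgram[of f C ?B \<Lambda> \<alpha> e'])
    show "dir.bounded_functional f C" using f by (simp add: H_functional_def)
  next
    fix \<phi> \<psi> \<eta> c assume t: "\<phi> \<in> T" "\<psi> \<in> T" "\<eta> \<in> T"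
    show "?B (\<lambda>x. \<phi> x + c * \<psi> x) \<eta> = ?B \<phi> \<eta> + c * ?B \<psi> \<eta>"
      unfolding grad_T_comb[OF t(1,2)] by (rule form_add_left[OF e]) (use t T_sqint in auto)
    show "?B \<eta> (\<lambda>x. \<phi> x + c * \<psi> x) = ?B \<eta> \<phi> + c * ?B \<eta> \<psi>"
      unfolding grad_T_comb[OF t(1,2)] by (rule form_add_right[OF e]) (use t T_sqint in auto)
  next
    fix \<phi> \<psi> assume t: "\<phi> \<in> T" "\<psi> \<in> T"
    show "\<bar>?B \<phi> \<psi>\<bar> \<le> \<Lambda> * dir.n \<phi> * dir.n \<psi>"
      unfolding dir_n by (rule form_bound[OF e]) (use t T_sqint in auto)
  next
    fix \<phi> assume t: "\<phi> \<in> T"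
    show "\<alpha> * (dir.n \<phi>)\<^sup>2 \<le> ?B \<phi> \<phi>"
      unfolding dir_n by (rule form_coercive[OF e]) (use t T_sqint in auto)
  qed (use \<alpha> e' in \<open>auto simp: dir_n\<close>)
  have "\<exists>\<phi>. \<forall>k. \<phi> k \<in> T \<and> (\<forall>\<eta>\<in>T. \<bar>f \<eta> - ?B (\<phi> k) \<eta>\<bar> \<le> (\<alpha> * (1/2)^k) * nrm2 N (grad \<eta>))"
  proof (rule choice, rule allI)
    fix k :: nat
    have "\<alpha> * (1/2)^k > 0" using \<alpha> by simp
    from ex[OF this] show "\<exists>w. w \<in> T \<and> (\<forall>\<eta>\<in>T. \<bar>f \<eta> - ?B w \<eta>\<bar> \<le> (\<alpha> * (1/2)^k) * nrm2 N (grad \<eta>))"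
      by blast
  qed
  then obtain \<phi> where \<phi>: "\<And>k. \<phi> k \<in> T" "\<And>k \<eta>. \<eta> \<in> T \<Longrightarrow> \<bar>f \<eta> - ?B (\<phi> k) \<eta>\<bar> \<le> (\<alpha> * (1/2)^k) * nrm2 N (grad \<eta>)"
    by blast
  note sq = T_sqint(2)[OF \<phi>(1)] T_sqint(1)[OF \<phi>(1)]
  have fast: "nrm2 N (\<lambda>x. grad (\<phi> (Suc k)) x - grad (\<phi> k) x) \<le> 2 * (1/2)^k" for k
  proof -
    define d where "d = (\<lambda>x. \<phi> (Suc k) x - \<phi> k x)"
    have d: "d \<in> T" unfolding d_def by (intro test_functions_diff \<phi>)
    have gd: "grad d = (\<lambda>x. grad (\<phi> (Suc k)) x - grad (\<phi> k) x)" unfolding d_def by (rule grad_T_diff[OF \<phi>(1) \<phi>(1)])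
    have "\<alpha> * (nrm2 N (grad d))\<^sup>2 \<le> form \<sigma> (grad d) (grad d)"
      by (rule form_coercive[OF e T_sqint(2)[OF d]])
    also have "\<dots> = ?B (\<phi> (Suc k)) d - ?B (\<phi> k) d"
      by (subst (1) gd) (rule form_diff_left[OF e sq(1) sq(1) T_sqint(2)[OF d]])
    also have "\<dots> \<le> (\<alpha> * (1/2)^k) * nrm2 N (grad d) + (\<alpha> * (1/2)^Suc k) * nrm2 N (grad d)"
      using \<phi>(2)[OF d, of k] \<phi>(2)[OF d, of "Suc k"] by linarith
    also have "\<dots> \<le> \<alpha> * ((2 * (1/2)^k) * nrm2 N (grad d))"
      using \<alpha> by (simp add: algebra_simps)
    finally have "nrm2 N (grad d) * nrm2 N (grad d) \<le> (2 * (1/2)^k) * nrm2 N (grad d)"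
      using \<alpha> by (simp add: power2_eq_square)
    then have "nrm2 N (grad d) \<le> 2 * (1/2)^k"
      using nrm2_nonneg[of N "grad d"] by (cases "nrm2 N (grad d) = 0") auto
    then show ?thesis unfolding gd .
  qed
  have fast0: "nrm2 N (\<lambda>x. \<phi> (Suc k) x - \<phi> k x) \<le> (cP * 2) * (1/2)^k" for k
  proof -
    have "nrm2 N (\<lambda>x. \<phi> (Suc k) x - \<phi> k x) \<le> cP * nrm2 N (grad (\<lambda>x. \<phi> (Suc k) x - \<phi> k x))"
      by (intro poincare test_functions_diff \<phi>)
    also have "\<dots> \<le> cP * (2 * (1/2)^k)"
      unfolding grad_T_diff[OF \<phi>(1) \<phi>(1)] by (intro mult_left_mono fast cP_nonneg)
    finally show ?thesis by simp
  qed
  obtain g where g: "sqint N g" "(\<lambda>k. nrm2 N (\<lambda>x. grad (\<phi> k) x - g x)) \<longlonglongrightarrow> 0"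
    using L2_complete_fast[OF finite_N sq(1) fast] by blast
  obtain u where u: "sqint N u" "(\<lambda>k. nrm2 N (\<lambda>x. \<phi> k x - u x)) \<longlonglongrightarrow> 0"
    using L2_complete_fast[OF finite_N sq(2) fast0] by blast
  have ap: "approx u g \<phi>" unfolding approx_def using \<phi> u g by blast
  have "form \<sigma> g (grad \<psi>) = f \<psi>" if \<psi>: "\<psi> \<in> T" for \<psi>
  proof -
    have bnd: "\<bar>form \<sigma> g (grad \<psi>) - f \<psi>\<bar> \<le> \<Lambda> * nrm2 N (\<lambda>x. grad (\<phi> k) x - g x) * nrm2 N (grad \<psi>) + (\<alpha> * (1/2)^k) * nrm2 N (grad \<psi>)" for k
      using form_bound[OF e sqint_diff(1)[OF sq(1) g(1)] T_sqint(2)[OF \<psi>], of k]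
        form_diff_left[OF e sq(1) g(1) T_sqint(2)[OF \<psi>], of k] \<phi>(2)[OF \<psi>, of k] by linarith
    have "(\<lambda>k. \<Lambda> * nrm2 N (\<lambda>x. grad (\<phi> k) x - g x) * nrm2 N (grad \<psi>) + (\<alpha> * (1/2)^k) * nrm2 N (grad \<psi>)) \<longlonglongrightarrow>
       \<Lambda> * 0 * nrm2 N (grad \<psi>) + (\<alpha> * 0) * nrm2 N (grad \<psi>)"
      by (intro tendsto_intros g(2) LIMSEQ_power_zero) simp
    then have "\<bar>form \<sigma> g (grad \<psi>) - f \<psi>\<bar> \<le> \<Lambda> * 0 * nrm2 N (grad \<psi>) + (\<alpha> * 0) * nrm2 N (grad \<psi>)"
      by (rule LIMSEQ_le_const) (use bnd in auto)
    then show ?thesis by simp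
  qed
  with ap have "sol \<sigma> f u g \<phi>" by (simp add: sol_def)
  then show ?thesis by (rule that)
qed

lemma the_dirichlet_solutionI:
  assumes "elliptic \<sigma> \<alpha> \<Lambda>" "sol \<sigma> f u g \<phi>"
  shows "the_dirichlet_solution \<Omega> \<sigma> f u"
  unfolding the_dirichlet_solution_def dirichlet_solution_iff
  using sol_unique[OF assms(1) _ assms(2)] assms(2) by blast

text \<open>Permits the choice of representatives by which convergence in the essential supremum
  norm becomes uniform convergence at every point.\<close>

lemma sol_cong_AE:
  assumes "sol \<sigma> f u g \<phi>" "u' \<in> borel_measurable N" "AE x in N. u' x = u x"
  shows "sol \<sigma> f u' g \<phi>"
proof -
  have a: "approx u g \<phi>" using assms by (simp add: sol_def)
  note a' = approxD[OF a]
  have u: "sqint N u'"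
    by (rule sqint_bound(1)[OF a'(2) assms(2)]) (use assms(3) in eventually_elim, simp)
  have m: "u \<in> borel_measurable N" "\<And>k. \<phi> k \<in> borel_measurable N"
    using a'(2) T_sqint(1)[OF a'(1)] by (auto simp: sqint_def)
  have "nrm2 N (\<lambda>x. \<phi> k x - u' x) = nrm2 N (\<lambda>x. \<phi> k x - u x)" for k
  proof (rule nrm2_cong_AE)
    show "AE x in N. \<phi> k x - u' x = \<phi> k x - u x" using assms(3) by eventually_elim simp
  qed (intro borel_measurable_diff m assms(2))+
  then have "approx u' g \<phi>" using a u by (simp add: approx_def)
  with assms(1) show ?thesis by (simp add: sol_def)
qed

end

section \<open>Stampacchia's truncation method\<close>

text \<open>Hoelder's inequality up to the factor 2, obtained by splitting at the root mean square l
  of F over A: above l the power p is dominated by l^(p - 2) times the square, below l by l^p. The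
  cases where l is 0 or has denominator 0 are treated first.\<close>

lemma nrm2_powr_bound:
  fixes F :: "'a \<Rightarrow> 'b::euclidean_space"
  assumes fin: "finite_measure M" and F: "sqint M F" and A: "A \<in> sets M" "\<And>x. x \<notin> A \<Longrightarrow> F x = 0"
    and p: "1 < p" "p < 2"
  shows "(LINT x|M. norm (F x) powr p) \<le> 2 * (nrm2 M F powr p * measure M A powr (1 - p / 2))"
proof -
  interpret finite_measure M by fact
  let ?m = "measure M A" and ?n = "nrm2 M F"
  have [measurable]: "F \<in> borel_measurable M" using F by (simp add: sqint_def)
  have "AE x in M. F x = 0" if "?m = 0 \<or> ?n = 0"
  proof (cases "?n = 0")
    case True
    then show ?thesis using nrm2_eq_0[OF F] by simp
  next
    case False
    then have "A \<in> null_sets M" using that A by (auto simp: null_sets_def emeasure_eq_measure)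
    then have "AE x in M. x \<notin> A" by (rule AE_not_in)
    then show ?thesis by eventually_elim (use A in auto)
  qed
  then have z: "(LINT x|M. norm (F x) powr p) = 0" if "?m = 0 \<or> ?n = 0"
  proof -
    have "(LINT x|M. norm (F x) powr p) = (LINT x|M. 0)"
      by (rule integral_cong_AE) (use that \<open>?m = 0 \<or> ?n = 0 \<Longrightarrow> AE x in M. F x = 0\<close> in \<open>auto elim: eventually_mono\<close>)
    then show ?thesis by simp
  qed
  show ?thesis
  proof (cases "?m = 0 \<or> ?n = 0")
    case True
    then show ?thesis using z by simp
  next
    case False
    then have m: "?m > 0" and n: "?n > 0" using nrm2_nonneg[of M F] measure_nonneg[of M A] by (auto simp: less_le)
    define l where "l = ?n / sqrt ?m"
    have l: "l > 0" using m n by (simp add: l_def)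
    have pw: "norm (F x) powr p \<le> l powr (p - 2) * (norm (F x))\<^sup>2 + l powr p * indicator A x" for x
    proof (cases "x \<in> A")
      case False
      then show ?thesis using A(2) by simp
    next
      case True
      show ?thesis
      proof (cases "norm (F x) \<ge> l")
        case True
        then have f: "norm (F x) > 0" using l by linarith
        have "norm (F x) powr p = norm (F x) powr (p - 2) * norm (F x) powr 2"
          using powr_add[of "norm (F x)" "p - 2" 2] by simp
        also have "\<dots> \<le> l powr (p - 2) * norm (F x) powr 2"
          using True l p by (intro mult_right_mono powr_mono2') auto
        also have "\<dots> \<le> l powr (p - 2) * (norm (F x))\<^sup>2 + l powr p * indicator A x"
          by simp
        finally show ?thesis .
      next
        case False
        then have "norm (F x) powr p \<le> l powr p * indicator A x"
          using p \<open>x \<in> A\<close> by (auto intro!: powr_mono2)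
        moreover have "0 \<le> l powr (p - 2) * (norm (F x))\<^sup>2" by simp
        ultimately show ?thesis by linarith
      qed
    qed
    have i: "integrable M (\<lambda>x. l powr (p - 2) * (norm (F x))\<^sup>2 + l powr p * indicator A x)"
      using F A by (auto simp: sqint_def less_top[symmetric])
    have "(LINT x|M. norm (F x) powr p) \<le> (LINT x|M. l powr (p - 2) * (norm (F x))\<^sup>2 + l powr p * indicator A x)"
    proof (rule Bochner_Integration.integral_mono[OF _ i pw])
      show "integrable M (\<lambda>x. norm (F x) powr p)"
        by (rule Bochner_Integration.integrable_bound[OF i]) (use pw in \<open>auto intro!: AE_I2 order_trans[OF _ abs_ge_self]\<close>)
    qed
    also have "\<dots> = l powr (p - 2) * ?n\<^sup>2 + l powr p * ?m"
      using F A sets.sets_into_space[OF A(1)]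
      by (subst Bochner_Integration.integral_add) (auto simp: sqint_def nrm2_power2 less_top[symmetric] Int_absorb2)
    also have "?n\<^sup>2 = l\<^sup>2 * ?m" using m by (simp add: l_def power_divide)
    also have "l powr (p - 2) * (l\<^sup>2 * ?m) = l powr p * ?m"
    proof -
      have "l powr (p - 2) * l powr 2 = l powr p" using powr_add[of l "p - 2" 2] by simp
      then show ?thesis using l by (simp add: mult.assoc[symmetric])
    qed
    also have "l powr p * ?m = ?n powr p * ?m powr (1 - p / 2)"
    proof -
      have "l powr p = ?n powr p / ?m powr (p / 2)"
        using m n by (simp add: l_def powr_divide powr_half_sqrt[symmetric] powr_powr)
      then show ?thesis using m by (simp add: powr_diff)
    qed
    finally show ?thesis by simp
  qed
qed

context bdd_domain
begin

text \<open>What Stampacchia's method uses of f: in comparison with the Dirichlet norm it gains a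
  positive power of the measure of the support.\<close>

definition supp_bound :: "((real^2 \<Rightarrow> real) \<Rightarrow> real) \<Rightarrow> real \<Rightarrow> real \<Rightarrow> bool" where
  "supp_bound f C \<gamma> \<longleftrightarrow> C \<ge> 0 \<and> \<gamma> > 0 \<and>
    (\<forall>\<psi>\<in>T. \<forall>A\<in>sets N. (\<forall>x. x \<notin> A \<longrightarrow> \<psi> x = 0 \<and> grad \<psi> x = 0) \<longrightarrow>
       \<bar>f \<psi>\<bar> \<le> C * measure N A powr \<gamma> * nrm2 N (grad \<psi>))"

text \<open>The conjugate exponent p = q / (q - 1) is below 2, and Hoelder's inequality on the
  support passes from L^p to L^2 with the gain \<gamma> = 1 / p - 1 / 2 = 1 / 2 - 1 / q. It is
  positive because q > 2.\<close>

lemma W_neg1_supp_bound: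
  assumes f: "f \<in> W_neg1 \<Omega> q" and q: "q > 2"
  obtains C \<gamma> where "supp_bound f C \<gamma>"
proof -
  define p where "p = q / (q - 1)"
  have p: "1 < p" "p < 2" using q by (auto simp: p_def field_simps)
  obtain C where C: "\<And>\<phi>. \<phi> \<in> T \<Longrightarrow> \<bar>f \<phi>\<bar> \<le> C * W1_norm \<Omega> p \<phi> (grad \<phi>)"
  proof -
    have "\<exists>C. \<forall>\<phi>\<in>T. \<bar>f \<phi>\<bar> \<le> C * W1_norm \<Omega> p \<phi> (grad \<phi>)"
      using f by (simp add: W_neg1_def p_def)
    then show ?thesis using that by blast
  qed
  define \<gamma> where "\<gamma> = (1 - p / 2) / p"
  define D where "D = (2 * (cP powr p + 1)) powr (1 / p)"
  have "\<bar>f \<psi>\<bar> \<le> (\<bar>C\<bar> * D) * measure N A powr \<gamma> * nrm2 N (grad \<psi>)"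
    if \<psi>: "\<psi> \<in> T" and A: "A \<in> sets N" "\<And>x. x \<notin> A \<Longrightarrow> \<psi> x = 0 \<and> grad \<psi> x = 0" for \<psi> A
  proof -
    let ?m = "measure N A" and ?n = "nrm2 N (grad \<psi>)"
    have "nrm2 N \<psi> \<le> cP * ?n"
      by (rule poincare[OF \<psi>])
    then have "nrm2 N \<psi> powr p \<le> cP powr p * ?n powr p"
      using p cP_nonneg by (simp flip: powr_mult add: powr_mono2)
    then have "(LINT x|N. norm (\<psi> x) powr p) + (LINT x|N. norm (grad \<psi> x) powr p)
      \<le> 2 * ((cP powr p * ?n powr p) * ?m powr (1 - p / 2)) + 2 * (?n powr p * ?m powr (1 - p / 2))"
      using nrm2_powr_bound[OF finite_N T_sqint(1)[OF \<psi>] A(1) _ p] nrm2_powr_bound[OF finite_N T_sqint(2)[OF \<psi>] A(1) _ p] A(2)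
      by (intro add_mono) (force intro: order_trans mult_left_mono mult_right_mono)+
    also have "\<dots> = (2 * (cP powr p + 1)) * (?n powr p * ?m powr (1 - p / 2))"
      by (simp add: algebra_simps)
    finally have "W1_norm \<Omega> p \<psi> (grad \<psi>) \<le> ((2 * (cP powr p + 1)) * (?n powr p * ?m powr (1 - p / 2))) powr (1 / p)"
      unfolding W1_norm_def using p by (intro powr_mono2) (auto intro!: add_nonneg_nonneg)
    also have "\<dots> = D * (?n * ?m powr \<gamma>)"
      using p by (simp add: powr_mult D_def powr_powr \<gamma>_def)
    finally have w: "W1_norm \<Omega> p \<psi> (grad \<psi>) \<le> D * (?n * ?m powr \<gamma>)" .
    have "\<bar>f \<psi>\<bar> \<le> C * W1_norm \<Omega> p \<psi> (grad \<psi>)" by (rule C[OF \<psi>])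
    also have "\<dots> \<le> \<bar>C\<bar> * W1_norm \<Omega> p \<psi> (grad \<psi>)" by (intro mult_right_mono) (auto simp: W1_norm_def)
    also have "\<dots> \<le> \<bar>C\<bar> * (D * (?n * ?m powr \<gamma>))" by (intro mult_left_mono w) auto
    finally show ?thesis by (simp add: mult_ac)
  qed
  moreover have "\<gamma> > 0" "\<bar>C\<bar> * D \<ge> 0" using p by (auto simp: \<gamma>_def D_def)
  ultimately have "supp_bound f (\<bar>C\<bar> * D) \<gamma>" unfolding supp_bound_def by blast
  then show ?thesis by (rule that)
qed

end

lemma closed_square: "closed (square c r)"
proof -
  have "square c r = (\<Inter>i. {x. \<bar>x $ i - c $ i\<bar> \<le> r})" by (auto simp: square_def)
  also have "closed \<dots>" by (intro closed_INT ballI closed_Collect_le continuous_intros)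
  finally show ?thesis .
qed

lemma square_bounded: "bounded (square c r)"
proof -
  have "x \<in> cbox (\<chi> i. c $ i - r) (\<chi> i. c $ i + r)" if "x \<in> square c r" for x
    using that by (auto simp: mem_box_cart square_def abs_le_iff algebra_simps)
  then show ?thesis by (meson bounded_cbox bounded_subset subsetI)
qed

lemma compact_square: "compact (square c r)"
  using closed_square square_bounded by (simp add: compact_eq_bounded_closed)

lemma open_square_interior:
  fixes c :: "real^2"
  shows "open {x. \<forall>i. \<bar>x $ i - c $ i\<bar> < r}"
proof -
  have "{x. \<forall>i. \<bar>x $ i - c $ i\<bar> < r} = (\<Inter>i\<in>(UNIV::2 set). {x. \<bar>x $ i - c $ i\<bar> < r})" by auto
  also have "open \<dots>" by (intro open_INT ballI finite open_Collect_less continuous_intros)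
  finally show ?thesis .
qed

context bdd_domain
begin

text \<open>The test function of Stampacchia's method: a smooth substitute for the truncation of
  \<^term>\<open>\<phi> - k\<close> at \<^term>\<open>h - k\<close> on a square on whose boundary \<^term>\<open>\<phi>\<close> stays below \<^term>\<open>k\<close>.\<close>

lemma truncation:
  assumes \<phi>: "\<phi> \<in> T" and M: "\<And>x. x \<in> square_bd c s \<Longrightarrow> \<phi> x \<le> M"
    and ins: "square c s \<subseteq> \<Omega> \<or> M \<ge> 0" and kh: "M < k" "k < h"
  defines "\<psi> \<equiv> \<lambda>x. if x \<in> square c s then (h - k) * exp_inv 0 ((1 / (h - k)) * \<phi> x + (- k / (h - k))) else 0"
    and "D \<equiv> \<lambda>x. if x \<in> square c s then exp_inv 2 ((1 / (h - k)) * \<phi> x + (- k / (h - k))) else 0"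
  shows "\<psi> \<in> T" "\<And>x. grad \<psi> x = D x *\<^sub>R grad \<phi> x"
proof -
  have sm: "smooth \<phi>" by (rule T_smooth[OF \<phi>])
  define G where "G t = (h - k) * exp_inv 0 ((1 / (h - k)) * t + (- k / (h - k)))" for t
  have G: "Dk j G" for j
    unfolding G_def[abs_def] by (intro Dk_mult Dk_const Dk_affine Dk_exp_inv)
  have G': "(G has_real_derivative exp_inv 2 ((1 / (h - k)) * t + (- k / (h - k)))) (at t)" for t
  proof -
    have "((\<lambda>t. (1 / (h - k)) * t + (- k / (h - k))) has_real_derivative 1 / (h - k)) (at t)"
      using kh by (auto intro!: derivative_eq_intros)
    from DERIV_cmult[OF DERIV_chain2[OF exp_inv_0_has_derivative this], of "h - k"]
    have "(G has_real_derivative (h - k) * (exp_inv 2 ((1 / (h - k)) * t + (- k / (h - k))) * (1 / (h - k)))) (at t)"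
      unfolding G_def[abs_def] .
    moreover have "(h - k) * (z * (1 / (h - k))) = z" for z
    proof -
      have "h - k \<noteq> 0" using kh by simp
      then show ?thesis by simp
    qed
    ultimately show ?thesis by (simp only:)
  qed
  have sG: "smooth (\<lambda>x. G (\<phi> x))" by (rule smooth_comp[OF G sm])
  have arg: "(1 / (h - k)) * \<phi> x + (- k / (h - k)) \<le> 0" if "\<phi> x \<le> k" for x
    using that kh divide_nonpos_pos[of "\<phi> x - k" "h - k"] by (simp add: diff_divide_distrib)
  have neg: "\<psi> x = 0" "D x = 0" if "\<phi> x \<le> k" for x
    using arg[OF that] by (auto simp: \<psi>_def D_def exp_inv_def)
  \<comment> \<open>Near a boundary point of the square \<open>\<phi>\<close> stays below k, where
    the profile vanishes. The case distinction in \<open>\<psi>\<close> is therefore invisible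
    there, and \<open>\<psi>\<close> is locally either \<open>G\<close> of \<open>\<phi>\<close> or
    0.\<close>
  have loc: "(\<exists>U. open U \<and> x \<in> U \<and> (\<forall>y\<in>U. \<psi> y = G (\<phi> y)) \<and> D x = exp_inv 2 ((1 / (h - k)) * \<phi> x + (- k / (h - k)))) \<or>
     (\<exists>U. open U \<and> x \<in> U \<and> (\<forall>y\<in>U. \<psi> y = 0) \<and> D x = 0)" for x
  proof -
    consider "x \<notin> square c s" | "\<forall>i. \<bar>x $ i - c $ i\<bar> < s" | "x \<in> square_bd c s"
      by (auto simp: square_def square_bd_def not_less order.antisym less_le)
    then show ?thesis
    proof cases
      case 1
      then show ?thesis
        by (intro disjI2 exI[of _ "- square c s"]) (auto simp: \<psi>_def D_def closed_square open_Compl)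
    next
      case 2
      then show ?thesis
        by (intro disjI1 exI[of _ "{x. \<forall>i. \<bar>x $ i - c $ i\<bar> < s}"])
           (auto simp: open_square_interior \<psi>_def D_def G_def square_def less_imp_le)
    next
      case 3
      have "\<phi> x < k" using M[OF 3] kh by simp
      moreover have "open {x. \<phi> x < k}"
        by (intro open_Collect_less smooth_continuous sm continuous_intros)
      ultimately show ?thesis
        by (intro disjI2 exI[of _ "{x. \<phi> x < k}"]) (auto intro!: neg)
    qed
  qed
  show "grad \<psi> x = D x *\<^sub>R grad \<phi> x" for x
    using loc[of x]
  proof (elim disjE exE conjE)
    fix U assume U: "open U" "x \<in> U" "\<forall>y\<in>U. \<psi> y = G (\<phi> y)" and D: "D x = exp_inv 2 ((1 / (h - k)) * \<phi> x + (- k / (h - k)))"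
    have "grad \<psi> x = grad (\<lambda>y. G (\<phi> y)) x" using grad_local(2)[OF U(1,2), of \<psi> "\<lambda>y. G (\<phi> y)"] U(3) by blast
    also have "\<dots> = D x *\<^sub>R grad \<phi> x" unfolding D by (rule grad_comp(2)[OF T_diff[OF \<phi>] G'])
    finally show ?thesis .
  next
    fix U assume U: "open U" "x \<in> U" "\<forall>y\<in>U. \<psi> y = 0" and D: "D x = 0"
    have "grad \<psi> x = grad (\<lambda>y. 0) x" using grad_local(2)[OF U(1,2), of \<psi> "\<lambda>y. 0"] U(3) by blast
    then show ?thesis by (simp add: D)
  qed
  have "smooth \<psi>"
  proof (rule smooth_local)
    fix x
    show "\<exists>U \<psi>'. open U \<and> x \<in> U \<and> smooth \<psi>' \<and> (\<forall>y\<in>U. \<psi> y = \<psi>' y)"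
      using loc[of x] sG smooth_const[of 0] by blast
  qed
  moreover define K where "K = square c s \<inter> {x. k \<le> \<phi> x}"
  have "compact K" unfolding K_def
    by (intro compact_Int_closed compact_square closed_Collect_le smooth_continuous sm continuous_intros)
  \<comment> \<open>If the square is not contained in \<Omega>, then M >= 0 forces k > 0, and points
    with \<open>k \<le> \<phi> x\<close> lie in \<Omega> because \<open>\<phi>\<close> vanishes
    outside.\<close>
  moreover have "K \<subseteq> \<Omega>"
    using ins kh T_outside(1)[OF \<phi>] by (auto simp: K_def) (metis leD less_le_trans order_le_less_trans)
  moreover have "\<psi> x = 0" if "x \<notin> K" for x
    using that neg(1)[of x] by (auto simp: K_def \<psi>_def)
  ultimately show "\<psi> \<in> T" unfolding test_functions_iff by blast
qed

definition level :: "(real^2 \<Rightarrow> real) \<Rightarrow> (real^2) set \<Rightarrow> real \<Rightarrow> (real^2) set" where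
  "level \<phi> Q k = {x \<in> \<Omega> \<inter> Q. k < \<phi> x}"

lemma level_sets:
  assumes "\<phi> \<in> T"
  shows "level \<phi> (square c s) k \<in> sets N"
proof -
  have "open {x. k < \<phi> x}"
    by (intro open_Collect_less smooth_continuous T_smooth assms continuous_intros)
  then have "{x. k < \<phi> x} \<in> sets borel" "square c s \<in> sets borel" "\<Omega> \<in> sets borel"
    using open_\<Omega> closed_square by auto
  then have "\<Omega> \<inter> (square c s \<inter> {x. k < \<phi> x}) \<in> sets borel" by blast
  then have "\<Omega> \<inter> (square c s \<inter> {x. k < \<phi> x}) \<in> sets lebesgue" by (simp add: sets_completionI_sets)
  moreover have "level \<phi> (square c s) k = \<Omega> \<inter> (square c s \<inter> {x. k < \<phi> x})"
    by (auto simp: level_def)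
  ultimately show ?thesis by (simp add: sets_restrict_space_iff)
qed

text \<open>The truncation lives on the level set at k, so testing with it bounds its gradient by (C
  (a k)^\<gamma> + \<epsilon>) / \<alpha>, and the Poincare inequality on that set adds the factor
  sqrt (a k). On the level set at h the truncation is at least (h - k) / exp 1, which is the origin
  of the constant exp 1.\<close>

lemma level_step:
  assumes e: "elliptic \<sigma> \<alpha> \<Lambda>" and f: "supp_bound f C \<gamma>" and \<phi>: "\<phi> \<in> T"
    and res: "\<And>\<psi>. \<psi> \<in> T \<Longrightarrow> \<bar>form \<sigma> (grad \<phi>) (grad \<psi>) - f \<psi>\<bar> \<le> \<epsilon> * nrm2 N (grad \<psi>)"
    and M: "\<And>x. x \<in> square_bd c s \<Longrightarrow> \<phi> x \<le> M" and ins: "square c s \<subseteq> \<Omega> \<or> M \<ge> 0"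
    and kh: "M < k" "k < h" and \<epsilon>: "\<epsilon> \<ge> 0"
  defines "a \<equiv> \<lambda>k. measure N (level \<phi> (square c s) k)"
  shows "(h - k)\<^sup>2 * a h \<le> (exp 1 / \<alpha>)\<^sup>2 * (a k * (C * a k powr \<gamma> + \<epsilon>)\<^sup>2)"
proof -
  interpret finite_measure N by (rule finite_N)
  have \<alpha>: "\<alpha> > 0" using e by (simp add: elliptic_def)
  define arg where "arg x = (1 / (h - k)) * \<phi> x + (- k / (h - k))" for x
  define \<psi> where "\<psi> = (\<lambda>x. if x \<in> square c s then (h - k) * exp_inv 0 (arg x) else 0)"
  define D where "D x = (if x \<in> square c s then exp_inv 2 (arg x) else 0)" for x
  have \<psi>: "\<psi> \<in> T" and g: "\<And>x. grad \<psi> x = D x *\<^sub>R grad \<phi> x"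
    using truncation[OF \<phi> M ins kh] unfolding \<psi>_def D_def arg_def by auto
  define A where "A = level \<phi> (square c s) k"
  have A: "A \<in> sets N" "level \<phi> (square c s) h \<in> sets N" unfolding A_def by (rule level_sets[OF \<phi>])+
  have D: "0 \<le> D x" "D x \<le> 1" for x using exp_inv_2_bounds by (auto simp: D_def)
  have out: "\<psi> x = 0 \<and> grad \<psi> x = 0" if "x \<notin> A" for x
  proof (cases "x \<in> \<Omega>")
    case True
    then have "x \<notin> square c s \<or> \<phi> x \<le> k" using that by (auto simp: A_def level_def)
    moreover have "arg x \<le> 0" if "\<phi> x \<le> k"
      using that kh divide_nonpos_pos[of "\<phi> x - k" "h - k"] by (simp add: arg_def diff_divide_distrib)
    ultimately show ?thesis unfolding g by (auto simp: \<psi>_def D_def exp_inv_def)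
  qed (use T_outside[OF \<psi>] in auto)
  let ?n = "nrm2 N (grad \<psi>)"
  have sq: "sqint N (grad \<psi>)" "sqint N (grad \<phi>)" by (auto intro: T_sqint \<psi> \<phi>)
  have "\<alpha> * ?n\<^sup>2 = (LINT x|N. \<alpha> * (norm (grad \<psi> x))\<^sup>2)" by (simp add: nrm2_power2)
  also have "\<dots> \<le> form \<sigma> (grad \<phi>) (grad \<psi>)"
    unfolding form_def
  proof (intro Bochner_Integration.integral_mono sqint_inner sqint_mv(1)[OF e] sq)
    show "integrable N (\<lambda>x. \<alpha> * (norm (grad \<psi> x))\<^sup>2)" using sq(1) by (simp add: sqint_def)
    fix x
    \<comment> \<open>Pointwise ellipticity is applied to \<open>grad \<phi>\<close>. The gradient
      of \<open>\<psi>\<close> carries the factor \<open>D\<close>, and one of its two powers is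
      dropped because it is at most 1.\<close>
    have "\<alpha> * (norm (grad \<psi> x))\<^sup>2 = D x * (D x * (\<alpha> * (norm (grad \<phi> x))\<^sup>2))"
      unfolding g by (simp add: power_mult_distrib power2_eq_square)
    also have "\<dots> \<le> 1 * (D x * (\<alpha> * (norm (grad \<phi> x))\<^sup>2))"
      using D[of x] \<alpha> by (intro mult_right_mono) auto
    also have "\<dots> \<le> 1 * (D x * ((\<sigma> x *v grad \<phi> x) \<bullet> grad \<phi> x))"
      using e D[of x] by (intro mult_left_mono) (auto simp: elliptic_def)
    also have "\<dots> = (\<sigma> x *v grad \<phi> x) \<bullet> grad \<psi> x" unfolding g by simp
    finally show "\<alpha> * (norm (grad \<psi> x))\<^sup>2 \<le> (\<sigma> x *v grad \<phi> x) \<bullet> grad \<psi> x" .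
  qed
  also have "\<dots> \<le> \<bar>f \<psi>\<bar> + \<epsilon> * ?n" using res[OF \<psi>] by linarith
  also have "\<bar>f \<psi>\<bar> \<le> C * a k powr \<gamma> * ?n"
    using f \<psi> A(1) out unfolding supp_bound_def a_def A_def by blast
  finally have "\<alpha> * ?n\<^sup>2 \<le> (C * a k powr \<gamma> + \<epsilon>) * ?n" by (simp add: algebra_simps)
  then have "(\<alpha> * ?n) * ?n \<le> (C * a k powr \<gamma> + \<epsilon>) * ?n" by (simp add: power2_eq_square)
  moreover have C: "0 \<le> C * a k powr \<gamma> + \<epsilon>" using f \<epsilon> by (simp add: supp_bound_def)
  ultimately have "\<alpha> * ?n \<le> C * a k powr \<gamma> + \<epsilon>"
    using nrm2_nonneg[of N "grad \<psi>"] by (cases "?n = 0") auto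
  then have n: "?n \<le> (C * a k powr \<gamma> + \<epsilon>) / \<alpha>" using \<alpha> by (simp add: field_simps)
  have ak: "a k = measure N A" by (simp add: a_def A_def)
  have ak0: "a k \<ge> 0" by (simp add: a_def)
  have "((h - k) * exp (-1))\<^sup>2 * a h = (LINT x|N. ((h - k) * exp (-1))\<^sup>2 * indicator (level \<phi> (square c s) h) x)"
    using A(2) sets.sets_into_space[OF A(2)] by (simp add: a_def Int_absorb2)
  also have "\<dots> \<le> (LINT x|N. (norm (\<psi> x))\<^sup>2)"
  proof (intro Bochner_Integration.integral_mono)
    show "integrable N (\<lambda>x. ((h - k) * exp (-1))\<^sup>2 * indicator (level \<phi> (square c s) h) x)"
      using A(2) by (intro integrable_mult_right integrable_real_indicator) (auto simp: less_top[symmetric])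
    show "integrable N (\<lambda>x. (norm (\<psi> x))\<^sup>2)" using T_sqint(1)[OF \<psi>] by (simp add: sqint_def)
    fix x
    show "((h - k) * exp (-1))\<^sup>2 * indicator (level \<phi> (square c s) h) x \<le> (norm (\<psi> x))\<^sup>2"
    proof (cases "x \<in> level \<phi> (square c s) h")
      case True
      then have "1 \<le> (\<phi> x - k) / (h - k)" using kh by (simp add: level_def)
      then have "arg x \<ge> 1" by (simp add: arg_def diff_divide_distrib)
      then have "exp (-1) \<le> exp_inv 0 (arg x)" by (rule exp_inv_0_ge)
      then have "(h - k) * exp (-1) \<le> \<psi> x" using True kh by (simp add: \<psi>_def level_def)
      then show ?thesis using True kh by (simp add: power_mono)
    qed simp
  qed
  also have "\<dots> = (nrm2 N \<psi>)\<^sup>2" by (simp add: nrm2_power2)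
  also have "\<dots> \<le> (sqrt (a k) * ((C * a k powr \<gamma> + \<epsilon>) / \<alpha>))\<^sup>2"
  proof (intro power_mono)
    have "nrm2 N \<psi> \<le> sqrt (measure N A) * ?n"
      by (rule poincare_supp[OF \<psi> A(1)]) (use out in auto)
    also have "\<dots> \<le> sqrt (a k) * ((C * a k powr \<gamma> + \<epsilon>) / \<alpha>)"
      unfolding ak[symmetric] using n ak0 by (intro mult_left_mono) auto
    finally show "nrm2 N \<psi> \<le> sqrt (a k) * ((C * a k powr \<gamma> + \<epsilon>) / \<alpha>)" .
  qed simp
  finally have "(exp 1)\<^sup>2 * (((h - k) * exp (-1))\<^sup>2 * a h) \<le> (exp 1)\<^sup>2 * (sqrt (a k) * ((C * a k powr \<gamma> + \<epsilon>) / \<alpha>))\<^sup>2"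
    by (intro mult_left_mono) auto
  moreover have "(exp 1)\<^sup>2 * (((h - k) * exp (-1))\<^sup>2 * a h) = (h - k)\<^sup>2 * a h"
    by (simp add: power_mult_distrib exp_minus field_simps)
  moreover have "(exp 1)\<^sup>2 * (sqrt (a k) * ((C * a k powr \<gamma> + \<epsilon>) / \<alpha>))\<^sup>2 = (exp 1 / \<alpha>)\<^sup>2 * (a k * (C * a k powr \<gamma> + \<epsilon>)\<^sup>2)"
    using ak0 by (simp add: power_mult_distrib power_divide)
  ultimately show ?thesis by simp
qed

end

text \<open>The perturbation \<epsilon> prevents level sets from being shown null; the claim is that
  they become smaller than \<tau>. As long as a exceeds \<tau>, the perturbation satisfies
  \<epsilon> <= \<tau>^\<gamma> <= a^\<gamma> and is absorbed into C + 1. The usual superlinear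
  recursion then forces geometric decay below \<tau>, a contradiction.\<close>

lemma stampacchia_iteration:
  fixes a :: "real \<Rightarrow> real"
  assumes mono: "\<And>k h. k \<le> h \<Longrightarrow> a h \<le> a k" and nonneg: "\<And>k. 0 \<le> a k" and m0: "\<And>k. a k \<le> m0"
    and step: "\<And>k h. M < k \<Longrightarrow> k < h \<Longrightarrow> (h - k)\<^sup>2 * a h \<le> P * (a k * (C * a k powr \<gamma> + \<epsilon>)\<^sup>2)"
    and par: "P \<ge> 0" "C \<ge> 0" "\<gamma> > 0" "\<epsilon> \<ge> 0" "\<tau> > 0" "\<epsilon> \<le> \<tau> powr \<gamma>" "d > 0"
    and d: "4 * 4 powr (1 / (2 * \<gamma>)) * (P * (C + 1)\<^sup>2) * m0 powr (2 * \<gamma>) \<le> d\<^sup>2"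
  shows "a (M + 2 * d) \<le> \<tau>"
proof (rule ccontr)
  assume "\<not> ?thesis"
  then have big: "a k > \<tau>" if "k \<le> M + 2 * d" for k
    using mono[OF that] by linarith
  \<comment> \<open>The rate of decay is 1 / b. Since b^(2 \<gamma>) = 4, the gain from the
    superlinear power compensates the factor 4^i that comes from the halved gaps between the
    levels.\<close>
  define b :: real where "b = 4 powr (1 / (2 * \<gamma>))"
  have b: "b > 1" "b powr (2 * \<gamma>) = 4" using par by (auto simp: b_def powr_powr)
  \<comment> \<open>The levels rise from M + d to M + 2 d with halved gaps. Starting at M + d keeps
    all of them strictly above M, as \<open>step\<close> requires.\<close>
  define k where "k i = M + 2 * d - d * (1/2)^i" for i :: nat
  have k: "M < k i" "k i \<le> M + 2 * d" "k (Suc i) - k i = d * (1/2)^Suc i" for i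
  proof -
    have "d * (1/2)^i \<le> d * 1" using par by (intro mult_left_mono) (auto simp: power_le_one)
    then show "M < k i" using par by (simp add: k_def)
    show "k i \<le> M + 2 * d" "k (Suc i) - k i = d * (1/2)^Suc i" using par by (auto simp: k_def)
  qed
  have m0p: "m0 > 0" using big[of M] m0[of M] par by linarith
  define P' where "P' = P * (C + 1)\<^sup>2"
  have P': "P' \<ge> 0" using par by (simp add: P'_def)
  have rec: "d\<^sup>2 * a (k (Suc i)) \<le> 4 * 4^i * P' * (a (k i) * a (k i) powr (2 * \<gamma>))" for i
  proof -
    have "0 < d * (1/2)^Suc i" using par by simp
    then have lt: "k i < k (Suc i)" using k(3)[of i] by linarith
    have "\<tau> powr \<gamma> \<le> a (k i) powr \<gamma>"
      using big[OF k(2)[of i]] par by (intro powr_mono2) auto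
    then have "C * a (k i) powr \<gamma> + \<epsilon> \<le> (C + 1) * a (k i) powr \<gamma>" using par by (simp add: algebra_simps)
    then have "(C * a (k i) powr \<gamma> + \<epsilon>)\<^sup>2 \<le> ((C + 1) * a (k i) powr \<gamma>)\<^sup>2"
      using par by (intro power_mono) auto
    then have "P * (a (k i) * (C * a (k i) powr \<gamma> + \<epsilon>)\<^sup>2) \<le> P * (a (k i) * ((C + 1) * a (k i) powr \<gamma>)\<^sup>2)"
      using par nonneg by (intro mult_left_mono) auto
    also have "((C + 1) * a (k i) powr \<gamma>)\<^sup>2 = (C + 1)\<^sup>2 * a (k i) powr (2 * \<gamma>)"
      using powr_add[of "a (k i)" \<gamma> \<gamma>] by (simp add: power_mult_distrib power2_eq_square)
    finally have "(k (Suc i) - k i)\<^sup>2 * a (k (Suc i)) \<le> P' * (a (k i) * a (k i) powr (2 * \<gamma>))"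
      using step[OF k(1) lt] by (simp add: P'_def mult_ac)
    then have le: "(2 * 2^i)\<^sup>2 * ((k (Suc i) - k i)\<^sup>2 * a (k (Suc i))) \<le> (2 * 2^i)\<^sup>2 * (P' * (a (k i) * a (k i) powr (2 * \<gamma>)))"
      by (intro mult_left_mono) auto
    have sq: "(2 * 2^i)\<^sup>2 = 4 * (4::real)^i"
      by (induction i) (auto simp: power2_eq_square)
    have "d\<^sup>2 * a (k (Suc i)) = (2 * 2^i)\<^sup>2 * ((k (Suc i) - k i)\<^sup>2 * a (k (Suc i)))"
      unfolding k(3) by (simp add: power_mult_distrib power_divide power_one_over)
    also note le
    also have "(2 * 2^i)\<^sup>2 * (P' * (a (k i) * a (k i) powr (2 * \<gamma>))) = 4 * 4^i * P' * (a (k i) * a (k i) powr (2 * \<gamma>))"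
      unfolding sq by (simp only: mult.assoc)
    finally show ?thesis .
  qed
  have decay: "a (k i) \<le> m0 * (1 / b) ^ i" for i
  proof (induction i)
    case 0
    show ?case using m0 by simp
  next
    case (Suc i)
    have pb: "m0 * (1 / b)^i > 0" using m0p b by simp
    have "a (k i) powr (2 * \<gamma>) \<le> (m0 * (1 / b)^i) powr (2 * \<gamma>)"
      using Suc nonneg par by (intro powr_mono2) auto
    also have "\<dots> = m0 powr (2 * \<gamma>) * (1 / 4)^i"
    proof -
      have "((1 / b)^i) powr (2 * \<gamma>) = ((1 / b) powr (2 * \<gamma>))^i"
        using b by (simp add: powr_powr mult.commute flip: powr_realpow)
      also have "(1 / b) powr (2 * \<gamma>) = 1 / 4" using b by (simp add: powr_divide)
      finally show ?thesis using m0p b by (simp add: powr_mult)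
    qed
    finally have "a (k i) * a (k i) powr (2 * \<gamma>) \<le> (m0 * (1 / b)^i) * (m0 powr (2 * \<gamma>) * (1 / 4)^i)"
      using Suc nonneg pb by (intro mult_mono) auto
    then have "d\<^sup>2 * a (k (Suc i)) \<le> 4 * 4^i * P' * ((m0 * (1 / b)^i) * (m0 powr (2 * \<gamma>) * (1 / 4)^i))"
      using rec[of i] P' by (smt (verit) mult_left_mono mult_nonneg_nonneg zero_le_power)
    also have "\<dots> = (4 * P' * m0 powr (2 * \<gamma>)) * (m0 * (1 / b)^i)"
      by (simp add: power_one_over field_simps)
    also have "\<dots> = (4 * b * P' * m0 powr (2 * \<gamma>)) * (m0 * (1 / b)^Suc i)"
      using b by (simp add: field_simps)
    also have "\<dots> \<le> d\<^sup>2 * (m0 * (1 / b)^Suc i)"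
      using d m0p b unfolding P'_def b_def[symmetric] by (intro mult_right_mono) auto
    finally show ?case by (rule mult_left_le_imp_le) (use par in simp)
  qed
  have "(\<lambda>i. m0 * (1 / b)^i) \<longlonglongrightarrow> m0 * 0"
    using b by (intro tendsto_intros LIMSEQ_power_zero) auto
  then have lim: "(\<lambda>i. m0 * (1 / b)^i) \<longlonglongrightarrow> 0" by simp
  have "\<tau> \<le> m0 * (1 / b)^i" for i using decay[of i] big[OF k(2)[of i]] by linarith
  then have "\<tau> \<le> 0" by (intro LIMSEQ_le_const[OF lim]) blast
  then show False using par by simp
qed

section \<open>Squares near a Lipschitz boundary\<close>

lemma J_mult: "(J *v e) $ 1 = - (e $ 2)" "(J *v e) $ 2 = e $ 1"
  by (simp_all add: J_def matrix_vector_mult_def sum_2)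

lemma inner_J: "e \<bullet> (J *v e) = 0"
  by (simp add: inner_vec_def sum_2 J_mult)

lemma square_cbox: "square c s = cbox (\<chi> i. c $ i - s) (\<chi> i. c $ i + s)"
  by (auto simp: square_def mem_box_cart abs_le_iff algebra_simps)

text \<open>Of the Lipschitz boundary only the following is used: every boundary point is the end
  point of a segment of a fixed length in the complement.\<close>

lemma exterior_segment:
  assumes "open \<Omega>" "bounded \<Omega>" "lipschitz_boundary \<Omega>"
  obtains \<rho> where "\<rho> > 0"
    "\<And>y. y \<in> frontier \<Omega> \<Longrightarrow> \<exists>e. norm e = 1 \<and> (\<forall>t. 0 \<le> t \<and> t < \<rho> \<longrightarrow> y - t *\<^sub>R e \<notin> \<Omega>)"
proof -
  define seg where "seg \<rho> y \<longleftrightarrow> (\<exists>e. norm e = 1 \<and> (\<forall>t. 0 \<le> t \<and> t < \<rho> \<longrightarrow> y - t *\<^sub>R e \<notin> \<Omega>))" for \<rho> y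
  have loc: "\<exists>r>0. \<forall>y\<in>frontier \<Omega>. dist x0 y < r \<longrightarrow> seg r y" if x0: "x0 \<in> frontier \<Omega>" for x0
  proof -
    obtain r e and \<gamma> :: "real \<Rightarrow> real" where r: "r > 0" and e: "norm e = 1"
      and ep: "\<Omega> \<inter> ball x0 r = {x \<in> ball x0 r. (x - x0) \<bullet> e > \<gamma> ((x - x0) \<bullet> (J *v e))}"
      using assms(3) x0 unfolding lipschitz_boundary_def by blast
    have "seg (r / 2) y" if y: "y \<in> frontier \<Omega>" "dist x0 y < r / 2" for y
    proof -
      have y\<Omega>: "y \<notin> \<Omega>" using y assms(1) by (simp add: frontier_def interior_open)
      \<comment> \<open>Moving along -e keeps the abscissa and lowers the height, so if the moved
        point were above the graph, y would be too. Starting within r / 2 of x0 and moving less than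
        r / 2 stays in the ball where the graph describes \<Omega>.\<close>
      have "y - t *\<^sub>R e \<notin> \<Omega>" if t: "0 \<le> t" "t < r / 2" for t
      proof
        assume in\<Omega>: "y - t *\<^sub>R e \<in> \<Omega>"
        have "dist (y - t *\<^sub>R e) y = t" using e t by (simp add: dist_norm)
        then have b: "y - t *\<^sub>R e \<in> ball x0 r" "y \<in> ball x0 r"
          using dist_triangle[of x0 "y - t *\<^sub>R e" y] y(2) t r by (auto simp: dist_commute)
        have "e \<bullet> e = 1" using e by (simp add: power2_norm_eq_inner[symmetric])
        then have 1: "(y - t *\<^sub>R e - x0) \<bullet> e = (y - x0) \<bullet> e - t"
          "(y - t *\<^sub>R e - x0) \<bullet> (J *v e) = (y - x0) \<bullet> (J *v e)"
          by (simp_all add: inner_diff_left inner_J)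
        have "y - t *\<^sub>R e \<in> \<Omega> \<inter> ball x0 r" using b in\<Omega> by blast
        then have "(y - x0) \<bullet> e - t > \<gamma> ((y - x0) \<bullet> (J *v e))"
          unfolding ep using 1 by simp
        then have "y \<in> \<Omega> \<inter> ball x0 r" unfolding ep using b t by simp
        then show False using y\<Omega> by simp
      qed
      then show ?thesis unfolding seg_def using e by blast
    qed
    then show ?thesis using r by (intro exI[of _ "r / 2"]) auto
  qed
  obtain r where r: "\<And>x0. x0 \<in> frontier \<Omega> \<Longrightarrow> r x0 > 0 \<and> (\<forall>y\<in>frontier \<Omega>. dist x0 y < r x0 \<longrightarrow> seg (r x0) y)"
    using bchoice[of "frontier \<Omega>" "\<lambda>x0 r. r > 0 \<and> (\<forall>y\<in>frontier \<Omega>. dist x0 y < r \<longrightarrow> seg r y)"] loc by blast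
  have "compact (frontier \<Omega>)" using assms(2) by (simp add: compact_frontier_bounded)
  moreover have "frontier \<Omega> \<subseteq> (\<Union>x0\<in>frontier \<Omega>. ball x0 (r x0))" using r by force
  ultimately obtain D where D: "D \<subseteq> frontier \<Omega>" "finite D" "frontier \<Omega> \<subseteq> (\<Union>x0\<in>D. ball x0 (r x0))"
    using compactE_image[of "frontier \<Omega>" "frontier \<Omega>" "\<lambda>x0. ball x0 (r x0)"] by auto
  define \<rho> where "\<rho> = Min (insert 1 (r ` D))"
  have \<rho>: "\<rho> > 0" "\<And>x0. x0 \<in> D \<Longrightarrow> \<rho> \<le> r x0"
    using D r by (auto simp: \<rho>_def)
  have "seg \<rho> y" if y: "y \<in> frontier \<Omega>" for y
  proof -
    obtain x0 where x0: "x0 \<in> D" "dist x0 y < r x0" using D(3) y by auto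
    then have "seg (r x0) y" using r[of x0] D(1) y by blast
    then show ?thesis unfolding seg_def using \<rho>(2)[OF x0(1)] by (meson less_le_trans)
  qed
  with \<rho>(1) show ?thesis unfolding seg_def by (rule that)
qed

text \<open>A square with boundary in \<Omega> that is not contained in \<Omega> would contain a
  frontier point. The exterior segment from that point is long enough to leave the square, and it
  would cross the boundary of the square at a point outside \<Omega>.\<close>

lemma square_bd_exterior:
  assumes "open \<Omega>" "bounded \<Omega>" "lipschitz_boundary \<Omega>"
  obtains R0 where "R0 > 0" "\<And>c s. 0 < s \<Longrightarrow> s < R0 \<Longrightarrow> square c s \<subseteq> \<Omega> \<or> \<not> square_bd c s \<subseteq> \<Omega>"
proof -
  obtain \<rho> where \<rho>: "\<rho> > 0"
    "\<And>y. y \<in> frontier \<Omega> \<Longrightarrow> \<exists>e. norm e = 1 \<and> (\<forall>t. 0 \<le> t \<and> t < \<rho> \<longrightarrow> y - t *\<^sub>R e \<notin> \<Omega>)"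
    using exterior_segment[OF assms] by blast
  have "square c s \<subseteq> \<Omega>" if s: "0 < s" "s < \<rho> / 3" and bd: "square_bd c s \<subseteq> \<Omega>" for c s
  proof (rule ccontr)
    assume n: "\<not> square c s \<subseteq> \<Omega>"
    have "c + s *\<^sub>R axis 1 1 \<in> square_bd c s"
      using s by (auto simp: square_bd_def square_def axis_def intro!: exI[of _ 1])
    then have "square c s \<inter> \<Omega> \<noteq> {}" using bd unfolding square_bd_def by blast
    moreover have "connected (square c s)" by (simp add: square_cbox convex_connected)
    ultimately have "square c s \<inter> frontier \<Omega> \<noteq> {}"
      using n by (intro connected_Int_frontier) auto
    then obtain y where y: "y \<in> square c s" "y \<in> frontier \<Omega>" by blast
    obtain e where e: "norm e = 1" "\<And>t. 0 \<le> t \<Longrightarrow> t < \<rho> \<Longrightarrow> y - t *\<^sub>R e \<notin> \<Omega>"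
      using \<rho>(2)[OF y(2)] by blast
    define L where "L = (\<lambda>t. y - t *\<^sub>R e) ` {0..3 * s}"
    have conL: "connected L" unfolding L_def
      by (intro connected_continuous_image continuous_intros) auto
    have "y \<in> L" unfolding L_def using s by (auto intro!: image_eqI[of _ _ 0])
    then have Lsq: "L \<inter> square c s \<noteq> {}" using y by blast
    \<comment> \<open>The length 3 s exceeds the diameter 2 sqrt 2 s of the square: if both end
      points were inside, both components of e would be at most 2 / 3, and norm e < 1.\<close>
    have "y - (3 * s) *\<^sub>R e \<notin> square c s"
    proof
      assume *: "y - (3 * s) *\<^sub>R e \<in> square c s"
      have "\<bar>e $ i\<bar> \<le> 2 / 3" for i
      proof -
        have "\<bar>y $ i - c $ i\<bar> \<le> s" "\<bar>(y $ i - 3 * s * e $ i) - c $ i\<bar> \<le> s"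
          using * y(1) by (auto simp: square_def)
        then have "\<bar>3 * s * e $ i\<bar> \<le> 2 * s" by linarith
        then have "s * (3 * \<bar>e $ i\<bar>) \<le> s * 2" using s by (simp add: abs_mult)
        then show ?thesis using s by simp
      qed
      then have "\<bar>e $ i\<bar>\<^sup>2 \<le> (2 / 3)\<^sup>2" for i by (intro power_mono) auto
      from this[of 1] this[of 2] have "(norm e)\<^sup>2 < 1"
        unfolding power2_norm_eq_inner by (simp add: inner_vec_def sum_2 power2_eq_square)
      then show False using e by simp
    qed
    moreover have "y - (3 * s) *\<^sub>R e \<in> L" unfolding L_def using s by (intro imageI) auto
    ultimately have "L - square c s \<noteq> {}" by blast
    with conL Lsq have "L \<inter> frontier (square c s) \<noteq> {}" by (rule connected_Int_frontier)
    then obtain z where z: "z \<in> L" "z \<in> frontier (square c s)" by blast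
    have "z \<in> square_bd c s"
    proof -
      have zs: "z \<in> square c s" "z \<notin> interior (square c s)"
        using z(2) by (auto simp: frontier_def closed_square)
      moreover have "{x. \<forall>i. \<bar>x $ i - c $ i\<bar> < s} \<subseteq> interior (square c s)"
        by (rule interior_maximal[OF _ open_square_interior]) (auto simp: square_def less_imp_le)
      ultimately have "\<not> (\<forall>i. \<bar>z $ i - c $ i\<bar> < s)" by blast
      then obtain i where "s \<le> \<bar>z $ i - c $ i\<bar>" by (auto simp: not_less)
      moreover have "\<bar>z $ i - c $ i\<bar> \<le> s" using zs(1) by (simp add: square_def)
      ultimately have "\<bar>z $ i - c $ i\<bar> = s" by (rule order.antisym[rotated])
      then show ?thesis using zs(1) unfolding square_bd_def by blast
    qed
    moreover have "z \<notin> \<Omega>" using z(1) e(2) s unfolding L_def by force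
    ultimately show False using bd by blast
  qed
  then show ?thesis using \<rho> by (intro that[of "\<rho> / 3"]) auto
qed

section \<open>Oscillation of approximate solutions in a square\<close>

context bdd_domain
begin

lemma measure_N_eq: "A \<in> sets N \<Longrightarrow> measure N A = measure lebesgue A"
  by (rule measure_restrict_space) (auto simp: sets_restrict_space_iff)

lemma level_measure_le:
  assumes "\<phi> \<in> T" "s > 0"
  shows "measure N (level \<phi> (square c s) k) \<le> 4 * s\<^sup>2"
proof -
  have A: "level \<phi> (square c s) k \<in> sets N" by (rule level_sets[OF assms(1)])
  have "measure N (level \<phi> (square c s) k) = measure lebesgue (level \<phi> (square c s) k)"
    by (rule measure_N_eq[OF A])
  also have "\<dots> \<le> measure lebesgue (square c s)"
    by (rule measure_mono_fmeasurable)
      (use A in \<open>auto simp: level_def square_cbox sets_restrict_space_iff\<close>)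
  also have "\<dots> = 4 * s\<^sup>2"
    unfolding square_cbox using assms(2)
    by (simp add: content_cbox_cart interval_eq_empty_cart UNIV_2 power2_eq_square not_less)
  finally show ?thesis .
qed

lemma test_functions_uminus:
  assumes "\<phi> \<in> T"
  shows "(\<lambda>x. - \<phi> x) \<in> T" "grad (\<lambda>x. - \<phi> x) = (\<lambda>x. - grad \<phi> x)"
proof -
  show "(\<lambda>x. - \<phi> x) \<in> T" using test_functions_cmult[OF assms, of "-1"] by simp
  show "grad (\<lambda>x. - \<phi> x) = (\<lambda>x. - grad \<phi> x)"
    using grad_cmult[OF T_diff[OF assms], of "-1"] by auto
qed

lemma level_small:
  assumes e: "elliptic \<sigma> \<alpha> \<Lambda>" and f: "supp_bound f C \<gamma>" and \<phi>: "\<phi> \<in> T"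
    and res: "\<And>\<psi>. \<psi> \<in> T \<Longrightarrow> \<bar>form \<sigma> (grad \<phi>) (grad \<psi>) - f \<psi>\<bar> \<le> \<epsilon> * nrm2 N (grad \<psi>)"
    and M: "\<And>x. x \<in> square_bd c s \<Longrightarrow> \<phi> x \<le> M" and ins: "square c s \<subseteq> \<Omega> \<or> M \<ge> 0"
    and par: "s > 0" "\<epsilon> \<ge> 0" "\<tau> > 0" "\<epsilon> \<le> \<tau> powr \<gamma>" "d > 0"
      "4 * 4 powr (1 / (2 * \<gamma>)) * ((exp 1 / \<alpha>)\<^sup>2 * (C + 1)\<^sup>2) * (4 * s\<^sup>2) powr (2 * \<gamma>) \<le> d\<^sup>2"
  shows "measure N (level \<phi> (square c s) (M + 2 * d)) \<le> \<tau>"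
proof (rule stampacchia_iteration[where a = "\<lambda>k. measure N (level \<phi> (square c s) k)"
      and P = "(exp 1 / \<alpha>)\<^sup>2" and C = C and \<gamma> = \<gamma> and \<epsilon> = \<epsilon> and ?m0.0 = "4 * s\<^sup>2"])
  interpret finite_measure N by (rule finite_N)
  show "measure N (level \<phi> (square c s) h) \<le> measure N (level \<phi> (square c s) k)" if "k \<le> h" for k h
    by (rule finite_measure_mono[OF _ level_sets[OF \<phi>]]) (use that in \<open>auto simp: level_def\<close>)
  show "(h - k)\<^sup>2 * measure N (level \<phi> (square c s) h)
      \<le> (exp 1 / \<alpha>)\<^sup>2 * (measure N (level \<phi> (square c s) k) * (C * measure N (level \<phi> (square c s) k) powr \<gamma> + \<epsilon>)\<^sup>2)"
    if "M < k" "k < h" for k h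
    by (rule level_step[OF e f \<phi> res M ins that par(2)])
qed (use par f level_measure_le[OF \<phi> par(1)] in \<open>auto simp: supp_bound_def\<close>)

text \<open>The bounds from above and below are the level estimates for \<phi> and -\<phi>. When the
  square leaves \<Omega>, the reference value m = 0 makes both barriers m + \<eta> and - m + \<eta>
  nonnegative, as the truncation requires there.\<close>

lemma oscillation_small:
  assumes e: "elliptic \<sigma> \<alpha> \<Lambda>" and f: "supp_bound f C \<gamma>" "H_functional f C0" and \<phi>: "\<phi> \<in> T"
    and res: "\<And>\<psi>. \<psi> \<in> T \<Longrightarrow> \<bar>form \<sigma> (grad \<phi>) (grad \<psi>) - f \<psi>\<bar> \<le> \<epsilon> * nrm2 N (grad \<psi>)"
    and osc: "\<And>x. x \<in> square_bd c s \<Longrightarrow> \<bar>\<phi> x - m\<bar> \<le> \<eta>" and ins: "square c s \<subseteq> \<Omega> \<or> m = 0" and \<eta>: "\<eta> \<ge> 0"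
    and par: "s > 0" "\<epsilon> \<ge> 0" "\<tau> > 0" "\<epsilon> \<le> \<tau> powr \<gamma>" "d > 0"
      "4 * 4 powr (1 / (2 * \<gamma>)) * ((exp 1 / \<alpha>)\<^sup>2 * (C + 1)\<^sup>2) * (4 * s\<^sup>2) powr (2 * \<gamma>) \<le> d\<^sup>2"
  obtains B where "B \<in> sets N" "measure N B \<le> 2 * \<tau>"
    "\<And>x. x \<in> \<Omega> \<Longrightarrow> x \<in> square c s \<Longrightarrow> x \<notin> B \<Longrightarrow> \<bar>\<phi> x - m\<bar> \<le> \<eta> + 2 * d"
proof -
  interpret finite_measure N by (rule finite_N)
  let ?\<phi> = "\<lambda>x. - \<phi> x"
  have \<phi>': "?\<phi> \<in> T" "grad ?\<phi> = (\<lambda>x. - grad \<phi> x)" using test_functions_uminus[OF \<phi>] by auto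
  define B1 where "B1 = level \<phi> (square c s) ((m + \<eta>) + 2 * d)"
  define B2 where "B2 = level ?\<phi> (square c s) ((- m + \<eta>) + 2 * d)"
  have 1: "measure N B1 \<le> \<tau>" unfolding B1_def
  proof (rule level_small[OF e f(1) \<phi> res _ _ par])
    show "\<phi> x \<le> m + \<eta>" if "x \<in> square_bd c s" for x using osc[OF that] by linarith
    show "square c s \<subseteq> \<Omega> \<or> 0 \<le> m + \<eta>" using ins \<eta> by auto
  qed
  have f': "supp_bound (\<lambda>\<psi>. - f \<psi>) C \<gamma>" using f(1) by (simp add: supp_bound_def)
  have 2: "measure N B2 \<le> \<tau>" unfolding B2_def
  proof (rule level_small[OF e f' \<phi>'(1) _ _ _ par])
    show "- \<phi> x \<le> - m + \<eta>" if "x \<in> square_bd c s" for x using osc[OF that] by linarith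
    show "square c s \<subseteq> \<Omega> \<or> 0 \<le> - m + \<eta>" using ins \<eta> by auto
    show "\<bar>form \<sigma> (grad ?\<phi>) (grad \<psi>) - - f \<psi>\<bar> \<le> \<epsilon> * nrm2 N (grad \<psi>)" if "\<psi> \<in> T" for \<psi>
    proof -
      have "form \<sigma> (grad ?\<phi>) (grad \<psi>) = - form \<sigma> (grad \<phi>) (grad \<psi>)"
        unfolding \<phi>'(2) form_def by (simp add: vec.neg)
      then show ?thesis using res[OF that] by linarith
    qed
  qed
  have sets: "B1 \<in> sets N" "B2 \<in> sets N" unfolding B1_def B2_def by (intro level_sets \<phi> \<phi>')+
  have "measure N (B1 \<union> B2) \<le> measure N B1 + measure N B2" by (rule measure_Un_le[OF sets])
  then have "measure N (B1 \<union> B2) \<le> 2 * \<tau>" using 1 2 by linarith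
  then show ?thesis
  proof (rule that[rotated])
    show "\<bar>\<phi> x - m\<bar> \<le> \<eta> + 2 * d" if "x \<in> \<Omega>" "x \<in> square c s" "x \<notin> B1 \<union> B2" for x
      using that by (auto simp: B1_def B2_def level_def)
  qed (use sets in auto)
qed

lemma chebyshev_nrm2:
  assumes "sqint N f" "t > 0"
  shows "{x \<in> \<Omega>. norm (f x) > t} \<in> sets N" "measure N {x \<in> \<Omega>. norm (f x) > t} \<le> (nrm2 N f / t)\<^sup>2"
proof -
  interpret finite_measure N by (rule finite_N)
  have m: "f \<in> borel_measurable N" using assms by (simp add: sqint_def)
  have "{x \<in> space N. norm (f x) > t} \<in> sets N" using m by measurable
  then show s: "{x \<in> \<Omega>. norm (f x) > t} \<in> sets N" by simp
  have "t\<^sup>2 * measure N {x \<in> \<Omega>. norm (f x) > t} = (LINT x|N. t\<^sup>2 * indicator {x \<in> \<Omega>. norm (f x) > t} x)"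
    using sets.sets_into_space[OF s] s by (simp add: Int_absorb2)
  also have "\<dots> \<le> (LINT x|N. (norm (f x))\<^sup>2)"
  proof (intro Bochner_Integration.integral_mono)
    show "integrable N (\<lambda>x. t\<^sup>2 * indicator {x \<in> \<Omega>. norm (f x) > t} x)"
      using s by (intro integrable_mult_right integrable_real_indicator) (auto simp: less_top[symmetric])
    show "integrable N (\<lambda>x. (norm (f x))\<^sup>2)" using assms by (simp add: sqint_def)
    show "t\<^sup>2 * indicator {x \<in> \<Omega>. norm (f x) > t} x \<le> (norm (f x))\<^sup>2" for x
      using assms(2) by (auto simp: indicator_def intro!: power_mono)
  qed
  finally show "measure N {x \<in> \<Omega>. norm (f x) > t} \<le> (nrm2 N f / t)\<^sup>2"
    using assms(2) by (simp add: nrm2_power2 power_divide field_simps)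
qed

end

section \<open>Equicontinuity of solutions\<close>

context bdd_domain
begin

definition ext0 :: "(real^2 \<Rightarrow> real) \<Rightarrow> real^2 \<Rightarrow> real" where
  "ext0 u x = (if x \<in> \<Omega> then u x else 0)"

text \<open>The smallness condition of the iteration scales with a positive power of the side, so
  any increment d > 0 is admissible in all sufficiently small squares.\<close>

lemma square_side_small:
  fixes c1 \<gamma> d R0 :: real
  assumes "c1 \<ge> 0" "\<gamma> > 0" "d > 0" "R0 > 0"
  obtains R where "0 < R" "R < R0" "\<And>s. 0 < s \<Longrightarrow> s < R \<Longrightarrow> c1 * (4 * s\<^sup>2) powr (2 * \<gamma>) \<le> d\<^sup>2"
proof -
  define z where "z = (d\<^sup>2 / (c1 + 1)) powr (1 / (2 * \<gamma>))"
  have z: "z > 0" using assms by (simp add: z_def)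
  define R where "R = min (R0 / 2) (sqrt z / 2)"
  have R: "0 < R" "R < R0" using z assms by (auto simp: R_def min_def)
  have "c1 * (4 * s\<^sup>2) powr (2 * \<gamma>) \<le> d\<^sup>2" if s: "0 < s" "s < R" for s
  proof -
    have "s \<le> sqrt z / 2" using s by (simp add: R_def)
    then have "s\<^sup>2 \<le> (sqrt z / 2)\<^sup>2" using s by (intro power_mono) auto
    then have "4 * s\<^sup>2 \<le> z" using z by (simp add: power_divide)
    then have "(4 * s\<^sup>2) powr (2 * \<gamma>) \<le> z powr (2 * \<gamma>)" using assms by (intro powr_mono2) auto
    also have "\<dots> = d\<^sup>2 / (c1 + 1)" using assms by (simp add: z_def powr_powr)
    finally have "c1 * (4 * s\<^sup>2) powr (2 * \<gamma>) \<le> c1 * (d\<^sup>2 / (c1 + 1))" using assms by (intro mult_left_mono) auto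
    also have "\<dots> \<le> d\<^sup>2" using assms by (simp add: field_simps)
    finally show ?thesis .
  qed
  with R show ?thesis by (rule that)
qed

text \<open>The order of quantifiers is the point: r is fixed before \<sigma> and its upper bound
  \<Lambda>. For one given solution \<Lambda> still appears as a factor of errors that tend to 0
  along the approximating sequence. The exceptional set G reflects that solutions are determined
  almost everywhere only.\<close>

lemma equicontinuity:
  assumes R0: "R0 > 0" "\<And>c s. 0 < s \<Longrightarrow> s < R0 \<Longrightarrow> square c s \<subseteq> \<Omega> \<or> \<not> square_bd c s \<subseteq> \<Omega>"
    and f: "supp_bound f C \<gamma>" "H_functional f C0" and "\<alpha> > 0" "\<omega> > 0"
  obtains r where "r > 0"
    "\<And>\<sigma> \<Lambda> u g \<phi> c. elliptic \<sigma> \<alpha> \<Lambda> \<Longrightarrow> sol \<sigma> f u g \<phi> \<Longrightarrow>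
      \<exists>G\<in>null_sets N. \<forall>x\<in>square c r. \<forall>y\<in>square c r. x \<notin> G \<longrightarrow> y \<notin> G \<longrightarrow> \<bar>ext0 u x - ext0 u y\<bar> \<le> \<omega>"
proof -
  \<comment> \<open>Two points of the square differ in value by at most 2 (\<eta> + 2 d + \<tau> i),
    and each of \<eta>, 2 d and eventually \<tau> i is at most \<omega> / 8.\<close>
  define d where "d = \<omega> / 16"
  define \<eta> where "\<eta> = \<omega> / 8"
  define c1 where "c1 = 4 * 4 powr (1 / (2 * \<gamma>)) * ((exp 1 / \<alpha>)\<^sup>2 * (C + 1)\<^sup>2)"
  have pos: "d > 0" "\<eta> > 0" "c1 \<ge> 0" "\<gamma> > 0"
    using assms by (auto simp: d_def \<eta>_def c1_def supp_bound_def)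
  obtain R where R: "0 < R" "R < R0" "\<And>s. 0 < s \<Longrightarrow> s < R \<Longrightarrow> c1 * (4 * s\<^sup>2) powr (2 * \<gamma>) \<le> d\<^sup>2"
    using square_side_small[OF pos(3,4,1) R0(1)] by blast
  \<comment> \<open>The added 1 makes the energy bound strict for the solution, so that the
    gradients of its approximations eventually satisfy it as well.\<close>
  define K where "K = (C0 / \<alpha>)\<^sup>2 + 1"
  have K: "K > 0" unfolding K_def by (rule add_nonneg_pos) auto
  \<comment> \<open>Solves 4 sqrt (16 K / l) = \<eta>, the Courant--Lebesgue bound with ln (R / r) =
    l; hence r = R exp (- l).\<close>
  define l where "l = 256 * K / \<eta>\<^sup>2"
  have l: "l > 0" using K pos by (simp add: l_def)
  define r where "r = R * exp (- l)"
  have r: "0 < r" "r < R" using R l by (auto simp: r_def)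
  have "R / r = exp l" using R by (simp add: r_def exp_minus field_simps)
  then have lnl: "ln (R / r) = l" by simp
  have \<eta>eq: "4 * sqrt (16 * K / ln (R / r)) = \<eta>"
  proof -
    have "16 * K / l = (\<eta> / 4)\<^sup>2" using K pos by (simp add: l_def power_divide)
    then show ?thesis using pos by (simp add: lnl)
  qed
  have "\<exists>G\<in>null_sets N. \<forall>x\<in>square c r. \<forall>y\<in>square c r. x \<notin> G \<longrightarrow> y \<notin> G \<longrightarrow> \<bar>ext0 u x - ext0 u y\<bar> \<le> \<omega>"
    if e: "elliptic \<sigma> \<alpha> \<Lambda>" and s: "sol \<sigma> f u g \<phi>" for \<sigma> \<Lambda> u g \<phi> c
  proof -
    have ap: "approx u g \<phi>" using s by (simp add: sol_def)
    note a = approxD[OF ap]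
    have \<Lambda>: "\<Lambda> > 0" using e by (auto simp: elliptic_def)
    have "nrm2 N g \<le> C0 / \<alpha>" using sol_grad_bound[OF e s f(2)] assms by (simp add: field_simps)
    then have "(nrm2 N g)\<^sup>2 < K" unfolding K_def
      using power_mono[of "nrm2 N g" "C0 / \<alpha>" 2] by simp
    moreover have "(\<lambda>j. (nrm2 N (grad (\<phi> j)))\<^sup>2) \<longlonglongrightarrow> (nrm2 N g)\<^sup>2"
      by (intro tendsto_intros nrm2_tendsto[OF T_sqint(2)[OF a(1)] a(3,5)])
    ultimately have "\<forall>\<^sub>F j in sequentially. (nrm2 N (grad (\<phi> j)))\<^sup>2 < K"
      by (rule order_tendstoD(2)[rotated])
    then obtain j0 where j0: "\<And>j. j \<ge> j0 \<Longrightarrow> (nrm2 N (grad (\<phi> j)))\<^sup>2 < K"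
      by (auto simp: eventually_sequentially)
    define \<phi>' where "\<phi>' j = \<phi> (j + j0)" for j
    have T': "\<phi>' j \<in> T" for j unfolding \<phi>'_def by (rule a(1))
    have lim': "(\<lambda>k. nrm2 N (\<lambda>x. \<phi>' k x - u x)) \<longlonglongrightarrow> 0" "(\<lambda>k. nrm2 N (\<lambda>x. grad (\<phi>' k) x - g x)) \<longlonglongrightarrow> 0"
      unfolding \<phi>'_def using LIMSEQ_ignore_initial_segment[OF a(4), of j0] LIMSEQ_ignore_initial_segment[OF a(5), of j0] by auto
    have en: "(\<integral>\<^sup>+x. ennreal ((norm (grad (\<phi>' j) x))\<^sup>2) \<partial>lborel) \<le> ennreal K" for j
      unfolding nn_grad_T[OF T'] using j0[of "j + j0"] by (intro ennreal_leI) (simp add: \<phi>'_def)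
    obtain s where s: "r < s" "s < R" and fr: "\<exists>\<^sub>F j in sequentially. \<forall>x\<in>square_bd c s. \<forall>y\<in>square_bd c s. \<bar>\<phi>' j x - \<phi>' j y\<bar> \<le> \<eta>"
      using courant_lebesgue[of \<phi>' K r R c, OF test_functions_cs[OF T'] en K r] unfolding \<eta>eq by blast
    have s0: "s > 0" using s r by linarith
    have "c + s *\<^sub>R axis 1 1 \<in> square_bd c s"
      using s0 by (auto simp: square_bd_def square_def axis_def intro!: exI[of _ 1])
    \<comment> \<open>The reference point lies on the boundary of the square. If the square leaves
      \<Omega>, it can be taken outside \<Omega>, where all test functions vanish, so the reference
      value is 0.\<close>
    then obtain x0 where x0: "x0 \<in> square_bd c s" "square c s \<subseteq> \<Omega> \<or> x0 \<notin> \<Omega>"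
    proof (cases "square c s \<subseteq> \<Omega>")
      case False
      then have "\<not> square_bd c s \<subseteq> \<Omega>" using R0(2)[of s c] s s0 R by auto
      then show ?thesis using that by blast
    qed blast
    define m where "m j = \<phi>' j x0" for j
    have m0: "m j = 0" if "x0 \<notin> \<Omega>" for j unfolding m_def by (rule T_outside(1)[OF T' that])
    define \<tau> :: "nat \<Rightarrow> real" where "\<tau> i = (1/2)^i" for i
    have \<tau>: "\<tau> i > 0" for i by (simp add: \<tau>_def)
    \<comment> \<open>For each i one member of the sequence that has small boundary oscillation, a
      residual admissible for the threshold \<tau> i = 2^(-i), and L2 distance at most 4^(-i) to the
      solution. The last rate makes the Chebyshev sets at level 2^(-i) summable.\<close>
    have "\<exists>j. (\<forall>x\<in>square_bd c s. \<bar>\<phi>' j x - m j\<bar> \<le> \<eta>) \<and>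
        \<Lambda> * nrm2 N (\<lambda>x. grad (\<phi>' j) x - g x) \<le> \<tau> i powr \<gamma> \<and> nrm2 N (\<lambda>x. \<phi>' j x - u x) \<le> (1/4)^i" for i
    proof -
      have "(\<lambda>j. \<Lambda> * nrm2 N (\<lambda>x. grad (\<phi>' j) x - g x)) \<longlonglongrightarrow> \<Lambda> * 0"
        by (intro tendsto_intros lim')
      then have "\<forall>\<^sub>F j in sequentially. \<Lambda> * nrm2 N (\<lambda>x. grad (\<phi>' j) x - g x) < \<tau> i powr \<gamma>"
        using \<tau>[of i] by (intro order_tendstoD(2)[of _ "\<Lambda> * 0"]) auto
      moreover have "\<forall>\<^sub>F j in sequentially. nrm2 N (\<lambda>x. \<phi>' j x - u x) < (1/4)^i"
        by (rule order_tendstoD(2)[OF lim'(1)]) simp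
      ultimately have "\<exists>\<^sub>F j in sequentially. (\<forall>x\<in>square_bd c s. \<forall>y\<in>square_bd c s. \<bar>\<phi>' j x - \<phi>' j y\<bar> \<le> \<eta>) \<and>
        (\<Lambda> * nrm2 N (\<lambda>x. grad (\<phi>' j) x - g x) < \<tau> i powr \<gamma> \<and> nrm2 N (\<lambda>x. \<phi>' j x - u x) < (1/4)^i)"
        by (intro frequently_eventually_frequently[OF fr] eventually_conj)
      then obtain j where "(\<forall>x\<in>square_bd c s. \<forall>y\<in>square_bd c s. \<bar>\<phi>' j x - \<phi>' j y\<bar> \<le> \<eta>) \<and>
        (\<Lambda> * nrm2 N (\<lambda>x. grad (\<phi>' j) x - g x) < \<tau> i powr \<gamma> \<and> nrm2 N (\<lambda>x. \<phi>' j x - u x) < (1/4)^i)"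
        using frequently_ex by blast
      then show ?thesis using x0(1) by (intro exI[of _ j]) (auto simp: m_def)
    qed
    then have "\<exists>j. \<forall>i. (\<forall>x\<in>square_bd c s. \<bar>\<phi>' (j i) x - m (j i)\<bar> \<le> \<eta>) \<and>
        \<Lambda> * nrm2 N (\<lambda>x. grad (\<phi>' (j i)) x - g x) \<le> \<tau> i powr \<gamma> \<and> nrm2 N (\<lambda>x. \<phi>' (j i) x - u x) \<le> (1/4)^i"
      by (intro choice allI)
    then obtain j where jall: "\<forall>i. (\<forall>x\<in>square_bd c s. \<bar>\<phi>' (j i) x - m (j i)\<bar> \<le> \<eta>) \<and>
        \<Lambda> * nrm2 N (\<lambda>x. grad (\<phi>' (j i)) x - g x) \<le> \<tau> i powr \<gamma> \<and> nrm2 N (\<lambda>x. \<phi>' (j i) x - u x) \<le> (1/4)^i"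
      by (elim exE)
    have j: "\<bar>\<phi>' (j i) x - m (j i)\<bar> \<le> \<eta>" if "x \<in> square_bd c s" for i x
      using jall that by blast
    have j2: "\<Lambda> * nrm2 N (\<lambda>x. grad (\<phi>' (j i)) x - g x) \<le> \<tau> i powr \<gamma>"
      "nrm2 N (\<lambda>x. \<phi>' (j i) x - u x) \<le> (1/4)^i" for i
      using jall by blast+
    have "\<exists>B. B \<in> sets N \<and> measure N B \<le> 2 * \<tau> i \<and>
        (\<forall>x\<in>\<Omega>. x \<in> square c s \<longrightarrow> x \<notin> B \<longrightarrow> \<bar>\<phi>' (j i) x - m (j i)\<bar> \<le> \<eta> + 2 * d)" for i
    proof (rule oscillation_small[OF e f T'[of "j i"], where s = s and c = c and m = "m (j i)" and \<eta> = \<eta> and d = d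
        and \<tau> = "\<tau> i" and \<epsilon> = "\<Lambda> * nrm2 N (\<lambda>x. grad (\<phi>' (j i)) x - g x)"])
      show "\<bar>form \<sigma> (grad (\<phi>' (j i))) (grad \<psi>) - f \<psi>\<bar> \<le> \<Lambda> * nrm2 N (\<lambda>x. grad (\<phi>' (j i)) x - g x) * nrm2 N (grad \<psi>)"
        if "\<psi> \<in> T" for \<psi>
      proof -
        have "form \<sigma> (grad (\<phi>' (j i))) (grad \<psi>) - f \<psi> = form \<sigma> (\<lambda>x. grad (\<phi>' (j i)) x - g x) (grad \<psi>)"
          using form_diff_left[OF e T_sqint(2)[OF T'] a(3) T_sqint(2)[OF that]] \<open>sol \<sigma> f u g \<phi>\<close> that
          by (simp add: sol_def)
        then show ?thesis
          using form_bound[OF e sqint_diff(1)[OF T_sqint(2)[OF T'] a(3)] T_sqint(2)[OF that]] by simp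
      qed
      show "square c s \<subseteq> \<Omega> \<or> m (j i) = 0" using x0(2) m0 by blast
      show "4 * 4 powr (1 / (2 * \<gamma>)) * ((exp 1 / \<alpha>)\<^sup>2 * (C + 1)\<^sup>2) * (4 * s\<^sup>2) powr (2 * \<gamma>) \<le> d\<^sup>2"
        using R(3)[OF s0 s(2)] by (simp add: c1_def)
      show "\<exists>B. B \<in> sets N \<and> measure N B \<le> 2 * \<tau> i \<and>
        (\<forall>x\<in>\<Omega>. x \<in> square c s \<longrightarrow> x \<notin> B \<longrightarrow> \<bar>\<phi>' (j i) x - m (j i)\<bar> \<le> \<eta> + 2 * d)"
        if "B \<in> sets N" "measure N B \<le> 2 * \<tau> i"
          "\<And>x. x \<in> \<Omega> \<Longrightarrow> x \<in> square c s \<Longrightarrow> x \<notin> B \<Longrightarrow> \<bar>\<phi>' (j i) x - m (j i)\<bar> \<le> \<eta> + 2 * d" for B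
        using that by blast
      show "\<bar>\<phi>' (j i) x - m (j i)\<bar> \<le> \<eta>" if "x \<in> square_bd c s" for x using that by (rule j)
      show "\<Lambda> * nrm2 N (\<lambda>x. grad (\<phi>' (j i)) x - g x) \<le> \<tau> i powr \<gamma>" by (rule j2)
    qed (use pos \<tau> s0 \<Lambda> in \<open>simp_all add: less_imp_le\<close>)
    then have "\<exists>B. \<forall>i. B i \<in> sets N \<and> measure N (B i) \<le> 2 * \<tau> i \<and>
        (\<forall>x\<in>\<Omega>. x \<in> square c s \<longrightarrow> x \<notin> B i \<longrightarrow> \<bar>\<phi>' (j i) x - m (j i)\<bar> \<le> \<eta> + 2 * d)"
      by (intro choice allI)
    then obtain B where Ball: "\<forall>i. B i \<in> sets N \<and> measure N (B i) \<le> 2 * \<tau> i \<and>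
        (\<forall>x\<in>\<Omega>. x \<in> square c s \<longrightarrow> x \<notin> B i \<longrightarrow> \<bar>\<phi>' (j i) x - m (j i)\<bar> \<le> \<eta> + 2 * d)"
      by (elim exE)
    have B: "B i \<in> sets N" "measure N (B i) \<le> 2 * \<tau> i"
      "x \<in> \<Omega> \<Longrightarrow> x \<in> square c s \<Longrightarrow> x \<notin> B i \<Longrightarrow> \<bar>\<phi>' (j i) x - m (j i)\<bar> \<le> \<eta> + 2 * d" for i x
      using Ball by blast+
    define E where "E i = B i \<union> {x \<in> \<Omega>. norm (\<phi>' (j i) x - u x) > \<tau> i}" for i
    have sq: "sqint N (\<lambda>x. \<phi>' (j i) x - u x)" for i by (intro sqint_diff T_sqint(1)[OF T'] a(2))
    have E: "E i \<in> sets N" "measure N (E i) \<le> 3 * (1/2)^i" for i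
    proof -
      note ch = chebyshev_nrm2[OF sq \<tau>, of i i]
      show "E i \<in> sets N" unfolding E_def using B(1) ch(1) by blast
      have "(nrm2 N (\<lambda>x. \<phi>' (j i) x - u x) / \<tau> i)\<^sup>2 \<le> ((1/4)^i / (1/2)^i)\<^sup>2"
        unfolding \<tau>_def by (intro power_mono divide_right_mono j2(2)) auto
      also have "((1/4)^i / (1/2)^i)\<^sup>2 = (1/4::real)^i"
        by (simp add: power_divide power2_eq_square flip: power_mult_distrib)
      also have "\<dots> \<le> (1/2)^i" by (intro power_mono) auto
      finally have "measure N {x \<in> \<Omega>. norm (\<phi>' (j i) x - u x) > \<tau> i} \<le> (1/2)^i" using ch(2) by linarith
      moreover have "measure N (E i) \<le> measure N (B i) + measure N {x \<in> \<Omega>. norm (\<phi>' (j i) x - u x) > \<tau> i}"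
        unfolding E_def by (rule measure_Un_le[OF B(1) ch(1)])
      ultimately show "measure N (E i) \<le> 3 * (1/2)^i" using B(2)[of i] by (simp add: \<tau>_def)
    qed
    interpret finite_measure N by (rule finite_N)
    \<comment> \<open>Borel--Cantelli: almost every point avoids the sets E i from some index on, so
      there the bounds for the approximations pass to u.\<close>
    have "AE x in N. \<forall>\<^sub>F i in sequentially. x \<in> space N - E i"
    proof (rule borel_cantelli_AE1)
      show "summable (\<lambda>i. measure N (E i))"
        by (rule summable_comparison_test'[of "\<lambda>i. 3 * (1/2)^i"])
           (use E(2) in \<open>auto intro!: summable_mult summable_geometric\<close>)
    qed (use E(1) in \<open>auto simp: less_top[symmetric]\<close>)
    then obtain G where G: "{x \<in> space N. \<not> (\<forall>\<^sub>F i in sequentially. x \<in> space N - E i)} \<subseteq> G" "emeasure N G = 0" "G \<in> sets N"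
      by (rule AE_E)
    have ev: "\<forall>\<^sub>F i in sequentially. \<bar>ext0 u x - m (j i)\<bar> \<le> \<eta> + 2 * d + \<tau> i" if x: "x \<in> square c r" "x \<notin> G" for x
    proof -
      have xs: "x \<in> square c s" using x s by (auto simp: square_def intro: order_trans less_imp_le)
      show ?thesis
      proof (cases "x \<in> \<Omega>")
        case True
        then have "\<forall>\<^sub>F i in sequentially. x \<in> space N - E i" using G(1) x(2) by auto
        then show ?thesis
        proof eventually_elim
          case (elim i)
          then have "\<bar>\<phi>' (j i) x - m (j i)\<bar> \<le> \<eta> + 2 * d" "\<bar>\<phi>' (j i) x - u x\<bar> \<le> \<tau> i"
            using B(3)[OF True xs] True by (auto simp: E_def not_less)
          then show ?case using True by (simp add: ext0_def)
        qed
      next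
        case False
        then have "x0 \<notin> \<Omega>" using x0(2) xs by blast
        then show ?thesis using False m0 pos \<tau> by (intro always_eventually) (auto simp: ext0_def less_imp_le)
      qed
    qed
    have "\<bar>ext0 u x - ext0 u y\<bar> \<le> \<omega>" if "x \<in> square c r" "y \<in> square c r" "x \<notin> G" "y \<notin> G" for x y
    proof -
      have "\<tau> \<longlonglongrightarrow> 0" unfolding \<tau>_def by (rule LIMSEQ_power_zero) simp
      then have "\<forall>\<^sub>F i in sequentially. \<tau> i < \<omega> / 8" by (rule order_tendstoD(2)) (use assms in simp)
      then have "\<forall>\<^sub>F i in sequentially. \<bar>ext0 u x - ext0 u y\<bar> \<le> \<omega>"
        using ev[OF that(1,3)] ev[OF that(2,4)]
      proof eventually_elim
        case (elim i)
        then show ?case using assms by (simp add: \<eta>_def d_def)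
      qed
      then show ?thesis by simp
    qed
    then show ?thesis using G by (intro bexI[of _ G]) (auto simp: null_sets_def)
  qed
  with r(1) show ?thesis by (rule that)
qed

lemma measure_square:
  assumes "r > 0" shows "measure lebesgue (square c r) = 4 * r\<^sup>2"
  unfolding square_cbox using assms
  by (simp add: content_cbox_cart interval_eq_empty_cart UNIV_2 power2_eq_square not_less)

text \<open>If u and v differed by more than 2 \<omega> + \<kappa> at one regular point, they would
  differ by more than \<kappa> on almost all of a square around it. In particular that part lies in
  \<Omega>, since both extensions vanish outside. Its area 4 r^2 then contradicts Chebyshev's
  inequality.\<close>

lemma AE_close_of_equicontinuity:
  assumes u: "sqint N u" "sqint N v" and r: "r > 0" and \<kappa>: "\<kappa> > 0"
    and eu: "\<And>c. \<exists>G\<in>null_sets N. \<forall>x\<in>square c r. \<forall>y\<in>square c r. x \<notin> G \<longrightarrow> y \<notin> G \<longrightarrow> \<bar>ext0 u x - ext0 u y\<bar> \<le> \<omega>"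
    and ev: "\<And>c. \<exists>G\<in>null_sets N. \<forall>x\<in>square c r. \<forall>y\<in>square c r. x \<notin> G \<longrightarrow> y \<notin> G \<longrightarrow> \<bar>ext0 v x - ext0 v y\<bar> \<le> \<omega>"
    and small: "nrm2 N (\<lambda>x. u x - v x) < \<kappa> * (2 * r)"
  shows "AE x in N. \<bar>u x - v x\<bar> \<le> 2 * \<omega> + \<kappa>"
proof -
  \<comment> \<open>The equicontinuity holds for each square up to its own null set. Countably many
    squares centred on a grid of mesh r cover the plane, so the null sets can be united.\<close>
  define Z where "Z = (\<lambda>(a::int, b::int). (vector [r * a, r * b] :: real^2)) ` UNIV"
  have "countable Z" by (simp add: Z_def)
  have "AE x in N. x \<in> square c r \<longrightarrow> \<bar>u x - v x\<bar> \<le> 2 * \<omega> + \<kappa>" for c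
  proof -
    obtain G1 where G1: "G1 \<in> null_sets N" "\<And>x y. x \<in> square c r \<Longrightarrow> y \<in> square c r \<Longrightarrow> x \<notin> G1 \<Longrightarrow> y \<notin> G1 \<Longrightarrow> \<bar>ext0 u x - ext0 u y\<bar> \<le> \<omega>"
      using eu[of c] by blast
    obtain G2 where G2: "G2 \<in> null_sets N" "\<And>x y. x \<in> square c r \<Longrightarrow> y \<in> square c r \<Longrightarrow> x \<notin> G2 \<Longrightarrow> y \<notin> G2 \<Longrightarrow> \<bar>ext0 v x - ext0 v y\<bar> \<le> \<omega>"
      using ev[of c] by blast
    define G where "G = G1 \<union> G2"
    have G: "G \<in> null_sets N" unfolding G_def using G1(1) G2(1) by (rule null_sets.Un)
    have *: "\<bar>u x - v x\<bar> \<le> 2 * \<omega> + \<kappa>" if x: "x \<in> \<Omega>" "x \<in> square c r" "x \<notin> G" for x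
    proof (rule ccontr)
      assume n: "\<not> ?thesis"
      define S where "S = {y \<in> \<Omega>. norm (u y - v y) > \<kappa>}"
      note ch = chebyshev_nrm2[OF sqint_diff(1)[OF u] \<kappa>]
      have sub: "square c r \<subseteq> S \<union> G"
      proof
        fix y assume y: "y \<in> square c r"
        show "y \<in> S \<union> G"
        proof (cases "y \<in> G")
          case False
          have "\<bar>ext0 u x - ext0 u y\<bar> \<le> \<omega>" "\<bar>ext0 v x - ext0 v y\<bar> \<le> \<omega>"
            using G1(2)[OF x(2) y] G2(2)[OF x(2) y] x(3) False by (auto simp: G_def)
          moreover have "\<bar>ext0 u x - ext0 v x\<bar> > 2 * \<omega> + \<kappa>" using n x(1) by (simp add: ext0_def)
          ultimately have "\<bar>ext0 u y - ext0 v y\<bar> > \<kappa>" by linarith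
          then show ?thesis using \<kappa> by (auto simp: S_def ext0_def split: if_splits)
        qed simp
      qed
      have sets: "S \<in> sets N" "G \<in> sets N" using ch(1) G by (auto simp: S_def null_sets_def)
      have "4 * r\<^sup>2 = measure lebesgue (square c r)" by (simp add: measure_square[OF r])
      also have "\<dots> \<le> measure lebesgue (S \<union> G)"
      proof (rule measure_mono_fmeasurable[OF sub])
        show "square c r \<in> sets lebesgue" by (simp add: square_cbox)
        have "S \<union> G \<in> sets lebesgue" "S \<union> G \<subseteq> \<Omega>"
          using sets by (auto simp: sets_restrict_space_iff)
        then show "S \<union> G \<in> lmeasurable" using sets_\<Omega>(2) by (meson fmeasurableI2)
      qed
      also have "\<dots> = measure N (S \<union> G)" using sets by (intro measure_N_eq[symmetric]) auto
      also have "\<dots> \<le> measure N S + measure N G" by (rule measure_Un_le[OF sets])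
      also have "measure N G = 0" using G by (simp add: null_sets_def measure_def)
      also have "measure N S \<le> (nrm2 N (\<lambda>x. u x - v x) / \<kappa>)\<^sup>2" unfolding S_def by (rule ch(2))
      also have "(nrm2 N (\<lambda>x. u x - v x) / \<kappa>)\<^sup>2 < (2 * r)\<^sup>2"
        using small \<kappa> by (intro power_strict_mono) (auto simp: field_simps)
      finally show False by (simp add: power2_eq_square)
    qed
    have "AE x in N. x \<notin> G" using G by (rule AE_not_in)
    moreover have "AE x in N. x \<in> \<Omega>" using AE_space[of N] by simp
    ultimately show ?thesis by eventually_elim (use * in blast)
  qed
  then have "AE x in N. \<forall>c\<in>Z. x \<in> square c r \<longrightarrow> \<bar>u x - v x\<bar> \<le> 2 * \<omega> + \<kappa>"
    by (subst AE_ball_countable[OF \<open>countable Z\<close>]) blast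
  then show ?thesis
  proof eventually_elim
    case (elim x)
    define c :: "real^2" where "c = vector [r * of_int \<lfloor>x $ 1 / r\<rfloor>, r * of_int \<lfloor>x $ 2 / r\<rfloor>]"
    have "\<bar>z - r * of_int \<lfloor>z / r\<rfloor>\<bar> \<le> r" for z :: real
    proof -
      have "r * of_int \<lfloor>z / r\<rfloor> \<le> r * (z / r)" "r * (z / r) \<le> r * (of_int \<lfloor>z / r\<rfloor> + 1)"
        using r by (intro mult_left_mono; linarith)+
      then show ?thesis using r by (simp add: algebra_simps)
    qed
    then have "x \<in> square c r" by (auto simp: square_def c_def forall_2)
    moreover have "c \<in> Z" unfolding Z_def c_def by (rule image_eqI[of _ _ "(\<lfloor>x $ 1 / r\<rfloor>, \<lfloor>x $ 2 / r\<rfloor>)"]) auto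
    ultimately show ?case using elim by blast
  qed
qed

end

section \<open>Periodic functions of one variable\<close>

text \<open>The offset from a nearest multiple of p, with values in [- p / 2, p / 2]; in each
  coordinate this is \<open>cell_translate\<close>.\<close>

definition per :: "real \<Rightarrow> real \<Rightarrow> real" where
  "per p y = y - p * of_int (round (y / p))"

lemma abs_per_le:
  assumes "p > 0" shows "\<bar>per p y\<bar> \<le> \<bar>y - p * of_int m\<bar>"
proof -
  have "p * \<bar>y / p - of_int (round (y / p))\<bar> \<le> p * \<bar>y / p - of_int m\<bar>"
    using assms by (intro mult_left_mono round_diff_minimal) auto
  moreover have "p * \<bar>y / p - of_int k\<bar> = \<bar>y - p * of_int k\<bar>" for k
  proof -
    have "p * \<bar>y / p - of_int k\<bar> = \<bar>p * (y / p - of_int k)\<bar>" using assms by (simp add: abs_mult)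
    also have "p * (y / p - of_int k) = y - p * of_int k" using assms by (simp add: algebra_simps)
    finally show ?thesis .
  qed
  ultimately show ?thesis by (simp add: per_def)
qed

lemma abs_per_half: "p > 0 \<Longrightarrow> \<bar>per p y\<bar> \<le> p / 2"
proof -
  assume p: "p > 0"
  have "\<bar>of_int (round (y / p)) - y / p\<bar> \<le> 1 / 2" by (rule of_int_round_abs_le)
  then have "p * \<bar>of_int (round (y / p)) - y / p\<bar> \<le> p * (1 / 2)" using p by (intro mult_left_mono) auto
  moreover have "p * \<bar>of_int (round (y / p)) - y / p\<bar> = \<bar>per p y\<bar>"
  proof -
    have "p * \<bar>of_int (round (y / p)) - y / p\<bar> = \<bar>p * (of_int (round (y / p)) - y / p)\<bar>" using p by (simp add: abs_mult)
    also have "p * (of_int (round (y / p)) - y / p) = - per p y" using p by (simp add: per_def algebra_simps)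
    finally show ?thesis by simp
  qed
  ultimately show ?thesis by simp
qed

lemma abs_per_lipschitz:
  assumes "p > 0" shows "\<bar>per p y\<bar> \<le> \<bar>per p z\<bar> + \<bar>y - z\<bar>"
  using abs_per_le[OF assms, of y "round (z / p)"] by (simp add: per_def)

lemma per_locally:
  assumes "p > 0" "\<bar>per p y\<bar> < p / 2"
  shows "\<exists>U m. open U \<and> y \<in> U \<and> (\<forall>z\<in>U. per p z = z - p * of_int m)"
proof -
  let ?m = "round (y / p)"
  have "per p z = z - p * of_int ?m" if "\<bar>z - p * of_int ?m\<bar> < p / 2" for z
  proof -
    have "\<bar>z / p - of_int ?m\<bar> < 1 / 2"
    proof -
      have "z / p - of_int ?m = (z - p * of_int ?m) / p" using assms by (simp add: field_simps)
      then show ?thesis using that assms by (simp add: abs_divide field_simps)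
    qed
    then have "round (z / p) = ?m" by (rule round_unique')
    then show ?thesis by (simp add: per_def)
  qed
  moreover have "open {z. \<bar>z - p * of_int ?m\<bar> < p / 2}"
    by (intro open_Collect_less continuous_intros)
  moreover have "y \<in> {z. \<bar>z - p * of_int ?m\<bar> < p / 2}" using assms(2) by (simp add: per_def)
  ultimately show ?thesis by blast
qed

lemma per_far_locally:
  assumes "p > 0" "\<bar>per p y\<bar> = p / 2" "q < p / 2"
  shows "\<exists>U. open U \<and> y \<in> U \<and> (\<forall>z\<in>U. q < \<bar>per p z\<bar>)"
proof -
  have "q < \<bar>per p z\<bar>" if "\<bar>y - z\<bar> < p / 2 - q" for z
    using abs_per_lipschitz[OF assms(1), of y z] assms(2) that by linarith
  moreover have "open {z. \<bar>y - z\<bar> < p / 2 - q}"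
    by (intro open_Collect_less continuous_intros)
  ultimately show ?thesis using assms(3) by (intro exI[of _ "{z. \<bar>y - z\<bar> < p / 2 - q}"]) auto
qed

text \<open>\<open>per\<close> is locally a translation except at the half periods, where it jumps.
  A profile that vanishes for arguments of modulus at least q < p / 2 does not see the jumps, so its
  periodic extension inherits its regularity.\<close>

lemma per_cases:
  assumes "p > 0" "q < p / 2"
  shows "(\<exists>U m. open U \<and> y \<in> U \<and> (\<forall>z\<in>U. per p z = z - p * of_int m)) \<or>
    (\<bar>per p y\<bar> = p / 2 \<and> (\<exists>U. open U \<and> y \<in> U \<and> (\<forall>z\<in>U. q < \<bar>per p z\<bar>)))"
proof (cases "\<bar>per p y\<bar> = p / 2")
  case True
  then show ?thesis using per_far_locally[OF assms(1) True assms(2)] by blast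
next
  case False
  then have "\<bar>per p y\<bar> < p / 2" using abs_per_half[OF assms(1), of y] by simp
  then show ?thesis using per_locally[OF assms(1)] by blast
qed

lemma Dk_per:
  assumes h: "\<And>k. Dk k h" and "p > 0" "q < p / 2" "\<And>y. \<bar>y\<bar> \<ge> q \<Longrightarrow> h y = 0"
  shows "Dk k (\<lambda>y. h (per p y))"
proof (rule Dk_local)
  fix y
  show "\<exists>U g. open U \<and> y \<in> U \<and> Dk k g \<and> (\<forall>z\<in>U. h (per p z) = g z)"
    using per_cases[OF assms(2,3), of y]
  proof (elim disjE exE conjE)
    fix U m assume U: "open U" "y \<in> U" "\<forall>z\<in>U. per p z = z - p * of_int m"
    show ?thesis
      by (intro exI[of _ U] exI[of _ "\<lambda>z. h (1 * z + (- p * of_int m))"] conjI U(1,2) Dk_affine h) (use U(3) in auto)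
  next
    fix U assume U: "open U" "y \<in> U" "\<forall>z\<in>U. q < \<bar>per p z\<bar>"
    show ?thesis
      by (intro exI[of _ U] exI[of _ "\<lambda>z. 0"] conjI U(1,2) Dk_const) (use U(3) assms(4) in auto)
  qed
qed

lemma per_has_derivative:
  assumes h: "\<And>y. (h has_real_derivative h' y) (at y)" and "p > 0" "q < p / 2"
    "\<And>y. \<bar>y\<bar> \<ge> q \<Longrightarrow> h y = 0" "\<And>y. \<bar>y\<bar> \<ge> q \<Longrightarrow> h' y = 0"
  shows "((\<lambda>y. h (per p y)) has_real_derivative h' (per p y)) (at y)"
  using per_cases[OF assms(2,3), of y]
proof (elim disjE exE conjE)
  fix U m assume U: "open U" "y \<in> U" "\<forall>z\<in>U. per p z = z - p * of_int m"
  have "((\<lambda>z. z - p * of_int m) has_real_derivative 1) (at y)"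
    by (auto intro!: derivative_eq_intros)
  from DERIV_chain2[OF h this] have "((\<lambda>z. h (z - p * of_int m)) has_real_derivative h' (y - p * of_int m)) (at y)"
    by simp
  then have "((\<lambda>z. h (per p z)) has_real_derivative h' (y - p * of_int m)) (at y)"
    by (rule has_field_derivative_transform_within_open[OF _ U(1,2)]) (use U(3) in auto)
  then show ?thesis using U by simp
next
  fix U assume U: "open U" "y \<in> U" "\<forall>z\<in>U. q < \<bar>per p z\<bar>"
  have "((\<lambda>z. 0) has_real_derivative 0) (at y)" by simp
  then have "((\<lambda>z. h (per p z)) has_real_derivative 0) (at y)"
    by (rule has_field_derivative_transform_within_open[OF _ U(1,2)]) (use U(3) assms(4) in auto)
  then show ?thesis using U(2,3) assms(5)[of "per p y"] by auto
qed

lemma measurable_per [measurable]: "per p \<in> borel_measurable borel"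
  unfolding per_def[abs_def] round_def by measurable

lemma per_eq_cover:
  assumes "p \<ge> 1" "\<epsilon> > 0" "\<bar>z\<bar> \<le> a"
  obtains m :: int where "\<bar>m\<bar> \<le> \<lceil>a / (\<epsilon> * p)\<rceil> + 1" "z = \<epsilon> * (p * of_int m + per p (z / \<epsilon>))"
proof -
  let ?m = "round (z / \<epsilon> / p)"
  have "\<bar>of_int ?m - z / \<epsilon> / p\<bar> \<le> 1 / 2" by (rule of_int_round_abs_le)
  moreover have "\<bar>z / \<epsilon> / p\<bar> \<le> a / (\<epsilon> * p)"
    using assms by (simp add: abs_divide divide_right_mono)
  ultimately have "\<bar>real_of_int ?m\<bar> \<le> a / (\<epsilon> * p) + 1" by linarith
  then have "\<bar>?m\<bar> \<le> \<lceil>a / (\<epsilon> * p)\<rceil> + 1" by linarith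
  moreover have "z = \<epsilon> * (p * of_int ?m + per p (z / \<epsilon>))" using assms by (simp add: per_def)
  ultimately show ?thesis by (rule that)
qed

lemma finite_per_set:
  assumes "p \<ge> 1" "\<epsilon> > 0" "finite D"
  shows "finite ({z. per p (z / \<epsilon>) \<in> D} \<inter> {-a..a})"
proof (rule finite_subset)
  let ?M = "\<lceil>a / (\<epsilon> * p)\<rceil> + 1"
  show "{z. per p (z / \<epsilon>) \<in> D} \<inter> {-a..a} \<subseteq> (\<lambda>(m, d). \<epsilon> * (p * of_int m + d)) ` ({-?M..?M} \<times> D)"
  proof
    fix z assume "z \<in> {z. per p (z / \<epsilon>) \<in> D} \<inter> {-a..a}"
    then have z: "per p (z / \<epsilon>) \<in> D" "\<bar>z\<bar> \<le> a" by auto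
    obtain m where "\<bar>m\<bar> \<le> ?M" "z = \<epsilon> * (p * of_int m + per p (z / \<epsilon>))"
      using per_eq_cover[OF assms(1,2) z(2)] by blast
    then show "z \<in> (\<lambda>(m, d). \<epsilon> * (p * of_int m + d)) ` ({-?M..?M} \<times> D)"
      using z(1) by (intro image_eqI[of _ _ "(m, per p (z / \<epsilon>))"]) auto
  qed
qed (use assms in auto)

text \<open>About 2 L / (\<epsilon> p) strips of width 2 \<epsilon> \<delta> meet the interval, so
  \<epsilon> cancels and the bound is uniform in it. Incomplete periods at the ends go into the
  constant, which is not sharp.\<close>

lemma strip_measure:
  assumes "p \<ge> 1" "0 < \<epsilon>" "\<epsilon> \<le> 1" "L > 0" "\<delta> > 0"
  shows "emeasure lborel {z. \<bar>z\<bar> \<le> L \<and> \<bar>per p (z / \<epsilon>)\<bar> \<le> \<delta>} \<le> ennreal ((4 * L + 14) * \<delta>)"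
proof -
  define M where "M = \<lceil>L / (\<epsilon> * p)\<rceil> + 1"
  have "0 \<le> L / (\<epsilon> * p)" using assms by simp
  then have M: "0 \<le> M" unfolding M_def by linarith
  have "{z. \<bar>z\<bar> \<le> L \<and> \<bar>per p (z / \<epsilon>)\<bar> \<le> \<delta>} \<subseteq> (\<Union>m\<in>{-M..M}. {\<epsilon> * (p * of_int m - \<delta>)..\<epsilon> * (p * of_int m + \<delta>)})"
  proof
    fix z assume "z \<in> {z. \<bar>z\<bar> \<le> L \<and> \<bar>per p (z / \<epsilon>)\<bar> \<le> \<delta>}"
    then have z: "\<bar>z\<bar> \<le> L" "\<bar>per p (z / \<epsilon>)\<bar> \<le> \<delta>" by auto
    obtain m where m: "\<bar>m\<bar> \<le> M" "z = \<epsilon> * (p * of_int m + per p (z / \<epsilon>))"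
      using per_eq_cover[OF assms(1,2) z(1)] unfolding M_def by blast
    have "\<epsilon> * (p * of_int m - \<delta>) \<le> \<epsilon> * (p * of_int m + per p (z / \<epsilon>))"
      "\<epsilon> * (p * of_int m + per p (z / \<epsilon>)) \<le> \<epsilon> * (p * of_int m + \<delta>)"
      using z(2) assms by (auto intro!: mult_left_mono simp: abs_le_iff)
    then have "z \<in> {\<epsilon> * (p * of_int m - \<delta>)..\<epsilon> * (p * of_int m + \<delta>)}"
      using m(2) by simp
    then show "z \<in> (\<Union>m\<in>{-M..M}. {\<epsilon> * (p * of_int m - \<delta>)..\<epsilon> * (p * of_int m + \<delta>)})"
      using m(1) by (intro UN_I[of m]) auto
  qed
  then have "emeasure lborel {z. \<bar>z\<bar> \<le> L \<and> \<bar>per p (z / \<epsilon>)\<bar> \<le> \<delta>}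
     \<le> emeasure lborel (\<Union>m\<in>{-M..M}. {\<epsilon> * (p * of_int m - \<delta>)..\<epsilon> * (p * of_int m + \<delta>)})"
    by (rule emeasure_mono) simp
  also have "\<dots> \<le> (\<Sum>m\<in>{-M..M}. emeasure lborel {\<epsilon> * (p * of_int m - \<delta>)..\<epsilon> * (p * of_int m + \<delta>)})"
    by (rule emeasure_subadditive_finite) auto
  also have "\<dots> = (\<Sum>m\<in>{-M..M}. ennreal (2 * \<epsilon> * \<delta>))"
  proof (rule sum.cong)
    fix m
    have "\<epsilon> * (p * of_int m - \<delta>) \<le> \<epsilon> * (p * of_int m + \<delta>)" using assms by (intro mult_left_mono) auto
    then show "emeasure lborel {\<epsilon> * (p * of_int m - \<delta>)..\<epsilon> * (p * of_int m + \<delta>)} = ennreal (2 * \<epsilon> * \<delta>)"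
      by (simp add: algebra_simps)
  qed simp
  also have "\<dots> = ennreal (\<Sum>m\<in>{-M..M}. 2 * \<epsilon> * \<delta>)"
    using assms by (intro sum_ennreal) auto
  also have "(\<Sum>m\<in>{-M..M}. 2 * \<epsilon> * \<delta>) = (2 * real_of_int M + 1) * (2 * \<epsilon> * \<delta>)"
    using M by (simp add: of_nat_nat)
  also have "\<dots> \<le> ennreal ((4 * L + 14) * \<delta>)"
  proof (rule ennreal_leI)
    have "real_of_int M \<le> L / (\<epsilon> * p) + 2" unfolding M_def by linarith
    then have "\<epsilon> * real_of_int M \<le> \<epsilon> * (L / (\<epsilon> * p) + 2)" using assms by (intro mult_left_mono) auto
    also have "\<dots> = L / p + 2 * \<epsilon>" using assms by (simp add: field_simps)
    also have "\<dots> \<le> L + 2" using assms divide_left_mono[of 1 p L] by simp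
    finally have "\<epsilon> * real_of_int M \<le> L + 2" .
    then have "2 * (2 * (\<epsilon> * real_of_int M) + \<epsilon>) * \<delta> \<le> 2 * (2 * (L + 2) + 1) * \<delta>"
      using assms by (intro mult_right_mono) auto
    then show "(2 * real_of_int M + 1) * (2 * \<epsilon> * \<delta>) \<le> (4 * L + 14) * \<delta>"
      using assms by (simp add: algebra_simps)
  qed
  finally show ?thesis .
qed

text \<open>A primitive of the \<^term>\<open>p\<close>-periodic function equal to \<open>1 / (2 t) - 1 / p\<close> in the strip
  \<open>\<bar>y\<bar> < t\<close> and to \<open>- 1 / p\<close> elsewhere; the mean value zero makes it bounded.\<close>

definition saw :: "real \<Rightarrow> real \<Rightarrow> real \<Rightarrow> real" where
  "saw p t y = (if \<bar>y\<bar> \<le> t then y / (2 * t) else sgn y / 2) - y / p"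

definition saw' :: "real \<Rightarrow> real \<Rightarrow> real \<Rightarrow> real" where
  "saw' p t y = (if \<bar>y\<bar> \<le> t then 1 / (2 * t) else 0) - 1 / p"

lemma saw_clamp: "t > 0 \<Longrightarrow> saw p t y = max (-t) (min t y) / (2 * t) - y / p"
  by (auto simp: saw_def max_def min_def sgn_if field_simps)

lemma saw_continuous: "t > 0 \<Longrightarrow> continuous_on UNIV (saw p t)"
proof -
  assume t: "t > 0"
  define q where "q = 1 / p"
  have "saw p t = (\<lambda>y. max (-t) (min t y) / (2 * t) - y * q)" using t by (auto simp: saw_clamp q_def)
  then show ?thesis using t by (auto intro!: continuous_intros)
qed

lemma saw_has_derivative:
  assumes "t > 0" "y \<noteq> t" "y \<noteq> - t"
  shows "(saw p t has_real_derivative saw' p t y) (at y)"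
proof -
  consider "\<bar>y\<bar> < t" | "y > t" | "y < - t" using assms by linarith
  then show ?thesis
  proof cases
    case 1
    have "((\<lambda>y. y / (2 * t) - y / p) has_real_derivative 1 / (2 * t) - 1 / p) (at y)"
      by (rule DERIV_diff[OF DERIV_cdivide[OF DERIV_ident] DERIV_cdivide[OF DERIV_ident]])
    then have "(saw p t has_real_derivative 1 / (2 * t) - 1 / p) (at y)"
      by (rule has_field_derivative_transform_within_open[of _ _ _ "{-t<..<t}"]) (use 1 in \<open>auto simp: saw_def\<close>)
    with 1 show ?thesis by (simp add: saw'_def)
  next
    case 2
    have "((\<lambda>y. 1 / 2 - y / p) has_real_derivative 0 - 1 / p) (at y)"
      by (rule DERIV_diff[OF DERIV_const DERIV_cdivide[OF DERIV_ident]])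
    then have "(saw p t has_real_derivative 0 - 1 / p) (at y)"
      by (rule has_field_derivative_transform_within_open[of _ _ _ "{t<..}"]) (use 2 assms in \<open>auto simp: saw_def\<close>)
    with 2 assms(1) show ?thesis by (simp add: saw'_def)
  next
    case 3
    have "((\<lambda>y. - 1 / 2 - y / p) has_real_derivative 0 - 1 / p) (at y)"
      by (rule DERIV_diff[OF DERIV_const DERIV_cdivide[OF DERIV_ident]])
    then have "(saw p t has_real_derivative 0 - 1 / p) (at y)"
      by (rule has_field_derivative_transform_within_open[of _ _ _ "{..<-t}"]) (use 3 assms in \<open>auto simp: saw_def\<close>)
    with 3 assms(1) show ?thesis by (simp add: saw'_def)
  qed
qed

text \<open>The second formula shows that the function tends to 0 at both ends of the period, a
  consequence of the mean value zero of its derivative. This is what makes the periodic extension in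
  \<open>saw_per\<close> continuous across the jumps of \<open>per\<close>.\<close>

lemma saw_bounds:
  assumes "0 < t" "t < p / 2" "\<bar>y\<bar> \<le> p / 2"
  shows "\<bar>saw p t y\<bar> \<le> 1" "t < \<bar>y\<bar> \<Longrightarrow> \<bar>saw p t y\<bar> = (p / 2 - \<bar>y\<bar>) / p"
proof -
  have p: "p > 0" using assms by linarith
  have yp: "\<bar>y / p\<bar> \<le> 1 / 2" using assms p by (simp add: abs_divide field_simps)
  have "\<bar>(if \<bar>y\<bar> \<le> t then y / (2 * t) else sgn y / 2)\<bar> \<le> 1 / 2"
    using assms by (auto simp: abs_divide field_simps abs_sgn_eq)
  then show "\<bar>saw p t y\<bar> \<le> 1" using yp unfolding saw_def by linarith
  assume "t < \<bar>y\<bar>"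
  then show "\<bar>saw p t y\<bar> = (p / 2 - \<bar>y\<bar>) / p"
  proof (cases "y > 0")
    case True
    then have "saw p t y = 1 / 2 - y / p" using \<open>t < \<bar>y\<bar>\<close> by (simp add: saw_def)
    then show ?thesis using yp True p by (simp add: diff_divide_distrib)
  next
    case False
    then have "y < 0" using \<open>t < \<bar>y\<bar>\<close> assms by auto
    then have "saw p t y = - 1 / 2 - y / p" using \<open>t < \<bar>y\<bar>\<close> by (simp add: saw_def)
    moreover have "- 1 / 2 - y / p \<le> 0" using yp by linarith
    ultimately have "\<bar>saw p t y\<bar> = 1 / 2 + y / p" by linarith
    moreover have "(p / 2 - \<bar>y\<bar>) / p = 1 / 2 + y / p" using p \<open>y < 0\<close> by (simp add: add_divide_distrib)
    ultimately show ?thesis by simp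
  qed
qed

lemma saw_per:
  assumes t: "0 < t" "t < p / 2" and p: "p \<ge> 1" and \<epsilon>: "\<epsilon> > 0"
  defines "Z \<equiv> \<lambda>z. \<epsilon> * saw p t (per p (z / \<epsilon>))" and "z' \<equiv> \<lambda>z. saw' p t (per p (z / \<epsilon>))"
  shows "continuous_on UNIV Z" "\<And>z. \<bar>Z z\<bar> \<le> \<epsilon>"
    "\<And>a. finite ({z. per p (z / \<epsilon>) \<in> {t, -t, p / 2, - p / 2}} \<inter> {-a..a})"
    "\<And>z. z \<notin> {z. per p (z / \<epsilon>) \<in> {t, -t, p / 2, - p / 2}} \<Longrightarrow> (Z has_real_derivative z' z) (at z)"
    "z' \<in> borel_measurable borel"
proof -
  have p0: "p > 0" using p by simp
  have "isCont (\<lambda>y. saw p t (per p y)) y" for y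
    using per_cases[OF p0 t(2), of y]
  proof (elim disjE exE conjE)
    fix U m assume U: "open U" "y \<in> U" "\<forall>z\<in>U. per p z = z - p * of_int m"
    have "continuous_on U (\<lambda>z. saw p t (z - p * of_int m))"
      by (rule continuous_on_compose2[OF saw_continuous[OF t(1)]]) (auto intro!: continuous_intros)
    then have "continuous_on U (\<lambda>y. saw p t (per p y))"
      by (rule continuous_on_eq) (use U(3) in simp)
    then show ?thesis using continuous_on_eq_continuous_at[OF U(1)] U(2) by blast
  next
    fix U assume y: "\<bar>per p y\<bar> = p / 2" and U: "open U" "y \<in> U" "\<forall>z\<in>U. t < \<bar>per p z\<bar>"
    have y0: "saw p t (per p y) = 0" using saw_bounds(2)[OF t, of "per p y"] y t by simp
    have "\<bar>saw p t (per p z)\<bar> \<le> \<bar>y - z\<bar> / p" if "z \<in> U" for z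
    proof -
      have "\<bar>saw p t (per p z)\<bar> = (p / 2 - \<bar>per p z\<bar>) / p"
        by (rule saw_bounds(2)[OF t abs_per_half[OF p0]]) (use that U in blast)
      also have "\<dots> \<le> \<bar>y - z\<bar> / p"
        using abs_per_lipschitz[OF p0, of y z] y p0 by (intro divide_right_mono) auto
      finally show ?thesis .
    qed
    then have "\<forall>\<^sub>F z in at y. norm (saw p t (per p z)) \<le> \<bar>y - z\<bar> / p"
      using eventually_at_in_open'[OF U(1,2)] by (auto elim: eventually_mono)
    moreover have "((\<lambda>z. \<bar>y - z\<bar> / p) \<longlongrightarrow> \<bar>y - y\<bar> / p) (at y)" using p0 by (intro tendsto_intros) auto
    then have "((\<lambda>z. \<bar>y - z\<bar> / p) \<longlongrightarrow> 0) (at y)" by simp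
    ultimately have "((\<lambda>z. saw p t (per p z)) \<longlongrightarrow> 0) (at y)" by (rule Lim_null_comparison)
    then show ?thesis by (simp add: isCont_def y0)
  qed
  then have "continuous_on UNIV (\<lambda>y. saw p t (per p y))" by (simp add: continuous_at_imp_continuous_on)
  then show "continuous_on UNIV Z" unfolding Z_def
    by (intro continuous_on_mult continuous_on_const continuous_on_compose2[of UNIV "\<lambda>y. saw p t (per p y)" UNIV "\<lambda>z. z / \<epsilon>"])
       (use \<epsilon> in \<open>auto intro!: continuous_intros\<close>)
  show "\<bar>Z z\<bar> \<le> \<epsilon>" for z
    using mult_left_mono[OF saw_bounds(1)[OF t abs_per_half[OF p0, of "z / \<epsilon>"]], of \<epsilon>] \<epsilon> by (simp add: Z_def abs_mult)
  show "finite ({z. per p (z / \<epsilon>) \<in> {t, -t, p / 2, - p / 2}} \<inter> {-a..a})" for a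
    by (rule finite_per_set[OF p \<epsilon>]) simp
  show "(Z has_real_derivative z' z) (at z)" if "z \<notin> {z. per p (z / \<epsilon>) \<in> {t, -t, p / 2, - p / 2}}" for z
  proof -
    let ?y = "z / \<epsilon>"
    have n: "per p ?y \<noteq> t" "per p ?y \<noteq> - t" "\<bar>per p ?y\<bar> \<noteq> p / 2" using that by auto
    with abs_per_half[OF p0, of ?y] have "\<bar>per p ?y\<bar> < p / 2" by simp
    then obtain U m where U: "open U" "?y \<in> U" "\<forall>z\<in>U. per p z = z - p * of_int m"
      using per_locally[OF p0] by blast
    have "((\<lambda>z. z - p * of_int m) has_real_derivative 1) (at ?y)"
      by (auto intro!: derivative_eq_intros)
    moreover have "(saw p t has_real_derivative saw' p t (?y - p * of_int m)) (at (?y - p * of_int m))"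
      using saw_has_derivative[OF t(1) n(1,2)] U by simp
    ultimately have "((\<lambda>z. saw p t (z - p * of_int m)) has_real_derivative saw' p t (?y - p * of_int m) * 1) (at ?y)"
      by (rule DERIV_chain2[rotated])
    then have "((\<lambda>z. saw p t (z - p * of_int m)) has_real_derivative saw' p t (per p ?y)) (at ?y)"
      using U by simp
    then have "((\<lambda>z. saw p t (per p z)) has_real_derivative saw' p t (per p ?y)) (at ?y)"
      by (rule has_field_derivative_transform_within_open[OF _ U(1,2)]) (use U(3) in auto)
    moreover have "((\<lambda>z. z / \<epsilon>) has_real_derivative 1 / \<epsilon>) (at z)"
      by (auto intro!: DERIV_cdivide)
    ultimately have "((\<lambda>z. saw p t (per p (z / \<epsilon>))) has_real_derivative saw' p t (per p ?y) * (1 / \<epsilon>)) (at z)"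
      by (rule DERIV_chain2)
    from DERIV_cmult[OF this, of \<epsilon>] show ?thesis unfolding Z_def z'_def using \<epsilon> by simp
  qed
  show "z' \<in> borel_measurable borel" unfolding z'_def saw'_def by measurable
qed

section \<open>The corrector of the cross-shaped structure\<close>

text \<open>The residual of the corrector: the flux of the approximate field
  \<open>(a - s1 (a + e b), b + s2 (e a - b))\<close> minus the divergence-free target flux. Inside the
  horizontal strip the field \<open>(1, e)\<close> with \<open>e = - B / A\<close> makes the transversal flux vanish, and
  the longitudinal one is \<open>(A\<^sup>2 + B\<^sup>2) / A\<close>.\<close>

lemma corrector_residual:
  fixes a b s1 s2 e A B t a1 b1 K \<kappa> Cs c g1 g2 p q :: real
  assumes t: "0 < t" "t \<le> 1" and \<kappa>: "\<kappa> \<ge> 1" and Cs: "Cs \<ge> 1" and ab: "\<bar>a\<bar> \<le> K" "\<bar>b\<bar> \<le> K"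
    and s: "\<bar>s1\<bar> \<le> Cs" "\<bar>s2\<bar> \<le> Cs" and A: "0 < A" "A \<le> \<kappa> / t" and B: "\<bar>B\<bar> \<le> \<kappa> / t"
    and e: "\<bar>e\<bar> \<le> \<kappa>\<^sup>2" "e * A = - B" and c: "c / (2 * t) = A - e * B"
    and V: "V1 \<Longrightarrow> s1 = 1" "V2 \<Longrightarrow> s2 = 1" "V1 \<Longrightarrow> W1" "V2 \<Longrightarrow> W2" and W: "\<not> W1 \<Longrightarrow> s1 = 0" "\<not> W2 \<Longrightarrow> s2 = 0"
    and a1: "0 < a1" "a1 \<le> \<kappa>" and b1: "\<bar>b1\<bar> \<le> \<kappa>"
    and g: "g1 = (if V1 then 1 / (2 * t) else 0)" "g2 = (if V2 then 1 / (2 * t) else 0)"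
    and pq: "p = (if V1 \<or> V2 then A else a1)" "q = (if V1 \<or> V2 then B else b1)"
  defines "E1 \<equiv> a - s1 * (a + e * b)" and "E2 \<equiv> b + s2 * (e * a - b)"
    and "w \<equiv> (if V1 \<or> V2 then 1 + (if W1 \<and> W2 then 1 / t else 0) else if W1 \<or> W2 then 1 else 0)"
    and "Q \<equiv> 10 * (\<kappa> ^ 3 * Cs * K)"
  shows "\<bar>p * E1 - q * E2 - (a * (a1 + c * g2) - b * b1)\<bar> \<le> Q * w"
    "\<bar>p * E2 + q * E1 - (a * b1 + b * (a1 + c * g1))\<bar> \<le> Q * w"
proof -
  have K: "K \<ge> 0" using ab by linarith
  define u where "u = a + e * b"
  define v where "v = e * a - b"
  define H where "H = \<kappa> ^ 3 * Cs * K"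
  have \<kappa>2: "1 \<le> \<kappa>\<^sup>2" "\<kappa> \<le> \<kappa> ^ 3" "1 \<le> \<kappa> ^ 3" using \<kappa> by (auto simp: one_le_power power_increasing[of 1 3 \<kappa>, simplified])
  have kK: "\<kappa> * K \<le> H"
  proof -
    have "\<kappa> * 1 * K \<le> \<kappa> ^ 3 * Cs * K" using \<kappa>2 \<kappa> Cs K by (intro mult_mono) auto
    then show ?thesis by (simp add: H_def)
  qed
  have H0: "0 \<le> H" using kK K \<kappa> by (meson mult_nonneg_nonneg order_trans zero_le_one)
  have uv: "\<bar>u\<bar> \<le> 2 * (\<kappa>\<^sup>2 * K)" "\<bar>v\<bar> \<le> 2 * (\<kappa>\<^sup>2 * K)"
  proof -
    have 1: "\<bar>e * b\<bar> \<le> \<kappa>\<^sup>2 * K" "\<bar>e * a\<bar> \<le> \<kappa>\<^sup>2 * K" using e ab by (auto simp: abs_mult intro!: mult_mono)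
    have 2: "K \<le> \<kappa>\<^sup>2 * K" using mult_right_mono[OF \<kappa>2(1) K] by simp
    show "\<bar>u\<bar> \<le> 2 * (\<kappa>\<^sup>2 * K)" "\<bar>v\<bar> \<le> 2 * (\<kappa>\<^sup>2 * K)" unfolding u_def v_def using 1 2 ab by linarith+
  qed
  have small: "\<bar>a * a1\<bar> \<le> H" "\<bar>b * b1\<bar> \<le> H" "\<bar>a * b1\<bar> \<le> H" "\<bar>b * a1\<bar> \<le> H"
  proof -
    have "\<bar>z * r\<bar> \<le> H" if "\<bar>z\<bar> \<le> K" "\<bar>r\<bar> \<le> \<kappa>" for z r
    proof -
      have "\<bar>z * r\<bar> \<le> K * \<kappa>" using that K by (auto simp: abs_mult intro!: mult_mono)
      then show ?thesis using kK by (simp add: mult.commute)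
    qed
    then show "\<bar>a * a1\<bar> \<le> H" "\<bar>b * b1\<bar> \<le> H" "\<bar>a * b1\<bar> \<le> H" "\<bar>b * a1\<bar> \<le> H" using ab a1 b1 by auto
  qed
  have prod3: "\<bar>r * \<sigma> * z\<bar> \<le> 2 * (H / \<theta>)" if "\<bar>r\<bar> \<le> \<kappa> / \<theta>" "\<bar>\<sigma>\<bar> \<le> Cs" "\<bar>z\<bar> \<le> 2 * (\<kappa>\<^sup>2 * K)" "\<theta> > 0" for r \<sigma> z \<theta>
  proof -
    have "\<bar>r * \<sigma> * z\<bar> \<le> (\<kappa> / \<theta>) * Cs * (2 * (\<kappa>\<^sup>2 * K))"
      unfolding abs_mult using that Cs \<kappa> K by (intro mult_mono) auto
    also have "\<dots> = 2 * (H / \<theta>)" using that by (simp add: H_def power2_eq_square power3_eq_cube)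
    finally show ?thesis .
  qed
  have big: "\<bar>z * r\<bar> \<le> H / t" if "\<bar>z\<bar> \<le> K" "\<bar>r\<bar> \<le> \<kappa> / t" for z r
  proof -
    have "\<bar>z * r\<bar> \<le> K * (\<kappa> / t)" unfolding abs_mult using that K by (intro mult_mono) auto
    also have "\<dots> = (\<kappa> * K) / t" by simp
    also have "\<dots> \<le> H / t" using kK t by (intro divide_right_mono) auto
    finally show ?thesis .
  qed
  have Ht: "0 \<le> H / t" using H0 t by simp
  have EA: "e * (A * z) = - (B * z)" for z using e(2) by (metis mult.assoc mult_minus_left)
  have QH: "Q = 10 * H" by (simp add: Q_def H_def)
  \<comment> \<open>The excess of order 1 / t, present only where both wide strips meet.\<close>
  define D where "D = (if W1 \<and> W2 then H / t else 0)"
  have D: "0 \<le> D" using Ht by (simp add: D_def)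
  have Qw: "Q * w = 10 * H + 10 * D" if "V1 \<or> V2"
    using that by (auto simp: QH w_def D_def algebra_simps)
  \<comment> \<open>Off the strips all coefficients are bounded. In exactly one strip the terms of
    order 1 / t cancel by e A = -B, except those carrying the cut-off of the other direction, which
    vanishes unless the wide strips meet. In a crossing both corrections act at full strength and
    terms of order 1 / t remain.\<close>
  consider (none) "\<not> V1" "\<not> V2" | (hor) "V2" "\<not> V1" | (ver) "V1" "\<not> V2" | (both) V1 V2 by blast
  then have "\<bar>p * E1 - q * E2 - (a * (a1 + c * g2) - b * b1)\<bar> \<le> Q * w \<and>
    \<bar>p * E2 + q * E1 - (a * b1 + b * (a1 + c * g1))\<bar> \<le> Q * w"
  proof cases
    case none
    have w: "p = a1" "q = b1" "g1 = 0" "g2 = 0"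
      using none by (simp_all add: pq g)
    have R: "p * E1 - q * E2 - (a * (a1 + c * g2) - b * b1) = - (a1 * s1 * u) - b1 * s2 * v"
      "p * E2 + q * E1 - (a * b1 + b * (a1 + c * g1)) = a1 * s2 * v - b1 * s1 * u"
      unfolding w E1_def E2_def u_def v_def by (simp_all add: algebra_simps)
    have X: "\<bar>a1 * s1 * u\<bar> \<le> 2 * (H / 1)" "\<bar>b1 * s2 * v\<bar> \<le> 2 * (H / 1)"
      "\<bar>a1 * s2 * v\<bar> \<le> 2 * (H / 1)" "\<bar>b1 * s1 * u\<bar> \<le> 2 * (H / 1)"
      by (rule prod3; use a1 b1 s uv in simp)+
    show ?thesis
    proof (cases "W1 \<or> W2")
      case True
      then have "Q * w = 10 * H" using none by (simp add: w_def QH)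
      then show ?thesis unfolding R using X H0 unfolding abs_le_iff by (elim conjE, intro conjI; linarith)
    next
      case False
      then show ?thesis unfolding R using none W by (simp add: w_def)
    qed
  next
    case hor
    have v: "p = A" "q = B" "c * g2 = A - e * B" "c * g1 = 0" "s2 = 1"
      using hor c V(2) by (simp_all add: pq g)
    have R1: "p * E1 - q * E2 - (a * (a1 + c * g2) - b * b1) = - (A * s1 * u) - a * a1 + b * b1"
      unfolding v E1_def E2_def u_def by (simp add: algebra_simps)
    have "p * E2 + q * E1 - (a * b1 + b * (a1 + c * g1)) = - (B * s1 * u) - a * b1 - b * a1 + (e * (A * a) + B * a)"
      unfolding v E1_def E2_def u_def by (simp add: algebra_simps)
    then have R2: "p * E2 + q * E1 - (a * b1 + b * (a1 + c * g1)) = - (B * s1 * u) - a * b1 - b * a1"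
      unfolding EA by simp
    have "\<bar>A * s1 * u\<bar> \<le> 2 * (H / t)" "\<bar>B * s1 * u\<bar> \<le> 2 * (H / t)"
      by (rule prod3; use A B s uv t in simp)+
    moreover have "\<not> W1 \<Longrightarrow> s1 = 0" "W2" using W V hor by blast+
    ultimately have X: "\<bar>A * s1 * u\<bar> \<le> 2 * D" "\<bar>B * s1 * u\<bar> \<le> 2 * D"
      by (cases W1; simp add: D_def)+
    show ?thesis unfolding R1 R2 Qw[OF disjI2[OF hor(1)]] using X D H0 small unfolding abs_le_iff by (elim conjE, intro conjI; linarith)
  next
    case ver
    have v: "p = A" "q = B" "c * g1 = A - e * B" "c * g2 = 0" "s1 = 1"
      using ver c V(1) by (simp_all add: pq g)
    have "p * E1 - q * E2 - (a * (a1 + c * g2) - b * b1) = - (B * s2 * v) - a * a1 + b * b1 - (e * (A * b) + B * b)"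
      unfolding v E1_def E2_def v_def by (simp add: algebra_simps)
    then have R1: "p * E1 - q * E2 - (a * (a1 + c * g2) - b * b1) = - (B * s2 * v) - a * a1 + b * b1"
      unfolding EA by simp
    have R2: "p * E2 + q * E1 - (a * b1 + b * (a1 + c * g1)) = A * s2 * v - a * b1 - b * a1"
      unfolding v E1_def E2_def v_def by (simp add: algebra_simps)
    have "\<bar>A * s2 * v\<bar> \<le> 2 * (H / t)" "\<bar>B * s2 * v\<bar> \<le> 2 * (H / t)"
      by (rule prod3; use A B s uv t in simp)+
    moreover have "\<not> W2 \<Longrightarrow> s2 = 0" "W1" using W V ver by blast+
    ultimately have X: "\<bar>A * s2 * v\<bar> \<le> 2 * D" "\<bar>B * s2 * v\<bar> \<le> 2 * D"
      by (cases W2; simp add: D_def)+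
    show ?thesis unfolding R1 R2 Qw[OF disjI1[OF ver(1)]] using X D H0 small unfolding abs_le_iff by (elim conjE, intro conjI; linarith)
  next
    case both
    have v: "p = A" "q = B" "c * g1 = A - e * B" "c * g2 = A - e * B" "s1 = 1" "s2 = 1"
      using both c V(1,2) by (simp_all add: pq g)
    have "p * E1 - q * E2 - (a * (a1 + c * g2) - b * b1) = b * B - a * A - a * a1 + b * b1 - (e * (A * b) + B * b)"
      unfolding v E1_def E2_def by (simp add: algebra_simps)
    then have R1: "p * E1 - q * E2 - (a * (a1 + c * g2) - b * b1) = b * B - a * A - a * a1 + b * b1"
      unfolding EA by simp
    have "p * E2 + q * E1 - (a * b1 + b * (a1 + c * g1)) = - (a * B) - b * A - a * b1 - b * a1 + (e * (A * a) + B * a)"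
      unfolding v E1_def E2_def by (simp add: algebra_simps)
    then have R2: "p * E2 + q * E1 - (a * b1 + b * (a1 + c * g1)) = - (a * B) - b * A - a * b1 - b * a1"
      unfolding EA by simp
    have "\<bar>b * B\<bar> \<le> H / t" "\<bar>a * A\<bar> \<le> H / t" "\<bar>a * B\<bar> \<le> H / t" "\<bar>b * A\<bar> \<le> H / t"
      by (rule big; use A B ab in simp)+
    moreover have "W1" "W2" using V both by blast+
    ultimately have X: "\<bar>b * B\<bar> \<le> D" "\<bar>a * A\<bar> \<le> D" "\<bar>a * B\<bar> \<le> D" "\<bar>b * A\<bar> \<le> D"
      by (simp_all add: D_def)
    show ?thesis unfolding R1 R2 Qw[OF disjI1[OF both(1)]] using X D H0 small unfolding abs_le_iff by (elim conjE, intro conjI; linarith)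
  qed
  then show "\<bar>p * E1 - q * E2 - (a * (a1 + c * g2) - b * b1)\<bar> \<le> Q * w"
    "\<bar>p * E2 + q * E1 - (a * b1 + b * (a1 + c * g1))\<bar> \<le> Q * w" by blast+
qed

text \<open>A residual of size w, tested against the energy, costs w^2 / \<alpha>. In the strips
  \<alpha> is at least of order 1 / t, so the size 1 + 1 / t near a crossing costs only 1 / t there,
  and size 1 costs less than 1 elsewhere, up to constants. The density \<rho> records these
  costs.\<close>

lemma residual_weight:
  fixes t \<kappa> A a1 eps :: real
  assumes t: "0 < t" "t \<le> 1" and \<kappa>: "\<kappa> \<ge> 1" and A: "1 / (\<kappa> * t) \<le> A" and a1: "1 / \<kappa> \<le> a1" and eps: "0 \<le> eps"
    and V: "V1 \<Longrightarrow> W1" "V2 \<Longrightarrow> W2"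
  defines "w \<equiv> (if V1 \<or> V2 then 1 + (if W1 \<and> W2 then 1 / t else 0) else if W1 \<or> W2 then 1 else 0)"
    and "\<alpha> \<equiv> (if V1 \<or> V2 then A else a1)"
    and "\<rho> \<equiv> of_bool W1 + of_bool W2 + of_bool (W1 \<and> W2) / t + eps\<^sup>2"
  shows "(w + eps)\<^sup>2 \<le> 6 * \<kappa> * (\<alpha> * \<rho>)"
proof (cases "V1 \<or> V2")
  case True
  define x where "x = (if W1 \<and> W2 then 1 / t else 0)"
  have x: "x\<^sup>2 \<le> x / t" "0 \<le> x" using t by (auto simp: x_def power2_eq_square)
  have \<rho>: "1 + x + eps\<^sup>2 \<le> \<rho>" using True V by (auto simp: \<rho>_def x_def)
  have "(w + eps)\<^sup>2 = (1 + x + eps)\<^sup>2" using True by (simp add: w_def x_def)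
  also have "\<dots> \<le> 3 * (1 + x\<^sup>2 + eps\<^sup>2)"
    using zero_le_power2[of "1 - x"] zero_le_power2[of "1 - eps"] zero_le_power2[of "x - eps"]
    by (simp add: power2_eq_square algebra_simps)
  also have "\<dots> \<le> 3 * (1 / t + x / t + eps\<^sup>2 / t)"
  proof -
    have "1 \<le> 1 / t" "eps\<^sup>2 \<le> eps\<^sup>2 / t"
      using t mult_right_mono[of t 1 "eps\<^sup>2"] by (auto simp: field_simps)
    then show ?thesis using x by simp
  qed
  also have "\<dots> = 3 * ((1 + x + eps\<^sup>2) / t)" by (simp add: add_divide_distrib)
  also have "\<dots> \<le> 3 * (\<rho> / t)" using \<rho> t by (intro mult_left_mono divide_right_mono) auto
  also have "\<rho> / t \<le> \<kappa> * (A * \<rho>)"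
  proof -
    have "0 \<le> \<rho>" using \<rho> x by (smt (verit) zero_le_power2)
    moreover have "1 / t \<le> \<kappa> * A" using A t \<kappa> by (simp add: field_simps)
    ultimately have "(1 / t) * \<rho> \<le> (\<kappa> * A) * \<rho>" by (intro mult_right_mono)
    then show ?thesis by (simp add: mult.assoc)
  qed
  also have "3 * (\<kappa> * (A * \<rho>)) \<le> 6 * \<kappa> * (\<alpha> * \<rho>)"
  proof -
    have "0 \<le> \<rho>" using \<rho> x by (smt (verit) zero_le_power2)
    then have "0 \<le> \<kappa> * (A * \<rho>)" using \<open>\<rho> / t \<le> \<kappa> * (A * \<rho>)\<close> t
      by (meson divide_nonneg_pos order_trans)
    moreover have "6 * \<kappa> * (\<alpha> * \<rho>) = 6 * (\<kappa> * (A * \<rho>))" using True by (simp add: \<alpha>_def)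
    ultimately show ?thesis by linarith
  qed
  finally show ?thesis by simp
next
  case False
  have w: "w = of_bool (W1 \<or> W2)" using False by (auto simp: w_def)
  have "(w + eps)\<^sup>2 \<le> 2 * (w\<^sup>2 + eps\<^sup>2)"
    using zero_le_power2[of "w - eps"] by (simp add: power2_eq_square algebra_simps)
  also have "w\<^sup>2 + eps\<^sup>2 \<le> \<rho>" using t by (auto simp: w \<rho>_def)
  finally have 1: "(w + eps)\<^sup>2 \<le> 2 * \<rho>" by simp
  then have \<rho>0: "0 \<le> \<rho>" by (smt (verit) zero_le_power2)
  have "1 \<le> \<kappa> * a1" using a1 \<kappa> by (simp add: field_simps)
  then have "1 * \<rho> \<le> (\<kappa> * a1) * \<rho>" using \<rho>0 by (intro mult_right_mono)
  then show ?thesis using 1 False \<rho>0 by (simp add: \<alpha>_def mult.assoc)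
qed

section \<open>The coefficient matrices and their ellipticity\<close>

lemma grad_coord: "grad (\<lambda>x. x $ i) x = axis i 1"
proof (rule grad_eqI)
  show "((\<lambda>x. x $ i) has_derivative (\<lambda>v. axis i 1 \<bullet> v)) (at x)"
    using bounded_linear_imp_has_derivative[OF bounded_linear_vec_nth]
    by (simp add: inner_axis')
qed

lemma mv_vec2: "((vector [vector [p, q], vector [r, s]] :: real^2^2) *v \<xi>) $ 1 = p * \<xi> $ 1 + q * \<xi> $ 2"
  "((vector [vector [p, q], vector [r, s]] :: real^2^2) *v \<xi>) $ 2 = r * \<xi> $ 1 + s * \<xi> $ 2"
  by (simp_all add: matrix_vector_mult_def sum_2)

lemma hall_mv: "(hall_matrix \<alpha> \<beta> h *v \<xi>) $ 1 = \<alpha> * \<xi> $ 1 - (\<beta> * h) * \<xi> $ 2"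
  "(hall_matrix \<alpha> \<beta> h *v \<xi>) $ 2 = \<alpha> * \<xi> $ 2 + (\<beta> * h) * \<xi> $ 1"
  by (simp_all add: hall_matrix_def J_def matrix_vector_mult_def sum_2 mat_def)

lemma inner_2: "x \<bullet> y = x $ 1 * y $ 1 + x $ 2 * y $ 2" for x y :: "real^2"
  by (simp add: inner_vec_def sum_2)

lemma norm_2: "(norm x)\<^sup>2 = (x $ 1)\<^sup>2 + (x $ 2)\<^sup>2" for x :: "real^2"
  by (simp only: power2_norm_eq_inner inner_2) (simp add: power2_eq_square)

text \<open>J is skew, so the Hall term drops out of the quadratic form. This makes the lower
  ellipticity bound independent of h and turns energies into weighted Dirichlet integrals.\<close>

lemma hall_inner: "(hall_matrix \<alpha> \<beta> h *v \<xi>) \<bullet> \<xi> = \<alpha> * (norm \<xi>)\<^sup>2"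
  unfolding inner_2 norm_2 hall_mv by (simp add: power2_eq_square algebra_simps)

lemma hall_norm: "norm (hall_matrix \<alpha> \<beta> h *v \<xi>) \<le> (\<bar>\<alpha>\<bar> + \<bar>\<beta> * h\<bar>) * norm \<xi>"
proof -
  have "(norm (hall_matrix \<alpha> \<beta> h *v \<xi>))\<^sup>2 = (\<alpha>\<^sup>2 + (\<beta> * h)\<^sup>2) * (norm \<xi>)\<^sup>2"
    unfolding norm_2 hall_mv by (simp add: power2_eq_square algebra_simps)
  also have "\<dots> \<le> (\<bar>\<alpha>\<bar> + \<bar>\<beta> * h\<bar>)\<^sup>2 * (norm \<xi>)\<^sup>2"
    by (intro mult_right_mono) (auto simp: power2_sum)
  also have "\<dots> = ((\<bar>\<alpha>\<bar> + \<bar>\<beta> * h\<bar>) * norm \<xi>)\<^sup>2" by (simp add: power_mult_distrib)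
  finally show ?thesis by (rule power2_le_imp_le) simp
qed

lemma cell_translate_nth: "cell_translate l x $ 1 = per l (x $ 1)" "cell_translate l x $ 2 = per 1 (x $ 2)"
  by (simp_all add: cell_translate_def per_def)

lemma measurable_nth [measurable]: "(\<lambda>x::real^2. x $ i) \<in> borel_measurable borel"
  by (intro borel_measurable_continuous_onI continuous_intros)

lemma cross_conductivity_measurable:
  "(\<lambda>x. cross_conductivity l t \<alpha>1 \<beta>1 \<alpha>2 \<beta>2 h (x /\<^sub>R eps)) \<in> borel_measurable borel"
proof -
  have m: "(\<lambda>x. per l ((x /\<^sub>R eps) $ 1)) \<in> borel_measurable borel" "(\<lambda>x. per 1 ((x /\<^sub>R eps) $ 2)) \<in> borel_measurable borel"
    by (auto intro!: measurable_compose[OF _ measurable_per] borel_measurable_continuous_onI continuous_intros)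
  have "{x \<in> space borel. cell_translate l (x /\<^sub>R eps) \<in> cross l t} \<in> sets borel"
    unfolding cross_def cell_def mem_Collect_eq cell_translate_nth
    using m by measurable
  then show ?thesis
    unfolding cross_conductivity_def by (intro measurable_If) auto
qed

lemma cross_conductivity_elliptic:
  assumes "\<alpha>1 > 0" "\<alpha>2 > 0"
  shows "elliptic (\<lambda>x. cross_conductivity l t \<alpha>1 \<beta>1 \<alpha>2 \<beta>2 h (x /\<^sub>R eps)) (min \<alpha>1 \<alpha>2)
    (max (\<bar>\<alpha>1\<bar> + \<bar>\<beta>1 * h\<bar>) (\<bar>\<alpha>2\<bar> + \<bar>\<beta>2 * h\<bar>))"
proof -
  have "min \<alpha>1 \<alpha>2 * (norm \<xi>)\<^sup>2 \<le> \<alpha>1 * (norm \<xi>)\<^sup>2" "min \<alpha>1 \<alpha>2 * (norm \<xi>)\<^sup>2 \<le> \<alpha>2 * (norm \<xi>)\<^sup>2" for \<xi> :: "real^2"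
    by (auto intro!: mult_right_mono)
  moreover have "norm (hall_matrix \<alpha>1 \<beta>1 h *v \<xi>) \<le> max (\<bar>\<alpha>1\<bar> + \<bar>\<beta>1 * h\<bar>) (\<bar>\<alpha>2\<bar> + \<bar>\<beta>2 * h\<bar>) * norm \<xi>"
    "norm (hall_matrix \<alpha>2 \<beta>2 h *v \<xi>) \<le> max (\<bar>\<alpha>1\<bar> + \<bar>\<beta>1 * h\<bar>) (\<bar>\<alpha>2\<bar> + \<bar>\<beta>2 * h\<bar>) * norm \<xi>" for \<xi>
    by (rule order_trans[OF hall_norm], rule mult_right_mono, simp, simp)+
  ultimately show ?thesis
    unfolding elliptic_def
    using assms cross_conductivity_measurable[of l t \<alpha>1 \<beta>1 \<alpha>2 \<beta>2 h eps]
    by (auto simp: cross_conductivity_def hall_inner)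
qed

context bdd_domain
begin

text \<open>Three orders are recorded because \<open>osc_by_parts\<close> takes two derivatives of a
  component of \<open>grad \<phi>\<close>.\<close>

definition bounded_test :: "(real^2 \<Rightarrow> real) \<Rightarrow> real \<Rightarrow> bool" where
  "bounded_test \<phi> K \<longleftrightarrow> \<phi> \<in> T \<and> (\<forall>x i. \<bar>grad \<phi> x $ i\<bar> \<le> K) \<and> (\<forall>x i j. \<bar>grad (\<lambda>x. grad \<phi> x $ i) x $ j\<bar> \<le> K) \<and>
    (\<forall>x i j k. \<bar>grad (\<lambda>x. grad (\<lambda>x. grad \<phi> x $ i) x $ j) x $ k\<bar> \<le> K)"

end

text \<open>One member of the sequence, with h absorbed into b1 and B. The constant \<kappa> bounds
  the quantities that converge, namely t A and t B, and the fixed a1 and b1; estimates in terms of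
  \<kappa> and Cs are then uniform in n. The bound t < 1/8 keeps the wide strips of half-width 4 t
  inside a period.\<close>

locale cross_corrector = bdd_domain +
  fixes l t eps a1 b1 A B \<kappa> Cs :: real and S S' :: "real \<Rightarrow> real"
  assumes l: "l \<ge> 1" and t: "0 < t" "t < 1/8" and eps: "0 < eps" "eps \<le> 1"
    and \<kappa>: "\<kappa> \<ge> 1" and a1: "1 / \<kappa> \<le> a1" "a1 \<le> \<kappa>" and b1: "\<bar>b1\<bar> \<le> \<kappa>"
    and A: "1 / (\<kappa> * t) \<le> A" "A \<le> \<kappa> / t" and B: "\<bar>B\<bar> \<le> \<kappa> / t"
    and S: "\<And>k. Dk k S" "\<And>y. (S has_real_derivative S' y) (at y)"
      "\<And>y. \<bar>y\<bar> \<le> 1 \<Longrightarrow> S' y = 1" "\<And>y. \<bar>y\<bar> \<ge> 4 \<Longrightarrow> S y = 0" "\<And>y. \<bar>y\<bar> \<ge> 4 \<Longrightarrow> S' y = 0"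
      "\<And>y. \<bar>S y\<bar> \<le> Cs" "\<And>y. \<bar>S' y\<bar> \<le> Cs" "Cs \<ge> 1"
begin

lemma A_pos: "A > 0"
  using A \<kappa> t by (smt (verit) divide_pos_pos mult_pos_pos)

lemma a1_pos: "a1 > 0"
  using a1 \<kappa> by (smt (verit) divide_pos_pos)

definition e :: real where "e = - B / A"
text \<open>A - e B = (A^2 + B^2) / A is the flux of the field (1, e) along a horizontal strip.
  Multiplied by the width 2 t it becomes the flux per unit height, which converges although A does
  not.\<close>

definition c :: real where "c = 2 * t * (A - e * B)"
definition pr :: "2 \<Rightarrow> real" where "pr i = (if i = 1 then l else 1)"
definition yy :: "2 \<Rightarrow> real^2 \<Rightarrow> real" where "yy i x = per (pr i) (x $ i / eps)"
definition sv :: "2 \<Rightarrow> real^2 \<Rightarrow> real" where "sv i x = S' (yy i x / t)"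
text \<open>The periodic corrector profile: of size eps t, with a derivative that is 1 in the strips
  and 0 off the wide strips.\<close>

definition X :: "2 \<Rightarrow> real \<Rightarrow> real" where "X i z = eps * (t * S (per (pr i) (z / eps) / t))"
text \<open>The index is the transversal coordinate: \<open>strip 1\<close> is the union of the
  vertical strips, \<open>strip 2\<close> that of the horizontal ones.\<close>

definition strip :: "2 \<Rightarrow> real^2 \<Rightarrow> bool" where "strip i x \<longleftrightarrow> \<bar>yy i x\<bar> \<le> t"
definition wide :: "2 \<Rightarrow> real^2 \<Rightarrow> bool" where "wide i x \<longleftrightarrow> \<bar>yy i x\<bar> \<le> 4 * t"
definition sig :: "real^2 \<Rightarrow> real^2^2" where "sig x = cross_conductivity l t a1 b1 A B 1 (x /\<^sub>R eps)"
text \<open>Excludes the lines at half periods. There \<open>cell_translate\<close> lies outside the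
  open cell, so the conductivity need not be described by \<open>strip\<close>.\<close>

definition good :: "real^2 \<Rightarrow> bool" where "good x \<longleftrightarrow> (\<forall>i. \<bar>yy i x\<bar> \<noteq> pr i / 2)"

lemma e_props: "e * A = - B" "\<bar>e\<bar> \<le> \<kappa>\<^sup>2"
proof -
  show "e * A = - B" using A_pos by (simp add: e_def)
  have "\<bar>B\<bar> \<le> \<kappa>\<^sup>2 * (1 / (\<kappa> * t))" using B \<kappa> t by (simp add: power2_eq_square)
  also have "\<dots> \<le> \<kappa>\<^sup>2 * A" using A by (intro mult_left_mono) auto
  finally show "\<bar>e\<bar> \<le> \<kappa>\<^sup>2" using A_pos by (simp add: e_def abs_divide field_simps)
qed

lemma pr_ge1: "pr i \<ge> 1" and pr_pos: "pr i > 0"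
  using l by (auto simp: pr_def)

lemma t4: "4 * t < pr i / 2"
  using t pr_ge1[of i] by simp

lemma X_Dk: "Dk k (X i)"
proof -
  have "Dk k (\<lambda>y. t * S ((1 / t) * y + 0))" for k by (intro Dk_mult Dk_const Dk_affine S)
  then have h: "\<And>k. Dk k (\<lambda>y. t * S (y / t))" by simp
  have "Dk k (\<lambda>y. t * S (per (pr i) y / t))"
    by (rule Dk_per[OF h pr_pos t4]) (use t S(4) in \<open>auto simp: field_simps\<close>)
  then have "Dk k (\<lambda>z. t * S (per (pr i) ((1 / eps) * z + 0) / t))" by (rule Dk_affine)
  then have "Dk k (\<lambda>z. t * S (per (pr i) (z / eps) / t))" by simp
  from Dk_mult[OF Dk_const[of k eps] this] show ?thesis by (simp add: X_def[abs_def])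
qed

lemma X_derivative: "(X i has_real_derivative S' (per (pr i) (z / eps) / t)) (at z)"
proof -
  have h: "((\<lambda>y. t * S (y / t)) has_real_derivative S' (y / t)) (at y)" for y
  proof -
    have "((\<lambda>y. y / t) has_real_derivative 1 / t) (at y)" by (rule DERIV_cdivide[OF DERIV_ident])
    from DERIV_cmult[OF DERIV_chain2[OF S(2) this], of t] show ?thesis using t by simp
  qed
  have p: "((\<lambda>y. t * S (per (pr i) y / t)) has_real_derivative S' (per (pr i) y / t)) (at y)" for y
    by (rule per_has_derivative[OF h pr_pos t4]) (use t S(4,5) in \<open>auto simp: field_simps\<close>)
  have "((\<lambda>z. z / eps) has_real_derivative 1 / eps) (at z)" by (rule DERIV_cdivide[OF DERIV_ident])
  from DERIV_cmult[OF DERIV_chain2[OF p this], of eps] show ?thesis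
    using eps by (simp add: X_def[abs_def])
qed

lemma X_bound: "\<bar>X i z\<bar> \<le> eps * t * Cs"
  using S(6)[of "per (pr i) (z / eps) / t"] eps t by (simp add: X_def abs_mult mult.assoc mult_left_mono)

lemma X_smooth: "smooth (\<lambda>x. X i (x $ i))"
  by (rule smooth_comp[OF X_Dk smooth_coord])

lemma X_grad: "grad (\<lambda>x. X i (x $ i)) x = sv i x *\<^sub>R axis i 1"
  by (subst grad_comp(2)[OF smooth_differentiable[OF smooth_coord] X_derivative])
     (simp add: grad_coord sv_def yy_def)

lemma AE_good: "AE x in lebesgue. good x"
proof -
  define D where "D i = {z. per (pr i) (z / eps) \<in> {pr i / 2, - (pr i / 2)}}" for i
  have "countable (D i)" for i
  proof -
    have "D i = (\<Union>n::nat. D i \<inter> {- real n..real n})"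
    proof
      show "D i \<subseteq> (\<Union>n::nat. D i \<inter> {- real n..real n})"
      proof
        fix z assume "z \<in> D i"
        moreover obtain n :: nat where "\<bar>z\<bar> \<le> real n" using real_arch_simple by blast
        ultimately have "z \<in> D i \<inter> {- real n..real n}" by (auto simp: abs_le_iff)
        then show "z \<in> (\<Union>n::nat. D i \<inter> {- real n..real n})" by blast
      qed
    qed auto
    also have "countable \<dots>"
      unfolding D_def
      by (rule countable_UN, simp, rule countable_finite, rule finite_per_set[OF pr_ge1 eps(1)], simp)
    finally show ?thesis .
  qed
  then have "(\<Union>z\<in>D i. {x::real^2. x $ i = z}) \<in> null_sets lebesgue" for i
    using negligible_standard_hyperplane[of "axis i (1::real)"]
    by (intro null_sets_UN') (auto simp: negligible_iff_null_sets inner_axis axis_in_Basis_iff inner_real_def)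
  then have "AE x in lebesgue. x \<notin> (\<Union>z\<in>D i. {x::real^2. x $ i = z})" for i by (rule AE_not_in)
  then have "AE x in lebesgue. \<forall>i. x $ i \<notin> D i"
    by (subst AE_all_countable) auto
  then show ?thesis
  proof eventually_elim
    case (elim x)
    have "\<bar>yy i x\<bar> \<noteq> pr i / 2" for i
    proof -
      have "yy i x \<noteq> pr i / 2 \<and> yy i x \<noteq> - (pr i / 2)"
        using elim[rule_format, of i] by (simp add: D_def yy_def)
      then show ?thesis by linarith
    qed
    then show ?case by (simp add: good_def)
  qed
qed

lemma AE_good_N: "AE x in N. good x"
  by (subst AE_restrict_space_iff) (use AE_good in \<open>auto elim: eventually_mono\<close>)

lemma sig_mv:
  assumes "good x"
  shows "(sig x *v \<xi>) $ 1 = (if strip 1 x \<or> strip 2 x then A else a1) * \<xi> $ 1 - (if strip 1 x \<or> strip 2 x then B else b1) * \<xi> $ 2"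
    "(sig x *v \<xi>) $ 2 = (if strip 1 x \<or> strip 2 x then A else a1) * \<xi> $ 2 + (if strip 1 x \<or> strip 2 x then B else b1) * \<xi> $ 1"
    "(sig x *v \<xi>) \<bullet> \<xi> = (if strip 1 x \<or> strip 2 x then A else a1) * (norm \<xi>)\<^sup>2"
proof -
  have y: "yy 1 x = per l (x $ 1 / eps)" "yy 2 x = per 1 (x $ 2 / eps)"
    by (simp_all add: yy_def pr_def)
  have "\<bar>yy 1 x\<bar> \<noteq> pr 1 / 2" "\<bar>yy 2 x\<bar> \<noteq> pr 2 / 2"
    using assms unfolding good_def by blast+
  then have n: "\<bar>per l (x $ 1 / eps)\<bar> < l / 2" "\<bar>per 1 (x $ 2 / eps)\<bar> < 1 / 2"
    using abs_per_half[of l "x $ 1 / eps"] abs_per_half[of 1 "x $ 2 / eps"] l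
    by (auto simp: y pr_def order.strict_iff_order)
  have d: "(x /\<^sub>R eps) $ i = x $ i / eps" for i by (simp add: field_simps)
  have "cell_translate l (x /\<^sub>R eps) \<in> cross l t \<longleftrightarrow> strip 1 x \<or> strip 2 x"
    unfolding cross_def cell_def mem_Collect_eq cell_translate_nth d strip_def y
    using n by auto
  then show "(sig x *v \<xi>) $ 1 = (if strip 1 x \<or> strip 2 x then A else a1) * \<xi> $ 1 - (if strip 1 x \<or> strip 2 x then B else b1) * \<xi> $ 2"
    "(sig x *v \<xi>) $ 2 = (if strip 1 x \<or> strip 2 x then A else a1) * \<xi> $ 2 + (if strip 1 x \<or> strip 2 x then B else b1) * \<xi> $ 1"
    "(sig x *v \<xi>) \<bullet> \<xi> = (if strip 1 x \<or> strip 2 x then A else a1) * (norm \<xi>)\<^sup>2"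
    unfolding sig_def cross_conductivity_def by (auto simp: hall_mv hall_inner)
qed

text \<open>With (a, b) the gradient of \<phi>, this is \<phi> + X 2 (e a - b) - X 1 (a + e b). In a
  horizontal strip the added gradient replaces b by e a, giving a multiple of (1, e); in a vertical
  one it replaces a by - e b, giving a multiple of (- e, 1).\<close>

definition corr :: "(real^2 \<Rightarrow> real) \<Rightarrow> real^2 \<Rightarrow> real" where
  "corr \<phi> x = \<phi> x + ((e * X 2 (x $ 2) - X 1 (x $ 1)) * grad \<phi> x $ 1 - (X 2 (x $ 2) + e * X 1 (x $ 1)) * grad \<phi> x $ 2)"

lemma osc_smooth:
  "smooth (\<lambda>x. e * X 2 (x $ 2) - X 1 (x $ 1))" "smooth (\<lambda>x. X 2 (x $ 2) + e * X 1 (x $ 1))"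
  by (intro smooth_diff smooth_add smooth_mult smooth_const X_smooth)+

lemma osc_grad:
  "grad (\<lambda>x. e * X 2 (x $ 2) - X 1 (x $ 1)) x = (e * sv 2 x) *\<^sub>R axis 2 1 - sv 1 x *\<^sub>R axis 1 1"
  "grad (\<lambda>x. X 2 (x $ 2) + e * X 1 (x $ 1)) x = sv 2 x *\<^sub>R axis 2 1 + (e * sv 1 x) *\<^sub>R axis 1 1"
proof -
  have d: "(\<lambda>x. X i (x $ i)) differentiable (at x)" "(\<lambda>x. e * X i (x $ i)) differentiable (at x)" for i
    by (intro smooth_differentiable smooth_mult smooth_const X_smooth)+
  show "grad (\<lambda>x. e * X 2 (x $ 2) - X 1 (x $ 1)) x = (e * sv 2 x) *\<^sub>R axis 2 1 - sv 1 x *\<^sub>R axis 1 1"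
    using grad_diff[OF d(2) d(1)] grad_cmult[OF d(1)] by (simp add: X_grad)
  show "grad (\<lambda>x. X 2 (x $ 2) + e * X 1 (x $ 1)) x = sv 2 x *\<^sub>R axis 2 1 + (e * sv 1 x) *\<^sub>R axis 1 1"
    using grad_add[OF d(1) d(2)] grad_cmult[OF d(1)] by (simp add: X_grad)
qed

lemma corr_T: "\<phi> \<in> T \<Longrightarrow> corr \<phi> \<in> T"
  unfolding corr_def[abs_def]
  by (intro test_functions_add test_functions_diff test_functions_mult test_functions_grad osc_smooth)

text \<open>The part of the gradient of the corrector in which the derivative falls on
  \<open>grad \<phi>\<close>. It is of size eps t, so that it is still of size eps after
  multiplication by coefficients of order 1 / t.\<close>

definition lower :: "(real^2 \<Rightarrow> real) \<Rightarrow> real^2 \<Rightarrow> real^2" where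
  "lower \<phi> x = (e * X 2 (x $ 2) - X 1 (x $ 1)) *\<^sub>R grad (\<lambda>x. grad \<phi> x $ 1) x - (X 2 (x $ 2) + e * X 1 (x $ 1)) *\<^sub>R grad (\<lambda>x. grad \<phi> x $ 2) x"

lemma corr_grad:
  assumes "\<phi> \<in> T"
  shows "grad (corr \<phi>) x $ 1 = (grad \<phi> x $ 1 - sv 1 x * (grad \<phi> x $ 1 + e * grad \<phi> x $ 2)) + lower \<phi> x $ 1"
    "grad (corr \<phi>) x $ 2 = (grad \<phi> x $ 2 + sv 2 x * (e * grad \<phi> x $ 1 - grad \<phi> x $ 2)) + lower \<phi> x $ 2"
proof -
  let ?F = "\<lambda>x. e * X 2 (x $ 2) - X 1 (x $ 1)" and ?G = "\<lambda>x. X 2 (x $ 2) + e * X 1 (x $ 1)"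
  have g: "(\<lambda>x. grad \<phi> x $ i) \<in> T" for i by (rule test_functions_grad[OF assms])
  have T2: "(\<lambda>x. ?F x * grad \<phi> x $ 1) \<in> T" "(\<lambda>x. ?G x * grad \<phi> x $ 2) \<in> T"
    by (intro test_functions_mult g osc_smooth)+
  have "grad (corr \<phi>) x = grad \<phi> x + (grad (\<lambda>x. ?F x * grad \<phi> x $ 1) x - grad (\<lambda>x. ?G x * grad \<phi> x $ 2) x)"
    unfolding corr_def[abs_def]
    using grad_add[OF T_diff[OF assms] T_diff[OF test_functions_diff[OF T2]]] grad_diff[OF T_diff[OF T2(1)] T_diff[OF T2(2)]] by simp
  also have "grad (\<lambda>x. ?F x * grad \<phi> x $ 1) x = ?F x *\<^sub>R grad (\<lambda>x. grad \<phi> x $ 1) x + grad \<phi> x $ 1 *\<^sub>R grad ?F x"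
    by (rule grad_mult[OF smooth_differentiable[OF osc_smooth(1)] T_diff[OF g]])
  also have "grad (\<lambda>x. ?G x * grad \<phi> x $ 2) x = ?G x *\<^sub>R grad (\<lambda>x. grad \<phi> x $ 2) x + grad \<phi> x $ 2 *\<^sub>R grad ?G x"
    by (rule grad_mult[OF smooth_differentiable[OF osc_smooth(2)] T_diff[OF g]])
  finally have *: "grad (corr \<phi>) x = grad \<phi> x + ((?F x *\<^sub>R grad (\<lambda>x. grad \<phi> x $ 1) x + grad \<phi> x $ 1 *\<^sub>R grad ?F x)
     - (?G x *\<^sub>R grad (\<lambda>x. grad \<phi> x $ 2) x + grad \<phi> x $ 2 *\<^sub>R grad ?G x))" .
  show "grad (corr \<phi>) x $ 1 = (grad \<phi> x $ 1 - sv 1 x * (grad \<phi> x $ 1 + e * grad \<phi> x $ 2)) + lower \<phi> x $ 1"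
    unfolding * osc_grad lower_def by (simp add: axis_def algebra_simps)
  show "grad (corr \<phi>) x $ 2 = (grad \<phi> x $ 2 + sv 2 x * (e * grad \<phi> x $ 1 - grad \<phi> x $ 2)) + lower \<phi> x $ 2"
    unfolding * osc_grad lower_def by (simp add: axis_def algebra_simps)
qed

text \<open>The target flux. Its first component oscillates only with x2, through the horizontal
  strips, and its second only with x1. The Hall coefficient of the strips is contained in c and
  leaves no off-diagonal term. Keeping a1 and b1 also inside the strips changes the flux by a
  bounded amount on a small set.\<close>

definition flux :: "(real^2 \<Rightarrow> real) \<Rightarrow> real^2 \<Rightarrow> real^2" where
  "flux \<phi> x = vector [grad \<phi> x $ 1 * (a1 + c * (if strip 2 x then 1 / (2 * t) else 0)) - grad \<phi> x $ 2 * b1,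
     grad \<phi> x $ 1 * b1 + grad \<phi> x $ 2 * (a1 + c * (if strip 1 x then 1 / (2 * t) else 0))]"

definition wgt :: "real^2 \<Rightarrow> real" where
  "wgt x = (if strip 1 x \<or> strip 2 x then A else a1)"

definition err :: "real^2 \<Rightarrow> real" where
  "err x = of_bool (wide 1 x) + of_bool (wide 2 x) + of_bool (wide 1 x \<and> wide 2 x) / t + eps\<^sup>2"

lemma wgt_pos: "wgt x > 0" using A_pos a1_pos by (simp add: wgt_def)

lemma err_nonneg: "err x \<ge> 0" using t by (simp add: err_def)

lemma osc_bound: "\<bar>e * X 2 (x $ 2) - X 1 (x $ 1)\<bar> \<le> 2 * \<kappa>\<^sup>2 * (eps * t * Cs)"
  "\<bar>X 2 (x $ 2) + e * X 1 (x $ 1)\<bar> \<le> 2 * \<kappa>\<^sup>2 * (eps * t * Cs)"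
proof -
  let ?M = "eps * t * Cs"
  have M: "?M \<ge> 0" using eps t S(8) by simp
  have 1: "\<bar>e * X i z\<bar> \<le> \<kappa>\<^sup>2 * ?M" for i z
    unfolding abs_mult using e_props(2) X_bound[of i z] by (intro mult_mono) auto
  have 2: "?M \<le> \<kappa>\<^sup>2 * ?M" using mult_right_mono[OF one_le_power[OF \<kappa>, of 2] M] by simp
  show "\<bar>e * X 2 (x $ 2) - X 1 (x $ 1)\<bar> \<le> 2 * \<kappa>\<^sup>2 * ?M"
    using 1[of 2 "x $ 2"] 2 X_bound[of 1 "x $ 1"] by linarith
  show "\<bar>X 2 (x $ 2) + e * X 1 (x $ 1)\<bar> \<le> 2 * \<kappa>\<^sup>2 * ?M"
    using 1[of 1 "x $ 1"] 2 X_bound[of 2 "x $ 2"] by linarith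
qed

lemma lower_bound:
  assumes "bounded_test \<phi> K"
  shows "\<bar>lower \<phi> x $ i\<bar> \<le> 4 * (\<kappa>\<^sup>2 * Cs * K) * (eps * t)"
proof -
  have K: "\<bar>grad (\<lambda>x. grad \<phi> x $ j) x $ i\<bar> \<le> K" for j using assms by (simp add: bounded_test_def)
  have "\<bar>(e * X 2 (x $ 2) - X 1 (x $ 1)) * grad (\<lambda>x. grad \<phi> x $ 1) x $ i\<bar> \<le> (2 * \<kappa>\<^sup>2 * (eps * t * Cs)) * K"
    "\<bar>(X 2 (x $ 2) + e * X 1 (x $ 1)) * grad (\<lambda>x. grad \<phi> x $ 2) x $ i\<bar> \<le> (2 * \<kappa>\<^sup>2 * (eps * t * Cs)) * K"
    unfolding abs_mult using osc_bound[of x] K eps t S(8) by (auto intro!: mult_mono mult_nonneg_nonneg)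
  moreover have "lower \<phi> x $ i = (e * X 2 (x $ 2) - X 1 (x $ 1)) * grad (\<lambda>x. grad \<phi> x $ 1) x $ i
      - (X 2 (x $ 2) + e * X 1 (x $ 1)) * grad (\<lambda>x. grad \<phi> x $ 2) x $ i" by (simp add: lower_def)
  moreover have "4 * (\<kappa>\<^sup>2 * Cs * K) * (eps * t) = 2 * ((2 * \<kappa>\<^sup>2 * (eps * t * Cs)) * K)" by simp
  ultimately show ?thesis by linarith
qed

lemma residual_pointwise:
  assumes "bounded_test \<phi> K" and gx: "good x"
  shows "(norm (sig x *v grad (corr \<phi>) x - flux \<phi> x))\<^sup>2 \<le> 12 * (10 * (\<kappa> ^ 3 * Cs * K))\<^sup>2 * \<kappa> * (wgt x * err x)"
proof -
  let ?a = "grad \<phi> x $ 1" and ?b = "grad \<phi> x $ 2"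
  define Q where "Q = 10 * (\<kappa> ^ 3 * Cs * K)"
  have \<phi>: "\<phi> \<in> T" and K: "\<bar>?a\<bar> \<le> K" "\<bar>?b\<bar> \<le> K" using assms by (auto simp: bounded_test_def)
  have K0: "K \<ge> 0" using K by linarith
  define p where "p = (if strip 1 x \<or> strip 2 x then A else a1)"
  define q where "q = (if strip 1 x \<or> strip 2 x then B else b1)"
  define w where "w = (if strip 1 x \<or> strip 2 x then 1 + (if wide 1 x \<and> wide 2 x then 1 / t else 0) else if wide 1 x \<or> wide 2 x then 1 else (0::real))"
  define E1 where "E1 = ?a - sv 1 x * (?a + e * ?b)"
  define E2 where "E2 = ?b + sv 2 x * (e * ?a - ?b)"
  have sV: "sv i x = 1" if "strip i x" for i
  proof -
    have "\<bar>yy i x / t\<bar> \<le> 1" using that t by (simp add: strip_def abs_divide)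
    then show ?thesis by (simp add: sv_def S(3))
  qed
  have VW: "wide i x" if "strip i x" for i using that t by (simp add: strip_def wide_def)
  have sW: "sv i x = 0" if "\<not> wide i x" for i
  proof -
    have "\<bar>yy i x / t\<bar> \<ge> 4" using that t by (simp add: wide_def abs_divide field_simps)
    then show ?thesis by (simp add: sv_def S(5))
  qed
  have cc: "c / (2 * t) = A - e * B" using t by (simp add: c_def)
  have t1: "t \<le> 1" using t by simp
  have sb: "\<bar>sv 1 x\<bar> \<le> Cs" "\<bar>sv 2 x\<bar> \<le> Cs" by (simp_all add: sv_def S(7))
  note main = corrector_residual[OF t(1) t1 \<kappa> S(8) K sb A_pos A(2) B e_props(2) e_props(1) cc sV sV VW VW sW sW a1_pos a1(2) b1 refl refl refl refl]
  have R: "\<bar>p * E1 - q * E2 - flux \<phi> x $ 1\<bar> \<le> Q * w" "\<bar>p * E2 + q * E1 - flux \<phi> x $ 2\<bar> \<le> Q * w"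
    using main unfolding p_def q_def E1_def E2_def w_def Q_def flux_def by simp_all
  have kt: "\<kappa> \<le> \<kappa> / t" using \<kappa> t t1 by (simp add: field_simps mult_left_le)
  have pq: "\<bar>p\<bar> \<le> \<kappa> / t" "\<bar>q\<bar> \<le> \<kappa> / t"
    using A A_pos a1 a1_pos b1 B kt by (auto simp: p_def q_def)
  \<comment> \<open>The factor t from the size of the profile compensates the coefficient, which is
    at most \<kappa> / t.\<close>
  have lo: "\<bar>z * lower \<phi> x $ i\<bar> \<le> 4 * (\<kappa> ^ 3 * Cs * K) * eps" if "\<bar>z\<bar> \<le> \<kappa> / t" for z i
  proof -
    have "\<bar>z * lower \<phi> x $ i\<bar> \<le> (\<kappa> / t) * (4 * (\<kappa>\<^sup>2 * Cs * K) * (eps * t))"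
      unfolding abs_mult using that lower_bound[OF assms(1), of x i] \<kappa> t by (intro mult_mono) auto
    also have "\<dots> = 4 * (\<kappa> ^ 3 * Cs * K) * eps" using t by (simp add: power2_eq_square power3_eq_cube)
    finally show ?thesis .
  qed
  have H0: "0 \<le> \<kappa> ^ 3 * Cs * K * eps" using \<kappa> S(8) K0 eps by simp
  have Qe: "Q * eps = 10 * (\<kappa> ^ 3 * Cs * K * eps)" by (simp add: Q_def)
  let ?R = "sig x *v grad (corr \<phi>) x - flux \<phi> x"
  have r1: "?R $ 1 = (p * E1 - q * E2 - flux \<phi> x $ 1) + (p * lower \<phi> x $ 1 - q * lower \<phi> x $ 2)"
    and r2: "?R $ 2 = (p * E2 + q * E1 - flux \<phi> x $ 2) + (p * lower \<phi> x $ 2 + q * lower \<phi> x $ 1)"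
    using sig_mv(1,2)[OF gx, of "grad (corr \<phi>) x"]
    by (simp_all add: corr_grad[OF \<phi>] E1_def E2_def p_def q_def algebra_simps)
  have Q0: "Q \<ge> 0" using \<kappa> S(8) K0 by (simp add: Q_def)
  have w0: "w \<ge> 0" using t by (simp add: w_def)
  have le: "\<bar>?R $ 1\<bar> \<le> Q * (w + eps)" "\<bar>?R $ 2\<bar> \<le> Q * (w + eps)"
  proof -
    have "\<bar>?R $ 1\<bar> \<le> \<bar>p * E1 - q * E2 - flux \<phi> x $ 1\<bar> + \<bar>p * lower \<phi> x $ 1\<bar> + \<bar>q * lower \<phi> x $ 2\<bar>"
      unfolding r1 by linarith
    also have "\<dots> \<le> Q * w + Q * eps"
      using R(1) lo[OF pq(1), of 1] lo[OF pq(2), of 2] H0 unfolding Qe by linarith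
    finally show "\<bar>?R $ 1\<bar> \<le> Q * (w + eps)" by (simp add: distrib_left)
    have "\<bar>?R $ 2\<bar> \<le> \<bar>p * E2 + q * E1 - flux \<phi> x $ 2\<bar> + \<bar>p * lower \<phi> x $ 2\<bar> + \<bar>q * lower \<phi> x $ 1\<bar>"
      unfolding r2 by linarith
    also have "\<dots> \<le> Q * w + Q * eps"
      using R(2) lo[OF pq(1), of 2] lo[OF pq(2), of 1] H0 unfolding Qe by linarith
    finally show "\<bar>?R $ 2\<bar> \<le> Q * (w + eps)" by (simp add: distrib_left)
  qed
  have "(norm ?R)\<^sup>2 = \<bar>?R $ 1\<bar>\<^sup>2 + \<bar>?R $ 2\<bar>\<^sup>2" by (simp only: norm_2 power2_abs)
  also have "\<dots> \<le> (Q * (w + eps))\<^sup>2 + (Q * (w + eps))\<^sup>2"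
    by (intro add_mono power_mono le) auto
  also have "\<dots> = 2 * Q\<^sup>2 * (w + eps)\<^sup>2" by (simp add: power_mult_distrib)
  also have "\<dots> \<le> 2 * Q\<^sup>2 * (6 * \<kappa> * (wgt x * err x))"
  proof (intro mult_left_mono)
    have eps0: "0 \<le> eps" using eps by simp
    show "(w + eps)\<^sup>2 \<le> 6 * \<kappa> * (wgt x * err x)"
      unfolding w_def wgt_def err_def
      by (rule residual_weight[OF t(1) t1 \<kappa> A(1) a1(1) eps0 VW VW])
  qed simp
  finally show ?thesis by (simp add: Q_def)
qed

end

section \<open>The residual tested against the energy\<close>

lemma nn_integral_product_real2:
  assumes [measurable]: "U \<in> sets borel" "V \<in> sets borel"
  shows "(\<integral>\<^sup>+x. indicator U (x $ i) * indicator V (x $ oth i) \<partial>(lborel :: (real^2) measure)) = emeasure lborel U * emeasure lborel V"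
proof -
  have "(\<integral>\<^sup>+x. indicator U (x $ i) * indicator V (x $ oth i) \<partial>(lborel :: (real^2) measure))
     = (\<integral>\<^sup>+u. \<integral>\<^sup>+s. indicator U s * indicator V u \<partial>lborel \<partial>lborel)"
    by (subst nn_integral_pt[of _ i]) auto
  also have "\<dots> = emeasure lborel U * emeasure lborel V"
    by (simp add: nn_integral_multc nn_integral_cmult)
  finally show ?thesis .
qed

context cross_corrector
begin

lemma wide_measurable [measurable]: "{x. wide i x} \<in> sets borel" "{x. strip i x} \<in> sets borel"
proof -
  have [measurable]: "yy i \<in> borel_measurable borel"
    unfolding yy_def[abs_def] by measurable
  have "{x \<in> space borel. \<bar>yy i x\<bar> \<le> 4 * t} \<in> sets borel" "{x \<in> space borel. \<bar>yy i x\<bar> \<le> t} \<in> sets borel"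
    by measurable
  then show "{x. wide i x} \<in> sets borel" "{x. strip i x} \<in> sets borel"
    by (simp_all add: wide_def strip_def)
qed

lemma err_measurable: "err \<in> borel_measurable borel"
proof -
  have [measurable]: "Measurable.pred borel (wide i)" for i
    using wide_measurable(1)[of i] by (simp add: pred_def)
  show ?thesis unfolding err_def[abs_def] by measurable
qed

lemma wgt_measurable: "wgt \<in> borel_measurable borel"
proof -
  have [measurable]: "Measurable.pred borel (strip i)" for i
    using wide_measurable(2)[of i] by (simp add: pred_def)
  show ?thesis unfolding wgt_def[abs_def] by measurable
qed

lemma flux_measurable: "\<phi> \<in> T \<Longrightarrow> flux \<phi> \<in> borel_measurable borel"
proof -
  assume \<phi>: "\<phi> \<in> T"
  have [measurable]: "Measurable.pred borel (strip i)" for i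
    using wide_measurable(2)[of i] by (simp add: pred_def)
  have [measurable]: "(\<lambda>x. grad \<phi> x $ i) \<in> borel_measurable borel" for i
    using T_measurable(1)[OF test_functions_grad[OF \<phi>]] .
  have "(\<lambda>x. flux \<phi> x $ i) \<in> borel_measurable borel" for i
    using exhaust_2[of i] by (auto simp: flux_def)
  then show ?thesis
    by (subst borel_measurable_euclidean_space) (auto simp: Basis_vec_def inner_axis)
qed

text \<open>With k = 4 (4 L + 14), a wide strip family has one-dimensional measure at most k t by
  \<open>strip_measure\<close>. The three terms are the two families of strips of length 2 L, the
  crossings with weight 1 / t, and the square of side 2 L with weight eps^2.\<close>

definition err_const :: "real \<Rightarrow> real" where
  "err_const L = 4 * L * (4 * (4 * L + 14)) + (4 * (4 * L + 14))\<^sup>2 + 4 * L\<^sup>2"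

text \<open>Whether x is in a wide strip depends on one coordinate only. By Tonelli the crossings
  thus have the product area (k t)^2, and the weight 1 / t leaves order t.\<close>

lemma err_integral:
  assumes L: "L > 0" and sub: "\<And>x i. x \<in> \<Omega> \<Longrightarrow> \<bar>x $ i\<bar> \<le> L"
  shows "integrable N err" "(LINT x|N. err x) \<le> err_const L * (t + eps\<^sup>2)"
proof -
  have m: "err \<in> borel_measurable N" by (intro borel_N err_measurable)
  define m0 where "m0 = (4 * L + 14) * (4 * t)"
  have m0: "m0 \<ge> 0" using L t by (simp add: m0_def)
  define Z where "Z i = {z. \<bar>z\<bar> \<le> L \<and> \<bar>per (pr i) (z / eps)\<bar> \<le> 4 * t}" for i
  define I where "I = {-L..L}"
  have Zm: "Z i \<in> sets borel" for i
  proof -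
    have "{z \<in> space borel. \<bar>z\<bar> \<le> L \<and> \<bar>per (pr i) (z / eps)\<bar> \<le> 4 * t} \<in> sets borel" by measurable
    then show ?thesis by (simp add: Z_def)
  qed
  have Im: "I \<in> sets borel" by (simp add: I_def)
  have Z: "emeasure lborel (Z i) \<le> ennreal m0" for i
    unfolding Z_def m0_def by (rule strip_measure[OF pr_ge1 eps L]) (use t in simp)
  have Ie: "emeasure lborel I = ennreal (2 * L)" using L by (simp add: I_def)
  let ?f = "\<lambda>x::real^2. indicator (Z 1) (x $ 1) * indicator I (x $ oth 1) :: ennreal"
  let ?g = "\<lambda>x::real^2. indicator (Z 2) (x $ 2) * indicator I (x $ oth 2) :: ennreal"
  let ?h = "\<lambda>x::real^2. indicator (Z 1) (x $ 1) * indicator (Z 2) (x $ oth 1) :: ennreal"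
  let ?k = "\<lambda>x::real^2. indicator I (x $ 1) * indicator I (x $ oth 1) :: ennreal"
  have [measurable]: "?f \<in> borel_measurable lborel" "?g \<in> borel_measurable lborel" "?h \<in> borel_measurable lborel" "?k \<in> borel_measurable lborel"
    using Zm Im by measurable
  have o: "oth 1 = 2" "oth 2 = 1" by (auto simp: oth_def)
  have "(\<integral>\<^sup>+x. ennreal (err x) \<partial>N) = (\<integral>\<^sup>+x. ennreal (err x) * indicator \<Omega> x \<partial>lborel)"
  proof -
    have "(\<integral>\<^sup>+x. ennreal (err x) \<partial>N) = (\<integral>\<^sup>+x. ennreal (err x) * indicator \<Omega> x \<partial>lebesgue)"
      by (rule nn_integral_restrict_space) simp
    also have "\<dots> = (\<integral>\<^sup>+x. ennreal (err x) * indicator \<Omega> x \<partial>lborel)"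
      by (rule nn_integral_completion)
    finally show ?thesis .
  qed
  also have "\<dots> \<le> (\<integral>\<^sup>+x. (?f x + ?g x) + (ennreal (1 / t) * ?h x + ennreal (eps\<^sup>2) * ?k x) \<partial>lborel)"
  proof (intro nn_integral_mono)
    fix x
    show "ennreal (err x) * indicator \<Omega> x \<le> (?f x + ?g x) + (ennreal (1 / t) * ?h x + ennreal (eps\<^sup>2) * ?k x)"
    proof (cases "x \<in> \<Omega>")
      case True
      have xI: "x $ i \<in> I" for i using sub[OF True, of i] by (auto simp: I_def abs_le_iff)
      have xZ: "x $ i \<in> Z i \<longleftrightarrow> wide i x" for i using sub[OF True, of i] by (simp add: Z_def wide_def yy_def)
      have "ennreal (err x) = (ennreal (of_bool (wide 1 x)) + ennreal (of_bool (wide 2 x))) + (ennreal (of_bool (wide 1 x \<and> wide 2 x) / t) + ennreal (eps\<^sup>2))"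
        unfolding err_def using t by (simp add: add.assoc flip: ennreal_plus)
      also have "\<dots> = (?f x + ?g x) + (ennreal (1 / t) * ?h x + ennreal (eps\<^sup>2) * ?k x)"
        using xI xZ by (auto simp: indicator_def o)
      finally show ?thesis using True by simp
    qed simp
  qed
  also have "\<dots> = (integral\<^sup>N lborel ?f + integral\<^sup>N lborel ?g) + (ennreal (1 / t) * integral\<^sup>N lborel ?h + ennreal (eps\<^sup>2) * integral\<^sup>N lborel ?k)"
    by (simp add: nn_integral_add nn_integral_cmult)
  also have "\<dots> = (emeasure lborel (Z 1) * emeasure lborel I + emeasure lborel (Z 2) * emeasure lborel I) +
     (ennreal (1 / t) * (emeasure lborel (Z 1) * emeasure lborel (Z 2)) + ennreal (eps\<^sup>2) * (emeasure lborel I * emeasure lborel I))"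
    using nn_integral_product_real2 Zm Im by presburger
  also have "\<dots> \<le> (ennreal m0 * ennreal (2 * L) + ennreal m0 * ennreal (2 * L)) +
     (ennreal (1 / t) * (ennreal m0 * ennreal m0) + ennreal (eps\<^sup>2) * (ennreal (2 * L) * ennreal (2 * L)))"
    unfolding Ie by (intro add_mono mult_mono mult_left_mono Z) auto
  also have "\<dots> = ennreal ((m0 * (2 * L) + m0 * (2 * L)) + ((1 / t) * (m0 * m0) + eps\<^sup>2 * ((2 * L) * (2 * L))))"
    using m0 L t by (simp flip: ennreal_mult ennreal_plus)
  also have "\<dots> \<le> ennreal (err_const L * (t + eps\<^sup>2))"
  proof (rule ennreal_leI)
    define k where "k = 4 * (4 * L + 14)"
    have m0k: "m0 = k * t" by (simp add: m0_def k_def)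
    have k: "k \<ge> 0" using L by (simp add: k_def)
    have "(1 / t) * (m0 * m0) = k\<^sup>2 * t" using t by (simp add: m0k power2_eq_square)
    then have "(m0 * (2 * L) + m0 * (2 * L)) + ((1 / t) * (m0 * m0) + eps\<^sup>2 * ((2 * L) * (2 * L)))
      = (4 * L * k) * t + k\<^sup>2 * t + (4 * L\<^sup>2) * eps\<^sup>2"
      by (simp add: m0k power2_eq_square)
    also have "\<dots> \<le> (4 * L * k) * (t + eps\<^sup>2) + k\<^sup>2 * (t + eps\<^sup>2) + (4 * L\<^sup>2) * (t + eps\<^sup>2)"
      using L k t by (intro add_mono mult_left_mono) auto
    also have "\<dots> = err_const L * (t + eps\<^sup>2)" by (simp add: err_const_def k_def distrib_right)
    finally show "(m0 * (2 * L) + m0 * (2 * L)) + ((1 / t) * (m0 * m0) + eps\<^sup>2 * ((2 * L) * (2 * L))) \<le> err_const L * (t + eps\<^sup>2)" .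
  qed
  finally have le: "(\<integral>\<^sup>+x. ennreal (err x) \<partial>N) \<le> ennreal (err_const L * (t + eps\<^sup>2))" .
  show int: "integrable N err"
    using m le err_nonneg by (intro integrableI_nonneg) (auto simp: le_less_trans[OF _ ennreal_less_top])
  have "ennreal (LINT x|N. err x) \<le> ennreal (err_const L * (t + eps\<^sup>2))"
    using nn_integral_eq_integral[OF int] err_nonneg le by simp
  moreover have "0 \<le> err_const L * (t + eps\<^sup>2)" using L t by (simp add: err_const_def)
  ultimately show "(LINT x|N. err x) \<le> err_const L * (t + eps\<^sup>2)" by simp
qed

lemma sig_elliptic: "elliptic sig (min a1 A) (max (\<bar>a1\<bar> + \<bar>b1\<bar>) (\<bar>A\<bar> + \<bar>B\<bar>))"
  using cross_conductivity_elliptic[OF a1_pos A_pos, of l t b1 B 1 eps] unfolding sig_def[abs_def] by simp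

lemma wgt_bounded: "0 \<le> wgt x" "wgt x \<le> a1 + A"
  using A_pos a1_pos by (auto simp: wgt_def)

lemma sqint_flux:
  assumes "bounded_test \<phi> K"
  shows "sqint N (flux \<phi>)"
proof -
  have \<phi>: "\<phi> \<in> T" and K: "\<And>i x. \<bar>grad \<phi> x $ i\<bar> \<le> K" using assms by (auto simp: bounded_test_def)
  have m: "flux \<phi> \<in> borel_measurable N" by (intro borel_N flux_measurable \<phi>)
  define M where "M = \<bar>a1\<bar> + \<bar>c * (1 / (2 * t))\<bar> + \<bar>b1\<bar>"
  have K0: "K \<ge> 0" using K[of 0 1] by linarith
  have comp: "\<bar>flux \<phi> x $ i\<bar> \<le> 2 * (K * M)" for x i
  proof -
    have 1: "\<bar>z * (a1 + c * (if P then 1 / (2 * t) else 0))\<bar> \<le> K * M" "\<bar>z * b1\<bar> \<le> K * M" if "\<bar>z\<bar> \<le> K" for z P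
    proof -
      have "\<bar>a1 + c * (if P then 1 / (2 * t) else 0)\<bar> \<le> M"
        using abs_triangle_ineq[of a1 "c * (1 / (2 * t))"] by (auto simp: M_def)
      then show "\<bar>z * (a1 + c * (if P then 1 / (2 * t) else 0))\<bar> \<le> K * M"
        unfolding abs_mult using that K0 by (intro mult_mono) auto
      show "\<bar>z * b1\<bar> \<le> K * M" unfolding abs_mult using that K0 by (intro mult_mono) (auto simp: M_def)
    qed
    have "flux \<phi> x $ 1 = grad \<phi> x $ 1 * (a1 + c * (if strip 2 x then 1 / (2 * t) else 0)) - grad \<phi> x $ 2 * b1"
      "flux \<phi> x $ 2 = grad \<phi> x $ 1 * b1 + grad \<phi> x $ 2 * (a1 + c * (if strip 1 x then 1 / (2 * t) else 0))"
      by (simp_all add: flux_def)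
    then have "\<bar>flux \<phi> x $ 1\<bar> \<le> 2 * (K * M)" "\<bar>flux \<phi> x $ 2\<bar> \<le> 2 * (K * M)"
      using 1(1)[OF K[of x 1], of "strip 2 x"] 1(2)[OF K[of x 2]] 1(2)[OF K[of x 1]] 1(1)[OF K[of x 2], of "strip 1 x"]
      unfolding abs_le_iff by (elim conjE, simp only:, linarith)+
    then show ?thesis using exhaust_2[of i] by auto
  qed
  have "norm (flux \<phi> x) \<le> norm (4 * (K * M))" for x
  proof -
    have "norm (flux \<phi> x) \<le> \<bar>flux \<phi> x $ 1\<bar> + \<bar>flux \<phi> x $ 2\<bar>"
      using norm_le_l1_cart[of "flux \<phi> x"] by (simp add: sum_2)
    also have "\<dots> \<le> 4 * (K * M)" using comp[of x 1] comp[of x 2] by linarith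
    finally show ?thesis by simp
  qed
  then show ?thesis by (intro sqint_bound(1)[OF sqint_const[OF finite_N, of "4 * (K * M)"] m]) auto
qed

text \<open>Cauchy--Schwarz with the coefficient as weight: the residual is divided by sqrt (wgt)
  and the gradient of \<psi> multiplied by it. The second factor becomes exactly the energy of
  \<psi>, because J is skew.\<close>

lemma residual_integral:
  assumes L: "L > 0" "\<And>x i. x \<in> \<Omega> \<Longrightarrow> \<bar>x $ i\<bar> \<le> L" and \<phi>: "bounded_test \<phi> K" and \<psi>: "\<psi> \<in> T"
  shows "\<bar>form sig (grad (corr \<phi>)) (grad \<psi>) - (LINT x|N. flux \<phi> x \<bullet> grad \<psi> x)\<bar>
    \<le> sqrt (12 * (10 * (\<kappa> ^ 3 * Cs * K))\<^sup>2 * \<kappa> * (err_const L * (t + eps\<^sup>2))) * sqrt (form sig (grad \<psi>) (grad \<psi>))"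
proof -
  define Q where "Q = 12 * (10 * (\<kappa> ^ 3 * Cs * K))\<^sup>2 * \<kappa>"
  have Q: "Q \<ge> 0" using \<kappa> by (simp add: Q_def)
  have \<phi>T: "\<phi> \<in> T" using \<phi> by (simp add: bounded_test_def)
  have sq: "sqint N (grad (corr \<phi>))" "sqint N (grad \<psi>)" "sqint N (flux \<phi>)"
    by (intro T_sqint(2) corr_T \<phi>T \<psi> sqint_flux[OF \<phi>])+
  have s1: "sqint N (\<lambda>x. sig x *v grad (corr \<phi>) x)" by (rule sqint_mv(1)[OF sig_elliptic sq(1)])
  define R where "R x = sig x *v grad (corr \<phi>) x - flux \<phi> x" for x
  have sR: "sqint N R" unfolding R_def by (intro sqint_diff s1 sq)
  have eq: "form sig (grad (corr \<phi>)) (grad \<psi>) - (LINT x|N. flux \<phi> x \<bullet> grad \<psi> x) = (LINT x|N. R x \<bullet> grad \<psi> x)"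
    unfolding form_def R_def inner_diff_left using sqint_inner[OF s1 sq(2)] sqint_inner[OF sq(3,2)] by simp
  define u where "u x = sqrt (Q * err x)" for x
  define v where "v x = sqrt (wgt x) *\<^sub>R grad \<psi> x" for x
  have u2: "(norm (u x))\<^sup>2 = Q * err x" for x using Q err_nonneg[of x] by (simp add: u_def)
  have v2: "(norm (v x))\<^sup>2 = wgt x * (norm (grad \<psi> x))\<^sup>2" for x using wgt_pos[of x] by (simp add: v_def power_mult_distrib)
  have mu: "u \<in> borel_measurable N" "wgt \<in> borel_measurable N"
    using borel_N[OF err_measurable] borel_N[OF wgt_measurable] by (auto simp: u_def[abs_def])
  have su: "sqint N u" unfolding sqint_def u2 using mu err_integral(1)[OF L] by simp
  have sv: "sqint N v"
  proof (rule sqint_bound(1)[OF sqint_scaleR[OF sq(2), of "sqrt (a1 + A)"]])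
    show "v \<in> borel_measurable N" unfolding v_def[abs_def] using mu sq(2) by (auto simp: sqint_def)
    show "AE x in N. norm (v x) \<le> norm (sqrt (a1 + A) *\<^sub>R grad \<psi> x)"
      using wgt_bounded A_pos a1_pos by (auto simp: v_def intro!: mult_right_mono)
  qed
  have nu: "nrm2 N u \<le> sqrt (Q * (err_const L * (t + eps\<^sup>2)))"
    unfolding nrm2_def u2 using err_integral(2)[OF L] Q by (auto intro!: mult_left_mono)
  have nv: "nrm2 N v = sqrt (form sig (grad \<psi>) (grad \<psi>))"
  proof -
    have "(LINT x|N. (norm (v x))\<^sup>2) = form sig (grad \<psi>) (grad \<psi>)"
      unfolding form_def
    proof (rule integral_cong_AE)
      show "AE x in N. (norm (v x))\<^sup>2 = (sig x *v grad \<psi> x) \<bullet> grad \<psi> x"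
        using AE_good_N unfolding v2 by eventually_elim (simp add: sig_mv(3) wgt_def)
      show "(\<lambda>x. (norm (v x))\<^sup>2) \<in> borel_measurable N"
        using sv unfolding sqint_def by (elim conjE) (rule borel_measurable_integrable)
      show "(\<lambda>x. (sig x *v grad \<psi> x) \<bullet> grad \<psi> x) \<in> borel_measurable N"
        using sqint_inner[OF sqint_mv(1)[OF sig_elliptic sq(2)] sq(2)] by simp
    qed
    then show ?thesis by (simp add: nrm2_def)
  qed
  have "\<bar>LINT x|N. R x \<bullet> grad \<psi> x\<bar> \<le> (LINT x|N. \<bar>R x \<bullet> grad \<psi> x\<bar>)" by (rule integral_abs_bound)
  also have "\<dots> \<le> (LINT x|N. norm (u x) * norm (v x))"
  proof (rule integral_mono_AE)
    show "integrable N (\<lambda>x. \<bar>R x \<bullet> grad \<psi> x\<bar>)" using sqint_inner[OF sR sq(2)] by simp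
    show "integrable N (\<lambda>x. norm (u x) * norm (v x))" by (rule sqint_norm_mult[OF su sv])
    show "AE x in N. \<bar>R x \<bullet> grad \<psi> x\<bar> \<le> norm (u x) * norm (v x)"
      using AE_good_N
    proof eventually_elim
      case (elim x)
      have "(norm (R x))\<^sup>2 \<le> Q * (wgt x * err x)" unfolding R_def Q_def by (rule residual_pointwise[OF \<phi> elim])
      also have "\<dots> = (norm (u x) * sqrt (wgt x))\<^sup>2" using wgt_pos[of x] by (simp add: power_mult_distrib u2[unfolded real_norm_def power2_abs])
      finally have "norm (R x) \<le> norm (u x) * sqrt (wgt x)" by (rule power2_le_imp_le) (use wgt_pos[of x] in simp)
      then have "norm (R x) * norm (grad \<psi> x) \<le> norm (u x) * sqrt (wgt x) * norm (grad \<psi> x)" by (rule mult_right_mono) simp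
      also have "\<dots> = norm (u x) * norm (v x)" using wgt_pos[of x] by (simp add: v_def)
      finally show ?case using Cauchy_Schwarz_ineq2[of "R x" "grad \<psi> x"] by linarith
    qed
  qed
  also have "\<dots> \<le> nrm2 N u * nrm2 N v" by (rule nrm2_norm_mult[OF su sv])
  also have "\<dots> \<le> sqrt (Q * (err_const L * (t + eps\<^sup>2))) * nrm2 N v" by (rule mult_right_mono[OF nu]) simp
  finally show ?thesis unfolding eq nv Q_def .
qed

end

section \<open>The limit of the flux\<close>

lemma oth_oth [simp]: "oth (oth i) = i"
  using exhaust_2[of i] by (auto simp: oth_def)

context bdd_domain
begin

lemma bounded_testD:
  assumes "bounded_test \<phi> K"
  shows "\<phi> \<in> T" "\<bar>grad \<phi> x $ i\<bar> \<le> K" "\<bar>grad (\<lambda>x. grad \<phi> x $ i) x $ j\<bar> \<le> K"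
    "\<bar>grad (\<lambda>x. grad (\<lambda>x. grad \<phi> x $ i) x $ j) x $ k\<bar> \<le> K" "K \<ge> 0"
proof -
  show 1: "\<phi> \<in> T" "\<bar>grad \<phi> x $ i\<bar> \<le> K" "\<bar>grad (\<lambda>x. grad \<phi> x $ i) x $ j\<bar> \<le> K"
    "\<bar>grad (\<lambda>x. grad (\<lambda>x. grad \<phi> x $ i) x $ j) x $ k\<bar> \<le> K" for x i j k
    using assms by (auto simp: bounded_test_def)
  show "K \<ge> 0" using 1(2)[of 0 1] by linarith
qed

lemma test_bounded:
  assumes "\<phi> \<in> T" obtains K where "K \<ge> 0" "\<And>x. \<bar>\<phi> x\<bar> \<le> K"
proof -
  obtain D where D: "smooth \<phi>" "compact D" "D \<subseteq> \<Omega>" "\<And>x. x \<notin> D \<Longrightarrow> \<phi> x = 0" "\<And>x. x \<notin> D \<Longrightarrow> grad \<phi> x = 0"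
    using test_functionsE[OF assms] by metis
  have "compact (\<phi> ` D)"
    by (rule compact_continuous_image[OF continuous_on_subset[OF smooth_continuous[OF D(1)]] D(2)]) simp
  then obtain B where B: "\<forall>z\<in>\<phi> ` D. norm z \<le> B" by (meson bounded_iff compact_imp_bounded)
  have "\<bar>\<phi> x\<bar> \<le> max B 0" for x
  proof (cases "x \<in> D")
    case True
    then have "norm (\<phi> x) \<le> B" using B by blast
    then show ?thesis by simp
  qed (simp add: D(4))
  then show ?thesis by (intro that[of "max B 0"]) auto
qed

lemma family_bounded:
  fixes F :: "'i::finite \<Rightarrow> real^2 \<Rightarrow> real"
  assumes "\<And>i. F i \<in> T" obtains K where "K \<ge> 0" "\<And>i x. \<bar>F i x\<bar> \<le> K"
proof -
  have "\<forall>i. \<exists>K. K \<ge> 0 \<and> (\<forall>x. \<bar>F i x\<bar> \<le> K)"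
  proof
    fix i show "\<exists>K. K \<ge> 0 \<and> (\<forall>x. \<bar>F i x\<bar> \<le> K)" by (rule test_bounded[OF assms[of i]]) blast
  qed
  then obtain k where k: "\<forall>i. k i \<ge> 0 \<and> (\<forall>x. \<bar>F i x\<bar> \<le> k i)" using choice[of "\<lambda>i K. K \<ge> 0 \<and> (\<forall>x. \<bar>F i x\<bar> \<le> K)"] by blast
  have "k i \<le> sum k UNIV" for i by (rule member_le_sum) (use k in auto)
  then have "\<bar>F i x\<bar> \<le> sum k UNIV" for i x using k order_trans by blast
  moreover have "sum k UNIV \<ge> 0" using k by (intro sum_nonneg) auto
  ultimately show ?thesis using that by blast
qed

lemma bounded_test_exists:
  assumes "\<phi> \<in> T" obtains K where "bounded_test \<phi> K"
proof -
  obtain K1 where K1: "K1 \<ge> 0" "\<And>i x. \<bar>grad \<phi> x $ i\<bar> \<le> K1"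
    using family_bounded[of "\<lambda>i x. grad \<phi> x $ i"] test_functions_grad[OF assms] by blast
  obtain K2 where K2: "K2 \<ge> 0" "\<And>p x. \<bar>(\<lambda>(i, j) x. grad (\<lambda>x. grad \<phi> x $ i) x $ j) p x\<bar> \<le> K2"
    using family_bounded[of "\<lambda>(i :: 2, j :: 2) x. grad (\<lambda>x. grad \<phi> x $ i) x $ j"] test_functions_grad[OF test_functions_grad[OF assms]]
    by (auto simp: case_prod_unfold)
  obtain K3 where K3: "K3 \<ge> 0" "\<And>p x. \<bar>(\<lambda>(i, j, k) x. grad (\<lambda>x. grad (\<lambda>x. grad \<phi> x $ i) x $ j) x $ k) p x\<bar> \<le> K3"
    using family_bounded[of "\<lambda>(i :: 2, j :: 2, k :: 2) x. grad (\<lambda>x. grad (\<lambda>x. grad \<phi> x $ i) x $ j) x $ k"]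
      test_functions_grad[OF test_functions_grad[OF test_functions_grad[OF assms]]]
    by (auto simp: case_prod_unfold)
  have "bounded_test \<phi> (K1 + K2 + K3)"
    unfolding bounded_test_def
  proof (intro conjI allI assms)
    fix x i j k
    show "\<bar>grad \<phi> x $ i\<bar> \<le> K1 + K2 + K3" using K1(2)[of x i] K2(1) K3(1) by linarith
    show "\<bar>grad (\<lambda>x. grad \<phi> x $ i) x $ j\<bar> \<le> K1 + K2 + K3" using K2(2)[of "(i, j)" x] K1(1) K3(1) by simp
    show "\<bar>grad (\<lambda>x. grad (\<lambda>x. grad \<phi> x $ i) x $ j) x $ k\<bar> \<le> K1 + K2 + K3" using K3(2)[of "(i, j, k)" x] K1(1) K2(1) by simp
  qed
  then show ?thesis by (rule that)
qed

lemma L1_bounds: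
  assumes "\<psi> \<in> T"
  shows "(LINT x|N. norm (grad \<psi> x)) \<le> cP * nrm2 N (grad \<psi>)" "(LINT x|N. norm (\<psi> x)) \<le> cP\<^sup>2 * nrm2 N (grad \<psi>)"
proof -
  show "(LINT x|N. norm (grad \<psi> x)) \<le> cP * nrm2 N (grad \<psi>)"
    using L1_le_nrm2[OF finite_N T_sqint(2)[OF assms]] by (simp add: cP_def mult.commute)
  have "(LINT x|N. norm (\<psi> x)) \<le> nrm2 N \<psi> * cP"
    using L1_le_nrm2[OF finite_N T_sqint(1)[OF assms]] by (simp add: cP_def)
  also have "\<dots> \<le> (cP * nrm2 N (grad \<psi>)) * cP" using poincare[OF assms] cP_nonneg by (intro mult_right_mono)
  finally show "(LINT x|N. norm (\<psi> x)) \<le> cP\<^sup>2 * nrm2 N (grad \<psi>)" by (simp add: power2_eq_square mult_ac)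
qed

end

section \<open>Oscillating factors of mean zero and the limit of the flux\<close>

context cross_corrector
begin

definition osc :: "2 \<Rightarrow> real \<Rightarrow> real" where "osc i z = saw' (pr i) t (per (pr i) (z / eps))"

lemma osc_props:
  "osc i \<in> borel_measurable borel" "\<bar>osc i z\<bar> \<le> 1 / (2 * t) + 1"
proof -
  have tp: "t < pr i / 2" using t4[of i] t by simp
  show "osc i \<in> borel_measurable borel"
    unfolding osc_def[abs_def] by (rule saw_per(5)[OF t(1) tp pr_ge1 eps(1)])
  have "0 \<le> 1 / pr i" "1 / pr i \<le> 1" using pr_ge1[of i] by auto
  moreover have "0 \<le> 1 / (2 * t)" using t by simp
  ultimately have "\<bar>1 / (2 * t) - 1 / pr i\<bar> \<le> 1 / (2 * t) + 1" "\<bar>0 - 1 / pr i\<bar> \<le> 1 / (2 * t) + 1"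
    by linarith+
  then show "\<bar>osc i z\<bar> \<le> 1 / (2 * t) + 1"
    unfolding osc_def saw'_def by (simp split: if_split)
qed

lemma osc_integrable:
  assumes "cs \<eta>"
  shows "integrable lborel (\<lambda>x. osc i (x $ i) * \<eta> x)"
proof -
  have "(\<lambda>x::real^2. osc i (x $ i)) \<in> borel_measurable lborel" using osc_props(1)[of i] by measurable
  from integrable_bounded_mult[OF cs_integrable[OF assms] this osc_props(2)] show ?thesis by simp
qed

text \<open>Since \<^term>\<open>osc i\<close> is the derivative of a function of size \<^term>\<open>eps\<close> and depends on the
  coordinate \<^term>\<open>i\<close> only, the derivative of \<^term>\<open>\<psi>\<close> in the other direction can be moved away
  before integrating by parts in direction \<^term>\<open>i\<close>.\<close>

lemma osc_by_parts:
  assumes \<eta>: "\<eta> \<in> T" and \<psi>: "\<psi> \<in> T"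
    and K: "\<And>x k. \<bar>grad \<eta> x $ k\<bar> \<le> K" "\<And>x k m. \<bar>grad (\<lambda>x. grad \<eta> x $ k) x $ m\<bar> \<le> K"
  shows "\<bar>LINT x|N. osc i (x $ i) * (\<eta> x * grad \<psi> x $ (oth i))\<bar> \<le> eps * K * (cP + cP\<^sup>2) * nrm2 N (grad \<psi>)"
proof -
  let ?j = "oth i"
  let ?M = "1 / (2 * t) + 1"
  have tp: "t < pr i / 2" using t4[of i] t by simp
  define Z where "Z z = eps * saw (pr i) t (per (pr i) (z / eps))" for z
  let ?D = "{z. per (pr i) (z / eps) \<in> {t, - t, pr i / 2, - pr i / 2}}"
  note saw = saw_per[OF t(1) tp pr_ge1 eps(1), folded Z_def osc_def]
  have Zb: "\<bar>Z z\<bar> \<le> eps" for z unfolding Z_def by (rule saw(2)[unfolded Z_def])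
  have "0 \<le> 1 / (2 * t)" using t by simp
  then have M: "eps \<le> ?M" "1 \<le> ?M" using eps by linarith+
  have g\<eta>: "(\<lambda>x. grad \<eta> x $ ?j) \<in> T" and g\<psi>: "(\<lambda>x. grad \<psi> x $ k) \<in> T" for k
    by (intro test_functions_grad \<eta> \<psi>)+
  have sm: "smooth \<eta>" "smooth \<psi>" "smooth (\<lambda>x. grad \<eta> x $ ?j)" "smooth (\<lambda>x. grad \<psi> x $ k)" for k
    using T_smooth \<eta> \<psi> g\<eta> g\<psi> by auto
  have cs1: "cs (\<lambda>x. \<eta> x * \<psi> x)" "cs (\<lambda>x. grad \<eta> x $ ?j * \<psi> x)" "cs (\<lambda>x. \<eta> x * grad \<psi> x $ ?j)"
    by (intro cs_mult test_functions_cs[OF \<psi>] test_functions_cs[OF g\<psi>] sm)+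
  have m: "osc i \<in> borel_measurable borel" by (rule osc_props(1))
  \<comment> \<open>The instance of \<open>by_parts\<close> in direction \<open>oth i\<close> with
    constant primitive: \<open>osc i\<close>, which depends on the other coordinate, is the passive
    weight.\<close>
  have 1: "(LINT x|lborel. osc i (x $ i) * grad (\<lambda>x. \<eta> x * \<psi> x) x $ ?j) = 0"
    using by_parts[OF cs1(1), of "\<lambda>_. 1" "{}" "\<lambda>_. 0" ?M "osc i" ?j] osc_props M m by simp
  have g1: "grad (\<lambda>x. \<eta> x * \<psi> x) x $ ?j = \<eta> x * grad \<psi> x $ ?j + grad \<eta> x $ ?j * \<psi> x" for x
    using grad_mult[OF smooth_differentiable[OF sm(1)] smooth_differentiable[OF sm(2)]] by (simp add: mult.commute)
  have 2: "(LINT x|lborel. osc i (x $ i) * (\<eta> x * grad \<psi> x $ ?j)) = - (LINT x|lborel. osc i (x $ i) * (grad \<eta> x $ ?j * \<psi> x))"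
    using 1 osc_integrable[OF cs1(3), of i] osc_integrable[OF cs1(2), of i] by (simp add: g1 distrib_left)
  have 3: "(LINT x|lborel. osc i (x $ i) * (grad \<eta> x $ ?j * \<psi> x)) = - (LINT x|lborel. Z (x $ i) * grad (\<lambda>x. grad \<eta> x $ ?j * \<psi> x) x $ i)"
  proof -
    have "(LINT x|lborel. 1 * osc i (x $ i) * (grad \<eta> x $ ?j * \<psi> x)) = - (LINT x|lborel. 1 * Z (x $ i) * grad (\<lambda>x. grad \<eta> x $ ?j * \<psi> x) x $ i)"
    proof (rule by_parts[OF cs1(2), where T = ?D and C = ?M])
      show "continuous_on UNIV Z" unfolding Z_def by (rule saw(1)[unfolded Z_def])
      show "finite (?D \<inter> {- a..a})" for a by (rule saw(3))
      show "(Z has_real_derivative osc i s) (at s)" if "s \<notin> ?D" for s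
        unfolding Z_def osc_def by (rule saw(4)[unfolded Z_def osc_def, OF that])
      show "\<bar>Z s\<bar> \<le> ?M" for s using Zb[of s] M by linarith
    qed (use osc_props M m in auto)
    then show ?thesis by simp
  qed
  have g2: "grad (\<lambda>x. grad \<eta> x $ ?j * \<psi> x) x $ i = grad \<eta> x $ ?j * grad \<psi> x $ i + \<psi> x * grad (\<lambda>x. grad \<eta> x $ ?j) x $ i" for x
    using grad_mult[OF smooth_differentiable[OF sm(3)] smooth_differentiable[OF sm(2)]] by simp
  have gcs: "(\<lambda>x. grad (\<lambda>x. grad \<eta> x $ ?j * \<psi> x) x $ i) \<in> T"
    by (intro test_functions_grad test_functions_mult \<psi> sm)
  have Zm: "Z \<in> borel_measurable borel"
    by (rule borel_measurable_continuous_onI) (unfold Z_def, rule saw(1)[unfolded Z_def])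
  have bm: "(\<lambda>x. osc i (x $ i) * (\<eta> x * grad \<psi> x $ ?j)) \<in> borel_measurable borel"
    using m T_measurable(1)[OF \<eta>] T_measurable(1)[OF g\<psi>] by measurable
  have bm2: "(\<lambda>x. Z (x $ i) * grad (\<lambda>x. grad \<eta> x $ ?j * \<psi> x) x $ i) \<in> borel_measurable borel"
    using Zm T_measurable(1)[OF gcs] by measurable
  have "(LINT x|N. osc i (x $ i) * (\<eta> x * grad \<psi> x $ ?j)) = (LINT x|lborel. osc i (x $ i) * (\<eta> x * grad \<psi> x $ ?j))"
    by (rule integral_N(1)[OF bm]) (simp add: T_outside(1)[OF \<eta>])
  also have "\<dots> = (LINT x|lborel. Z (x $ i) * grad (\<lambda>x. grad \<eta> x $ ?j * \<psi> x) x $ i)" unfolding 2 3 by simp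
  also have "\<dots> = (LINT x|N. Z (x $ i) * grad (\<lambda>x. grad \<eta> x $ ?j * \<psi> x) x $ i)"
    by (rule integral_N(1)[symmetric, OF bm2]) (simp add: T_outside(1)[OF gcs])
  finally have eq: "(LINT x|N. osc i (x $ i) * (\<eta> x * grad \<psi> x $ ?j)) = (LINT x|N. Z (x $ i) * grad (\<lambda>x. grad \<eta> x $ ?j * \<psi> x) x $ i)" .
  have ii: "integrable N (\<lambda>x. norm (grad \<psi> x))" "integrable N (\<lambda>x. norm (\<psi> x))"
    using sqint_integrable[OF finite_N T_sqint(1)[OF \<psi>]] sqint_integrable[OF finite_N T_sqint(2)[OF \<psi>]] by auto
  have "norm (LINT x|N. Z (x $ i) * grad (\<lambda>x. grad \<eta> x $ ?j * \<psi> x) x $ i) \<le> (LINT x|N. norm (Z (x $ i) * grad (\<lambda>x. grad \<eta> x $ ?j * \<psi> x) x $ i))"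
    by (rule Bochner_Integration.integral_norm_bound)
  also have "\<dots> \<le> (LINT x|N. eps * K * (norm (grad \<psi> x) + norm (\<psi> x)))"
  proof (rule Bochner_Integration.integral_mono)
    have pw: "norm (Z (x $ i) * grad (\<lambda>x. grad \<eta> x $ ?j * \<psi> x) x $ i) \<le> eps * K * (norm (grad \<psi> x) + norm (\<psi> x))" for x
    proof -
      have K0: "K \<ge> 0" using K(1)[of x i] by linarith
      have "\<bar>grad \<eta> x $ ?j * grad \<psi> x $ i\<bar> \<le> K * norm (grad \<psi> x)"
        unfolding abs_mult using K(1)[of x ?j] K0 by (intro mult_mono component_le_norm_cart) auto
      moreover have "\<bar>\<psi> x * grad (\<lambda>x. grad \<eta> x $ ?j) x $ i\<bar> \<le> K * norm (\<psi> x)"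
        using mult_mono[OF K(2)[of ?j x i] order_refl[of "\<bar>\<psi> x\<bar>"]] K0 by (simp add: abs_mult mult.commute)
      ultimately have "\<bar>grad (\<lambda>x. grad \<eta> x $ ?j * \<psi> x) x $ i\<bar> \<le> K * (norm (grad \<psi> x) + norm (\<psi> x))"
        unfolding g2 by (simp add: distrib_left)
      then have "\<bar>Z (x $ i)\<bar> * \<bar>grad (\<lambda>x. grad \<eta> x $ ?j * \<psi> x) x $ i\<bar> \<le> eps * (K * (norm (grad \<psi> x) + norm (\<psi> x)))"
        using Zb[of "x $ i"] eps by (intro mult_mono) auto
      then show ?thesis by (simp add: abs_mult mult.assoc)
    qed
    show "norm (Z (x $ i) * grad (\<lambda>x. grad \<eta> x $ ?j * \<psi> x) x $ i) \<le> eps * K * (norm (grad \<psi> x) + norm (\<psi> x))" for x by (rule pw)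
    show r: "integrable N (\<lambda>x. eps * K * (norm (grad \<psi> x) + norm (\<psi> x)))" using ii by simp
    show "integrable N (\<lambda>x. norm (Z (x $ i) * grad (\<lambda>x. grad \<eta> x $ ?j * \<psi> x) x $ i))"
      by (rule Bochner_Integration.integrable_bound[OF r])
         (use borel_N[OF bm2] pw in \<open>auto intro!: AE_I2 order_trans[OF _ abs_ge_self]\<close>)
  qed
  also have "\<dots> = eps * K * ((LINT x|N. norm (grad \<psi> x)) + (LINT x|N. norm (\<psi> x)))" using ii by simp
  also have "\<dots> \<le> eps * K * (cP * nrm2 N (grad \<psi>) + cP\<^sup>2 * nrm2 N (grad \<psi>))"
  proof (rule mult_left_mono)
    have "K \<ge> 0" using K(1)[of 0 i] by linarith
    then show "0 \<le> eps * K" using eps by simp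
  qed (intro add_mono L1_bounds \<psi>)
  finally show ?thesis unfolding eq by (simp add: algebra_simps)
qed

text \<open>The strip factor, 1 / (2 t) in the strip and 0 elsewhere, is \<open>osc\<close> plus its
  mean value. The mean is 1 over the period of the horizontal strips and 1 / l over that of the
  vertical ones; this is the origin of d and d / l. The oscillating parts are of order eps, and the
  rest is the difference between c and its limit d.\<close>

lemma flux_limit:
  fixes d :: real
  assumes \<phi>: "bounded_test \<phi> K" and \<psi>: "\<psi> \<in> T"
  defines "Am \<equiv> (vector [vector [a1 + d, - b1], vector [b1, a1 + d / l]] :: real^2^2)"
  shows "\<bar>(LINT x|N. flux \<phi> x \<bullet> grad \<psi> x) - form (\<lambda>_. Am) (grad \<phi>) (grad \<psi>)\<bar>
    \<le> (2 * \<bar>c\<bar> * (eps * K * (cP + cP\<^sup>2)) + 2 * \<bar>c - d\<bar> * (K * cP)) * nrm2 N (grad \<psi>)"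
proof -
  note b = bounded_testD[OF \<phi>]
  have o: "oth 1 = 2" "oth 2 = 1" by (auto simp: oth_def)
  have gT: "(\<lambda>x. grad \<phi> x $ k) \<in> T" "(\<lambda>x. grad \<psi> x $ k) \<in> T" for k by (intro test_functions_grad b \<psi>)+
  have csp: "cs (\<lambda>x. grad \<phi> x $ k * grad \<psi> x $ k)" for k
    by (intro cs_mult test_functions_cs[OF gT(2)] T_smooth[OF gT(1)])
  have ik: "integrable N (\<lambda>x. osc i (x $ i) * (grad \<phi> x $ k * grad \<psi> x $ k))"
    "integrable N (\<lambda>x. grad \<phi> x $ k * grad \<psi> x $ k)" for i k
  proof -
    have "(\<lambda>x. grad \<phi> x $ k * grad \<psi> x $ k) \<in> borel_measurable borel" by (rule cs_measurable[OF csp])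
    moreover from this have "(\<lambda>x. osc i (x $ i) * (grad \<phi> x $ k * grad \<psi> x $ k)) \<in> borel_measurable borel"
      using osc_props(1)[of i] by measurable
    ultimately show "integrable N (\<lambda>x. osc i (x $ i) * (grad \<phi> x $ k * grad \<psi> x $ k))"
      "integrable N (\<lambda>x. grad \<phi> x $ k * grad \<psi> x $ k)"
      using integral_N(2)[of "\<lambda>x. osc i (x $ i) * (grad \<phi> x $ k * grad \<psi> x $ k)"] osc_integrable[OF csp]
        integral_N(2)[of "\<lambda>x. grad \<phi> x $ k * grad \<psi> x $ k"] cs_integrable[OF csp] T_outside(1)[OF gT(1)]
      by auto
  qed
  have oscs: "osc 2 (x $ 2) = (if strip 2 x then 1 / (2 * t) else 0) - 1" "osc 1 (x $ 1) = (if strip 1 x then 1 / (2 * t) else 0) - 1 / l" for x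
    by (simp_all add: osc_def saw'_def strip_def yy_def pr_def)
  have pw: "flux \<phi> x \<bullet> grad \<psi> x - (Am *v grad \<phi> x) \<bullet> grad \<psi> x =
     c * (osc 2 (x $ 2) * (grad \<phi> x $ 1 * grad \<psi> x $ 1)) + c * (osc 1 (x $ 1) * (grad \<phi> x $ 2 * grad \<psi> x $ 2)) +
     ((c - d) * (grad \<phi> x $ 1 * grad \<psi> x $ 1) + (c - d) / l * (grad \<phi> x $ 2 * grad \<psi> x $ 2))" for x
    unfolding inner_2 Am_def mv_vec2 oscs by (simp add: flux_def algebra_simps diff_divide_distrib)
  have fl: "integrable N (\<lambda>x. flux \<phi> x \<bullet> grad \<psi> x)" by (rule sqint_inner[OF sqint_flux[OF \<phi>] T_sqint(2)[OF \<psi>]])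
  have am: "integrable N (\<lambda>x. (Am *v grad \<phi> x) \<bullet> grad \<psi> x)"
  proof -
    have "integrable N (\<lambda>x. flux \<phi> x \<bullet> grad \<psi> x - (flux \<phi> x \<bullet> grad \<psi> x - (Am *v grad \<phi> x) \<bullet> grad \<psi> x))"
      unfolding pw using fl ik by (intro Bochner_Integration.integrable_diff Bochner_Integration.integrable_add integrable_mult_right)
    then show ?thesis by simp
  qed
  let ?n = "nrm2 N (grad \<psi>)"
  have "(LINT x|N. flux \<phi> x \<bullet> grad \<psi> x) - form (\<lambda>_. Am) (grad \<phi>) (grad \<psi>)
     = (LINT x|N. flux \<phi> x \<bullet> grad \<psi> x - (Am *v grad \<phi> x) \<bullet> grad \<psi> x)"
    unfolding form_def using fl am by simp
  also have "\<dots> = c * (LINT x|N. osc 2 (x $ 2) * (grad \<phi> x $ 1 * grad \<psi> x $ 1)) + c * (LINT x|N. osc 1 (x $ 1) * (grad \<phi> x $ 2 * grad \<psi> x $ 2)) +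
     ((c - d) * (LINT x|N. grad \<phi> x $ 1 * grad \<psi> x $ 1) + (c - d) / l * (LINT x|N. grad \<phi> x $ 2 * grad \<psi> x $ 2))"
    unfolding pw using ik by simp
  finally have eq: "(LINT x|N. flux \<phi> x \<bullet> grad \<psi> x) - form (\<lambda>_. Am) (grad \<phi>) (grad \<psi>)
     = c * (LINT x|N. osc 2 (x $ 2) * (grad \<phi> x $ 1 * grad \<psi> x $ 1)) + c * (LINT x|N. osc 1 (x $ 1) * (grad \<phi> x $ 2 * grad \<psi> x $ 2)) +
     ((c - d) * (LINT x|N. grad \<phi> x $ 1 * grad \<psi> x $ 1) + (c - d) / l * (LINT x|N. grad \<phi> x $ 2 * grad \<psi> x $ 2))" .
  have o2: "\<bar>LINT x|N. osc 2 (x $ 2) * (grad \<phi> x $ 1 * grad \<psi> x $ 1)\<bar> \<le> eps * K * (cP + cP\<^sup>2) * ?n"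
    using osc_by_parts[OF gT(1) \<psi> b(3,4), of 2 1] by (simp add: o)
  have o1: "\<bar>LINT x|N. osc 1 (x $ 1) * (grad \<phi> x $ 2 * grad \<psi> x $ 2)\<bar> \<le> eps * K * (cP + cP\<^sup>2) * ?n"
    using osc_by_parts[OF gT(1) \<psi> b(3,4), of 1 2] by (simp add: o)
  have r: "\<bar>LINT x|N. grad \<phi> x $ k * grad \<psi> x $ k\<bar> \<le> K * cP * ?n" for k
  proof -
    have ii: "integrable N (\<lambda>x. norm (grad \<psi> x))"
      using sqint_integrable[OF finite_N T_sqint(2)[OF \<psi>]] by auto
    have "\<bar>LINT x|N. grad \<phi> x $ k * grad \<psi> x $ k\<bar> \<le> (LINT x|N. \<bar>grad \<phi> x $ k * grad \<psi> x $ k\<bar>)" by (rule integral_abs_bound)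
    also have "\<dots> \<le> (LINT x|N. K * norm (grad \<psi> x))"
    proof (rule Bochner_Integration.integral_mono)
      show "\<bar>grad \<phi> x $ k * grad \<psi> x $ k\<bar> \<le> K * norm (grad \<psi> x)" for x
        unfolding abs_mult using b(2,5) by (intro mult_mono component_le_norm_cart) auto
    qed (use ii ik in auto)
    also have "\<dots> = K * (LINT x|N. norm (grad \<psi> x))" using ii by simp
    also have "\<dots> \<le> K * (cP * ?n)" by (intro mult_left_mono L1_bounds \<psi> b)
    finally show ?thesis by (simp add: mult.assoc)
  qed
  have l1: "\<bar>(c - d) / l\<bar> \<le> \<bar>c - d\<bar>" using l by (simp add: abs_divide field_simps mult_left_le_one_le)
       (metis abs_ge_zero mult.commute mult_le_cancel_left1 mult.right_neutral mult_left_mono)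
  have t1: "\<bar>c * (LINT x|N. osc 2 (x $ 2) * (grad \<phi> x $ 1 * grad \<psi> x $ 1))\<bar> \<le> \<bar>c\<bar> * (eps * K * (cP + cP\<^sup>2) * ?n)"
    "\<bar>c * (LINT x|N. osc 1 (x $ 1) * (grad \<phi> x $ 2 * grad \<psi> x $ 2))\<bar> \<le> \<bar>c\<bar> * (eps * K * (cP + cP\<^sup>2) * ?n)"
    unfolding abs_mult by (rule mult_left_mono[OF o2 abs_ge_zero], rule mult_left_mono[OF o1 abs_ge_zero])
  have t2: "\<bar>(c - d) * (LINT x|N. grad \<phi> x $ 1 * grad \<psi> x $ 1)\<bar> \<le> \<bar>c - d\<bar> * (K * cP * ?n)"
    unfolding abs_mult using r by (intro mult_left_mono) auto
  have t3: "\<bar>(c - d) / l * (LINT x|N. grad \<phi> x $ 2 * grad \<psi> x $ 2)\<bar> \<le> \<bar>c - d\<bar> * (K * cP * ?n)"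
    unfolding abs_mult[of "(c - d) / l"] using r l1 by (intro mult_mono) auto
  have "\<bar>(LINT x|N. flux \<phi> x \<bullet> grad \<psi> x) - form (\<lambda>_. Am) (grad \<phi>) (grad \<psi>)\<bar> \<le> 2 * (\<bar>c\<bar> * (eps * K * (cP + cP\<^sup>2) * ?n)) + 2 * (\<bar>c - d\<bar> * (K * cP * ?n))"
    unfolding eq using t1 t2 t3 unfolding abs_le_iff by (elim conjE, intro conjI; linarith)
  then show ?thesis by (simp add: algebra_simps)
qed

end

section \<open>Convergence of the solutions\<close>

lemma elliptic_mono: "elliptic \<sigma> \<alpha> \<Lambda> \<Longrightarrow> 0 < \<alpha>' \<Longrightarrow> \<alpha>' \<le> \<alpha> \<Longrightarrow> elliptic \<sigma> \<alpha>' \<Lambda>"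
  unfolding elliptic_def by (meson mult_right_mono order_trans zero_le_power2)

context bdd_domain
begin

text \<open>The residual is split between two norms. The part s is measured in the energy of the
  test function, where the large coefficients help, and the part r in the Dirichlet norm. Testing
  with the difference and dividing by the root of its energy gives the bound.\<close>

lemma energy_estimate:
  assumes e: "elliptic \<sigma> m \<Lambda>" and v: "sol \<sigma> f v g \<phi>" and w: "w \<in> T" and s: "s \<ge> 0" and r: "r \<ge> 0"
    and res: "\<And>\<psi>. \<psi> \<in> T \<Longrightarrow> \<bar>f \<psi> - form \<sigma> (grad w) (grad \<psi>)\<bar>
      \<le> s * sqrt (form \<sigma> (grad \<psi>) (grad \<psi>)) + r * nrm2 N (grad \<psi>)"
  shows "nrm2 N (\<lambda>x. v x - w x) \<le> cP / sqrt m * (s + r / sqrt m)"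
proof -
  have m: "m > 0" "\<Lambda> > 0" using e by (auto simp: elliptic_def)
  have ap: "approx v g \<phi>" using v by (simp add: sol_def)
  note a = approxD[OF ap]
  define \<theta> where "\<theta> k = nrm2 N (\<lambda>x. grad (\<phi> k) x - g x)" for k
  have \<theta>: "\<theta> \<longlonglongrightarrow> 0" unfolding \<theta>_def[abs_def] by (rule a(5))
  \<comment> \<open>The difference v - w is not a test function, but \<phi> k - w is. The additional
    term with \<Lambda> vanishes as k grows, since \<sigma> and hence \<Lambda> are fixed
    here.\<close>
  have bnd: "nrm2 N (\<lambda>x. \<phi> k x - w x) \<le> cP / sqrt m * (s + (r + \<Lambda> * \<theta> k) / sqrt m)" for k
  proof -
    define \<psi> where "\<psi> = (\<lambda>x. \<phi> k x - w x)"
    have \<psi>: "\<psi> \<in> T" unfolding \<psi>_def by (intro test_functions_diff a w)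
    have g\<psi>: "grad \<psi> = (\<lambda>x. grad (\<phi> k) x - grad w x)" unfolding \<psi>_def by (rule grad_T_diff[OF a(1) w])
    note sq = T_sqint(2)[OF \<psi>] T_sqint(2)[OF a(1)] T_sqint(2)[OF w] a(3)
    let ?Q = "form \<sigma> (grad \<psi>) (grad \<psi>)" and ?n = "nrm2 N (grad \<psi>)"
    have co: "m * ?n\<^sup>2 \<le> ?Q" by (rule form_coercive[OF e sq(1)])
    then have Q0: "?Q \<ge> 0" using m by (meson mult_nonneg_nonneg less_imp_le order_trans zero_le_power2)
    have n: "?n \<le> sqrt ?Q / sqrt m"
    proof -
      have "?n\<^sup>2 \<le> ?Q / m" using co m by (simp add: field_simps)
      then have "?n \<le> sqrt (?Q / m)" by (rule real_le_rsqrt)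
      then show ?thesis by (simp add: real_sqrt_divide)
    qed
    have "?Q = form \<sigma> (grad (\<phi> k)) (grad \<psi>) - form \<sigma> (grad w) (grad \<psi>)"
      by (subst (1) g\<psi>) (rule form_diff_left[OF e sq(2,3,1)])
    also have "form \<sigma> (grad (\<phi> k)) (grad \<psi>) = f \<psi> + form \<sigma> (\<lambda>x. grad (\<phi> k) x - g x) (grad \<psi>)"
      using form_diff_left[OF e sq(2,4,1), of k] v \<psi> by (simp add: sol_def)
    also have "f \<psi> + form \<sigma> (\<lambda>x. grad (\<phi> k) x - g x) (grad \<psi>) - form \<sigma> (grad w) (grad \<psi>)
       \<le> (s * sqrt ?Q + r * ?n) + \<Lambda> * \<theta> k * ?n"
      using res[OF \<psi>] form_bound[OF e sqint_diff(1)[OF sq(2,4)] sq(1), of k] unfolding \<theta>_def by linarith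
    also have "\<dots> = s * sqrt ?Q + (r + \<Lambda> * \<theta> k) * ?n" by (simp add: algebra_simps)
    also have "\<dots> \<le> s * sqrt ?Q + (r + \<Lambda> * \<theta> k) * (sqrt ?Q / sqrt m)"
      using r m by (intro add_left_mono mult_left_mono[OF n]) (simp add: \<theta>_def)
    finally have "sqrt ?Q * sqrt ?Q \<le> (s + (r + \<Lambda> * \<theta> k) / sqrt m) * sqrt ?Q"
      using Q0 by (simp add: algebra_simps)
    then have "sqrt ?Q \<le> s + (r + \<Lambda> * \<theta> k) / sqrt m"
    proof (cases "?Q = 0")
      case True
      then show ?thesis using s r m by (simp add: \<theta>_def)
    next
      case False
      then have "sqrt ?Q > 0" using Q0 by simp
      with \<open>sqrt ?Q * sqrt ?Q \<le> _\<close> show ?thesis by (rule mult_right_le_imp_le)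
    qed
    then have "sqrt ?Q / sqrt m \<le> (s + (r + \<Lambda> * \<theta> k) / sqrt m) / sqrt m" using m by (intro divide_right_mono) auto
    with n have "?n \<le> (s + (r + \<Lambda> * \<theta> k) / sqrt m) / sqrt m" by linarith
    then have "cP * ?n \<le> cP * ((s + (r + \<Lambda> * \<theta> k) / sqrt m) / sqrt m)" by (intro mult_left_mono cP_nonneg)
    then have "cP * ?n \<le> cP / sqrt m * (s + (r + \<Lambda> * \<theta> k) / sqrt m)" by simp
    with poincare[OF \<psi>] show ?thesis unfolding \<psi>_def by linarith
  qed
  have lim1: "(\<lambda>k. nrm2 N (\<lambda>x. \<phi> k x - w x)) \<longlonglongrightarrow> nrm2 N (\<lambda>x. v x - w x)"
    by (rule nrm2_tendsto) (use a T_sqint(1)[OF w] T_sqint(1)[OF a(1)] in \<open>auto intro: sqint_diff\<close>)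
  have "(\<lambda>k. cP / sqrt m * (s + (r + \<Lambda> * \<theta> k) / sqrt m)) \<longlonglongrightarrow> cP / sqrt m * (s + (r + \<Lambda> * 0) / sqrt m)"
    using m by (intro tendsto_intros \<theta>) auto
  from LIMSEQ_le[OF lim1 this] bnd show ?thesis by auto
qed

end

context cross_corrector
begin

lemma c_eq: "c = 2 * ((t * A)\<^sup>2 + (t * B)\<^sup>2) / (t * A)"
  using A_pos t by (simp add: c_def e_def field_simps power2_eq_square)

text \<open>The path leads from v to \<open>corr \<phi>\<close> by the energy estimate, then to
  \<phi> by the smallness of the corrector, then to u. In the residual, f is first written as the
  limit form of gu, then gu is replaced by \<open>grad \<phi>\<close>, and the result is compared
  with the target flux and with the corrected field.\<close>

lemma L2_estimate:
  fixes d :: real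
  assumes L: "L > 0" "\<And>x i. x \<in> \<Omega> \<Longrightarrow> \<bar>x $ i\<bar> \<le> L" and bt: "bounded_test \<phi> K"
    and v: "sol sig f v g \<phi>v"
  defines "Am \<equiv> (vector [vector [a1 + d, - b1], vector [b1, a1 + d / l]] :: real^2^2)"
  assumes e: "elliptic (\<lambda>_. Am) \<alpha> \<Lambda>" and u: "sol (\<lambda>_. Am) f u gu \<phi>u"
  shows "nrm2 N (\<lambda>x. v x - u x) \<le>
    cP / sqrt (1 / \<kappa>) * (sqrt (12 * (10 * (\<kappa> ^ 3 * Cs * K))\<^sup>2 * \<kappa> * (err_const L * (t + eps\<^sup>2))) +
      ((2 * \<bar>c\<bar> * (eps * K * (cP + cP\<^sup>2)) + 2 * \<bar>c - d\<bar> * (K * cP)) + \<Lambda> * nrm2 N (\<lambda>x. gu x - grad \<phi> x)) / sqrt (1 / \<kappa>)) +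
    4 * (\<kappa>\<^sup>2 * Cs * K) * eps * cP + nrm2 N (\<lambda>x. \<phi> x - u x)"
    (is "_ \<le> cP / _ * (?s + (?r + ?d) / _) + ?o + _")
proof -
  note b = bounded_testD[OF bt]
  have w: "corr \<phi> \<in> T" by (rule corr_T[OF b(1)])
  have \<Lambda>: "\<Lambda> > 0" using e by (auto simp: elliptic_def)
  have ap: "approx u gu \<phi>u" "approx v g \<phi>v" using u v by (auto simp: sol_def)
  note a = approxD[OF ap(1)] and a' = approxD[OF ap(2)]
  have "1 / \<kappa> \<le> 1 / (\<kappa> * t)" using t \<kappa> by (intro divide_left_mono) (auto simp: mult_left_le)
  then have "1 / \<kappa> \<le> min a1 A" using a1 A by simp
  then have es: "elliptic sig (1 / \<kappa>) (max (\<bar>a1\<bar> + \<bar>b1\<bar>) (\<bar>A\<bar> + \<bar>B\<bar>))"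
    using \<kappa> by (intro elliptic_mono[OF sig_elliptic]) auto
  have ec: "err_const L \<ge> 0" unfolding err_const_def using L by simp
  have s0: "?s \<ge> 0" using ec t \<kappa> by simp
  have r0: "?r + ?d \<ge> 0" using eps b(5) cP_nonneg \<Lambda> by simp
  have "nrm2 N (\<lambda>x. v x - corr \<phi> x) \<le> cP / sqrt (1 / \<kappa>) * (?s + (?r + ?d) / sqrt (1 / \<kappa>))"
  proof (rule energy_estimate[OF es v w s0 r0])
    fix \<psi> assume \<psi>: "\<psi> \<in> T"
    have f: "f \<psi> = form (\<lambda>_. Am) gu (grad \<psi>)" using u \<psi> by (simp add: sol_def)
    have 1: "form (\<lambda>_. Am) (\<lambda>x. gu x - grad \<phi> x) (grad \<psi>) = form (\<lambda>_. Am) gu (grad \<psi>) - form (\<lambda>_. Am) (grad \<phi>) (grad \<psi>)"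
      by (rule form_diff_left[OF e a(3) T_sqint(2)[OF b(1)] T_sqint(2)[OF \<psi>]])
    have 2: "\<bar>form (\<lambda>_. Am) (\<lambda>x. gu x - grad \<phi> x) (grad \<psi>)\<bar> \<le> ?d * nrm2 N (grad \<psi>)"
      by (rule form_bound[OF e sqint_diff(1)[OF a(3) T_sqint(2)[OF b(1)]] T_sqint(2)[OF \<psi>]])
    have 3: "\<bar>(LINT x|N. flux \<phi> x \<bullet> grad \<psi> x) - form (\<lambda>_. Am) (grad \<phi>) (grad \<psi>)\<bar> \<le> ?r * nrm2 N (grad \<psi>)"
      unfolding Am_def by (rule flux_limit[OF bt \<psi>])
    have 4: "\<bar>form sig (grad (corr \<phi>)) (grad \<psi>) - (LINT x|N. flux \<phi> x \<bullet> grad \<psi> x)\<bar> \<le> ?s * sqrt (form sig (grad \<psi>) (grad \<psi>))"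
      by (rule residual_integral[OF L bt \<psi>])
    have "(?r + ?d) * nrm2 N (grad \<psi>) = ?r * nrm2 N (grad \<psi>) + ?d * nrm2 N (grad \<psi>)" by (rule distrib_right)
    with 1 2 3 4 f show "\<bar>f \<psi> - form sig (grad (corr \<phi>)) (grad \<psi>)\<bar>
      \<le> ?s * sqrt (form sig (grad \<psi>) (grad \<psi>)) + (?r + ?d) * nrm2 N (grad \<psi>)" by linarith
  qed
  moreover have "nrm2 N (\<lambda>x. corr \<phi> x - \<phi> x) \<le> ?o"
  proof -
    let ?M = "4 * (\<kappa>\<^sup>2 * Cs * K) * eps"
    have M: "?M \<ge> 0" using eps S(8) b(5) by simp
    have "\<bar>corr \<phi> x - \<phi> x\<bar> \<le> ?M" for x
    proof -
      let ?p = "e * X 2 (x $ 2) - X 1 (x $ 1)" and ?q = "X 2 (x $ 2) + e * X 1 (x $ 1)"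
      have t1: "2 * \<kappa>\<^sup>2 * (eps * t * Cs) \<le> 2 * \<kappa>\<^sup>2 * (eps * 1 * Cs)"
        using t eps S(8) by (intro mult_left_mono mult_right_mono) auto
      have p: "\<bar>?p\<bar> \<le> 2 * \<kappa>\<^sup>2 * (eps * 1 * Cs)" "\<bar>?q\<bar> \<le> 2 * \<kappa>\<^sup>2 * (eps * 1 * Cs)"
        using osc_bound[of x] t1 by linarith+
      have p0: "0 \<le> 2 * \<kappa>\<^sup>2 * (eps * 1 * Cs)" using eps S(8) by simp
      have "\<bar>?p * grad \<phi> x $ 1\<bar> \<le> 2 * \<kappa>\<^sup>2 * (eps * 1 * Cs) * K"
        unfolding abs_mult[of ?p] by (rule mult_mono[OF p(1) b(2) p0 abs_ge_zero])
      moreover have "\<bar>?q * grad \<phi> x $ 2\<bar> \<le> 2 * \<kappa>\<^sup>2 * (eps * 1 * Cs) * K"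
        unfolding abs_mult[of ?q] by (rule mult_mono[OF p(2) b(2) p0 abs_ge_zero])
      moreover have "?M = 2 * \<kappa>\<^sup>2 * (eps * 1 * Cs) * K + 2 * \<kappa>\<^sup>2 * (eps * 1 * Cs) * K" by simp
      moreover have "corr \<phi> x - \<phi> x = ?p * grad \<phi> x $ 1 - ?q * grad \<phi> x $ 2" by (simp add: corr_def)
      ultimately show ?thesis by linarith
    qed
    then have ae: "AE x in N. norm (corr \<phi> x - \<phi> x) \<le> norm ?M" using M by simp
    have "(\<lambda>x. corr \<phi> x - \<phi> x) \<in> borel_measurable N"
      using sqint_diff(1)[OF T_sqint(1)[OF w] T_sqint(1)[OF b(1)]] by (simp add: sqint_def)
    from sqint_bound(2)[OF sqint_const[OF finite_N] this ae]
    have "nrm2 N (\<lambda>x. corr \<phi> x - \<phi> x) \<le> nrm2 N (\<lambda>x. ?M)" .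
    also have "\<dots> = ?M * cP" using nrm2_const[OF finite_N, of ?M] M by (simp add: cP_def)
    finally show ?thesis .
  qed
  moreover have "nrm2 N (\<lambda>x. v x - u x) \<le> nrm2 N (\<lambda>x. v x - corr \<phi> x) + nrm2 N (\<lambda>x. corr \<phi> x - u x)"
    by (rule nrm2_triangle[OF a'(2) T_sqint(1)[OF w] a(2)])
  moreover have "nrm2 N (\<lambda>x. corr \<phi> x - u x) \<le> nrm2 N (\<lambda>x. corr \<phi> x - \<phi> x) + nrm2 N (\<lambda>x. \<phi> x - u x)"
    by (rule nrm2_triangle[OF T_sqint(1)[OF w] T_sqint(1)[OF b(1)] a(2)])
  ultimately show ?thesis by linarith
qed

end

lemma const_elliptic:
  fixes p r b :: real
  assumes "\<alpha> > 0" "\<alpha> \<le> p" "\<alpha> \<le> r"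
  obtains \<Lambda> where "elliptic (\<lambda>_. vector [vector [p, - b], vector [b, r]]) \<alpha> \<Lambda>"
proof -
  let ?M = "vector [vector [p, - b], vector [b, r]] :: real^2^2"
  obtain k where k: "\<And>\<xi>. norm (?M *v \<xi>) \<le> norm \<xi> * k"
    using bounded_linear.bounded[OF matrix_vector_mul_bounded_linear[of ?M]] by blast
  have up: "norm (?M *v \<xi>) \<le> max k \<alpha> * norm \<xi>" for \<xi>
  proof -
    have "norm (?M *v \<xi>) \<le> norm \<xi> * k" by (rule k)
    also have "\<dots> \<le> norm \<xi> * max k \<alpha>" by (intro mult_left_mono) auto
    finally show ?thesis by (simp add: mult.commute)
  qed
  have lo: "\<alpha> * (norm \<xi>)\<^sup>2 \<le> (?M *v \<xi>) \<bullet> \<xi>" for \<xi>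
  proof -
    have "\<alpha> * (\<xi> $ 1)\<^sup>2 \<le> p * (\<xi> $ 1)\<^sup>2" "\<alpha> * (\<xi> $ 2)\<^sup>2 \<le> r * (\<xi> $ 2)\<^sup>2"
      using assms by (auto intro!: mult_right_mono)
    moreover have "(?M *v \<xi>) \<bullet> \<xi> = p * (\<xi> $ 1)\<^sup>2 + r * (\<xi> $ 2)\<^sup>2"
      unfolding inner_2 mv_vec2 by (simp add: power2_eq_square algebra_simps)
    ultimately show ?thesis unfolding norm_2 by (simp add: distrib_left)
  qed
  have "elliptic (\<lambda>_. ?M) \<alpha> (max k \<alpha>)"
    unfolding elliptic_def using up lo assms by auto
  then show ?thesis by (rule that)
qed

text \<open>All bounds, for every n and every tolerance 1 / (k + 1), hold simultaneously off one
  null set. Setting v n equal to u there gives uniform convergence at every point.\<close>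

lemma AE_uniform_limit_modify:
  fixes v :: "nat \<Rightarrow> 'a \<Rightarrow> real"
  assumes conv: "\<And>\<omega>. \<omega> > 0 \<Longrightarrow> \<forall>\<^sub>F n in sequentially. AE x in M. \<bar>v n x - u x\<bar> \<le> \<omega>"
  obtains Z where "Z \<in> null_sets M" "uniform_limit (space M) (\<lambda>n x. if x \<in> Z then u x else v n x) u sequentially"
proof -
  define P where "P n k \<longleftrightarrow> (AE x in M. \<bar>v n x - u x\<bar> \<le> inverse (real (Suc k)))" for n k :: nat
  have "AE x in M. P n k \<longrightarrow> \<bar>v n x - u x\<bar> \<le> inverse (real (Suc k))" for n k
    by (cases "P n k") (auto simp: P_def)
  then have "AE x in M. \<forall>n k. P n k \<longrightarrow> \<bar>v n x - u x\<bar> \<le> inverse (real (Suc k))"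
    by (simp add: AE_all_countable)
  then obtain Z where Z: "{x \<in> space M. \<not> (\<forall>n k. P n k \<longrightarrow> \<bar>v n x - u x\<bar> \<le> inverse (real (Suc k)))} \<subseteq> Z"
    "emeasure M Z = 0" "Z \<in> sets M"
    by (rule AE_E)
  have "uniform_limit (space M) (\<lambda>n x. if x \<in> Z then u x else v n x) u sequentially"
  proof (rule uniform_limitI)
    fix \<omega> :: real assume "\<omega> > 0"
    then obtain k where k: "inverse (real (Suc k)) < \<omega>" using reals_Archimedean by blast
    have "\<forall>\<^sub>F n in sequentially. P n k" unfolding P_def by (rule conv) simp
    then show "\<forall>\<^sub>F n in sequentially. \<forall>x\<in>space M. dist (if x \<in> Z then u x else v n x) (u x) < \<omega>"
    proof eventually_elim
      case (elim n)
      show ?case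
      proof
        fix x assume x: "x \<in> space M"
        show "dist (if x \<in> Z then u x else v n x) (u x) < \<omega>"
        proof (cases "x \<in> Z")
          case False
          then have "\<bar>v n x - u x\<bar> \<le> inverse (real (Suc k))" using Z(1) x elim by blast
          with k False show ?thesis by (simp add: dist_real_def)
        qed (use \<open>\<omega> > 0\<close> in simp)
      qed
    qed
  qed
  moreover have "Z \<in> null_sets M" using Z by auto
  ultimately show ?thesis by (rule that[rotated])
qed

context bdd_domain
begin

text \<open>Two limits in a fixed order: a test function close to u is fixed first, and with it the
  bound K on its derivatives, which may be huge; then n tends to infinity and all terms containing K
  vanish.\<close>

lemma cross_L2_convergence:
  fixes l a1 b1 p s :: real and eps t A B :: "nat \<Rightarrow> real"
  assumes l: "l \<ge> 1" and eps: "\<And>n. eps n > 0" "eps \<longlonglongrightarrow> 0" and t: "\<And>n. t n > 0" "t \<longlonglongrightarrow> 0" and a1: "a1 > 0"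
    and tA: "(\<lambda>n. t n * A n) \<longlonglongrightarrow> p" "p > 0" and tB: "(\<lambda>n. t n * B n) \<longlonglongrightarrow> s"
    and v: "\<And>n. sol (\<lambda>x. cross_conductivity l (t n) a1 b1 (A n) (B n) 1 (x /\<^sub>R eps n)) f (v n) (gv n) (\<phi>v n)"
  defines "d \<equiv> 2 * (p\<^sup>2 + s\<^sup>2) / p"
  assumes u: "sol (\<lambda>_. vector [vector [a1 + d, - b1], vector [b1, a1 + d / l]]) f u gu \<phi>u"
  shows "(\<lambda>n. nrm2 N (\<lambda>x. v n x - u x)) \<longlonglongrightarrow> 0"
proof -
  have d0: "d \<ge> 0" using tA(2) by (simp add: d_def)
  obtain \<Lambda> where e: "elliptic (\<lambda>_. vector [vector [a1 + d, - b1], vector [b1, a1 + d / l]]) a1 \<Lambda>"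
    using const_elliptic[of a1 "a1 + d" "a1 + d / l" b1] a1 d0 l by auto
  have ap: "approx u gu \<phi>u" using u by (simp add: sol_def)
  note a = approxD[OF ap]
  obtain S S' :: "real \<Rightarrow> real" and Cs :: real where S: "\<And>k. Dk k S" "\<And>y. (S has_real_derivative S' y) (at y)"
    "\<And>y. \<bar>y\<bar> \<le> 1 \<Longrightarrow> S y = y" "\<And>y. \<bar>y\<bar> \<le> 1 \<Longrightarrow> S' y = 1"
    "\<And>y. \<bar>y\<bar> \<ge> 4 \<Longrightarrow> S y = 0" "\<And>y. \<bar>y\<bar> \<ge> 4 \<Longrightarrow> S' y = 0"
    "\<And>y. \<bar>S y\<bar> \<le> Cs" "\<And>y. \<bar>S' y\<bar> \<le> Cs" "Cs \<ge> 1"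
    by (rule cutoff_identity_exists) blast
  obtain L where L: "L > 0" "\<And>x i. x \<in> \<Omega> \<Longrightarrow> \<bar>x $ i\<bar> \<le> L"
  proof -
    obtain L where "L > 0" "\<And>x. x \<in> \<Omega> \<Longrightarrow> norm x \<le> L" using bounded_\<Omega> by (auto simp: bounded_pos)
    then show ?thesis using that component_le_norm_cart order_trans by metis
  qed
  \<comment> \<open>Large enough for a1 and b1 and, with a margin, for the limits p of t A and s of
    t B; the bounds of the locale then hold for all large n.\<close>
  define \<kappa> where "\<kappa> = 2 + a1 + 1 / a1 + \<bar>b1\<bar> + 2 / p + p + \<bar>s\<bar>"
  have pp: "0 < 1 / a1" "0 < 2 / p" using a1 tA by auto
  then have \<kappa>: "\<kappa> \<ge> 1" "a1 \<le> \<kappa>" "\<bar>b1\<bar> \<le> \<kappa>" "1 / a1 \<le> \<kappa>" "2 / p \<le> \<kappa>" "p + 1 \<le> \<kappa>" "\<bar>s\<bar> + 1 \<le> \<kappa>"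
    using a1 tA by (simp_all add: \<kappa>_def)
  define m where "m = 1 / \<kappa>"
  have m: "m > 0" using \<kappa> by (simp add: m_def)
  have \<kappa>1: "1 / \<kappa> \<le> a1" "1 / \<kappa> \<le> p / 2" using \<kappa> a1 tA(2) by (auto simp: field_simps)
  define c where "c n = 2 * ((t n * A n)\<^sup>2 + (t n * B n)\<^sup>2) / (t n * A n)" for n
  have c: "c \<longlonglongrightarrow> d" unfolding c_def[abs_def] d_def by (intro tendsto_intros tA tB) (use tA in auto)
  define E where "E K \<delta> \<rho> n = cP / sqrt m * (sqrt (12 * (10 * (\<kappa> ^ 3 * Cs * K))\<^sup>2 * \<kappa> * (cross_corrector.err_const L * (t n + (eps n)\<^sup>2))) +
      ((2 * \<bar>c n\<bar> * (eps n * K * (cP + cP\<^sup>2)) + 2 * \<bar>c n - d\<bar> * (K * cP)) + \<Lambda> * \<delta>) / sqrt m) +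
    4 * (\<kappa>\<^sup>2 * Cs * K) * eps n * cP + \<rho>" for K \<delta> \<rho> n
  have E: "E K \<delta> \<rho> \<longlonglongrightarrow> cP / sqrt m * (sqrt (12 * (10 * (\<kappa> ^ 3 * Cs * K))\<^sup>2 * \<kappa> * (cross_corrector.err_const L * (0 + 0\<^sup>2))) +
      ((2 * \<bar>d\<bar> * (0 * K * (cP + cP\<^sup>2)) + 2 * \<bar>d - d\<bar> * (K * cP)) + \<Lambda> * \<delta>) / sqrt m) +
    4 * (\<kappa>\<^sup>2 * Cs * K) * 0 * cP + \<rho>" for K \<delta> \<rho>
    unfolding E_def[abs_def] by (intro tendsto_intros eps t c) (use m in auto)
  have le: "\<forall>\<^sub>F n in sequentially. nrm2 N (\<lambda>x. v n x - u x) \<le> E K (nrm2 N (\<lambda>x. gu x - grad \<phi> x)) (nrm2 N (\<lambda>x. \<phi> x - u x)) n"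
    if bt: "bounded_test \<phi> K" for \<phi> K
  proof -
    have "\<forall>\<^sub>F n in sequentially. t n < 1/8" by (rule order_tendstoD(2)[OF t(2)]) simp
    moreover have "\<forall>\<^sub>F n in sequentially. eps n < 1" by (rule order_tendstoD(2)[OF eps(2)]) simp
    moreover have "\<forall>\<^sub>F n in sequentially. t n * A n > p / 2" by (rule order_tendstoD(1)[OF tA(1)]) (use tA in simp)
    moreover have "\<forall>\<^sub>F n in sequentially. t n * A n < p + 1" by (rule order_tendstoD(2)[OF tA(1)]) simp
    moreover have "\<forall>\<^sub>F n in sequentially. \<bar>t n * B n\<bar> < \<bar>s\<bar> + 1" by (rule order_tendstoD(2)[OF tendsto_rabs[OF tB]]) simp
    ultimately show ?thesis
    proof eventually_elim
      case (elim n)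
      have tn: "t n > 0" by (rule t)
      interpret cc: cross_corrector \<Omega> l "t n" "eps n" a1 b1 "A n" "B n" \<kappa> Cs S S'
      proof
        have "1 / \<kappa> \<le> t n * A n" "t n * A n \<le> \<kappa>" "\<bar>t n * B n\<bar> \<le> \<kappa>" using elim \<kappa> \<kappa>1 by linarith+
        then show "1 / (\<kappa> * t n) \<le> A n" "A n \<le> \<kappa> / t n" "\<bar>B n\<bar> \<le> \<kappa> / t n"
          using tn \<kappa> by (auto simp: field_simps abs_mult)
        show "t n < 1/8" "eps n \<le> 1" "1 / \<kappa> \<le> a1" using elim \<kappa>1 by auto
      qed (intro S l \<kappa> tn eps; assumption)+
      have "cc.c = c n" unfolding c_def by (rule cc.c_eq)
      moreover have "sol cc.sig f (v n) (gv n) (\<phi>v n)" using v[of n] unfolding cc.sig_def[abs_def] .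
      ultimately show ?case
        using cc.L2_estimate[OF L bt _ e u] unfolding E_def m_def by simp
    qed
  qed
  show ?thesis
  proof (rule order_tendstoI)
    fix z :: real assume "z < 0"
    then show "\<forall>\<^sub>F n in sequentially. z < nrm2 N (\<lambda>x. v n x - u x)"
      by (intro always_eventually allI) (rule order_less_le_trans[OF _ nrm2_nonneg])
  next
    fix z :: real assume z: "z > 0"
    have "(\<lambda>k. cP / sqrt m * (\<Lambda> * nrm2 N (\<lambda>x. gu x - grad (\<phi>u k) x) / sqrt m) + nrm2 N (\<lambda>x. \<phi>u k x - u x))
       \<longlonglongrightarrow> cP / sqrt m * (\<Lambda> * 0 / sqrt m) + 0"
      by (intro tendsto_intros a(4) a(5)[folded nrm2_commute[of N gu]]) (use m in auto)
    then have "\<forall>\<^sub>F k in sequentially. cP / sqrt m * (\<Lambda> * nrm2 N (\<lambda>x. gu x - grad (\<phi>u k) x) / sqrt m) + nrm2 N (\<lambda>x. \<phi>u k x - u x) < z"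
      by (rule order_tendstoD(2)) (use z in simp)
    then obtain k where k: "cP / sqrt m * (\<Lambda> * nrm2 N (\<lambda>x. gu x - grad (\<phi>u k) x) / sqrt m) + nrm2 N (\<lambda>x. \<phi>u k x - u x) < z"
      by (auto simp: eventually_sequentially)
    \<comment> \<open>K depends on the chosen k, which stays fixed while n tends to
      infinity.\<close>
    obtain K where K: "bounded_test (\<phi>u k) K" using bounded_test_exists[OF a(1)] by blast
    have "\<forall>\<^sub>F n in sequentially. E K (nrm2 N (\<lambda>x. gu x - grad (\<phi>u k) x)) (nrm2 N (\<lambda>x. \<phi>u k x - u x)) n < z"
      by (rule order_tendstoD(2)[OF E]) (use k in simp)
    with le[OF K] show "\<forall>\<^sub>F n in sequentially. nrm2 N (\<lambda>x. v n x - u x) < z"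
      by eventually_elim linarith
  qed
qed

text \<open>Eventually the solutions v n share the lower ellipticity bound \<alpha> with u, hence
  one radius of equicontinuity; closeness in L2 relative to this radius is upgraded to closeness
  almost everywhere.\<close>

lemma uniform_convergence:
  assumes R0: "R0 > 0" "\<And>c s. 0 < s \<Longrightarrow> s < R0 \<Longrightarrow> square c s \<subseteq> \<Omega> \<or> \<not> square_bd c s \<subseteq> \<Omega>"
    and f: "supp_bound f C \<gamma>" "H_functional f C0" and \<omega>: "\<omega> > 0"
    and e: "\<forall>\<^sub>F n in sequentially. elliptic (\<sigma> n) \<alpha> (\<Lambda> n)" "elliptic \<sigma>' \<alpha> \<Lambda>'"
    and v: "\<And>n. sol (\<sigma> n) f (v n) (gv n) (\<phi>v n)" and u: "sol \<sigma>' f u gu \<phi>u"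
    and lim: "(\<lambda>n. nrm2 N (\<lambda>x. v n x - u x)) \<longlonglongrightarrow> 0"
  shows "\<forall>\<^sub>F n in sequentially. AE x in N. \<bar>v n x - u x\<bar> \<le> \<omega>"
proof -
  have \<alpha>: "\<alpha> > 0" using e(2) by (simp add: elliptic_def)
  have \<omega>3: "\<omega> / 3 > 0" using \<omega> by simp
  obtain r where r: "r > 0" "\<And>\<sigma> \<Lambda> u g \<phi> c. elliptic \<sigma> \<alpha> \<Lambda> \<Longrightarrow> sol \<sigma> f u g \<phi> \<Longrightarrow>
      \<exists>G\<in>null_sets N. \<forall>x\<in>square c r. \<forall>y\<in>square c r. x \<notin> G \<longrightarrow> y \<notin> G \<longrightarrow> \<bar>ext0 u x - ext0 u y\<bar> \<le> \<omega> / 3"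
    using equicontinuity[OF R0 f \<alpha> \<omega>3] by (metis (no_types))
  have sq: "sqint N u" "sqint N (v n)" for n
    using u v approxD(2) unfolding sol_def by blast+
  have "\<forall>\<^sub>F n in sequentially. nrm2 N (\<lambda>x. v n x - u x) < \<omega> / 3 * (2 * r)"
    by (rule order_tendstoD(2)[OF lim]) (use \<omega> r in simp)
  with e(1) show ?thesis
  proof eventually_elim
    case (elim n)
    have "AE x in N. \<bar>v n x - u x\<bar> \<le> 2 * (\<omega> / 3) + \<omega> / 3"
      by (rule AE_close_of_equicontinuity[OF sq(2) sq(1) r(1) \<omega>3 r(2)[OF elim(1) v] r(2)[OF e(2) u] elim(2)])
    then show ?case by simp
  qed
qed

end

theorem proposition3p2:
  fixes \<Omega> :: "(real^2) set"
    and f :: "(real^2 \<Rightarrow> real) \<Rightarrow> real"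
    and q h l \<alpha>\<^sub>1 \<beta>\<^sub>1 \<alpha>\<^sub>2 \<beta>\<^sub>2 :: real
    and \<epsilon> t \<alpha>2n \<beta>2n :: "nat \<Rightarrow> real"
  assumes "open \<Omega>" and "bounded \<Omega>" and "lipschitz_boundary \<Omega>"
    and "\<And>n. \<epsilon> n > 0" and "\<epsilon> \<longlonglongrightarrow> 0"
    and "q > 2" and "f \<in> H_neg1 \<Omega> \<inter> W_neg1 \<Omega> q"
    and "l \<ge> 1" and "\<alpha>\<^sub>1 > 0" and "\<beta>\<^sub>1 > 0"
    and "\<And>n. 0 < t n \<and> t n \<le> 1 / 2" and "t \<longlonglongrightarrow> 0"
    and "\<And>n. \<alpha>2n n > 0" and "\<And>n. \<beta>2n n > 0"
    and "(\<lambda>n. 2 * t n * (l + 1) * \<alpha>2n n) \<longlonglongrightarrow> \<alpha>\<^sub>2" and "\<alpha>\<^sub>2 > 0"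
    and "(\<lambda>n. 2 * t n * (l + 1) * \<beta>2n n) \<longlonglongrightarrow> \<beta>\<^sub>2" and "\<beta>\<^sub>2 > 0"
  shows "homogenized_conductivity \<Omega> f
    (\<lambda>n x. cross_conductivity l (t n) \<alpha>\<^sub>1 \<beta>\<^sub>1 (\<alpha>2n n) (\<beta>2n n) h (x /\<^sub>R \<epsilon> n))
    (vector
      [vector [\<alpha>\<^sub>1 + (\<alpha>\<^sub>2\<^sup>2 + \<beta>\<^sub>2\<^sup>2 * h\<^sup>2) / ((l + 1) * \<alpha>\<^sub>2), - (h * \<beta>\<^sub>1)],
       vector [h * \<beta>\<^sub>1, \<alpha>\<^sub>1 + (\<alpha>\<^sub>2\<^sup>2 + \<beta>\<^sub>2\<^sup>2 * h\<^sup>2) / (l * (l + 1) * \<alpha>\<^sub>2)]])"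
proof -
  interpret bdd_domain \<Omega> by unfold_locales fact+
  obtain R0 where R0: "R0 > 0" "\<And>c s. 0 < s \<Longrightarrow> s < R0 \<Longrightarrow> square c s \<subseteq> \<Omega> \<or> \<not> square_bd c s \<subseteq> \<Omega>"
    using square_bd_exterior[OF assms(1-3)] by blast
  have f: "f \<in> H_neg1 \<Omega>" "f \<in> W_neg1 \<Omega> q" using assms(7) by auto
  obtain C0 where C0: "H_functional f C0" using H_neg1_functional[OF f(1)] by blast
  obtain C \<gamma> where C: "supp_bound f C \<gamma>" using W_neg1_supp_bound[OF f(2) assms(6)] by blast
  define \<sigma> where "\<sigma> n = (\<lambda>x. cross_conductivity l (t n) \<alpha>\<^sub>1 \<beta>\<^sub>1 (\<alpha>2n n) (\<beta>2n n) h (x /\<^sub>R \<epsilon> n))" for n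
  \<comment> \<open>p and s are the limits of t times the coefficients in the strips; the
    normalization 2 t (l + 1) of the hypotheses is divided out. Inserting them into 2 (p^2 + s^2) /
    p gives the announced diagonal term.\<close>
  define p where "p = \<alpha>\<^sub>2 / (2 * (l + 1))"
  define s where "s = \<beta>\<^sub>2 * h / (2 * (l + 1))"
  define d where "d = 2 * (p\<^sup>2 + s\<^sup>2) / p"
  define Am where "Am = (vector [vector [\<alpha>\<^sub>1 + d, - (\<beta>\<^sub>1 * h)], vector [\<beta>\<^sub>1 * h, \<alpha>\<^sub>1 + d / l]] :: real^2^2)"
  have l: "l + 1 > 0" "l > 0" using assms(8) by auto
  have p: "p > 0" using assms(16) l by (simp add: p_def)
  have d: "d = (\<alpha>\<^sub>2\<^sup>2 + \<beta>\<^sub>2\<^sup>2 * h\<^sup>2) / ((l + 1) * \<alpha>\<^sub>2)"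
    using l assms(16) unfolding d_def p_def s_def by (simp add: power_divide power_mult_distrib power2_eq_square divide_simps) (simp add: algebra_simps)
  have dl: "d / l = (\<alpha>\<^sub>2\<^sup>2 + \<beta>\<^sub>2\<^sup>2 * h\<^sup>2) / (l * (l + 1) * \<alpha>\<^sub>2)" unfolding d by (simp add: mult_ac)
  have scale: "(\<lambda>n. t n * z n) \<longlonglongrightarrow> y / (2 * (l + 1))" if "(\<lambda>n. 2 * t n * (l + 1) * z n) \<longlonglongrightarrow> y" for z y
  proof -
    have "2 * t n * (l + 1) * z n / (2 * (l + 1)) = t n * z n" for n using l by (simp add: divide_simps)
    moreover have "(\<lambda>n. 2 * t n * (l + 1) * z n / (2 * (l + 1))) \<longlonglongrightarrow> y / (2 * (l + 1))"
      by (intro tendsto_divide that tendsto_const) (use l in simp)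
    ultimately show ?thesis by (simp only:)
  qed
  have tA: "(\<lambda>n. t n * \<alpha>2n n) \<longlonglongrightarrow> p" unfolding p_def by (rule scale[OF assms(15)])
  have tB: "(\<lambda>n. t n * (\<beta>2n n * h)) \<longlonglongrightarrow> s"
    using tendsto_mult_right[OF scale[OF assms(17)], of h] by (simp add: s_def mult.assoc)
  \<comment> \<open>Only the product of h with the Hall coefficients enters, so h is absorbed into
    them and replaced by 1.\<close>
  have \<sigma>_eq: "\<sigma> n = (\<lambda>x. cross_conductivity l (t n) \<alpha>\<^sub>1 (\<beta>\<^sub>1 * h) (\<alpha>2n n) (\<beta>2n n * h) 1 (x /\<^sub>R \<epsilon> n))" for n
    unfolding \<sigma>_def cross_conductivity_def hall_matrix_def mult_1_right ..
  define \<Lambda> where "\<Lambda> n = max (\<bar>\<alpha>\<^sub>1\<bar> + \<bar>\<beta>\<^sub>1 * h\<bar>) (\<bar>\<alpha>2n n\<bar> + \<bar>\<beta>2n n * h\<bar>)" for n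
  have e: "elliptic (\<sigma> n) (min \<alpha>\<^sub>1 (\<alpha>2n n)) (\<Lambda> n)" for n
    unfolding \<sigma>_def \<Lambda>_def by (rule cross_conductivity_elliptic) (use assms in auto)
  have d0: "d \<ge> 0" using p by (simp add: d_def)
  obtain \<Lambda>' where e': "elliptic (\<lambda>_. Am) \<alpha>\<^sub>1 \<Lambda>'"
    using const_elliptic[of \<alpha>\<^sub>1 "\<alpha>\<^sub>1 + d" "\<alpha>\<^sub>1 + d / l" "\<beta>\<^sub>1 * h"] d0 l assms(9) unfolding Am_def by auto
  have "\<exists>w. sol (\<sigma> n) f (fst w) (fst (snd w)) (snd (snd w))" for n
    by (rule sol_exists[OF e C0, of n]) (metis fst_conv snd_conv)
  then obtain w where w: "\<And>n. sol (\<sigma> n) f (fst (w n)) (fst (snd (w n))) (snd (snd (w n)))" by metis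
  define v where "v n = fst (w n)" for n
  define gv where "gv n = fst (snd (w n))" for n
  define \<phi>v where "\<phi>v n = snd (snd (w n))" for n
  have v: "sol (\<sigma> n) f (v n) (gv n) (\<phi>v n)" for n using w by (simp add: v_def gv_def \<phi>v_def)
  obtain u gu \<phi>u where u: "sol (\<lambda>_. Am) f u gu \<phi>u" by (rule sol_exists[OF e' C0])
  have lim: "(\<lambda>n. nrm2 N (\<lambda>x. v n x - u x)) \<longlonglongrightarrow> 0"
  proof (rule cross_L2_convergence[OF assms(8) assms(4,5) _ assms(12) assms(9) tA p tB])
    show "sol (\<lambda>x. cross_conductivity l (t n) \<alpha>\<^sub>1 (\<beta>\<^sub>1 * h) (\<alpha>2n n) (\<beta>2n n * h) 1 (x /\<^sub>R \<epsilon> n)) f (v n) (gv n) (\<phi>v n)" for n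
      using v[of n] unfolding \<sigma>_eq .
    show "sol (\<lambda>_. vector [vector [\<alpha>\<^sub>1 + 2 * (p\<^sup>2 + s\<^sup>2) / p, - (\<beta>\<^sub>1 * h)], vector [\<beta>\<^sub>1 * h, \<alpha>\<^sub>1 + 2 * (p\<^sup>2 + s\<^sup>2) / p / l]]) f u gu \<phi>u"
      using u unfolding Am_def d_def .
  qed (use assms(11) in auto)
  \<comment> \<open>A lower ellipticity bound common to all large n: the coefficients in the strips
    eventually exceed 1, because t tends to 0 while t times them tends to p > 0.\<close>
  define \<alpha> where "\<alpha> = min \<alpha>\<^sub>1 1"
  have \<alpha>: "\<alpha> > 0" "\<alpha> \<le> \<alpha>\<^sub>1" using assms(9) by (auto simp: \<alpha>_def)
  have "\<forall>\<^sub>F n in sequentially. t n < p / 2" by (rule order_tendstoD(2)[OF assms(12)]) (use p in simp)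
  moreover have "\<forall>\<^sub>F n in sequentially. t n * \<alpha>2n n > p / 2" by (rule order_tendstoD(1)[OF tA]) (use p in simp)
  ultimately have ev: "\<forall>\<^sub>F n in sequentially. elliptic (\<sigma> n) \<alpha> (\<Lambda> n)"
  proof eventually_elim
    case (elim n)
    have "t n * 1 < t n * \<alpha>2n n" using elim by linarith
    then have "1 < \<alpha>2n n" using assms(11)[of n] by simp
    then show ?case by (intro elliptic_mono[OF e \<alpha>(1)]) (auto simp: \<alpha>_def)
  qed
  obtain Z where Z: "Z \<in> null_sets N" "uniform_limit (space N) (\<lambda>n x. if x \<in> Z then u x else v n x) u sequentially"
    by (rule AE_uniform_limit_modify[OF uniform_convergence[OF R0 C C0 _ ev elliptic_mono[OF e' \<alpha>] v u lim]])
  \<comment> \<open>Representatives of the same solutions, changed on a null set so that the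
    convergence is uniform on all of \<Omega>.\<close>
  define v' where "v' n = (\<lambda>x. if x \<in> Z then u x else v n x)" for n
  have sq: "sqint N u" "sqint N (v n)" for n
    using u v approxD(2) unfolding sol_def by blast+
  have v': "sol (\<sigma> n) f (v' n) (gv n) (\<phi>v n)" for n
  proof (rule sol_cong_AE[OF v])
    show "v' n \<in> borel_measurable N"
      unfolding v'_def using sq Z(1) by (intro measurable_If_set) (auto simp: sqint_def)
    show "AE x in N. v' n x = v n x"
      using AE_not_in[OF Z(1)] by eventually_elim (simp add: v'_def)
  qed
  have "uniform_limit \<Omega> v' u sequentially" using Z(2) by (simp add: v'_def[abs_def])
  then have "homogenized_conductivity \<Omega> f \<sigma> Am"
    unfolding homogenized_conductivity_def
    using the_dirichlet_solutionI[OF e v'] the_dirichlet_solutionI[OF e' u] by blast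
  then show ?thesis unfolding Am_def dl unfolding d \<sigma>_def[abs_def] by (simp add: mult.commute)
qed

end
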